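(* Let $X$ be a mixed-exponential jump-diffusion process with Lévy exponent $G$, let $h<H$ be real numbers, and let $\alpha>0$, $\rho_1>0$, $\rho_2>0$ and $\gamma$ be real numbers with $0\le\gamma<\min(\eta_1,\theta_1)$ and $G(\gamma)<\alpha$. Assume that the root assumption $\mathrm{(R}_a)$ described in the context holds for $a=\alpha$, $a=\alpha+\rho_1$ and $a=\alpha+\rho_2$. Then there are real coefficients $\omega_i^L,\omega_i^0$ ($1\le i\le m+1$) and $\nu_j^0,\nu_j^U$ ($1\le j\le n+1$), not depending on $x$, such that for all $x\in\mathbb{R}$ $$ \int_0^\infty \alpha e^{-\alpha T}\,\mathbb{E}_x\!\left[e^{-\rho_1\int_0^T \mathbf 1_{\{X_t\le h\}}\,dt-\rho_2\int_0^T \mathbf 1_{\{X_t\ge H\}}\,dt+\gamma X_T}\right]dT =\begin{cases} \sum_{i=1}^{m+1}\omega_i^L e^{\beta_{i,\alpha+\rho_1}(x-h)}-c_L e^{\gamma x}, & x\le h,\\[2pt] -\sum_{i=1}^{m+1}\omega_i^0 e^{\beta_{i,\alpha}(x-H)}-\sum_{j=1}^{n+1}\nu_j^0 e^{-\gamma_{j,\alpha}(x-h)}-c_0e^{\gamma x}, & h<x<H,\\[2pt] \sum_{j=1}^{n+1}\nu_j^U e^{-\gamma_{j,\alpha+\rho_2}(x-H)}-c_Ue^{\gamma x}, & x\ge H, \end{cases} $$ where $$c_L=\frac{\alpha}{G(\gamma)-(\alpha+\rho_1)},\qquad c_0=\frac{\alpha}{G(\gamma)-\alpha},\qquad c_U=\frac{\alpha}{G(\gamma)-(\alpha+\rho_2)},$$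 and the column vector of coefficients $$Q'=\left(\omega_1^L,\dots,\omega_{m+1}^L,\ \omega_1^0,\dots,\omega_{m+1}^0,\ \nu_1^0,\dots,\nu_{n+1}^0,\ \nu_1^U,\dots,\nu_{n+1}^U\right)^{\top}\in\mathbb{R}^{2S},\qquad S=m+n+2,$$ satisfies the linear system $B'Q'=V$. Here $$V=(c_U-c_0)\begin{pmatrix} V_1\\ V_2\end{pmatrix},\qquad V_1=e^{\gamma h}\,v(\gamma),\qquad V_2=e^{\gamma H}\,v(\gamma),\qquad B'=\begin{pmatrix} M' & N'Z_\beta\\ M'Z_\gamma & N'\end{pmatrix},$$ $v(a)$ is the column vector $$v(a)=\left(1,\ a,\ \tfrac{1}{\eta_1-a},\dots,\tfrac1{\eta_m-a},\ \tfrac1{\theta_1+a},\dots,\tfrac1{\theta_n+a}\right)^{\top}\in\mathbb{R}^S,$$ $M'$ is the $S\times S$ matrix with successive columns $v(\beta_{1,\alpha+\rho_1}),\dots,v(\beta_{m+1,\alpha+\rho_1}),v(-\gamma_{1,\alpha}),\dots,v(-\gamma_{n+1,\alpha})$, $N'$ is the $S\times S$ matrix with successive columns $v(-\gamma_{1,\alpha+\rho_2}),\dots,v(-\gamma_{n+1,\alpha+\rho_2}),v(\beta_{1,\alpha}),\dots,v(\beta_{m+1,\alpha})$, and $Z_\beta$, $Z_\gamma$ are the $S\times S$ diagonal matrices with diagonal entries, respectively, $$\big(\underbrace{0,\dots,0}_{n+1},e^{\beta_{1,\alpha}(h-H)},\dots,e^{\beta_{m+1,\alpha}(h-H)}\big)\quad\text{and}\quad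 \big(\underbrace{0,\dots,0}_{m+1},e^{\gamma_{1,\alpha}(h-H)},\dots,e^{\gamma_{n+1,\alpha}(h-H)}\big).$$
   Context: Mixed-exponential jump-diffusion (MEJD) process: $X_t=X_0+\mu t+\sigma W_t+\sum_{i=1}^{N_t}Y_i$, $t\ge0$, where $\mu\in\mathbb{R}$, $\sigma\ge0$, $W$ is a standard Brownian motion, $N$ is a homogeneous Poisson process with rate $\lambda$, and $Y_1,Y_2,\dots$ are i.i.d. with probability density function $$f_Y(y)=p_u\sum_{i=1}^m p_i\eta_ie^{-\eta_iy}\mathbf 1_{\{y\ge0\}}+q_d\sum_{j=1}^n q_j\theta_je^{\theta_jy}\mathbf 1_{\{y<0\}},$$ with $W$, $N$, $(Y_i)$ mutually independent. Here $p_u,q_d\ge0$, $p_u+q_d=1$, $p_i,q_j\in\mathbb{R}$ (possibly negative, but such that $f_Y$ is a probability density), $\sum_{i=1}^m p_i=1$, $\sum_{j=1}^n q_j=1$, $0<\eta_1<\dots<\eta_m$ and $0<\theta_1<\dots<\theta_n$. $\mathbb{P}_x$ and $\mathbb{E}_x$ denote the law of $X$ with $X_0=x$ and its expectation. The Lévy exponent is $$G(\zeta)=\mu\zeta+\frac{\sigma^2}{2}\zeta^2+\lambda\left(p_u\sum_{i=1}^m\frac{p_i\eta_i}{\eta_i-\zeta}+q_d\sum_{j=1}^n\frac{q_j\theta_j}{\theta_j+\zeta}-1\right),$$ so that $\mathbb{E}_0[e^{\zeta X_t}]=e^{tG(\zeta)}$ for $\zeta\in(-\theta_1,\eta_1)$;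 $G$ is also regarded as a rational function on $\mathbb{R}$ minus its poles. Root assumption $\mathrm{(R}_a)$, for $a>0$: the equation $G(\zeta)=a$ has exactly $m+n+2$ distinct real solutions, namely $m+1$ positive ones $\beta_{1,a},\dots,\beta_{m+1,a}$ and $n+1$ negative ones, written $-\gamma_{1,a},\dots,-\gamma_{n+1,a}$ with $\gamma_{j,a}>0$, satisfying $$0<\beta_{1,a}<\eta_1<\beta_{2,a}<\dots<\eta_m<\beta_{m+1,a}<\infty,\qquad 0<\gamma_{1,a}<\theta_1<\gamma_{2,a}<\dots<\theta_n<\gamma_{n+1,a}<\infty.$$
   Formalization: The printed linear system is false; it is corrected so that V has upper block (c_L−c_0)V_1 and lower block (c_U−c_0)V_2, and the unknowns in Q' are ordered (ω^L, ν^0, ν^U, ω^0) to match the columns of B'. *)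

theory Defs
  imports "HOL-Probability.Probability" "Jordan_Normal_Form.Matrix"
begin

text \<open>Upward and downward exponential components are numbered from 1. The downward
  parameters \<open>down_rate\<close> are the positive \<open>\<theta>\<^sub>j\<close>, so that the exponent has poles at \<open>- \<theta>\<^sub>j\<close>.\<close>

record mejd =
  drift :: real                       (* mu *)
  vol :: real                         (* sigma *)
  rate :: real                        (* lambda *)
  up_prob :: real                     (* p_u *)
  down_prob :: real                   (* q_d *)
  up_num :: nat                       (* m *)
  down_num :: nat                     (* n *)
  up_weight :: "nat \<Rightarrow> real"    (* p_i *)
  down_weight :: "nat \<Rightarrow> real"  (* q_j *)
  up_rate :: "nat \<Rightarrow> real"      (* eta_i *)
  down_rate :: "nat \<Rightarrow> real"    (* theta_j *)

definition jump_density :: "mejd \<Rightarrow> real \<Rightarrow> real" where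
  "jump_density P y =
     up_prob P * (\<Sum>i=1..up_num P. up_weight P i * up_rate P i * exp (- up_rate P i * y))
       * indicator {0..} y
   + down_prob P * (\<Sum>j=1..down_num P. down_weight P j * down_rate P j * exp (down_rate P j * y))
       * indicator {..<0} y"

text \<open>The weights may be negative; that the density has total mass 1 follows from the
  normalisations, so only its nonnegativity is required separately. The normalisations of
  the weights also force at least one component on either side.\<close>

definition mejd_params :: "mejd \<Rightarrow> bool" where
  "mejd_params P \<longleftrightarrow>
     0 \<le> vol P \<and> 0 < rate P \<and>
     0 \<le> up_prob P \<and> 0 \<le> down_prob P \<and> up_prob P + down_prob P = 1 \<and>
     (\<Sum>i=1..up_num P. up_weight P i) = 1 \<and>
     (\<Sum>j=1..down_num P. down_weight P j) = 1 \<and>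
     0 < up_rate P 1 \<and> (\<forall>i\<in>{1..<up_num P}. up_rate P i < up_rate P (Suc i)) \<and>
     0 < down_rate P 1 \<and> (\<forall>j\<in>{1..<down_num P}. down_rate P j < down_rate P (Suc j)) \<and>
     (\<forall>y. 0 \<le> jump_density P y)"

definition indep_increments :: "'a measure \<Rightarrow> (real \<Rightarrow> 'a \<Rightarrow> real) \<Rightarrow> bool" where
  "indep_increments M X \<longleftrightarrow>
     (\<forall>(\<tau> :: nat \<Rightarrow> real) k. 0 \<le> \<tau> 0 \<and> incseq \<tau> \<longrightarrow>
        prob_space.indep_vars M (\<lambda>_. borel) (\<lambda>i \<omega>. X (\<tau> (Suc i)) \<omega> - X (\<tau> i) \<omega>) {..<k})"

text \<open>The path properties of both driving processes are required of every sample point. Only times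
  \<open>t \<ge> 0\<close> are meaningful.\<close>

definition std_brownian_motion :: "'a measure \<Rightarrow> (real \<Rightarrow> 'a \<Rightarrow> real) \<Rightarrow> bool" where
  "std_brownian_motion M W \<longleftrightarrow>
     (\<forall>t\<ge>0. W t \<in> borel_measurable M) \<and>
     (\<forall>\<omega>\<in>space M. W 0 \<omega> = 0) \<and>
     (\<forall>\<omega>\<in>space M. continuous_on {0..} (\<lambda>t. W t \<omega>)) \<and>
     indep_increments M W \<and>
     (\<forall>s t. 0 \<le> s \<and> s < t \<longrightarrow>
        distributed M lborel (\<lambda>\<omega>. W t \<omega> - W s \<omega>) (normal_density 0 (sqrt (t - s))))"

definition poisson_process :: "'a measure \<Rightarrow> real \<Rightarrow> (real \<Rightarrow> 'a \<Rightarrow> nat) \<Rightarrow> bool" where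
  "poisson_process M r N \<longleftrightarrow>
     (\<forall>t\<ge>0. N t \<in> measurable M (count_space UNIV)) \<and>
     (\<forall>\<omega>\<in>space M. N 0 \<omega> = 0) \<and>
     (\<forall>\<omega>\<in>space M. mono_on {0..} (\<lambda>t. N t \<omega>)) \<and>
     (\<forall>\<omega>\<in>space M. \<forall>t\<ge>0. continuous (at_right t) (\<lambda>s. real (N s \<omega>))) \<and>
     indep_increments M (\<lambda>t \<omega>. real (N t \<omega>)) \<and>
     (\<forall>s t. 0 \<le> s \<and> s < t \<longrightarrow>
        distr M (count_space UNIV) (\<lambda>\<omega>. N t \<omega> - N s \<omega>) = measure_pmf (poisson_pmf (r * (t - s))))"

definition process_events ::
  "'a measure \<Rightarrow> 'i set \<Rightarrow> 'b measure \<Rightarrow> ('i \<Rightarrow> 'a \<Rightarrow> 'b) \<Rightarrow> 'a set set" where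
  "process_events M I S X =
     sigma_sets (space M) {X i -` A \<inter> space M | i A. i \<in> I \<and> A \<in> sets S}"

definition mejd_driver ::
  "'a measure \<Rightarrow> mejd \<Rightarrow> (real \<Rightarrow> 'a \<Rightarrow> real) \<Rightarrow> (real \<Rightarrow> 'a \<Rightarrow> nat) \<Rightarrow> (nat \<Rightarrow> 'a \<Rightarrow> real) \<Rightarrow> bool" where
  "mejd_driver M P W N Y \<longleftrightarrow>
     prob_space M \<and>
     std_brownian_motion M W \<and>
     poisson_process M (rate P) N \<and>
     prob_space.indep_vars M (\<lambda>_. borel) Y {1..} \<and>
     (\<forall>i\<ge>1. distributed M lborel (Y i) (jump_density P)) \<and>
     prob_space.indep_sets M
       (\<lambda>k. [process_events M {0..} borel W,
             process_events M {0..} (count_space UNIV) N,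
             process_events M {1..} borel Y] ! k) {0, 1, 2}"

text \<open>For a driver \<open>(W, N, Y)\<close>, the law of \<open>mejd_process P W N Y x\<close> is the
  law of the process started at \<open>x\<close>.\<close>

definition mejd_process ::
  "mejd \<Rightarrow> (real \<Rightarrow> 'a \<Rightarrow> real) \<Rightarrow> (real \<Rightarrow> 'a \<Rightarrow> nat) \<Rightarrow> (nat \<Rightarrow> 'a \<Rightarrow> real) \<Rightarrow> real \<Rightarrow> real \<Rightarrow> 'a \<Rightarrow> real" where
  "mejd_process P W N Y x t \<omega> = x + drift P * t + vol P * W t \<omega> + (\<Sum>i=1..N t \<omega>. Y i \<omega>)"

definition levy_exponent :: "mejd \<Rightarrow> real \<Rightarrow> real" where
  "levy_exponent P z =
     drift P * z + (vol P)\<^sup>2 / 2 * z\<^sup>2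
     + rate P *
        (up_prob P * (\<Sum>i=1..up_num P. up_weight P i * up_rate P i / (up_rate P i - z))
         + down_prob P * (\<Sum>j=1..down_num P. down_weight P j * down_rate P j / (down_rate P j + z))
         - 1)"

definition levy_poles :: "mejd \<Rightarrow> real set" where
  "levy_poles P = up_rate P ` {1..up_num P} \<union> (\<lambda>j. - down_rate P j) ` {1..down_num P}"

text \<open>Division by zero gives \<open>levy_exponent\<close> junk values at its poles, which are therefore
  excluded from the solution set. The interlacing makes the listed roots distinct.\<close>

definition root_assumption :: "mejd \<Rightarrow> real \<Rightarrow> (nat \<Rightarrow> real) \<Rightarrow> (nat \<Rightarrow> real) \<Rightarrow> bool" where
  "root_assumption P a \<beta> \<gamma> \<longleftrightarrow>
     {z. z \<notin> levy_poles P \<and> levy_exponent P z = a}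
       = \<beta> ` {1..up_num P + 1} \<union> (\<lambda>j. - \<gamma> j) ` {1..down_num P + 1} \<and>
     0 < \<beta> 1 \<and>
     (\<forall>i\<in>{1..up_num P}. \<beta> i < up_rate P i \<and> up_rate P i < \<beta> (Suc i)) \<and>
     0 < \<gamma> 1 \<and>
     (\<forall>j\<in>{1..down_num P}. \<gamma> j < down_rate P j \<and> down_rate P j < \<gamma> (Suc j))"

abbreviation sys_dim :: "mejd \<Rightarrow> nat" where
  "sys_dim P \<equiv> up_num P + down_num P + 2"

definition fit_vec :: "mejd \<Rightarrow> real \<Rightarrow> real Matrix.vec" where
  "fit_vec P a = vec_of_list
     ([1, a] @ map (\<lambda>i. 1 / (up_rate P i - a)) [1..<up_num P + 1]
             @ map (\<lambda>j. 1 / (down_rate P j + a)) [1..<down_num P + 1])"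

definition M_mat :: "mejd \<Rightarrow> (nat \<Rightarrow> real) \<Rightarrow> (nat \<Rightarrow> real) \<Rightarrow> real mat" where
  "M_mat P \<beta>L \<gamma>0 = mat_of_cols (sys_dim P)
     (map (\<lambda>i. fit_vec P (\<beta>L i)) [1..<up_num P + 2]
      @ map (\<lambda>j. fit_vec P (- \<gamma>0 j)) [1..<down_num P + 2])"

definition N_mat :: "mejd \<Rightarrow> (nat \<Rightarrow> real) \<Rightarrow> (nat \<Rightarrow> real) \<Rightarrow> real mat" where
  "N_mat P \<beta>0 \<gamma>U = mat_of_cols (sys_dim P)
     (map (\<lambda>j. fit_vec P (- \<gamma>U j)) [1..<down_num P + 2]
      @ map (\<lambda>i. fit_vec P (\<beta>0 i)) [1..<up_num P + 2])"

definition diag_of_list :: "real list \<Rightarrow> real mat" where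
  "diag_of_list xs = mat_diag (length xs) (\<lambda>i. xs ! i)"

definition Z_beta :: "mejd \<Rightarrow> real \<Rightarrow> real \<Rightarrow> (nat \<Rightarrow> real) \<Rightarrow> real mat" where
  "Z_beta P h H \<beta>0 = diag_of_list
     (replicate (down_num P + 1) 0 @ map (\<lambda>i. exp (\<beta>0 i * (h - H))) [1..<up_num P + 2])"

definition Z_gamma :: "mejd \<Rightarrow> real \<Rightarrow> real \<Rightarrow> (nat \<Rightarrow> real) \<Rightarrow> real mat" where
  "Z_gamma P h H \<gamma>0 = diag_of_list
     (replicate (up_num P + 1) 0 @ map (\<lambda>j. exp (\<gamma>0 j * (h - H))) [1..<down_num P + 2])"

definition B_mat ::
  "mejd \<Rightarrow> real \<Rightarrow> real \<Rightarrow> (nat \<Rightarrow> real) \<Rightarrow> (nat \<Rightarrow> real) \<Rightarrow> (nat \<Rightarrow> real) \<Rightarrow> (nat \<Rightarrow> real) \<Rightarrow> real mat" where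
  "B_mat P h H \<beta>L \<beta>0 \<gamma>0 \<gamma>U =
     four_block_mat (M_mat P \<beta>L \<gamma>0)                    (N_mat P \<beta>0 \<gamma>U * Z_beta P h H \<beta>0)
                    (M_mat P \<beta>L \<gamma>0 * Z_gamma P h H \<gamma>0) (N_mat P \<beta>0 \<gamma>U)"

text \<open>The unknowns are listed in the order of the columns of \<open>B_mat\<close>: the columns of
  \<open>M_mat\<close> belong to \<open>\<omega>\<^sup>L\<close> and \<open>\<nu>\<^sup>0\<close>, those of \<open>N_mat\<close> to \<open>\<nu>\<^sup>U\<close> and \<open>\<omega>\<^sup>0\<close>.\<close>

definition coeff_vec ::
  "mejd \<Rightarrow> (nat \<Rightarrow> real) \<Rightarrow> (nat \<Rightarrow> real) \<Rightarrow> (nat \<Rightarrow> real) \<Rightarrow> (nat \<Rightarrow> real) \<Rightarrow> real Matrix.vec" where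
  "coeff_vec P \<omega>L \<omega>0 \<nu>0 \<nu>U = vec_of_list
     (map \<omega>L [1..<up_num P + 2] @ map \<nu>0 [1..<down_num P + 2]
      @ map \<nu>U [1..<down_num P + 2] @ map \<omega>0 [1..<up_num P + 2])"

text \<open>The upper half of the system matches the two outer expressions with the middle one at
  \<open>h\<close>, the lower half at \<open>H\<close>. The coefficient of \<open>exp (\<gamma> x)\<close> jumps by
  \<open>cL - c0\<close> at \<open>h\<close> and by \<open>cU - c0\<close> at \<open>H\<close>; the two differ unless the
  two occupation rates agree.\<close>

definition V_vec ::
  "mejd \<Rightarrow> real \<Rightarrow> real \<Rightarrow> real \<Rightarrow> real \<Rightarrow> real \<Rightarrow> real \<Rightarrow> real Matrix.vec" where
  "V_vec P h H \<gamma> cL c0 cU =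
     ((cL - c0) * exp (\<gamma> * h)) \<cdot>\<^sub>v fit_vec P \<gamma> @\<^sub>v ((cU - c0) * exp (\<gamma> * H)) \<cdot>\<^sub>v fit_vec P \<gamma>"

definition occ_payoff ::
  "(real \<Rightarrow> 'a \<Rightarrow> real) \<Rightarrow> real \<Rightarrow> real \<Rightarrow> real \<Rightarrow> real \<Rightarrow> real \<Rightarrow> real \<Rightarrow> 'a \<Rightarrow> real" where
  "occ_payoff X h H \<rho>1 \<rho>2 \<gamma> T \<omega> =
     exp (- \<rho>1 * (LBINT t:{0..T}. indicator {..h} (X t \<omega>))
          - \<rho>2 * (LBINT t:{0..T}. indicator {H..} (X t \<omega>))
          + \<gamma> * X T \<omega>)"

end

theory Submission
  imports Defs "HOL-Real_Asymp.Real_Asymp"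
begin

text \<open>Let \<open>u x\<close> be the transform, \<open>k = \<rho>\<^sub>1 1\<^bsub>(-\<infinity>,h]\<^esub> + \<rho>\<^sub>2 1\<^bsub>[H,\<infinity>)\<^esub>\<close> and
  \<open>d \<in> {0, \<rho>\<^sub>1, \<rho>\<^sub>2}\<close>. Integrating the exponential of the occupation integral along the path and
  using the Markov property at deterministic times yields the resolvent equation
  \<open>(\<alpha> + d) u = R\<^sub>d (\<alpha> e\<^bsup>\<gamma>x\<^esup> + (d - k) u)\<close>, where \<open>R\<^sub>d\<close> averages over the displacement at an independent
  exponential time of rate \<open>\<alpha> + d\<close>. The characteristic function of that displacement is
  \<open>(\<alpha> + d) / (\<alpha> + d - G(it))\<close>; its partial fraction expansion over the roots of \<open>G = \<alpha> + d\<close> makes its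
  density a combination of one-sided exponentials. With \<open>d = \<rho>\<^sub>1\<close>, \<open>0\<close>, \<open>\<rho>\<^sub>2\<close> the argument of \<open>R\<^sub>d\<close> is
  \<open>\<alpha> e\<^bsup>\<gamma>x\<^esup>\<close> on the lower, middle and upper region respectively, so \<open>u\<close> is there a sum of exponentials,
  and its growth of order at most \<open>e\<^bsup>\<gamma>x\<^esup>\<close> removes half of the roots in the outer regions. For the linear
  system, the resolvent with \<open>d = 0\<close> is evaluated at a barrier from both sides. The outer expression has to
  be reproduced by it, so the coefficients of all \<open>e\<^bsup>zx\<^esup>\<close> with \<open>G(z) = \<alpha>\<close> vanish there; since a rational
  function with the poles of \<open>G\<close> and the entries of \<open>v(a)\<close> as numerators expands into partial fractions
  over the same roots, this gives one equation for each entry of \<open>v\<close>.\<close>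

section \<open>Partial fractions of the exponent\<close>

text \<open>No generator, stopping time or smoothness of \<open>u\<close> enters: a priori
  \<open>u\<close> is merely measurable of growth \<open>e^(\<gamma>x)\<close>, and \<open>k\<close>
  jumps at the barriers. Three difficulties shape the proof. Weights may be negative, so nothing
  shows directly that the exponential sum from partial fractions is a density; its sign follows from
  uniqueness of characteristic functions. Exponential moments, needed to dominate the payoff, are
  not computed from the jump law: averaged over an exponential time they are finite by that density,
  as \<gamma> lies below the first positive root, which \<open>G(\<gamma>) < \<alpha>\<close>
  secures; multiplicativity in time then makes each of them finite. Finally, the number of jumps in
  an interval is random, so increments are analysed for prescribed jump counts, where they use
  disjoint sets of independent variables, and then averaged over the counts. The resolvent equation
  is proved in extended nonnegative numbers, with subtracted terms moved across, and only then read
  in the reals.\<close>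

lemma lagrange_partial_fractions:
  fixes p :: "'a::field poly"
  assumes fin: "finite R" and deg: "degree p < card R" and s: "s \<notin> R"
  shows "(\<Sum>z\<in>R. poly p z / (\<Prod>z'\<in>R - {z}. z - z') / (s - z)) = poly p s / (\<Prod>z\<in>R. s - z)"
proof -
  \<comment> \<open>Lagrange interpolant of \<open>p\<close> at the nodes \<open>R\<close>. It
    agrees with \<open>p\<close> at \<open>card R\<close> points while both degrees stay below
    \<open>card R\<close>, so the two coincide.\<close>
  define L where "L = (\<Sum>z\<in>R. Polynomial.smult (poly p z / (\<Prod>z'\<in>R - {z}. z - z')) (\<Prod>z'\<in>R - {z}. [:- z', 1:]))"
  have polyL: "poly L x = (\<Sum>z\<in>R. poly p z / (\<Prod>z'\<in>R - {z}. z - z') * (\<Prod>z'\<in>R - {z}. x - z'))" for x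
    by (simp add: L_def poly_sum poly_prod)
  have degL: "degree L < card R"
  proof -
    have "degree (Polynomial.smult (poly p z / (\<Prod>z'\<in>R - {z}. z - z')) (\<Prod>z'\<in>R - {z}. [:- z', 1:])) \<le> card R - 1"
      if "z \<in> R" for z
    proof -
      have "degree (\<Prod>z'\<in>R - {z}. [:- z', 1:]) \<le> (\<Sum>z'\<in>R - {z}. degree [:- z', 1:])"
        using degree_prod_sum_le[of "R - {z}" "\<lambda>z'. [:- z', 1:]"] fin by (simp add: o_def)
      also have "\<dots> = card R - 1" using that fin by (simp add: card_Diff_singleton)
      finally show ?thesis using degree_smult_le order_trans by blast
    qed
    then have "degree L \<le> card R - 1" unfolding L_def
      by (intro degree_sum_le) (use fin in auto)
    then show ?thesis using deg by linarith
  qed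
  have "p - L = 0"
  proof (rule ccontr)
    assume ne: "p - L \<noteq> 0"
    have "poly L z = poly p z" if z: "z \<in> R" for z
    proof -
      have "poly L z = (\<Sum>y\<in>R. if y = z then poly p z else 0)"
        unfolding polyL
      proof (rule sum.cong)
        fix y assume y: "y \<in> R"
        have "(\<Prod>z'\<in>R - {z}. z - z') \<noteq> 0" using fin by auto
        moreover have "(\<Prod>z'\<in>R - {y}. z - z') = 0" if "y \<noteq> z" using fin z that by auto
        ultimately show "poly p y / (\<Prod>z'\<in>R - {y}. y - z') * (\<Prod>z'\<in>R - {y}. z - z') = (if y = z then poly p z else 0)"
          by auto
      qed simp
      then show ?thesis using fin z by simp
    qed
    then have "R \<subseteq> {x. poly (p - L) x = 0}" by auto
    then have "card R \<le> card {x. poly (p - L) x = 0}"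
      using poly_roots_finite[OF ne] by (rule card_mono[rotated])
    also have "\<dots> \<le> degree (p - L)" using ne by (rule card_poly_roots_bound)
    also have "\<dots> < card R" using deg degL by (simp add: degree_diff_less)
    finally show False by simp
  qed
  then have pL: "poly p s = poly L s" by simp
  have "poly L s / (\<Prod>z\<in>R. s - z) = (\<Sum>z\<in>R. poly p z / (\<Prod>z'\<in>R - {z}. z - z') / (s - z))"
    unfolding polyL sum_divide_distrib
  proof (rule sum.cong)
    fix z assume z: "z \<in> R"
    have "(\<Prod>z\<in>R. s - z) = (s - z) * (\<Prod>z'\<in>R - {z}. s - z')"
      using fin z by (simp add: prod.remove)
    moreover have "(\<Prod>z'\<in>R - {z}. s - z') \<noteq> 0" "s - z \<noteq> 0" using fin s z by auto
    ultimately show "poly p z / (\<Prod>z'\<in>R - {z}. z - z') * (\<Prod>z'\<in>R - {z}. s - z') / (\<Prod>z\<in>R. s - z)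
        = poly p z / (\<Prod>z'\<in>R - {z}. z - z') / (s - z)"
      by simp
  qed simp
  then show ?thesis using pL by simp
qed

text \<open>Dividing by the exponential with the least exponent and letting \<open>x\<close> tend to
  minus infinity leaves only that coefficient, which therefore vanishes; the other exponents follow
  by induction on the set.\<close>

lemma exp_sum_independent:
  fixes c :: "real \<Rightarrow> real"
  assumes fin: "finite Z" and zero: "\<And>x. x \<le> b \<Longrightarrow> (\<Sum>z\<in>Z. c z * exp (z * x)) = 0" and z: "z \<in> Z"
  shows "c z = 0"
  using assms
proof (induction Z arbitrary: z rule: finite_psubset_induct)
  case (psubset Z)
  define m where "m = Min Z"
  have m: "m \<in> Z" "\<And>z. z \<in> Z \<Longrightarrow> m \<le> z"
    using psubset.hyps psubset.prems(2) by (auto simp: m_def intro!: Min_in)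
  have lim: "((\<lambda>x. \<Sum>z\<in>Z. c z * exp ((z - m) * x)) \<longlongrightarrow> (\<Sum>z\<in>Z. if z = m then c m else 0)) at_bot"
  proof (rule tendsto_sum)
    fix y assume y: "y \<in> Z"
    show "((\<lambda>x. c y * exp ((y - m) * x)) \<longlongrightarrow> (if y = m then c m else 0)) at_bot"
    proof (cases "y = m")
      case False
      then have "y - m > 0" using m(2)[OF y] by simp
      then have "filterlim (\<lambda>x. (y - m) * x) at_bot at_bot"
        by (intro filterlim_tendsto_pos_mult_at_bot[OF tendsto_const]) (auto simp: filterlim_ident)
      then have "((\<lambda>x. exp ((y - m) * x)) \<longlongrightarrow> 0) at_bot"
        by (rule filterlim_compose[OF exp_at_bot])
      then show ?thesis using False tendsto_mult_right_zero by auto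
    qed simp
  qed
  have zero: "(\<Sum>z\<in>Z. c z * exp ((z - m) * x)) = 0" if "x \<le> b" for x
  proof -
    have "(\<Sum>z\<in>Z. c z * exp ((z - m) * x)) = exp (- m * x) * (\<Sum>z\<in>Z. c z * exp (z * x))"
      by (simp add: sum_distrib_left algebra_simps flip: exp_add)
    then show ?thesis using psubset.prems(1) that by simp
  qed
  have "eventually (\<lambda>x. (\<Sum>z\<in>Z. c z * exp ((z - m) * x)) = 0) at_bot"
    using eventually_le_at_bot[of b] by (rule eventually_mono) (rule zero)
  then have "((\<lambda>x. \<Sum>z\<in>Z. c z * exp ((z - m) * x)) \<longlongrightarrow> 0) at_bot"
    by (rule tendsto_eventually)
  with lim have "(\<Sum>z\<in>Z. if z = m then c m else 0) = 0"
    by (rule tendsto_unique[rotated]) simp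
  then have cm: "c m = 0" using psubset.hyps m(1) by simp
  show ?case
  proof (cases "z = m")
    case False
    have "c z = 0"
    proof (rule psubset.IH[of "Z - {m}"])
      show "(\<Sum>z\<in>Z - {m}. c z * exp (z * x)) = 0" if "x \<le> b" for x
        using psubset.prems(1)[OF that] cm m(1) psubset.hyps by (simp add: sum.remove[of Z m])
    qed (use m(1) psubset.prems(2) False in auto)
    then show ?thesis .
  qed (use cm in simp)
qed

text \<open>The exponent over an arbitrary real field: the complex instance on the imaginary axis is the
  characteristic exponent.\<close>

definition lexp :: "mejd \<Rightarrow> 'a::real_field \<Rightarrow> 'a" where
  "lexp P z = of_real (drift P) * z + of_real ((vol P)\<^sup>2 / 2) * z\<^sup>2
     + of_real (rate P) *
        (of_real (up_prob P) * (\<Sum>i=1..up_num P. of_real (up_weight P i * up_rate P i) / (of_real (up_rate P i) - z))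
         + of_real (down_prob P) * (\<Sum>j=1..down_num P. of_real (down_weight P j * down_rate P j) / (of_real (down_rate P j) + z))
         - 1)"

text \<open>Common denominator of the fractions in the exponent. Since division is total, the
  condition of not being a pole is expressed as \<open>lden P s \<noteq> 0\<close>, in every field
  in which \<open>lexp\<close> is used.\<close>

definition lden :: "mejd \<Rightarrow> 'a::real_field \<Rightarrow> 'a" where
  "lden P z = (\<Prod>i=1..up_num P. of_real (up_rate P i) - z) * (\<Prod>j=1..down_num P. of_real (down_rate P j) + z)"

lemma lexp_real: "lexp P (x::real) = levy_exponent P x"
  by (simp add: lexp_def levy_exponent_def)

lemma lexp_of_real: "lexp P (of_real x) = of_real (levy_exponent P x)"
  by (simp add: lexp_def levy_exponent_def)

lemma lden_of_real: "lden P (of_real x) = of_real (lden P x)"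
  by (simp add: lden_def)

lemma lden_zero_iff: "lden P (x::real) = 0 \<longleftrightarrow> x \<in> levy_poles P"
proof -
  have "down_rate P j + x = 0 \<longleftrightarrow> x = - down_rate P j" for j by linarith
  then show ?thesis by (auto simp: lden_def levy_poles_def)
qed

lemma mejd_params_rates:
  assumes "mejd_params P"
  shows "i \<in> {1..up_num P} \<Longrightarrow> up_rate P 1 \<le> up_rate P i \<and> 0 < up_rate P i"
    and "j \<in> {1..down_num P} \<Longrightarrow> down_rate P 1 \<le> down_rate P j \<and> 0 < down_rate P j"
    and "1 \<le> up_num P" "1 \<le> down_num P"
proof -
  have mono: "f 1 \<le> f i" if "\<forall>i\<in>{1..<n}. f i < f (Suc i)" "i \<in> {1..n}" for f :: "nat \<Rightarrow> real" and i n
  proof -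
    have "1 \<le> i" "i \<le> n" using that by auto
    then show ?thesis
    proof (induction i rule: dec_induct)
      case (step k) then show ?case using that(1)[rule_format, of k] by auto
    qed simp
  qed
  note P = assms[unfolded mejd_params_def]
  show "i \<in> {1..up_num P} \<Longrightarrow> up_rate P 1 \<le> up_rate P i \<and> 0 < up_rate P i"
    using mono[of "up_num P" "up_rate P" i] P by fastforce
  show "j \<in> {1..down_num P} \<Longrightarrow> down_rate P 1 \<le> down_rate P j \<and> 0 < down_rate P j"
    using mono[of "down_num P" "down_rate P" j] P by fastforce
  show "1 \<le> up_num P" using P by (cases "up_num P") auto
  show "1 \<le> down_num P" using P by (cases "down_num P") auto
qed

lemma levy_exponent_0:
  assumes "mejd_params P" shows "levy_exponent P 0 = 0"
proof -
  note P = assms[unfolded mejd_params_def]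
  have "(\<Sum>i=1..up_num P. up_weight P i * up_rate P i / up_rate P i) = (\<Sum>i=1..up_num P. up_weight P i)"
    using mejd_params_rates(1)[OF assms] by (intro sum.cong) (force simp del: One_nat_def)+
  moreover have "(\<Sum>i=1..down_num P. down_weight P i * down_rate P i / down_rate P i) = (\<Sum>i=1..down_num P. down_weight P i)"
    using mejd_params_rates(2)[OF assms] by (intro sum.cong) (force simp del: One_nat_def)+
  ultimately show ?thesis using P by (simp add: levy_exponent_def)
qed

definition roots_set :: "mejd \<Rightarrow> (nat \<Rightarrow> real) \<Rightarrow> (nat \<Rightarrow> real) \<Rightarrow> real set" where
  "roots_set P \<beta> \<gamma> = \<beta> ` {1..up_num P + 1} \<union> (\<lambda>j. - \<gamma> j) ` {1..down_num P + 1}"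

lemma degree_prod_pCons_le:
  "finite A \<Longrightarrow> degree (\<Prod>i\<in>A. [:f i, g i:]) \<le> card A"
  using degree_prod_sum_le[of A "\<lambda>i. [:f i, g i:]"]
  by (rule order_trans) (auto intro!: order_trans[OF sum_bounded_above[where K=1]])

lemma degree_mult_le_add: "degree p \<le> a \<Longrightarrow> degree q \<le> b \<Longrightarrow> degree (p * q) \<le> a + b"
  using degree_mult_le[of p q] by linarith

text \<open>The quadratic part raises the degree \<open>m + n\<close> of the denominator by two,
  while each fraction cancels one factor. The identity is restricted to nonzero
  \<open>lden P s\<close>: at a pole the right-hand side is 0, but the polynomial need not vanish
  there.\<close>

lemma lexp_poly:
  fixes P :: mejd and q :: real
  obtains p :: "'a::real_field poly" where
    "degree p \<le> sys_dim P"
    "\<And>s. lden P s \<noteq> 0 \<Longrightarrow> poly p s = (lexp P s - of_real q) * lden P s"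
proof -
  let ?m = "up_num P" and ?n = "down_num P"
  define A :: "nat set \<Rightarrow> 'a poly" where "A I = (\<Prod>i\<in>I. [:of_real (up_rate P i), - 1:])" for I
  define B :: "nat set \<Rightarrow> 'a poly" where "B I = (\<Prod>i\<in>I. [:of_real (down_rate P i), 1:])" for I
  have dA: "degree (A I) \<le> card I" and dB: "degree (B I) \<le> card I" if "finite I" for I
    using that by (simp_all add: A_def B_def degree_prod_pCons_le)
  define p where "p = [:of_real (- q - rate P), of_real (drift P), of_real ((vol P)\<^sup>2 / 2):] * (A {1..?m} * B {1..?n})
    + Polynomial.smult (of_real (rate P * up_prob P)) (\<Sum>i\<in>{1..?m}.
        Polynomial.smult (of_real (up_weight P i * up_rate P i)) (A ({1..?m} - {i}) * B {1..?n}))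
    + Polynomial.smult (of_real (rate P * down_prob P)) (\<Sum>j\<in>{1..?n}.
        Polynomial.smult (of_real (down_weight P j * down_rate P j)) (A {1..?m} * B ({1..?n} - {j})))"
  show thesis
  proof
    have 1: "degree (A {1..?m} * B {1..?n}) \<le> ?m + ?n"
      using dA[of "{1..?m}"] dB[of "{1..?n}"] by (intro degree_mult_le_add) auto
    have 2: "degree (A ({1..?m} - {i}) * B {1..?n}) \<le> sys_dim P" if "i \<in> {1..?m}" for i
      using degree_mult_le_add[OF dA[of "{1..?m} - {i}"] dB[of "{1..?n}"]] that by simp
    have 3: "degree (A {1..?m} * B ({1..?n} - {i})) \<le> sys_dim P" if "i \<in> {1..?n}" for i
      using degree_mult_le_add[OF dA[of "{1..?m}"] dB[of "{1..?n} - {i}"]] that by simp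
    have "degree ([:of_real (- q - rate P), of_real (drift P), of_real ((vol P)\<^sup>2 / 2):] * (A {1..?m} * B {1..?n})) \<le> 2 + (?m + ?n)"
      by (rule degree_mult_le_add[OF _ 1]) (simp add: degree_pCons_eq_if)
    then show "degree p \<le> sys_dim P"
      unfolding p_def using 2 3
      by (intro degree_add_le order_trans[OF degree_smult_le] degree_sum_le) (auto simp: add.commute)
    fix s :: 'a assume s: "lden P s \<noteq> 0"
    have nz: "of_real (up_rate P i) - s \<noteq> 0" if "i \<in> {1..?m}" for i
      using s that by (auto simp: lden_def)
    have nz': "of_real (down_rate P i) + s \<noteq> 0" if "i \<in> {1..?n}" for i
      using s that by (auto simp: lden_def)
    have AB: "poly (A {1..?m}) s * poly (B {1..?n}) s = lden P s"
      by (simp add: A_def B_def lden_def poly_prod)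
    have Ai: "poly (A ({1..?m} - {i})) s * poly (B {1..?n}) s = lden P s / (of_real (up_rate P i) - s)" if "i \<in> {1..?m}" for i
      using nz[OF that] that prod.remove[of "{1..?m}" i "\<lambda>i. of_real (up_rate P i) - s"]
      by (simp add: A_def B_def lden_def poly_prod)
    have Bi: "poly (A {1..?m}) s * poly (B ({1..?n} - {i})) s = lden P s / (of_real (down_rate P i) + s)" if "i \<in> {1..?n}" for i
      using nz'[OF that] that prod.remove[of "{1..?n}" i "\<lambda>i. of_real (down_rate P i) + s"]
      by (simp add: A_def B_def lden_def poly_prod)
    have "poly p s = (of_real (- q - rate P) + of_real (drift P) * s + of_real ((vol P)\<^sup>2 / 2) * s\<^sup>2) * lden P s
      + of_real (rate P * up_prob P) * (\<Sum>i\<in>{1..?m}. of_real (up_weight P i * up_rate P i) * (lden P s / (of_real (up_rate P i) - s)))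
      + of_real (rate P * down_prob P) * (\<Sum>i\<in>{1..?n}. of_real (down_weight P i * down_rate P i) * (lden P s / (of_real (down_rate P i) + s)))"
    proof -
      have "(\<Sum>i\<in>{1..?m}. of_real (up_weight P i * up_rate P i) * (poly (A ({1..?m} - {i})) s * poly (B {1..?n}) s))
        = (\<Sum>i\<in>{1..?m}. of_real (up_weight P i * up_rate P i) * (lden P s / (of_real (up_rate P i) - s)))"
        using Ai by (intro sum.cong) (simp_all del: One_nat_def)
      moreover have "(\<Sum>i\<in>{1..?n}. of_real (down_weight P i * down_rate P i) * (poly (A {1..?m}) s * poly (B ({1..?n} - {i})) s))
        = (\<Sum>i\<in>{1..?n}. of_real (down_weight P i * down_rate P i) * (lden P s / (of_real (down_rate P i) + s)))"
        using Bi by (intro sum.cong) (simp_all del: One_nat_def)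
      ultimately show ?thesis
        by (simp add: p_def poly_sum AB[symmetric] power2_eq_square algebra_simps del: One_nat_def)
    qed
    also have "\<dots> = (lexp P s - of_real q) * lden P s"
      by (simp add: lexp_def sum_distrib_left sum_distrib_right algebra_simps)
    finally show "poly p s = (lexp P s - of_real q) * lden P s" .
  qed
qed

lemma strict_chain:
  fixes f :: "nat \<Rightarrow> real"
  assumes "\<forall>i\<in>{1..<n}. f i < f (Suc i)" "1 \<le> i" "i < j" "j \<le> n"
  shows "f i < f j"
proof -
  have "Suc i \<le> j" using assms by simp
  then show ?thesis using assms(4)
  proof (induction j rule: dec_induct)
    case base then show ?case using assms by auto
  next
    case (step k)
    then have "f i < f k" by auto
    also have "f k < f (Suc k)" using assms(1) step assms(2) by auto
    finally show ?case .
  qed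
qed

lemma strict_chain_inj:
  fixes f :: "nat \<Rightarrow> real"
  assumes "\<forall>i\<in>{1..<n}. f i < f (Suc i)"
  shows "inj_on f {1..n}"
proof (rule inj_onI)
  fix i j assume ij: "i \<in> {1..n}" "j \<in> {1..n}" "f i = f j"
  show "i = j"
    using strict_chain[OF assms, of i j] strict_chain[OF assms, of j i] ij
    by (cases i j rule: linorder_cases) auto
qed

text \<open>The leading coefficient of the polynomial \<open>(G z - q) * lden P z\<close>, read off at \<open>0\<close> from \<open>G 0 = 0\<close>.\<close>

definition leadc :: "mejd \<Rightarrow> real \<Rightarrow> real set \<Rightarrow> real" where
  "leadc P q R = - q * lden P 0 / (\<Prod>z\<in>R. - z)"

text \<open>The weight \<open>1 / G'(z)\<close> of a root \<open>z\<close>, written without the derivative.\<close>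

definition rweight :: "mejd \<Rightarrow> real \<Rightarrow> real set \<Rightarrow> real \<Rightarrow> real" where
  "rweight P q R z = lden P z / (leadc P q R * (\<Prod>z'\<in>R - {z}. z - z'))"

section \<open>Factorisation of the exponent over the roots of G = q\<close>

locale mejd_roots =
  fixes P :: mejd and q :: real and \<beta> g :: "nat \<Rightarrow> real"
  assumes params: "mejd_params P" and q_pos: "0 < q" and roots: "root_assumption P q \<beta> g"
begin

abbreviation "R \<equiv> roots_set P \<beta> g"
abbreviation "w \<equiv> rweight P q R"

lemma root_iff: "z \<in> R \<longleftrightarrow> z \<notin> levy_poles P \<and> levy_exponent P z = q"
  using roots unfolding root_assumption_def roots_set_def by blast

lemma finite_R: "finite R"
  by (simp add: roots_set_def)

lemma beta_chain: "\<forall>i\<in>{1..<up_num P + 1}. \<beta> i < \<beta> (Suc i)"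
  using roots unfolding root_assumption_def by (metis Suc_eq_plus1 atLeastLessThanSuc_atLeastAtMost less_trans)

lemma g_chain: "\<forall>i\<in>{1..<down_num P + 1}. g i < g (Suc i)"
  using roots unfolding root_assumption_def by (metis Suc_eq_plus1 atLeastLessThanSuc_atLeastAtMost less_trans)

lemma beta_inj: "inj_on \<beta> {1..up_num P + 1}" and g_inj: "inj_on g {1..down_num P + 1}"
  using strict_chain_inj[OF beta_chain] strict_chain_inj[OF g_chain] by auto

lemma beta_ge: "i \<in> {1..up_num P + 1} \<Longrightarrow> \<beta> 1 \<le> \<beta> i"
  using strict_chain[OF beta_chain, of 1 i] by (cases "i = 1") auto

lemma g_ge: "i \<in> {1..down_num P + 1} \<Longrightarrow> g 1 \<le> g i"
  using strict_chain[OF g_chain, of 1 i] by (cases "i = 1") auto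

lemma beta_pos: "i \<in> {1..up_num P + 1} \<Longrightarrow> 0 < \<beta> i"
  using beta_ge[of i] roots unfolding root_assumption_def by linarith

lemma g_pos: "i \<in> {1..down_num P + 1} \<Longrightarrow> 0 < g i"
  using g_ge[of i] roots unfolding root_assumption_def by linarith

lemma R_pos: "{z\<in>R. 0 < z} = \<beta> ` {1..up_num P + 1}"
  and R_neg: "{z\<in>R. z < 0} = (\<lambda>j. - g j) ` {1..down_num P + 1}"
proof -
  show "{z\<in>R. 0 < z} = \<beta> ` {1..up_num P + 1}"
  proof safe
    fix z assume "z \<in> R" "0 < z"
    then show "z \<in> \<beta> ` {1..up_num P + 1}" using g_pos unfolding roots_set_def by fastforce
  qed (use beta_pos in \<open>simp_all add: roots_set_def\<close>)
  show "{z\<in>R. z < 0} = (\<lambda>j. - g j) ` {1..down_num P + 1}"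
  proof safe
    fix z assume "z \<in> R" "z < 0"
    then show "z \<in> (\<lambda>j. - g j) ` {1..down_num P + 1}" using beta_pos unfolding roots_set_def by fastforce
  qed (use g_pos in \<open>simp_all add: roots_set_def\<close>)
qed

lemma R_nonzero: "z \<in> R \<Longrightarrow> z \<noteq> 0"
  using q_pos levy_exponent_0[OF params] by (auto simp: root_iff)

lemma sum_R: "(\<Sum>z\<in>R. f z) = (\<Sum>i=1..up_num P + 1. f (\<beta> i)) + (\<Sum>j=1..down_num P + 1. f (- g j))"
proof -
  have "\<beta> ` {1..up_num P + 1} \<inter> (\<lambda>j. - g j) ` {1..down_num P + 1} = {}"
  proof -
    have "\<beta> i \<noteq> - g j" if "i \<in> {1..up_num P + 1}" "j \<in> {1..down_num P + 1}" for i j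
      using beta_pos[OF that(1)] g_pos[OF that(2)] by linarith
    then show ?thesis by blast
  qed
  moreover have "inj_on (\<lambda>j. - g j) {1..down_num P + 1}"
    using g_inj by (auto simp: inj_on_def)
  ultimately show ?thesis
    using beta_inj unfolding roots_set_def
    by (subst sum.union_disjoint) (auto simp: sum.reindex simp del: One_nat_def)
qed

lemma card_R: "card R = sys_dim P"
  using sum_R[of "\<lambda>_. 1::nat"] by simp

lemma lden_R: "z \<in> R \<Longrightarrow> lden P z \<noteq> 0"
  by (simp add: root_iff lden_zero_iff)

lemma zero_not_pole: "0 \<notin> levy_poles P"
  using mejd_params_rates[OF params] by (force simp: levy_poles_def)

lemma prod_R_ne: "(\<Prod>z\<in>R. - z) \<noteq> 0"
  using R_nonzero finite_R by auto

lemma leadc_nonzero: "leadc P q R \<noteq> 0"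
  using q_pos zero_not_pole R_nonzero finite_R by (auto simp: leadc_def lden_zero_iff)

text \<open>The numerator has degree at most \<open>m + n + 2\<close> and vanishes at as many
  distinct real points, which determines it up to a constant; the value of the exponent at 0
  supplies the constant. The field is left open so that the roots found on the real line also factor
  the characteristic exponent on the imaginary axis.\<close>

lemma exponent_factor:
  fixes s :: "'a::real_field"
  assumes s: "lden P s \<noteq> 0"
  shows "(lexp P s - of_real q) * lden P s = of_real (leadc P q R) * (\<Prod>z\<in>R. s - of_real z)"
proof -
  obtain p :: "'a poly" where p: "degree p \<le> sys_dim P"
    "\<And>s. lden P s \<noteq> 0 \<Longrightarrow> poly p s = (lexp P s - of_real q) * lden P s"
    using lexp_poly by blast
  define Q :: "'a poly" where "Q = (\<Prod>z\<in>R. [:- of_real z, 1:])"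
  have polyQ: "poly Q x = (\<Prod>z\<in>R. x - of_real z)" for x
    by (simp add: Q_def poly_prod)
  have degQ: "degree Q = sys_dim P"
    unfolding Q_def by (subst degree_prod_eq_sum_degree) (simp_all add: card_R)
  have monQ: "coeff Q (sys_dim P) = 1"
    unfolding degQ[symmetric] Q_def by (simp add: lead_coeff_prod)
  \<comment> \<open>The only candidate for the constant: subtracting \<open>C\<close> times the
    monic \<open>Q\<close> removes the top coefficient, while the difference still has
    \<open>m + n + 2\<close> zeros.\<close>
  define C where "C = coeff p (sys_dim P)"
  have pQ: "p = Polynomial.smult C Q"
  proof (rule ccontr)
    let ?D = "p - Polynomial.smult C Q"
    assume "p \<noteq> Polynomial.smult C Q"
    then have ne: "?D \<noteq> 0" by simp
    have "of_real ` R \<subseteq> {x. poly ?D x = 0}"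
    proof safe
      fix z assume z: "z \<in> R"
      have "poly Q (of_real z) = 0" unfolding polyQ using finite_R z by auto
      moreover have "poly p (of_real z) = 0"
        using z lden_R[OF z] by (subst p(2)) (auto simp: lden_of_real lexp_of_real root_iff)
      ultimately show "poly ?D (of_real z) = 0" by simp
    qed
    then have "card ((of_real :: real \<Rightarrow> 'a) ` R) \<le> card {x. poly ?D x = 0}"
      using poly_roots_finite[OF ne] by (rule card_mono[rotated])
    also have "\<dots> \<le> degree ?D" using ne by (rule card_poly_roots_bound)
    also have "card ((of_real :: real \<Rightarrow> 'a) ` R) = sys_dim P"
      using card_R by (simp add: card_image inj_on_def)
    finally have "sys_dim P \<le> degree ?D" .
    moreover have "degree ?D \<le> sys_dim P"
      using p(1) degQ degree_smult_le[of C Q] by (intro degree_diff_le) auto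
    ultimately have "degree ?D = sys_dim P" by (rule antisym[rotated])
    moreover have "lead_coeff ?D \<noteq> 0" using ne by (simp only: leading_coeff_neq_0 not_False_eq_True)
    ultimately have "coeff ?D (sys_dim P) \<noteq> 0" by argo
    moreover have "coeff ?D (sys_dim P) = 0" using monQ unfolding C_def coeff_diff coeff_smult by simp
    ultimately show False by contradiction
  qed
  have "lden P (0::'a) \<noteq> 0"
    using lden_of_real[of P 0, where 'a='a] zero_not_pole by (simp add: lden_zero_iff)
  from p(2)[OF this] have "C * (\<Prod>z\<in>R. - of_real z) = - of_real q * lden P 0"
    using lexp_of_real[of P 0, where 'a='a] levy_exponent_0[OF params] by (simp add: pQ polyQ)
  then have "C * of_real (\<Prod>z\<in>R. - z) = of_real (- q * lden P 0)"
    using lden_of_real[of P 0, where 'a='a] by simp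
  moreover have "of_real (\<Prod>z\<in>R. - z) \<noteq> (0::'a)" using prod_R_ne by (simp only: of_real_eq_0_iff not_False_eq_True)
  ultimately have "C = of_real (- q * lden P 0) / of_real (\<Prod>z\<in>R. - z)" by (metis nonzero_eq_divide_eq)
  then have "C = of_real (leadc P q R)" by (simp only: leadc_def of_real_divide)
  then show ?thesis using p(2)[OF s] by (simp add: pQ polyQ)
qed

text \<open>Lagrange interpolation of the numerator \<open>v * lden\<close> at the roots. The choice
  \<open>v = 1\<close> produces the transform of the resolvent density; an entry of
  \<open>fit_vec\<close> as \<open>v\<close> produces a row of the linear system.\<close>

lemma exponent_partial_fractions:
  fixes s :: "'a::real_field" and v :: "'a \<Rightarrow> 'a"
  assumes s: "lden P s \<noteq> 0" "s \<notin> of_real ` R"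
    and V: "degree V < sys_dim P" "\<And>x. lden P x \<noteq> 0 \<Longrightarrow> poly V x = v x * lden P x"
  shows "(\<Sum>z\<in>R. v (of_real z) * of_real (w z) / (s - of_real z)) = v s / (lexp P s - of_real q)"
proof -
  let ?R = "(of_real :: real \<Rightarrow> 'a) ` R" and ?C = "of_real (leadc P q R) :: 'a"
  have C: "?C \<noteq> 0" using leadc_nonzero by simp
  have inj: "inj_on (of_real :: real \<Rightarrow> 'a) A" for A by (simp add: inj_on_def)
  have cR: "card ?R = sys_dim P" using card_R inj by (simp add: card_image)
  have "(\<Sum>z\<in>?R. poly V z / (\<Prod>z'\<in>?R - {z}. z - z') / (s - z)) = poly V s / (\<Prod>z\<in>?R. s - z)"
    by (rule lagrange_partial_fractions) (use finite_R V cR s in auto)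
  also have "(\<Sum>z\<in>?R. poly V z / (\<Prod>z'\<in>?R - {z}. z - z') / (s - z))
     = (\<Sum>z\<in>R. ?C * (v (of_real z) * of_real (w z) / (s - of_real z)))"
    unfolding sum.reindex[OF inj] o_def
  proof (rule sum.cong)
    fix z assume z: "z \<in> R"
    have "?R - {of_real z} = of_real ` (R - {z})" by auto
    then have "(\<Prod>z'\<in>?R - {of_real z}. of_real z - z') = (of_real (\<Prod>z'\<in>R - {z}. z - z') :: 'a)"
      by (simp add: prod.reindex[OF inj])
    moreover have "poly V (of_real z) = v (of_real z) * of_real (lden P z)"
      using V(2)[of "of_real z"] lden_R[OF z] by (simp add: lden_of_real)
    ultimately show "poly V (of_real z) / (\<Prod>z'\<in>?R - {of_real z}. of_real z - z') / (s - of_real z)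
       = ?C * (v (of_real z) * of_real (w z) / (s - of_real z))"
      using C by (simp add: rweight_def)
  qed simp
  also have "\<dots> = ?C * (\<Sum>z\<in>R. v (of_real z) * of_real (w z) / (s - of_real z))"
    by (simp add: sum_distrib_left)
  also have "poly V s / (\<Prod>z\<in>?R. s - z) = v s * lden P s / (\<Prod>z\<in>R. s - of_real z)"
    using V(2)[OF s(1)] by (simp add: prod.reindex[OF inj])
  finally have "?C * (\<Sum>z\<in>R. v (of_real z) * of_real (w z) / (s - of_real z))
      = v s * lden P s / (\<Prod>z\<in>R. s - of_real z)" .
  then have "(\<Sum>z\<in>R. v (of_real z) * of_real (w z) / (s - of_real z))
      = v s * lden P s / (\<Prod>z\<in>R. s - of_real z) / ?C"
    using C by (metis nonzero_mult_div_cancel_left)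
  also have "\<dots> = v s * lden P s / (?C * (\<Prod>z\<in>R. s - of_real z))"
    by (simp only: divide_divide_eq_left mult.commute)
  also have "\<dots> = v s * lden P s / ((lexp P s - of_real q) * lden P s)"
    by (simp only: exponent_factor[OF s(1)])
  also have "\<dots> = v s / (lexp P s - of_real q)" using s by simp
  finally show ?thesis .
qed

text \<open>Between 0 and the first upward pole the sign of \<open>G - q\<close> changes only at
  \<open>\<beta> 1\<close>. Dividing the factored form by its value at 0 removes the leading
  constant; for a point beyond \<open>\<beta> 1\<close> only the quotient
  \<open>(x - z) / (- z)\<close> of that root would be nonpositive, against a positive left-hand
  side.\<close>

lemma below_first_root:
  assumes "0 \<le> x" "x < up_rate P 1" "levy_exponent P x < q"
  shows "x < \<beta> 1"
proof (rule ccontr)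
  assume "\<not> x < \<beta> 1"
  then have x: "\<beta> 1 \<le> x" by simp
  have b1: "\<beta> 1 \<in> R" by (auto simp: roots_set_def)
  have far: "up_rate P 1 < \<beta> i" if "i \<in> {1..up_num P + 1} - {1}" for i
  proof -
    have "up_rate P 1 < \<beta> (Suc 1)" using roots mejd_params_rates(3)[OF params]
      unfolding root_assumption_def by auto
    also have "\<beta> (Suc 1) \<le> \<beta> i" using strict_chain[OF beta_chain, of 2 i] that
      by (cases "i = 2") (auto simp: numeral_2_eq_2)
    finally show ?thesis .
  qed
  have den: "0 < lden P y" if "0 \<le> y" "y < up_rate P 1" for y
  proof -
    have u: "0 < up_rate P i - y" if "i \<in> {1..up_num P}" for i
      using mejd_params_rates(1)[OF params that] \<open>y < up_rate P 1\<close> by linarith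
    have d: "0 < down_rate P i + y" if "i \<in> {1..down_num P}" for i
      using mejd_params_rates(2)[OF params that] \<open>0 \<le> y\<close> by linarith
    show ?thesis unfolding lden_def using u d by (intro mult_pos_pos prod_pos) (simp_all only: of_real_eq_id id_apply)
  qed
  have ratio: "0 \<le> (x - z) / (- z)" if "z \<in> R - {\<beta> 1}" for z
  proof (cases "0 < z")
    case True
    then have "z \<in> \<beta> ` ({1..up_num P + 1} - {1})" using that R_pos by blast
    then have "x - z < 0" using far assms by fastforce
    then show ?thesis using True by (intro divide_nonpos_neg) auto
  next
    case False
    then have "z < 0" using that R_nonzero[of z] by auto
    then show ?thesis using assms(1) by (intro divide_nonneg_pos) auto
  qed
  have "(levy_exponent P y - q) * lden P y = leadc P q R * (\<Prod>z\<in>R. y - z)" if "0 \<le> y" "y < up_rate P 1" for y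
    using exponent_factor[of y] den[OF that] by (simp add: lexp_real)
  from this[of x] this[of 0] have
    "(levy_exponent P x - q) * lden P x / (- q * lden P 0) = (\<Prod>z\<in>R. x - z) / (\<Prod>z\<in>R. - z)"
    using assms leadc_nonzero levy_exponent_0[OF params] by (simp del: minus_mult_left)
  also have "\<dots> = (\<Prod>z\<in>R. (x - z) / (- z))"
    by (simp only: prod_dividef)
  also have "\<dots> = (x - \<beta> 1) / (- \<beta> 1) * (\<Prod>z\<in>R - {\<beta> 1}. (x - z) / (- z))"
    using b1 finite_R by (rule prod.remove[rotated])
  also have "\<dots> \<le> 0"
  proof (rule mult_nonpos_nonneg)
    show "(x - \<beta> 1) / - \<beta> 1 \<le> 0" using x beta_pos[of 1] by (intro divide_nonneg_neg) auto
    show "0 \<le> (\<Prod>z\<in>R - {\<beta> 1}. (x - z) / (- z))" using ratio by (intro prod_nonneg)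
  qed
  finally have "(levy_exponent P x - q) * lden P x / (- q * lden P 0) \<le> 0" .
  moreover have "0 < (levy_exponent P x - q) * lden P x / (- q * lden P 0)"
    using den[of x] den[of 0] assms q_pos by (intro divide_neg_neg mult_neg_pos) auto
  ultimately show False by linarith
qed

end

section \<open>Densities from characteristic functions\<close>

lemma exp_integral_identity_cont:
  fixes a :: "real \<Rightarrow> real"
  assumes cont: "continuous_on UNIV a" and T: "0 \<le> T"
  shows "(LBINT t:{0..T}. a t * exp (- (LBINT s:{t..T}. a s))) = 1 - exp (- (LBINT s:{0..T}. a s))"
proof -
  have "isCont a x" for x using cont by (simp add: continuous_on_eq_continuous_at)
  then obtain G where G: "(G has_vector_derivative a x) (at x)" for x
    using einterval_antiderivative[of "-\<infinity>" "\<infinity>" a] by auto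
  have I: "(LBINT s:{t..T}. a s) = G T - G t" if "t \<le> T" for t
    unfolding set_lebesgue_integral_def
    by (rule integral_FTC_atLeastAtMost[OF that has_vector_derivative_at_within[OF G] continuous_on_subset[OF cont]]) simp
  have dG: "(G has_real_derivative a x) (at x)" for x
    using G by (simp add: has_real_derivative_iff_has_vector_derivative)
  have "((\<lambda>t. exp (- (G T - G t))) has_real_derivative a t * exp (- (G T - G t))) (at t within {0..T})" for t
    by (auto intro!: derivative_eq_intros has_field_derivative_at_within[OF dG])
  moreover have "continuous_on {0..T} (\<lambda>t. a t * exp (- (G T - G t)))"
    using dG by (intro continuous_intros continuous_on_subset[OF cont] DERIV_continuous_on[where D=a]) (auto intro: has_field_derivative_at_within)
  ultimately have "(LBINT t:{0..T}. a t * exp (- (G T - G t))) = exp (- (G T - G T)) - exp (- (G T - G 0))"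
    unfolding set_lebesgue_integral_def
    by (intro integral_FTC_atLeastAtMost T) (auto simp: has_real_derivative_iff_has_vector_derivative)
  moreover have "(LBINT t:{0..T}. a t * exp (- (LBINT s:{t..T}. a s))) = (LBINT t:{0..T}. a t * exp (- (G T - G t)))"
    by (intro set_lebesgue_integral_cong) (auto simp: I)
  ultimately show ?thesis using T by (simp add: I)
qed

lemma integrable_indicator_Icc [simp]: "integrable lborel (indicator {a..b::real} :: real \<Rightarrow> real)"
  by (intro integrable_real_indicator) (auto simp: emeasure_lborel_Icc_eq)

lemma measurable_tail_integral [measurable]:
  fixes a :: "real \<Rightarrow> real"
  assumes [measurable]: "a \<in> borel_measurable borel"
  shows "(\<lambda>t. LBINT s:{t..T}. a s) \<in> borel_measurable borel"
proof -
  have "(\<lambda>t. LBINT s:{t..T}. a s) = (\<lambda>t. LBINT s. (if t \<le> s \<and> s \<le> T then a s else 0))"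
    by (auto simp: set_lebesgue_integral_def fun_eq_iff indicator_def intro!: Bochner_Integration.integral_cong)
  then show ?thesis by simp
qed

text \<open>For continuous \<open>a\<close> the integrand is a derivative. The rates met along a
  path are merely bounded and measurable, so \<open>a\<close> is approximated almost everywhere by
  continuous functions and both sides pass to the limit by dominated convergence.\<close>

lemma exp_integral_identity:
  fixes a :: "real \<Rightarrow> real"
  assumes meas [measurable]: "a \<in> borel_measurable borel" and bound: "\<And>t. \<bar>a t\<bar> \<le> B" and T: "0 \<le> T"
  shows "(LBINT t:{0..T}. a t * exp (- (LBINT s:{t..T}. a s))) = 1 - exp (- (LBINT s:{0..T}. a s))"
proof -
  have B: "0 \<le> B" using bound[of 0] by linarith
  have "a measurable_on UNIV"
    using meas by (subst measurable_on_iff_borel_measurable) (auto simp: lebesgue_on_UNIV_eq intro: measurable_completion)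
  then obtain N g where N: "negligible N" and g: "\<And>n. continuous_on UNIV (g n :: real \<Rightarrow> real)"
      and lim: "\<And>x. x \<notin> N \<Longrightarrow> (\<lambda>n. g n x) \<longlonglongrightarrow> a x"
    unfolding measurable_on_def by auto
  \<comment> \<open>Clipping at the bound of \<open>a\<close> preserves the limit and gives all
    approximants one common bound.\<close>
  define f where "f n t = max (- B) (min B (g n t))" for n t
  have fcont: "continuous_on UNIV (f n)" for n
    unfolding f_def by (intro continuous_intros g)
  have [measurable]: "f n \<in> borel_measurable borel" for n
    using fcont by (rule borel_measurable_continuous_onI)
  have fB: "\<bar>f n t\<bar> \<le> B" for n t using B by (auto simp: f_def)
  have flim: "AE x in lborel. (\<lambda>n. f n x) \<longlonglongrightarrow> a x"
  proof -
    have "AE x in lborel. x \<notin> N"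
      using AE_not_in[of N lebesgue] N by (simp add: negligible_iff_null_sets AE_completion_iff)
    then show ?thesis
    proof eventually_elim
      case (elim x)
      have "(\<lambda>n. f n x) \<longlonglongrightarrow> max (- B) (min B (a x))"
        unfolding f_def by (intro tendsto_intros lim elim)
      then show ?case using bound[of x] by (simp add: abs_le_iff max_def min_def split: if_splits)
    qed
  qed
  have tail: "(\<lambda>n. LBINT s:{t..T}. f n s) \<longlonglongrightarrow> (LBINT s:{t..T}. a s)" for t
    unfolding set_lebesgue_integral_def
  proof (rule integral_dominated_convergence[where w="\<lambda>s. indicator {t..T} s * B"])
    show "AE x in lborel. (\<lambda>i. indicator {t..T} x *\<^sub>R f i x) \<longlonglongrightarrow> indicator {t..T} x *\<^sub>R a x"
      using flim by eventually_elim (intro tendsto_intros)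
    show "AE x in lborel. norm (indicator {t..T} x *\<^sub>R f i x) \<le> indicator {t..T} x * B" for i
      using fB by (auto simp: indicator_def)
  qed auto
  have tail_le: "\<bar>LBINT s:{t..T}. f n s\<bar> \<le> B * T" if "t \<in> {0..T}" for n t
  proof -
    have "norm (LBINT x. indicator {t..T} x *\<^sub>R f n x) \<le> (LBINT x. indicator {t..T} x * B)"
    proof (rule Bochner_Integration.integral_norm_bound_integral)
      show "integrable lborel (\<lambda>x. indicator {t..T} x *\<^sub>R f n x)"
        by (rule Bochner_Integration.integrable_bound[where f="\<lambda>x. indicator {t..T} x * B"])
           (use fB B in \<open>auto split: split_indicator\<close>)
    qed (use fB in \<open>auto split: split_indicator\<close>)
    then have "\<bar>LBINT s:{t..T}. f n s\<bar> \<le> (LBINT x. indicator {t..T} x * B)"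
      by (simp add: set_lebesgue_integral_def)
    also have "\<dots> = B * (T - t)" using that by (simp add: mult.commute)
    also have "\<dots> \<le> B * T" using that B by (intro mult_left_mono) auto
    finally show ?thesis .
  qed
  have "(\<lambda>n. LBINT t:{0..T}. f n t * exp (- (LBINT s:{t..T}. f n s))) \<longlonglongrightarrow>
        (LBINT t:{0..T}. a t * exp (- (LBINT s:{t..T}. a s)))"
    unfolding set_lebesgue_integral_def[of _ "{0..T}"]
  proof (rule integral_dominated_convergence[where w="\<lambda>s. indicator {0..T} s * (B * exp (B * T))"])
    show "AE x in lborel. (\<lambda>i. indicator {0..T} x *\<^sub>R (f i x * exp (- (LBINT s:{x..T}. f i s)))) \<longlonglongrightarrow>
        indicator {0..T} x *\<^sub>R (a x * exp (- (LBINT s:{x..T}. a s)))"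
      using flim by eventually_elim (intro tendsto_intros tail)
    show "AE x in lborel. norm (indicator {0..T} x *\<^sub>R (f i x * exp (- (LBINT s:{x..T}. f i s)))) \<le> indicator {0..T} x * (B * exp (B * T))" for i
    proof (rule AE_I2)
      fix x
      show "norm (indicator {0..T} x *\<^sub>R (f i x * exp (- (LBINT s:{x..T}. f i s)))) \<le> indicator {0..T} x * (B * exp (B * T))"
        using fB[of i x] tail_le[of x i] B
        by (auto simp: indicator_def abs_mult intro!: mult_mono)
    qed
  qed auto
  moreover have "(\<lambda>n. 1 - exp (- (LBINT s:{0..T}. f n s))) \<longlonglongrightarrow> 1 - exp (- (LBINT s:{0..T}. a s))"
    by (intro tendsto_intros tail)
  ultimately show ?thesis
    unfolding exp_integral_identity_cont[OF fcont T] by (rule LIMSEQ_unique)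
qed

section \<open>Laplace and characteristic transforms\<close>

lemma complex_exp_integral:
  fixes s :: complex
  assumes s: "0 < Re s"
  shows "integrable lborel (\<lambda>y. indicator {0..} y *\<^sub>R exp (- s * of_real y))"
    and "(LINT y|lborel. indicator {0..} y *\<^sub>R exp (- s * of_real y)) = 1 / s"
proof -
  have s0: "s \<noteq> 0" using s by auto
  \<comment> \<open>The modulus of the integrand is the exponential density of rate
    \<open>Re s\<close> up to a constant factor; its total mass 1 gives integrability, and it is the
    dominating function later on.\<close>
  have "integrable lborel (exponential_density (Re s))"
  proof (rule integrableI_nonneg)
    show "(\<integral>\<^sup>+ x. ennreal (exponential_density (Re s) x) \<partial>lborel) < \<infinity>"
      using prob_space.emeasure_space_1[OF prob_space_exponential_density[OF s]]
      by (simp add: emeasure_density)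
  qed (use s in \<open>auto intro!: exponential_density_nonneg\<close>)
  then have int: "integrable lborel (\<lambda>y. exponential_density (Re s) y / Re s)" by simp
  have norm_eq: "norm (indicator {0..} y *\<^sub>R exp (- s * of_real y)) = exponential_density (Re s) y / Re s" for y
    using s by (auto simp: exponential_density_def indicator_def norm_exp_eq_Re mult.commute)
  have [measurable]: "(\<lambda>y. exp (- s * of_real y)) \<in> borel_measurable borel"
    by (intro borel_measurable_continuous_onI continuous_intros)
  show integ: "integrable lborel (\<lambda>y. indicator {0..} y *\<^sub>R exp (- s * of_real y))"
    by (rule Bochner_Integration.integrable_bound[OF int])
       (use norm_eq s in \<open>auto simp: exponential_density_nonneg\<close>)
  have deriv: "((\<lambda>y. - exp (- s * of_real y) / s) has_vector_derivative exp (- s * of_real y)) (at y within A)" for y A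
    using s0 by (auto intro!: derivative_eq_intros has_vector_derivative_real_field)
  have "(LBINT y. indicator {0..real n} y *\<^sub>R exp (- s * of_real y)) = 1 / s - exp (- s * of_real (real n)) / s" for n
    by (subst integral_FTC_atLeastAtMost[OF _ deriv]) (auto intro!: continuous_intros)
  moreover have "(\<lambda>n. 1 / s - exp (- s * of_real (real n)) / s) \<longlonglongrightarrow> 1 / s - 0 / s"
  proof (intro tendsto_intros s0)
    have "(\<lambda>n. exp (- Re s * real n)) \<longlonglongrightarrow> 0"
      using s by real_asymp
    then show "(\<lambda>n. exp (- s * of_real (real n))) \<longlonglongrightarrow> 0"
      by (subst tendsto_norm_zero_iff[symmetric]) (simp add: norm_exp_eq_Re)
  qed
  moreover have "(\<lambda>n. LBINT y. indicator {0..real n} y *\<^sub>R exp (- s * of_real y)) \<longlonglongrightarrow>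
     (LBINT y. indicator {0..} y *\<^sub>R exp (- s * of_real y))"
  proof (rule integral_dominated_convergence[where w="\<lambda>y. exponential_density (Re s) y / Re s"])
    show "AE x in lborel. (\<lambda>i. indicat_real {0..real i} x *\<^sub>R exp (- s * complex_of_real x)) \<longlonglongrightarrow>
        indicat_real {0..} x *\<^sub>R exp (- s * complex_of_real x)"
    proof (intro AE_I2 tendsto_intros tendsto_eventually)
      fix x show "\<forall>\<^sub>F n in sequentially. indicat_real {0..real n} x = indicat_real {0..} x"
        using eventually_ge_at_top[of "nat \<lceil>x\<rceil>"] by eventually_elim (auto simp: indicator_def)
    qed
    show "AE x in lborel. norm (indicat_real {0..real i} x *\<^sub>R exp (- s * complex_of_real x)) \<le> exponential_density (Re s) x / Re s" for i
    proof (intro AE_I2)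
      fix x show "norm (indicat_real {0..real i} x *\<^sub>R exp (- s * complex_of_real x)) \<le> exponential_density (Re s) x / Re s"
        unfolding norm_eq[symmetric] by (auto simp: indicator_def)
    qed
  qed (use int in auto)
  ultimately show "(LINT y|lborel. indicator {0..} y *\<^sub>R exp (- s * of_real y)) = 1 / s"
    by (auto dest: LIMSEQ_unique)
qed

text \<open>A mixture averages the bounded functions cos and sin, hence also the characteristic
  function. It serves twice: for the two-point mixture in \<open>char_eq_imp_density\<close> and for
  the Poisson mixture \<open>\<kappa>\<close>.\<close>

lemma char_bind:
  assumes M: "prob_space M" and N [measurable]: "N \<in> measurable M (subprob_algebra borel)"
    and pN: "\<And>x. x \<in> space M \<Longrightarrow> prob_space (N x)"
  shows "char (M \<bind> N) t = (CLINT x|M. char (N x) t)"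
proof -
  interpret M: prob_space M by fact
  have sN: "sets (N x) = sets borel" if "x \<in> space M" for x
    by (rule sets_kernel[OF N that])
  interpret B: prob_space "M \<bind> N"
    by (rule M.prob_space_bind[OF AE_I2[OF pN] N])
  have sB: "sets (M \<bind> N) = sets borel"
    by (rule sets_bind[OF sN M.not_empty])
  have ch: "char K t = Complex (\<integral>y. cos (t * y) \<partial>K) (\<integral>y. sin (t * y) \<partial>K)"
    if "prob_space K" "sets K = sets borel" for K
  proof -
    interpret K: prob_space K by fact
    have [measurable_cong]: "sets K = sets borel" by fact
    have i: "integrable K (\<lambda>y. cos (t * y))" "integrable K (\<lambda>y. sin (t * y))"
      by (rule K.integrable_const_bound[where B=1]; auto)+
    have "char K t = (CLINT y|K. of_real (cos (t * y)) + \<i> * of_real (sin (t * y)))"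
      unfolding char_def by (intro Bochner_Integration.integral_cong) (simp_all add: exp_Euler cos_of_real sin_of_real flip: of_real_mult)
    also have "\<dots> = of_real (\<integral>y. cos (t * y) \<partial>K) + \<i> * of_real (\<integral>y. sin (t * y) \<partial>K)"
      using i by simp
    finally show ?thesis by (simp only: Complex_eq)
  qed
  have bd: "integral\<^sup>L (M \<bind> N) f = (\<integral>x. integral\<^sup>L (N x) f \<partial>M)" "integrable M (\<lambda>x. integral\<^sup>L (N x) f)"
    if f [measurable]: "f \<in> borel_measurable borel" and b: "\<And>x. \<bar>f x\<bar> \<le> 1" for f :: "real \<Rightarrow> real"
  proof -
    show "integral\<^sup>L (M \<bind> N) f = (\<integral>x. integral\<^sup>L (N x) f \<partial>M)"
      by (rule integral_bind[where K=borel and B=1 and B'=1])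
         (use b N in \<open>auto simp: M.finite_measure prob_space.emeasure_space_1[OF pN]\<close>)
    show "integrable M (\<lambda>x. integral\<^sup>L (N x) f)"
    proof (rule M.integrable_const_bound[where B=1])
      show "AE x in M. norm (integral\<^sup>L (N x) f) \<le> 1"
      proof (rule AE_I2)
        fix x assume x: "x \<in> space M"
        interpret K: prob_space "N x" by (rule pN[OF x])
        have "f \<in> borel_measurable (N x)"
          using f measurable_cong_sets[OF sN[OF x] refl] by blast
        then have "integrable (N x) f" by (intro K.integrable_const_bound[where B=1]) (use b in auto)
        then have "norm (integral\<^sup>L (N x) f) \<le> (\<integral>y. 1 \<partial>N x)"
          by (intro Bochner_Integration.integral_norm_bound_integral) (use b in auto)
        then show "norm (integral\<^sup>L (N x) f) \<le> 1" by (simp add: K.prob_space)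
      qed
      show "(\<lambda>x. integral\<^sup>L (N x) f) \<in> borel_measurable M"
        by (rule measurable_compose[OF N integral_measurable_subprob_algebra]) (rule f)
    qed
  qed
  have c: "(\<lambda>y. cos (t * y)) \<in> borel_measurable borel" "(\<lambda>y. sin (t * y)) \<in> borel_measurable borel" by measurable
  have "(CLINT x|M. char (N x) t) = (CLINT x|M. Complex (\<integral>y. cos (t * y) \<partial>N x) (\<integral>y. sin (t * y) \<partial>N x))"
    by (intro Bochner_Integration.integral_cong) (auto simp: ch pN sN)
  also have "\<dots> = Complex (\<integral>x. \<integral>y. cos (t * y) \<partial>N x \<partial>M) (\<integral>x. \<integral>y. sin (t * y) \<partial>N x \<partial>M)"
    unfolding Complex_eq using bd(2)[OF c(1)] bd(2)[OF c(2)] by simp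
  also have "\<dots> = char (M \<bind> N) t"
    using ch[OF B.prob_space_axioms sB] bd(1)[OF c(1)] bd(1)[OF c(2)] by simp
  finally show ?thesis by simp
qed

text \<open>No positivity of \<open>r\<close> is assumed: the negative part of \<open>r\<close> is moved to the other side,
  so that two genuine distributions are compared.\<close>

lemma char_eq_imp_density:
  fixes r :: "real \<Rightarrow> real"
  assumes K: "real_distribution K" and r: "integrable lborel r"
    and ch: "\<And>t. char K t = (CLINT y|lborel. of_real (r y) * iexp (t * y))"
  shows "K = density lborel (\<lambda>y. ennreal (r y))" "AE y in lborel. 0 \<le> r y"
proof -
  interpret K: real_distribution K by fact
  \<comment> \<open>Any probability density would do. Adding it to both parts of \<open>r\<close>
    keeps their difference and gives the second part mass at least 1, so that it can be normalised
    even if \<open>r\<close> has no negative part.\<close>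
  define g where "g = std_normal_density"
  have [measurable]: "r \<in> borel_measurable borel" using borel_measurable_integrable[OF r] by simp
  have g: "integrable lborel g" "(LINT y|lborel. g y) = 1" "\<And>y. 0 \<le> g y" and [measurable]: "g \<in> borel_measurable borel"
    unfolding g_def by auto
  define r1 where "r1 y = max 0 (r y) + g y" for y
  define r2 where "r2 y = max 0 (- r y) + g y" for y
  have r12: "r1 y = r y + r2 y" for y by (simp add: r1_def r2_def)
  have nn: "0 \<le> r1 y" "0 \<le> r2 y" for y using g(3)[of y] by (auto simp: r1_def r2_def)
  have [measurable]: "r1 \<in> borel_measurable borel" "r2 \<in> borel_measurable borel"
    unfolding r1_def r2_def by measurable
  have i2: "integrable lborel r2" and i1: "integrable lborel r1"
    unfolding r1_def r2_def using r g(1) by (auto intro!: integrable_max)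
  define m1 where "m1 = (LINT y|lborel. r1 y)"
  define m2 where "m2 = (LINT y|lborel. r2 y)"
  have m2: "1 \<le> m2"
  proof -
    have "(LINT y|lborel. g y) \<le> m2" unfolding m2_def using g(1) i2
      by (rule integral_mono) (auto simp: r2_def)
    then show ?thesis using g(2) by simp
  qed
  \<comment> \<open>At \<open>t = 0\<close> the hypothesis says that \<open>r\<close> integrates to
    1.\<close>
  have "complex_of_real 1 = of_real (LINT y|lborel. r y)"
    using ch[of 0] K.char_zero by simp
  then have "(LINT y|lborel. r y) = 1" by (simp only: of_real_eq_iff)
  then have m12: "m1 = 1 + m2"
    unfolding m1_def m2_def r12 using r i2 by simp
  have dens: "real_distribution (density lborel (\<lambda>y. ennreal (f y / m)))"
      "char (density lborel (\<lambda>y. ennreal (f y / m))) t = (CLINT y|lborel. of_real (f y) * iexp (t * y)) / of_real m"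
    if f [measurable]: "f \<in> borel_measurable borel" "integrable lborel f" "\<And>y. 0 \<le> f y" "m = (LINT y|lborel. f y)" "0 < m" for f m t
  proof -
    have "emeasure (density lborel (\<lambda>y. ennreal (f y / m))) UNIV = 1"
      using that by (simp add: emeasure_density nn_integral_eq_integral)
    then show "real_distribution (density lborel (\<lambda>y. ennreal (f y / m)))"
      by (auto simp: real_distribution_def real_distribution_axioms_def intro!: prob_spaceI)
    show "char (density lborel (\<lambda>y. ennreal (f y / m))) t = (CLINT y|lborel. of_real (f y) * iexp (t * y)) / of_real m"
      unfolding char_def using that
      by (subst integral_density) (auto simp: scaleR_conv_of_real algebra_simps)
  qed
  define K2 where "K2 = density lborel (\<lambda>y. ennreal (r2 y / m2))"
  define K1 where "K1 = density lborel (\<lambda>y. ennreal (r1 y / m1))"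
  have K2: "real_distribution K2" "\<And>t. char K2 t = (CLINT y|lborel. of_real (r2 y) * iexp (t * y)) / of_real m2"
    unfolding K2_def by (rule dens; use i2 nn m2 m2_def in auto)+
  have K1: "real_distribution K1" "\<And>t. char K1 t = (CLINT y|lborel. of_real (r1 y) * iexp (t * y)) / of_real m1"
    unfolding K1_def by (rule dens; use i1 nn m2 m12 m1_def in auto)+
  interpret K2: real_distribution K2 by fact
  define N where "N b = (if b then K else K2)" for b
  \<comment> \<open>Since \<open>m1 = 1 + m2\<close>, the numbers \<open>1 / m1\<close> and
    \<open>m2 / m1\<close> are the weights of a mixture: \<open>K\<close> and the normalised
    \<open>r2\<close> together have the characteristic function of the normalised
    \<open>r1\<close>.\<close>
  define p where "p = 1 / m1"
  have p: "0 \<le> p" "p \<le> 1" using m2 m12 by (auto simp: p_def)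
  have m1: "0 < m1" using m2 m12 by simp
  have m1p: "m1 * p = 1" "m1 * (1 - p) = m2" using m1 m12 by (auto simp: p_def field_simps)
  have mN: "N \<in> measurable (measure_pmf (bernoulli_pmf p)) (subprob_algebra borel)"
    by (auto simp: N_def space_subprob_algebra K.prob_space_axioms K2.prob_space_axioms prob_space_imp_subprob_space)
  have pN: "prob_space (N b)" for b by (simp add: N_def K.prob_space_axioms K2.prob_space_axioms)
  define Mx where "Mx = measure_pmf (bernoulli_pmf p) \<bind> N"
  have "real_distribution Mx"
    unfolding Mx_def real_distribution_def real_distribution_axioms_def
    using measure_pmf.prob_space_bind[OF AE_I2[OF pN] mN] sets_bind[of _ N borel] by (auto simp: N_def)
  moreover have "char Mx = char K1"
  proof
    fix t
    have ii: "integrable lborel (\<lambda>y. of_real (f y) * iexp (t * y))" if "integrable lborel f" for f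
      by (rule Bochner_Integration.integrable_bound[OF that])
         (use borel_measurable_integrable[OF that] in \<open>auto simp: norm_mult\<close>)
    have "char Mx t = (CLINT b|measure_pmf (bernoulli_pmf p). char (N b) t)"
      unfolding Mx_def by (rule char_bind) (use mN pN measure_pmf.prob_space_axioms in auto)
    also have "\<dots> = of_real p * char K t + of_real (1 - p) * char K2 t"
      using p by (subst integral_measure_pmf[of UNIV]) (auto simp: N_def UNIV_bool scaleR_conv_of_real)
    also have "\<dots> = ((CLINT y|lborel. of_real (r y) * iexp (t * y)) + (CLINT y|lborel. of_real (r2 y) * iexp (t * y))) / of_real m1"
    proof -
      have "1 - p = m2 / m1" using m1 m12 by (simp add: p_def field_simps)
      then have "complex_of_real p = 1 / of_real m1" "complex_of_real (1 - p) = of_real m2 / of_real m1"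
        by (simp_all only: p_def of_real_divide of_real_1)
      then show ?thesis unfolding ch K2 using m2 by (simp add: add_divide_distrib)
    qed
    also have "\<dots> = char K1 t"
      unfolding K1 r12 of_real_add distrib_right using ii[OF r] ii[OF i2] by simp
    finally show "char Mx t = char K1 t" .
  qed
  ultimately have eq: "Mx = K1" using K1(1) by (intro Levy_uniqueness)
  have em: "emeasure K A + (\<integral>\<^sup>+y\<in>A. ennreal (r2 y) \<partial>lborel) = (\<integral>\<^sup>+y\<in>A. ennreal (r1 y) \<partial>lborel)" if A[measurable]: "A \<in> sets borel" for A
  proof -
    have "emeasure Mx A = ennreal p * emeasure K A + ennreal (1 - p) * emeasure K2 A"
      unfolding Mx_def using p emeasure_bind[OF _ mN, of A] by (simp add: N_def mult.commute)
    moreover have "ennreal m1 * (ennreal p * emeasure K A) = emeasure K A"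
      using m1 p m1p by (simp add: ennreal_mult[symmetric] mult.assoc[symmetric])
    moreover have "ennreal m1 * (ennreal (1 - p) * emeasure K2 A) = (\<integral>\<^sup>+y\<in>A. ennreal (r2 y) \<partial>lborel)"
    proof -
      have "ennreal m1 * (ennreal (1 - p) * emeasure K2 A) = ennreal m2 * emeasure K2 A"
        using m1 p m1p by (simp add: mult.assoc[symmetric] ennreal_mult[symmetric])
      also have "\<dots> = (\<integral>\<^sup>+y. ennreal m2 * (ennreal (r2 y / m2) * indicator A y) \<partial>lborel)"
        unfolding K2_def by (simp add: emeasure_density nn_integral_cmult)
      also have "\<dots> = (\<integral>\<^sup>+y\<in>A. ennreal (r2 y) \<partial>lborel)"
        using m2 nn by (intro nn_integral_cong) (simp add: mult.assoc[symmetric] ennreal_mult[symmetric])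
      finally show ?thesis .
    qed
    moreover have "ennreal m1 * emeasure K1 A = (\<integral>\<^sup>+y\<in>A. ennreal (r1 y) \<partial>lborel)"
    proof -
      have "ennreal m1 * emeasure K1 A = (\<integral>\<^sup>+y. ennreal m1 * (ennreal (r1 y / m1) * indicator A y) \<partial>lborel)"
        unfolding K1_def by (simp add: emeasure_density nn_integral_cmult)
      also have "\<dots> = (\<integral>\<^sup>+y\<in>A. ennreal (r1 y) \<partial>lborel)"
        using m1 nn by (intro nn_integral_cong) (simp add: mult.assoc[symmetric] ennreal_mult[symmetric])
      finally show ?thesis .
    qed
    ultimately show ?thesis using eq by (metis distrib_left)
  qed
  \<comment> \<open>Finiteness is what permits cancelling this term in extended arithmetic
    below.\<close>
  have fin2: "(\<integral>\<^sup>+y\<in>A. ennreal (r2 y) \<partial>lborel) < \<infinity>" if "A \<in> sets borel" for A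
  proof -
    have "(\<integral>\<^sup>+y\<in>A. ennreal (r2 y) \<partial>lborel) \<le> (\<integral>\<^sup>+y. ennreal (r2 y) \<partial>lborel)"
      by (intro nn_integral_mono) (auto split: split_indicator)
    also have "\<dots> < \<infinity>" using i2 nn by (simp add: nn_integral_eq_integral)
    finally show ?thesis .
  qed
  \<comment> \<open>On the set where \<open>r\<close> is negative, \<open>em\<close> forces the mass
    under \<open>K\<close> and the integral of \<open>- r\<close> to add up to zero.\<close>
  show nonneg: "AE y in lborel. 0 \<le> r y"
  proof -
    let ?A = "{y. r y < 0}"
    have "(\<integral>\<^sup>+y\<in>?A. ennreal (r1 y) \<partial>lborel) + (\<integral>\<^sup>+y\<in>?A. ennreal (- r y) \<partial>lborel) = (\<integral>\<^sup>+y\<in>?A. ennreal (r2 y) \<partial>lborel)"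
      using nn by (subst nn_integral_add[symmetric], simp, simp, intro nn_integral_cong)
        (auto simp: r12 ennreal_plus[symmetric] split: split_indicator simp del: ennreal_plus)
    moreover have "?A \<in> sets borel" by measurable
    note em[OF this]
    ultimately have "(\<integral>\<^sup>+y\<in>?A. ennreal (r2 y) \<partial>lborel) + (emeasure K ?A + (\<integral>\<^sup>+y\<in>?A. ennreal (- r y) \<partial>lborel))
        = (\<integral>\<^sup>+y\<in>?A. ennreal (r2 y) \<partial>lborel) + 0"
      by (metis (no_types, lifting) ab_semigroup_add_class.add_ac(1) add.commute add.right_neutral)
    then have "emeasure K ?A + (\<integral>\<^sup>+y\<in>?A. ennreal (- r y) \<partial>lborel) = 0"
      using fin2[of ?A] by (subst (asm) ennreal_add_left_cancel) auto
    then have "(\<integral>\<^sup>+y\<in>?A. ennreal (- r y) \<partial>lborel) = 0" by simp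
    then have "AE y in lborel. ennreal (- r y) * indicator ?A y = 0"
      by (subst (asm) nn_integral_0_iff_AE) auto
    then show ?thesis by eventually_elim (auto simp: indicator_def ennreal_eq_0_iff split: if_splits)
  qed
  show "K = density lborel (\<lambda>y. ennreal (r y))"
  proof (rule measure_eqI)
    fix A assume "A \<in> sets K"
    then have A [measurable]: "A \<in> sets borel" by simp
    have "(\<integral>\<^sup>+y\<in>A. ennreal (r y) \<partial>lborel) + (\<integral>\<^sup>+y\<in>A. ennreal (r2 y) \<partial>lborel) = (\<integral>\<^sup>+y\<in>A. ennreal (r1 y) \<partial>lborel)"
      by (subst nn_integral_add[symmetric], simp, simp, rule nn_integral_cong_AE)
         (use nonneg nn in \<open>auto elim!: eventually_mono simp: r12 ennreal_plus split: split_indicator\<close>)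
    with em[OF A] have "(\<integral>\<^sup>+y\<in>A. ennreal (r2 y) \<partial>lborel) + emeasure K A = (\<integral>\<^sup>+y\<in>A. ennreal (r2 y) \<partial>lborel) + (\<integral>\<^sup>+y\<in>A. ennreal (r y) \<partial>lborel)"
      by (simp add: add.commute)
    then have "emeasure K A = (\<integral>\<^sup>+y\<in>A. ennreal (r y) \<partial>lborel)"
      using fin2[OF A] by (subst (asm) ennreal_add_left_cancel) auto
    then show "emeasure K A = emeasure (density lborel (\<lambda>y. ennreal (r y))) A"
      by (simp add: emeasure_density)
  qed simp
qed

section \<open>Increments of the process\<close>

text \<open>The driver is given by independence within each of its three processes and independence
  of the sigma-algebras they generate. A finite intersection factors first over the groups and then
  inside each group, which yields joint independence of all coordinates.\<close>

lemma (in prob_space) indep_vars_Sigma: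
  assumes G: "finite G"
    and grp: "\<And>g. g \<in> G \<Longrightarrow> indep_vars (\<lambda>_. N) (\<lambda>i. X (g, i)) (I g)"
    and F: "indep_sets F G"
    and sub: "\<And>g. g \<in> G \<Longrightarrow> sigma_algebra (space M) (F g)"
    and ev: "\<And>g i A. g \<in> G \<Longrightarrow> i \<in> I g \<Longrightarrow> A \<in> sets N \<Longrightarrow> X (g, i) -` A \<inter> space M \<in> F g"
  shows "indep_vars (\<lambda>_. N) X (Sigma G I)"
  unfolding indep_vars_def2
proof (intro conjI ballI)
  fix p assume "p \<in> Sigma G I"
  then show "random_variable N (X p)" using grp unfolding indep_vars_def2 by fastforce
next
  show "indep_sets (\<lambda>i. {X i -` A \<inter> space M |A. A \<in> sets N}) (Sigma G I)"
  proof (rule indep_setsI)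
    fix p assume "p \<in> Sigma G I"
    then have "random_variable N (X p)" using grp unfolding indep_vars_def2 by fastforce
    then show "{X p -` A \<inter> space M |A. A \<in> sets N} \<subseteq> events" by auto
  next
    fix A J assume J: "J \<noteq> {}" "J \<subseteq> Sigma G I" "finite J"
      and A: "\<forall>j\<in>J. A j \<in> {X j -` A \<inter> space M |A. A \<in> sets N}"
    define K where "K g = {i. (g, i) \<in> J}" for g
    define H where "H = fst ` J"
    have H: "finite H" "H \<noteq> {}" "H \<subseteq> G" using J by (auto simp: H_def)
    have JS: "J = Sigma H K" by (force simp: H_def K_def)
    have K: "finite (K g)" "K g \<noteq> {}" "K g \<subseteq> I g" if "g \<in> H" for g
    proof -
      have "K g \<subseteq> snd ` J" by (force simp: K_def)
      then show "finite (K g)" using J(3) finite_surj by blast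
      show "K g \<noteq> {}" using that by (auto simp: H_def K_def)
      show "K g \<subseteq> I g" using J(2) by (auto simp: K_def)
    qed
    define B where "B g = (\<Inter>i\<in>K g. A (g, i))" for g
    have BF: "B g \<in> F g" if g: "g \<in> H" for g
    proof -
      interpret F: sigma_algebra "space M" "F g" using sub H g by auto
      have "A (g, i) \<in> F g" if i: "i \<in> K g" for i
      proof -
        have "(g, i) \<in> J" using i by (simp add: K_def)
        then obtain A' where "A' \<in> sets N" "A (g, i) = X (g, i) -` A' \<inter> space M" using A by blast
        then show ?thesis using ev[of g i A'] i g H K(3)[OF g] by auto
      qed
      then show ?thesis unfolding B_def using K[OF g] by (intro F.finite_INT) auto
    qed
    have "(\<Inter>j\<in>J. A j) = (\<Inter>g\<in>H. B g)" unfolding JS B_def by auto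
    also have "prob \<dots> = (\<Prod>g\<in>H. prob (B g))"
      using indep_setsD[OF F H(3,2,1)] BF by auto
    also have "\<dots> = (\<Prod>g\<in>H. \<Prod>i\<in>K g. prob (A (g, i)))"
    proof (rule prod.cong)
      fix g assume g: "g \<in> H"
      have "indep_sets (\<lambda>i. {X (g, i) -` A \<inter> space M |A. A \<in> sets N}) (I g)"
        using grp[of g] H g by (auto simp: indep_vars_def2)
      then show "prob (B g) = (\<Prod>i\<in>K g. prob (A (g, i)))"
        unfolding B_def by (rule indep_setsD) (use K[OF g] A in \<open>auto simp: K_def\<close>)
    qed simp
    also have "\<dots> = (\<Prod>j\<in>J. prob (A j))"
      unfolding JS using H(1) K(1) by (subst prod.Sigma) auto
    finally show "prob (\<Inter>j\<in>J. A j) = (\<Prod>j\<in>J. prob (A j))" .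
  qed
qed

lemma Collect_ex_vimage: "{X i -` A \<inter> S |i A. i \<in> I \<and> A \<in> T} \<subseteq> Pow S" by auto

lemma measurable_process_events:
  assumes "i \<in> I" "X i \<in> space M \<rightarrow> space S"
  shows "X i \<in> measurable (sigma (space M) {X i -` A \<inter> space M | i A. i \<in> I \<and> A \<in> sets S}) S"
proof (rule measurableI)
  fix A assume "A \<in> sets S"
  then show "X i -` A \<inter> space (sigma (space M) {X i -` A \<inter> space M | i A. i \<in> I \<and> A \<in> sets S})
    \<in> sets (sigma (space M) {X i -` A \<inter> space M | i A. i \<in> I \<and> A \<in> sets S})"
    using assms(1) unfolding sets_measure_of[OF Collect_ex_vimage] space_measure_of_conv by blast
qed (use assms(2) in \<open>auto simp: space_measure_of_conv\<close>)

lemma sigma_algebra_process_events: "sigma_algebra (space M) (process_events M I S X)"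
  unfolding process_events_def by (intro sigma_algebra_sigma_sets) auto

lemma sets_process_events:
  "sets (sigma (space M) {X i -` A \<inter> space M | i A. i \<in> I \<and> A \<in> sets S}) = process_events M I S X"
  unfolding process_events_def by (rule sets_measure_of) auto

lemma char_affine:
  assumes "prob_space M" "X \<in> borel_measurable M"
  shows "char (distr M borel (\<lambda>\<omega>. a + b * X \<omega>)) t = iexp (t * a) * char (distr M borel X) (t * b)"
proof -
  have "char (distr M borel (\<lambda>\<omega>. a + b * X \<omega>)) t = (CLINT \<omega>|M. iexp (t * a) * iexp (t * b * X \<omega>))"
    unfolding char_def using assms by (subst integral_distr) (auto simp: algebra_simps exp_add)
  also have "\<dots> = iexp (t * a) * (CLINT \<omega>|M. iexp (t * b * X \<omega>))" by simp
  also have "(CLINT \<omega>|M. iexp (t * b * X \<omega>)) = char (distr M borel X) (t * b)"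
    unfolding char_def using assms by (subst integral_distr) auto
  finally show ?thesis .
qed

lemma (in prob_space) char_normal:
  assumes D: "distributed M lborel X (normal_density 0 \<sigma>)" and s: "0 < \<sigma>"
  shows "char (distr M borel X) t = exp (- ((\<sigma> * t)\<^sup>2) / 2)"
proof -
  have [measurable]: "X \<in> borel_measurable M" using distributed_measurable[OF D] by simp
  have "distributed M lborel (\<lambda>x. X x / \<sigma>) std_normal_density"
    using D normal_standard_normal_convert[OF s, of X 0] by simp
  then have "distr M borel (\<lambda>x. X x / \<sigma>) = std_normal_distribution"
    by (metis distributed_distr_eq_density distr_cong sets_lborel)
  moreover have "X = (\<lambda>x. 0 + \<sigma> * (X x / \<sigma>))" using s by auto
  then have "char (distr M borel X) t = iexp (t * 0) * char (distr M borel (\<lambda>x. X x / \<sigma>)) (t * \<sigma>)"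
    using char_affine[of M "\<lambda>x. X x / \<sigma>" 0 \<sigma> t] prob_space_axioms by simp
  ultimately show ?thesis by (simp add: char_std_normal_distribution mult.commute exp_of_real[symmetric])
qed

definition jump_char :: "mejd \<Rightarrow> real \<Rightarrow> complex" where
  "jump_char P t = (CLINT y|lborel. of_real (jump_density P y) * iexp (t * y))"

text \<open>Characteristic function of an increment over a time \<open>\<delta>\<close> containing
  exactly \<open>n\<close> jumps: a drift phase, a centred Gaussian of standard deviation
  \<open>vol P * sqrt \<delta>\<close>, and \<open>n\<close> independent jumps.\<close>

definition kernel_char :: "mejd \<Rightarrow> real \<Rightarrow> nat \<Rightarrow> real \<Rightarrow> complex" where
  "kernel_char P \<delta> n t = iexp (t * (drift P * \<delta>)) * exp (- ((sqrt \<delta> * (t * vol P))\<^sup>2) / 2) * jump_char P t ^ n"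

lemma measurable_jump_density [measurable]: "jump_density P \<in> borel_measurable borel"
  unfolding jump_density_def[abs_def] by measurable

section \<open>Building blocks of an increment\<close>

locale mejd_driven = prob_space M for M :: "'a measure" +
  fixes P :: mejd and W :: "real \<Rightarrow> 'a \<Rightarrow> real" and N :: "real \<Rightarrow> 'a \<Rightarrow> nat" and Y :: "nat \<Rightarrow> 'a \<Rightarrow> real"
  assumes params: "mejd_params P" and driver: "mejd_driver M P W N Y"
begin

abbreviation "X \<equiv> mejd_process P W N Y 0"

lemma process_shift: "mejd_process P W N Y x t \<omega> = x + X t \<omega>"
  by (simp add: mejd_process_def)

lemma W_meas: "0 \<le> t \<Longrightarrow> W t \<in> borel_measurable M"
  and N_meas: "0 \<le> t \<Longrightarrow> N t \<in> measurable M (count_space UNIV)"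
  and Y_meas: "1 \<le> i \<Longrightarrow> Y i \<in> borel_measurable M"
  using driver unfolding mejd_driver_def std_brownian_motion_def poisson_process_def
  by (auto dest!: spec[of _ i] distributed_measurable)

lemma N_0: "\<omega> \<in> space M \<Longrightarrow> N 0 \<omega> = 0" and W_0: "\<omega> \<in> space M \<Longrightarrow> W 0 \<omega> = 0"
  and N_mono: "\<omega> \<in> space M \<Longrightarrow> mono_on {0..} (\<lambda>t. N t \<omega>)"
  using driver unfolding mejd_driver_def std_brownian_motion_def poisson_process_def by auto

lemma X_meas: assumes "0 \<le> t" shows "X t \<in> borel_measurable M"
proof -
  have [measurable]: "W t \<in> borel_measurable M" "N t \<in> measurable M (count_space UNIV)"
    using assms by (auto intro: W_meas N_meas)
  have "(\<lambda>\<omega>. \<Sum>i=1..n. Y i \<omega>) \<in> borel_measurable M" for n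
    by (intro borel_measurable_sum Y_meas) auto
  then have [measurable]: "(\<lambda>\<omega>. \<Sum>i=1..N t \<omega>. Y i \<omega>) \<in> borel_measurable M"
    by (rule measurable_compose_countable) fact
  show ?thesis unfolding mejd_process_def by measurable
qed

lemma rate_pos: "0 < rate P" using params unfolding mejd_params_def by auto

lemma char_Y: "1 \<le> i \<Longrightarrow> char (distr M borel (Y i)) t = jump_char P t"
proof -
  assume i: "1 \<le> i"
  then have D: "distributed M lborel (Y i) (jump_density P)"
    using driver unfolding mejd_driver_def by auto
  have nn: "0 \<le> jump_density P y" for y using params unfolding mejd_params_def by auto
  have "distr M borel (Y i) = density lborel (jump_density P)"
    using distributed_distr_eq_density[OF D] by (metis distr_cong sets_lborel)
  then show ?thesis unfolding char_def jump_char_def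
    using nn by (simp add: integral_density scaleR_conv_of_real)
qed

text \<open>The index \<open>(0, i)\<close> is for the \<open>i\<close>-th increment of \<open>W\<close>, \<open>(1, i)\<close> for that of
  \<open>N\<close>, and \<open>(2, j)\<close> for the jump \<open>Y j\<close>.\<close>

definition Z :: "(nat \<Rightarrow> real) \<Rightarrow> nat \<times> nat \<Rightarrow> 'a \<Rightarrow> real" where
  "Z \<tau> p \<omega> = (if fst p = 0 then W (\<tau> (Suc (snd p))) \<omega> - W (\<tau> (snd p)) \<omega>
     else if fst p = 1 then real (N (\<tau> (Suc (snd p))) \<omega>) - real (N (\<tau> (snd p)) \<omega>)
     else Y (snd p) \<omega>)"

lemma indep_Z:
  assumes tau: "0 \<le> \<tau> 0" "incseq \<tau>"
  shows "indep_vars (\<lambda>_. borel) (Z \<tau>) (SIGMA g:{0, 1, 2::nat}. if g = 2 then {1..} else {..<k})"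
proof -
  have t0: "0 \<le> \<tau> i" for i using tau incseqD[OF tau(2), of 0 i] by simp
  let ?F = "\<lambda>k. [process_events M {0..} borel W, process_events M {0..} (count_space UNIV) N, process_events M {1..} borel Y] ! k"
  \<comment> \<open>Measurability with respect to \<open>M\<close> would not suffice: each
    coordinate has to be measurable for the sigma-algebra generated by its own process.\<close>
  let ?sW = "sigma (space M) {W i -` A \<inter> space M | i A. i \<in> {0..} \<and> A \<in> sets borel}"
  let ?sN = "sigma (space M) {N i -` A \<inter> space M | i A. i \<in> {0..} \<and> A \<in> sets (count_space UNIV)}"
  let ?sY = "sigma (space M) {Y i -` A \<inter> space M | i A. i \<in> {1..} \<and> A \<in> sets borel}"
  have mW: "W t \<in> borel_measurable ?sW" if "0 \<le> t" for t
    by (rule measurable_process_events) (use that in auto)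
  have mN: "N t \<in> measurable ?sN (count_space UNIV)" if "0 \<le> t" for t
    by (rule measurable_process_events) (use that in auto)
  have mY: "Y i \<in> borel_measurable ?sY" if "1 \<le> i" for i
    by (rule measurable_process_events) (use that in auto)
  show ?thesis
  proof (rule indep_vars_Sigma[where F="?F"])
    show "indep_sets ?F {0, 1, 2}" using driver unfolding mejd_driver_def by auto
    fix g :: nat assume g: "g \<in> {0, 1, 2}"
    show "sigma_algebra (space M) (?F g)" using g by (auto simp: sigma_algebra_process_events)
    show "indep_vars (\<lambda>_. borel) (\<lambda>i. Z \<tau> (g, i)) (if g = 2 then {1..} else {..<k})"
      using g driver tau unfolding mejd_driver_def std_brownian_motion_def poisson_process_def indep_increments_def
      by (auto simp: Z_def[abs_def])
    fix i and A :: "real set" assume i: "i \<in> (if g = 2 then {1..} else {..<k})" and A: "A \<in> sets borel"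
    have "Z \<tau> (0, i) \<in> borel_measurable ?sW"
      unfolding Z_def[abs_def] using mW t0 by simp
    moreover have "Z \<tau> (1, i) \<in> borel_measurable ?sN"
      unfolding Z_def[abs_def] using mN t0 by simp
    moreover have "Z \<tau> (2, i) \<in> borel_measurable ?sY" if "1 \<le> i"
      unfolding Z_def[abs_def] using mY that by simp
    ultimately show "Z \<tau> (g, i) -` A \<inter> space M \<in> ?F g"
      using g i A measurable_sets[of "Z \<tau> (0, i)" ?sW borel A] measurable_sets[of "Z \<tau> (1, i)" ?sN borel A]
        measurable_sets[of "Z \<tau> (2, i)" ?sY borel A]
      unfolding sets_process_events by (auto simp: space_measure_of_conv)
  qed auto
qed

lemma tau_nonneg: "\<tau> 0 = (0::real) \<Longrightarrow> (\<And>i. \<tau> i < \<tau> (Suc i)) \<Longrightarrow> 0 \<le> \<tau> i"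
  by (induction i) (auto intro: order_trans less_imp_le)

text \<open>The \<open>i\<close>-th increment of the process if the jump counts were the fixed numbers \<open>d\<close>.\<close>

definition V :: "(nat \<Rightarrow> real) \<Rightarrow> (nat \<Rightarrow> nat) \<Rightarrow> nat \<Rightarrow> 'a \<Rightarrow> real" where
  "V \<tau> d i \<omega> = drift P * (\<tau> (Suc i) - \<tau> i) + vol P * Z \<tau> (0, i) \<omega>
     + (\<Sum>j\<in>{sum d {..<i}<..sum d {..<Suc i}}. Z \<tau> (2, j) \<omega>)"

definition dN :: "(nat \<Rightarrow> real) \<Rightarrow> nat \<Rightarrow> 'a \<Rightarrow> nat" where
  "dN \<tau> i \<omega> = N (\<tau> (Suc i)) \<omega> - N (\<tau> i) \<omega>"

definition dX :: "(nat \<Rightarrow> real) \<Rightarrow> nat \<Rightarrow> 'a \<Rightarrow> real" where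
  "dX \<tau> i \<omega> = X (\<tau> (Suc i)) \<omega> - X (\<tau> i) \<omega>"

context
  fixes \<tau> :: "nat \<Rightarrow> real"
  assumes tau: "\<tau> 0 = 0" "\<And>i. \<tau> i < \<tau> (Suc i)"
begin

lemma tau_incseq: "incseq \<tau>" using tau by (simp add: incseq_Suc_iff less_imp_le)

lemmas tau_nn = tau_nonneg[of \<tau>, OF tau]

lemma N_tau_mono: "\<omega> \<in> space M \<Longrightarrow> N (\<tau> i) \<omega> \<le> N (\<tau> (Suc i)) \<omega>"
  using N_mono tau_nn tau(2) by (auto simp: mono_on_def less_imp_le)

lemma Z_1: "\<omega> \<in> space M \<Longrightarrow> Z \<tau> (1, i) \<omega> = real (dN \<tau> i \<omega>)"
  using N_tau_mono[of \<omega> i] by (simp add: Z_def dN_def of_nat_diff)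

lemma Z_meas: "p \<in> (SIGMA g:{0, 1, 2::nat}. if g = 2 then {1..} else {..<k}) \<Longrightarrow> Z \<tau> p \<in> borel_measurable M"
  using indep_Z[of \<tau> k] tau tau_incseq unfolding indep_vars_def by auto

text \<open>There are no jumps at time 0, so prescribed counts make the counter at
  \<open>\<tau> i\<close> a fixed partial sum, and the jumps falling in the \<open>i\<close>-th
  interval carry fixed indices.\<close>

lemma dX_eq_V:
  assumes w: "\<omega> \<in> space M" and d: "\<And>i. i < k \<Longrightarrow> dN \<tau> i \<omega> = d i" and i: "i < k"
  shows "dX \<tau> i \<omega> = V \<tau> d i \<omega>"
proof -
  have Nd: "N (\<tau> i) \<omega> = sum d {..<i}" if "i \<le> k" for i
    using that
  proof (induction i)
    case 0 then show ?case using w tau by (simp add: N_0)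
  next
    case (Suc i)
    then show ?case using d[of i] N_tau_mono[OF w, of i] by (simp add: dN_def)
  qed
  have "(\<Sum>j=1..b. Y j \<omega>) - (\<Sum>j=1..a. Y j \<omega>) = (\<Sum>j\<in>{a<..b}. Y j \<omega>)" if "a \<le> b" for a b :: nat
  proof -
    have "{1..b} = {1..a} \<union> {a<..b}" "{1..a} \<inter> {a<..b} = {}" using that by auto
    then show ?thesis by (simp add: sum.union_disjoint)
  qed
  from this[of "N (\<tau> i) \<omega>" "N (\<tau> (Suc i)) \<omega>"] show ?thesis
    using N_tau_mono[OF w, of i] Nd[of i] Nd[of "Suc i"] i
    by (simp add: dX_def V_def mejd_process_def Z_def algebra_simps)
qed

text \<open>For prescribed jump counts \<open>d\<close> the variables on the two sides of \<open>dX_eq_V\<close> live on disjoint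
  blocks of the independent family \<open>Z\<close>.\<close>

lemma indep_V_dN:
  "indep_vars (\<lambda>_. borel) (\<lambda>p. if fst p = 0 then V \<tau> d (snd p) else Z \<tau> (1, snd p)) ({0, 1::nat} \<times> {..<k})"
proof -
  let ?I = "SIGMA g:{0, 1, 2::nat}. if g = 2 then {1..} else {..<k}"
  \<comment> \<open>The coordinates of \<open>Z\<close> that each variable reads. Blocks of jump
    indices of different intervals are separated by the partial sums of \<open>d\<close>, so these
    sets are disjoint.\<close>
  define K where "K p = (if fst p = 0 then insert (0, snd p) ((\<lambda>j. (2, j)) ` {sum d {..<snd p}<..sum d {..<Suc (snd p)}})
     else {(1::nat, snd p)})" for p :: "nat \<times> nat"
  define f :: "nat \<times> nat \<Rightarrow> (nat \<times> nat \<Rightarrow> real) \<Rightarrow> real" where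
    "f p z = (if fst p = 0 then drift P * (\<tau> (Suc (snd p)) - \<tau> (snd p)) + vol P * z (0, snd p)
       + (\<Sum>j\<in>{sum d {..<snd p}<..sum d {..<Suc (snd p)}}. z (2, j)) else z (1, snd p))" for p z
  have "indep_vars (\<lambda>p. PiM (K p) (\<lambda>_. borel)) (\<lambda>p \<omega>. restrict (\<lambda>i. Z \<tau> i \<omega>) (K p)) ({0, 1::nat} \<times> {..<k})"
  proof (rule indep_vars_restrict[OF indep_Z[of \<tau> k]])
    show "0 \<le> \<tau> 0" "incseq \<tau>" using tau tau_incseq by auto
    show "K p \<subseteq> ?I" if "p \<in> {0, 1::nat} \<times> {..<k}" for p
      using that by (auto simp: K_def)
    have blk: "{sum d {..<i}<..sum d {..<Suc i}} \<inter> {sum d {..<j}<..sum d {..<Suc j}} = {}" if "i < j" for i j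
    proof -
      have "sum d {..<Suc i} \<le> sum d {..<j}" using that by (intro sum_mono2) auto
      then show ?thesis by auto
    qed
    show "disjoint_family_on K ({0, 1::nat} \<times> {..<k})"
      unfolding disjoint_family_on_def
    proof (intro ballI impI)
      fix p p' assume p: "p \<in> {0, 1::nat} \<times> {..<k}" "p' \<in> {0, 1::nat} \<times> {..<k}" "p \<noteq> p'"
      show "K p \<inter> K p' = {}"
      proof (cases "fst p = 0 \<and> fst p' = 0")
        case True
        then have "snd p \<noteq> snd p'" using p by (auto simp: prod_eq_iff)
        then have "{sum d {..<snd p}<..sum d {..<Suc (snd p)}} \<inter> {sum d {..<snd p'}<..sum d {..<Suc (snd p')}} = {}"
          using blk[of "snd p" "snd p'"] blk[of "snd p'" "snd p"] by (cases "snd p" "snd p'" rule: linorder_cases) auto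
        then show ?thesis using True \<open>snd p \<noteq> snd p'\<close> unfolding K_def by auto
      qed (use p in \<open>auto simp: K_def\<close>)
    qed
  qed
  then have "indep_vars (\<lambda>_. borel) (\<lambda>p \<omega>. f p (restrict (\<lambda>i. Z \<tau> i \<omega>) (K p))) ({0, 1::nat} \<times> {..<k})"
  proof (rule indep_vars_compose2)
    fix p :: "nat \<times> nat"
    show "f p \<in> borel_measurable (PiM (K p) (\<lambda>_. borel))"
    proof (cases "fst p = 0")
      case True
      have "(\<lambda>z. z q) \<in> borel_measurable (PiM (K p) (\<lambda>_. borel))" if "q \<in> K p" for q
        using that by (rule measurable_component_singleton)
      then show ?thesis unfolding f_def using True
        by (auto simp: K_def intro!: borel_measurable_add borel_measurable_sum borel_measurable_times)
    next
      case False
      then have "(1, snd p) \<in> K p" by (simp add: K_def)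
      from measurable_component_singleton[OF this, of "\<lambda>_. borel"] show ?thesis unfolding f_def using False by simp
    qed
  qed
  also have "(\<lambda>p \<omega>. f p (restrict (\<lambda>i. Z \<tau> i \<omega>) (K p))) = (\<lambda>p. if fst p = 0 then V \<tau> d (snd p) else Z \<tau> (1, snd p))"
    by (auto simp: fun_eq_iff f_def K_def V_def intro!: sum.cong)
  finally show ?thesis .
qed

lemma char_V: "char (distr M borel (V \<tau> d i)) t = kernel_char P (\<tau> (Suc i) - \<tau> i) (d i) t"
proof -
  define B where "B = {sum d {..<i}<..sum d {..<Suc i}}"
  define J where "J = insert (0, i) ((\<lambda>j. (2::nat, j)) ` B)"
  let ?I = "SIGMA g:{0, 1, 2::nat}. if g = 2 then {1..} else {..<Suc i}"
  have J: "J \<subseteq> ?I" by (auto simp: J_def B_def)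
  \<comment> \<open>The volatility is absorbed into the Brownian coordinate, so the increment is its
    drift plus a sum of independent variables, and zero volatility is no separate case.\<close>
  define U where "U p \<omega> = (if p = (0, i) then 0 + vol P * Z \<tau> p \<omega> else 0 + 1 * Z \<tau> p \<omega>)" for p \<omega>
  have mZ: "Z \<tau> p \<in> borel_measurable M" if "p \<in> J" for p using Z_meas[of p "Suc i"] J that by auto
  have "indep_vars (\<lambda>_. borel) (Z \<tau>) J"
    by (rule indep_vars_subset[OF indep_Z J]) (use tau tau_incseq in auto)
  then have "indep_vars (\<lambda>_. borel) (\<lambda>p \<omega>. (\<lambda>z. if p = (0, i) then 0 + vol P * z else 0 + 1 * z) (Z \<tau> p \<omega>)) J"
    by (rule indep_vars_compose2) auto
  then have indU: "indep_vars (\<lambda>_. borel) U J"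
    by (simp add: U_def[abs_def] cong: if_cong)
  have [simp]: "finite B" by (simp add: B_def)
  have inj: "inj_on (\<lambda>j. (2::nat, j)) B" by (auto simp: inj_on_def)
  have notin: "(0, i) \<notin> (\<lambda>j. (2::nat, j)) ` B" by auto
  have cB: "card B = d i" by (simp add: B_def)
  have "V \<tau> d i = (\<lambda>\<omega>. drift P * (\<tau> (Suc i) - \<tau> i) + 1 * (\<Sum>p\<in>J. U p \<omega>))"
    unfolding V_def J_def B_def[symmetric] using notin
    by (auto simp: fun_eq_iff U_def sum.reindex[OF inj])
  moreover have "(\<lambda>\<omega>. \<Sum>p\<in>J. U p \<omega>) \<in> borel_measurable M"
    using indU unfolding indep_vars_def by (intro borel_measurable_sum) auto
  ultimately have "char (distr M borel (V \<tau> d i)) t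
     = iexp (t * (drift P * (\<tau> (Suc i) - \<tau> i))) * char (distr M borel (\<lambda>\<omega>. \<Sum>p\<in>J. U p \<omega>)) t"
    using char_affine[of M "\<lambda>\<omega>. \<Sum>p\<in>J. U p \<omega>" "drift P * (\<tau> (Suc i) - \<tau> i)" 1 t]
    by (simp add: prob_space_axioms)
  also have "char (distr M borel (\<lambda>\<omega>. \<Sum>p\<in>J. U p \<omega>)) t = (\<Prod>p\<in>J. char (distr M borel (U p)) t)"
    by (rule char_distr_sum[OF indU])
  also have "\<dots> = char (distr M borel (U (0, i))) t * (\<Prod>j\<in>B. char (distr M borel (U (2, j))) t)"
    unfolding J_def using notin by (simp add: prod.reindex[OF inj])
  also have "(\<Prod>j\<in>B. char (distr M borel (U (2, j))) t) = jump_char P t ^ d i"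
  proof -
    have "char (distr M borel (U (2, j))) t = jump_char P t" if "j \<in> B" for j
    proof -
      have "U (2, j) = Y j" by (auto simp: U_def Z_def)
      then show ?thesis using char_Y[of j t] that by (simp add: B_def)
    qed
    then show ?thesis by (simp add: cB)
  qed
  also have "char (distr M borel (U (0, i))) t = exp (- ((sqrt (\<tau> (Suc i) - \<tau> i) * (t * vol P))\<^sup>2) / 2)"
  proof -
    have "distributed M lborel (\<lambda>\<omega>. W (\<tau> (Suc i)) \<omega> - W (\<tau> i) \<omega>) (normal_density 0 (sqrt (\<tau> (Suc i) - \<tau> i)))"
      using driver tau_nn tau unfolding mejd_driver_def std_brownian_motion_def by auto
    then have "distributed M lborel (Z \<tau> (0, i)) (normal_density 0 (sqrt (\<tau> (Suc i) - \<tau> i)))"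
      by (simp add: Z_def[abs_def])
    from char_normal[OF this] have "char (distr M borel (Z \<tau> (0, i))) (t * vol P) = exp (- ((sqrt (\<tau> (Suc i) - \<tau> i) * (t * vol P))\<^sup>2) / 2)"
      using tau by simp
    moreover have "U (0, i) = (\<lambda>\<omega>. 0 + vol P * Z \<tau> (0, i) \<omega>)" by (auto simp: U_def)
    ultimately show ?thesis using char_affine[of M "Z \<tau> (0, i)" 0 "vol P" t] mZ[of "(0, i)"]
      by (simp add: J_def prob_space_axioms)
  qed
  finally show ?thesis by (simp add: kernel_char_def)
qed

lemma V_meas: "V \<tau> d i \<in> borel_measurable M"
  using indep_V_dN[of d "Suc i"] unfolding indep_vars_def by (auto dest!: bspec[of _ _ "(0, i)"])

lemma dN_law: "distr M (count_space UNIV) (dN \<tau> i) = measure_pmf (poisson_pmf (rate P * (\<tau> (Suc i) - \<tau> i)))"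
  using driver tau_nn tau unfolding mejd_driver_def poisson_process_def dN_def[abs_def] by auto

lemma dN_meas: "dN \<tau> i \<in> measurable M (count_space UNIV)"
proof -
  have [measurable]: "N (\<tau> i) \<in> measurable M (count_space UNIV)" "N (\<tau> (Suc i)) \<in> measurable M (count_space UNIV)"
    by (rule N_meas[OF tau_nn])+
  show ?thesis unfolding dN_def[abs_def] by measurable
qed

lemma prob_dN: "prob {\<omega>\<in>space M. dN \<tau> i \<omega> = n} = pmf (poisson_pmf (rate P * (\<tau> (Suc i) - \<tau> i))) n"
proof -
  have "pmf (poisson_pmf (rate P * (\<tau> (Suc i) - \<tau> i))) n = measure (distr M (count_space UNIV) (dN \<tau> i)) {n}"
    unfolding dN_law by (simp add: measure_pmf_single)
  also have "\<dots> = prob {\<omega>\<in>space M. dN \<tau> i \<omega> = n}"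
    by (subst measure_distr[OF dN_meas]) (auto intro!: arg_cong[where f=prob])
  finally show ?thesis by simp
qed

end

text \<open>The law of an increment of length \<open>\<delta>\<close> with \<open>n\<close> jumps.
  Uniform grid and constant counts are one convenient realisation; by \<open>V_law\<close> only
  \<open>\<delta>\<close> and \<open>n\<close> matter.\<close>

definition Q :: "real \<Rightarrow> nat \<Rightarrow> real measure" where
  "Q \<delta> n = distr M borel (V (\<lambda>i. real i * \<delta>) (\<lambda>_. n) 0)"

lemma Q_grid: assumes "0 < \<delta>" shows "real 0 * \<delta> = 0" "real i * \<delta> < real (Suc i) * \<delta>"
  using assms by auto

lemma Q_real_distribution: "0 < \<delta> \<Longrightarrow> real_distribution (Q \<delta> n)"
  unfolding Q_def real_distribution_def real_distribution_axioms_def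
  by (auto intro!: prob_space_distr V_meas Q_grid)

lemma char_Q: "0 < \<delta> \<Longrightarrow> char (Q \<delta> n) t = kernel_char P \<delta> n t"
  unfolding Q_def by (subst char_V) auto

text \<open>The transition law of the process over a time \<open>\<delta>\<close>, as
  \<open>X_law\<close> confirms: the number of jumps has been averaged out.\<close>

definition \<kappa> :: "real \<Rightarrow> real measure" where
  "\<kappa> \<delta> = measure_pmf (poisson_pmf (rate P * \<delta>)) \<bind> Q \<delta>"

lemma Q_kernel: "0 < \<delta> \<Longrightarrow> Q \<delta> \<in> measurable (measure_pmf p) (subprob_algebra borel)"
  using Q_real_distribution[of \<delta>]
  by (auto simp: space_subprob_algebra real_distribution_def real_distribution_axioms_def prob_space_imp_subprob_space)

lemma \<kappa>_real_distribution: assumes "0 < \<delta>" shows "real_distribution (\<kappa> \<delta>)"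
proof -
  have "prob_space (Q \<delta> n)" "sets (Q \<delta> n) = sets borel" for n
    using Q_real_distribution[OF assms] by (auto simp: real_distribution_def real_distribution_axioms_def)
  then show ?thesis
    unfolding \<kappa>_def real_distribution_def real_distribution_axioms_def
    using measure_pmf.prob_space_bind[OF AE_I2 Q_kernel[OF assms]] sets_bind[of _ "Q \<delta>" borel] by auto
qed

lemma emeasure_\<kappa>: "0 < \<delta> \<Longrightarrow> B \<in> sets borel \<Longrightarrow>
  emeasure (\<kappa> \<delta>) B = (\<integral>\<^sup>+n. emeasure (Q \<delta> n) B \<partial>measure_pmf (poisson_pmf (rate P * \<delta>)))"
  unfolding \<kappa>_def by (rule emeasure_bind[OF _ Q_kernel]) auto

text \<open>Powers of \<open>jump_char\<close> averaged over a Poisson count form an exponential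
  series; this is where the characteristic exponent of the process first appears.\<close>

lemma char_\<kappa>:
  assumes d: "0 < \<delta>"
  shows "char (\<kappa> \<delta>) t = exp (of_real \<delta> * (\<i> * of_real (t * drift P) - of_real ((vol P * t)\<^sup>2 / 2)
    + of_real (rate P) * (jump_char P t - 1)))"
proof -
  let ?r = "rate P * \<delta>"
  let ?c = "iexp (t * (drift P * \<delta>)) * exp (- ((sqrt \<delta> * (t * vol P))\<^sup>2) / 2)"
  have r: "0 < ?r" using rate_pos d by simp
  have jc: "norm (jump_char P t) \<le> 1"
  proof -
    have "real_distribution (distr M borel (Y 1))"
      by (auto simp: real_distribution_def real_distribution_axioms_def intro!: prob_space_distr Y_meas)
    from real_distribution.cmod_char_le_1[OF this, of t] show ?thesis using char_Y[of 1 t] by simp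
  qed
  have "char (\<kappa> \<delta>) t = (CLINT n|measure_pmf (poisson_pmf ?r). char (Q \<delta> n) t)"
    unfolding \<kappa>_def
    by (rule char_bind) (use Q_kernel[OF d] Q_real_distribution[OF d] in \<open>auto simp: measure_pmf.prob_space_axioms real_distribution_def\<close>)
  also have "\<dots> = (CLINT n|count_space UNIV. pmf (poisson_pmf ?r) n *\<^sub>R kernel_char P \<delta> n t)"
    unfolding measure_pmf_eq_density char_Q[OF d] by (subst integral_density) auto
  also have "\<dots> = (\<Sum>n. pmf (poisson_pmf ?r) n *\<^sub>R kernel_char P \<delta> n t)"
  proof (rule integral_count_space_nat)
    show "integrable (count_space UNIV) (\<lambda>n. pmf (poisson_pmf ?r) n *\<^sub>R kernel_char P \<delta> n t)"
    proof (rule Bochner_Integration.integrable_bound[OF integrable_pmf[of UNIV "poisson_pmf ?r"]])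
      show "AE n in count_space UNIV. norm (pmf (poisson_pmf ?r) n *\<^sub>R kernel_char P \<delta> n t) \<le> norm (pmf (poisson_pmf ?r) n)"
        using jc by (auto simp: kernel_char_def norm_mult norm_power norm_exp_eq_Re intro!: mult_left_le mult_le_one power_le_one)
    qed auto
  qed
  also have "(\<lambda>n. pmf (poisson_pmf ?r) n *\<^sub>R kernel_char P \<delta> n t)
      = (\<lambda>n. (?c * exp (- of_real ?r)) * ((of_real ?r * jump_char P t) ^ n /\<^sub>R fact n))"
    unfolding pmf_poisson[OF r] kernel_char_def
    by (auto simp: fun_eq_iff scaleR_conv_of_real power_mult_distrib field_simps exp_of_real[symmetric])
  also have "(\<Sum>n. (?c * exp (- of_real ?r)) * ((of_real ?r * jump_char P t) ^ n /\<^sub>R fact n))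
      = (?c * exp (- of_real ?r)) * exp (of_real ?r * jump_char P t)"
  proof -
    have "(\<Sum>n. (of_real ?r * jump_char P t) ^ n /\<^sub>R fact n) = exp (of_real ?r * jump_char P t)"
      by (simp add: exp_def)
    then show ?thesis by (subst suminf_mult[OF summable_exp_generic]) (simp only:)
  qed
  also have "\<dots> = exp (of_real \<delta> * (\<i> * of_real (t * drift P) - of_real ((vol P * t)\<^sup>2 / 2)
    + of_real (rate P) * (jump_char P t - 1)))"
    using d by (simp add: exp_add[symmetric] exp_of_real[symmetric] power_mult_distrib algebra_simps)
  finally show ?thesis .
qed

context
  fixes \<tau> :: "nat \<Rightarrow> real"
  assumes tau: "\<tau> 0 = 0" "\<And>i. \<tau> i < \<tau> (Suc i)"
begin

lemma V_law: "distr M borel (V \<tau> d i) = Q (\<tau> (Suc i) - \<tau> i) (d i)"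
proof (rule Levy_uniqueness)
  show "real_distribution (distr M borel (V \<tau> d i))"
    by (auto simp: real_distribution_def real_distribution_axioms_def intro!: prob_space_distr V_meas tau)
  show "real_distribution (Q (\<tau> (Suc i) - \<tau> i) (d i))"
    by (rule Q_real_distribution) (use tau in simp)
  show "char (distr M borel (V \<tau> d i)) = char (Q (\<tau> (Suc i) - \<tau> i) (d i))"
    using tau by (auto simp: fun_eq_iff char_V[OF tau] char_Q)
qed

lemma dX_meas: "dX \<tau> i \<in> borel_measurable M"
  unfolding dX_def using tau_nonneg[of \<tau>, OF tau] by (intro borel_measurable_diff X_meas)

text \<open>Sorting sample points by the vector of jump counts replaces random blocks of jumps by
  fixed ones. For fixed counts the variables \<open>V\<close> are independent of each other and of
  the counts, and averaging over independent Poisson counts turns a sum of products into a product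
  of sums.\<close>

lemma emeasure_dX:
  assumes B: "\<And>i. i < k \<Longrightarrow> B i \<in> sets borel"
  shows "emeasure M {\<omega>\<in>space M. \<forall>i<k. dX \<tau> i \<omega> \<in> B i} = (\<Prod>i<k. emeasure (\<kappa> (\<tau> (Suc i) - \<tau> i)) (B i))"
proof (cases "k = 0")
  case True then show ?thesis by (simp add: emeasure_space_1)
next
  case False
  define \<pi> where "\<pi> i = poisson_pmf (rate P * (\<tau> (Suc i) - \<tau> i))" for i
  \<comment> \<open>Coordinates from \<open>k\<close> on are pinned to 0, so that a sample point
    belongs to \<open>E d\<close> for at most one \<open>d\<close> in the support.\<close>
  define p where "p = Pi_pmf {..<k} 0 \<pi>"
  have dpos: "0 < \<tau> (Suc i) - \<tau> i" for i using tau by simp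
  have setp: "set_pmf p = {d. \<forall>i\<ge>k. d i = 0}"
    using rate_pos dpos by (auto simp: p_def set_Pi_pmf \<pi>_def PiE_dflt_def)
  define E where "E d = {\<omega>\<in>space M. (\<forall>i<k. dN \<tau> i \<omega> = d i) \<and> (\<forall>i<k. V \<tau> d i \<omega> \<in> B i)}" for d
  have mE: "E d \<in> sets M" for d
  proof -
    have "V \<tau> d i -` B i \<inter> space M \<in> sets M" if "i < k" for i
      using V_meas[OF tau] B[OF that] by (rule measurable_sets)
    moreover have "dN \<tau> i -` {d i} \<inter> space M \<in> sets M" for i
      using dN_meas[OF tau] by (rule measurable_sets) simp
    ultimately have "(\<Inter>i\<in>{..<k}. (V \<tau> d i -` B i \<inter> space M) \<inter> (dN \<tau> i -` {d i} \<inter> space M)) \<in> sets M"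
      using False by (intro sets.finite_INT) auto
    also have "(\<Inter>i\<in>{..<k}. (V \<tau> d i -` B i \<inter> space M) \<inter> (dN \<tau> i -` {d i} \<inter> space M)) = E d"
      using False by (auto simp: E_def)
    finally show ?thesis .
  qed
  have UN: "{\<omega>\<in>space M. \<forall>i<k. dX \<tau> i \<omega> \<in> B i} = (\<Union>d\<in>set_pmf p. E d)"
  proof safe
    fix \<omega> assume w: "\<omega> \<in> space M" "\<forall>i<k. dX \<tau> i \<omega> \<in> B i"
    define d where "d i = (if i < k then dN \<tau> i \<omega> else 0)" for i
    have "dX \<tau> i \<omega> = V \<tau> d i \<omega>" if "i < k" for i
      by (rule dX_eq_V[OF tau w(1) _ that]) (simp add: d_def)
    then have "\<omega> \<in> E d" using w by (auto simp: E_def d_def)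
    moreover have "d \<in> set_pmf p" by (simp add: setp d_def)
    ultimately show "\<omega> \<in> (\<Union>d\<in>set_pmf p. E d)" by blast
  next
    fix d \<omega> assume "\<omega> \<in> E d"
    then show "\<omega> \<in> space M" by (simp add: E_def)
    fix i assume "i < k"
    then show "dX \<tau> i \<omega> \<in> B i"
      using \<open>\<omega> \<in> E d\<close> dX_eq_V[OF tau, of \<omega> k d i] by (auto simp: E_def)
  qed
  have disj: "disjoint_family_on E (set_pmf p)"
    unfolding disjoint_family_on_def
  proof (intro ballI impI)
    fix d d' assume d: "d \<in> set_pmf p" "d' \<in> set_pmf p" "d \<noteq> d'"
    then obtain i where "d i \<noteq> d' i" by auto
    moreover from this have "i < k" using d by (metis (mono_tags, lifting) setp mem_Collect_eq not_le)
    ultimately show "E d \<inter> E d' = {}" by (auto simp: E_def)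
  qed
  have Ed: "emeasure M (E d) = ennreal (pmf p d) * (\<Prod>i<k. emeasure (Q (\<tau> (Suc i) - \<tau> i) (d i)) (B i))" if d: "d \<in> set_pmf p" for d
  proof -
    define U where "U q = (if fst q = 0 then V \<tau> d (snd q) else Z \<tau> (1, snd q))" for q :: "nat \<times> nat"
    define A where "A q = (if fst q = 0 then B (snd q) else {real (d (snd q))})" for q :: "nat \<times> nat"
    let ?I = "{0, 1::nat} \<times> {..<k}"
    have ind: "indep_vars (\<lambda>_. borel) U ?I"
      unfolding U_def by (rule indep_V_dN[OF tau])
    have "E d = (\<Inter>q\<in>?I. U q -` A q \<inter> space M)"
      using False Z_1[OF tau] by (auto simp: E_def U_def A_def)
    also have "prob \<dots> = (\<Prod>q\<in>?I. prob (U q -` A q \<inter> space M))"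
      by (rule indep_varsD[OF ind]) (use False B in \<open>auto simp: A_def\<close>)
    also have "\<dots> = (\<Prod>i<k. prob (V \<tau> d i -` B i \<inter> space M)) * (\<Prod>i<k. prob (Z \<tau> (1, i) -` {real (d i)} \<inter> space M))"
    proof -
      have "(\<Prod>q\<in>?I. f q) = (\<Prod>i<k. f (0, i)) * (\<Prod>i<k. f (1, i))" for f :: "nat \<times> nat \<Rightarrow> real"
        using prod.cartesian_product[of "\<lambda>x y. f (x, y)" "{..<k}" "{0, 1::nat}"] by simp
      then show ?thesis by (simp add: U_def A_def)
    qed
    also have "(\<Prod>i<k. prob (Z \<tau> (1, i) -` {real (d i)} \<inter> space M)) = pmf p d"
    proof -
      have "Z \<tau> (1, i) -` {real (d i)} \<inter> space M = {\<omega>\<in>space M. dN \<tau> i \<omega> = d i}" for i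
        using Z_1[OF tau] by auto
      moreover have "d i = 0" if "i \<notin> {..<k}" for i using d that unfolding setp by auto
      ultimately show ?thesis unfolding p_def by (subst pmf_Pi') (auto simp: prob_dN[OF tau] \<pi>_def)
    qed
    also have "(\<Prod>i<k. prob (V \<tau> d i -` B i \<inter> space M)) = (\<Prod>i<k. measure (Q (\<tau> (Suc i) - \<tau> i) (d i)) (B i))"
      using B by (intro prod.cong refl) (simp add: V_law[symmetric] measure_distr[OF V_meas[OF tau]])
    finally have "prob (E d) = (\<Prod>i<k. measure (Q (\<tau> (Suc i) - \<tau> i) (d i)) (B i)) * pmf p d" .
    moreover have "emeasure (Q (\<tau> (Suc i) - \<tau> i) (d i)) (B i) = ennreal (measure (Q (\<tau> (Suc i) - \<tau> i) (d i)) (B i))" for i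
    proof -
      interpret q: real_distribution "Q (\<tau> (Suc i) - \<tau> i) (d i)" by (rule Q_real_distribution[OF dpos])
      show ?thesis by (rule q.emeasure_eq_measure)
    qed
    ultimately show ?thesis
      by (simp add: emeasure_eq_measure prod_ennreal ennreal_mult prod_nonneg mult.commute)
  qed
  have "emeasure M {\<omega>\<in>space M. \<forall>i<k. dX \<tau> i \<omega> \<in> B i} = (\<integral>\<^sup>+d. emeasure M (E d) \<partial>count_space (set_pmf p))"
    unfolding UN by (rule emeasure_UN_countable) (use mE disj in auto)
  also have "\<dots> = (\<integral>\<^sup>+d. ennreal (pmf p d) * (\<Prod>i<k. emeasure (Q (\<tau> (Suc i) - \<tau> i) (d i)) (B i)) \<partial>count_space (set_pmf p))"
    by (intro nn_integral_cong) (simp add: Ed)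
  also have "\<dots> = (\<integral>\<^sup>+d. ennreal (pmf p d) * (\<Prod>i<k. emeasure (Q (\<tau> (Suc i) - \<tau> i) (d i)) (B i)) \<partial>count_space UNIV)"
    by (subst nn_integral_count_space_indicator)
       (auto intro!: nn_integral_cong simp: indicator_def set_pmf_iff)
  also have "\<dots> = (\<integral>\<^sup>+d. (\<Prod>i<k. emeasure (Q (\<tau> (Suc i) - \<tau> i) (d i)) (B i)) \<partial>measure_pmf p)"
    by (simp add: nn_integral_measure_pmf)
  also have "\<dots> = (\<Prod>i<k. \<integral>\<^sup>+n. emeasure (Q (\<tau> (Suc i) - \<tau> i) n) (B i) \<partial>measure_pmf (\<pi> i))"
    unfolding p_def by (rule nn_integral_prod_Pi_pmf) simp
  also have "\<dots> = (\<Prod>i<k. emeasure (\<kappa> (\<tau> (Suc i) - \<tau> i)) (B i))"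
    using B dpos by (intro prod.cong refl) (simp add: emeasure_\<kappa> \<pi>_def)
  finally show ?thesis .
qed

end

end

section \<open>The law at an exponential time\<close>

lemma exp_char_up:
  assumes "0 < \<eta>"
  shows "has_bochner_integral lborel (\<lambda>y. of_real (exp (- \<eta> * y) * indicator {0..} y) * iexp (t * y))
    (1 / (of_real \<eta> - \<i> * of_real t))"
proof -
  have eq: "(\<lambda>y. of_real (exp (- \<eta> * y) * indicator {0..} y) * iexp (t * y))
    = (\<lambda>y. indicator {0..} y *\<^sub>R exp (- (of_real \<eta> - \<i> * of_real t) * of_real y))"
    by (auto simp: fun_eq_iff scaleR_conv_of_real exp_of_real[symmetric] exp_add[symmetric] algebra_simps split: split_indicator)
  show ?thesis unfolding eq
    using complex_exp_integral[of "of_real \<eta> - \<i> * of_real t"] assms by (simp add: has_bochner_integral_iff)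
qed

lemma exp_char_down:
  assumes "0 < \<theta>"
  shows "has_bochner_integral lborel (\<lambda>y. of_real (exp (\<theta> * y) * indicator {..<0} y) * iexp (t * y))
    (1 / (of_real \<theta> + \<i> * of_real t))"
proof -
  let ?f = "\<lambda>y. of_real (exp (\<theta> * y) * indicator {..<0} y) * iexp (t * y)"
  let ?g = "\<lambda>y. of_real (exp (- \<theta> * y) * indicator {0..} y) * iexp (- t * y)"
  have g: "has_bochner_integral lborel ?g (1 / (of_real \<theta> + \<i> * of_real t))"
    using exp_char_up[OF assms, of "- t"] by simp
  \<comment> \<open>Reflection exchanges the two half lines up to the point 0, which is
    null.\<close>
  have ae: "AE y in lborel. ?f (0 + - 1 * y) = ?g y"
    using AE_lborel_singleton[of 0] by eventually_elim (auto split: split_indicator)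
  have m: "?f \<in> borel_measurable lborel" "?g \<in> borel_measurable lborel" by measurable
  have i: "integrable lborel (\<lambda>y. ?f (0 + - 1 * y))"
    using g by (subst integrable_cong_AE[OF _ _ ae]) (auto simp: has_bochner_integral_iff)
  then have "integrable lborel ?f"
    using lborel_integrable_real_affine_iff[of "- 1" ?f 0] by simp
  moreover have "(LINT y|lborel. ?f y) = (LINT y|lborel. ?f (0 + - 1 * y))"
    by (subst lborel_integral_real_affine[of "- 1" ?f 0]) auto
  moreover have "(LINT y|lborel. ?f (0 + - 1 * y)) = (LINT y|lborel. ?g y)"
    by (rule integral_cong_AE[OF _ _ ae]) auto
  ultimately show ?thesis using g by (simp add: has_bochner_integral_iff)
qed

lemma jump_char_formula:
  assumes P: "mejd_params P"
  shows "jump_char P t = of_real (up_prob P) * (\<Sum>i=1..up_num P. of_real (up_weight P i * up_rate P i) / (of_real (up_rate P i) - \<i> * of_real t))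
      + of_real (down_prob P) * (\<Sum>j=1..down_num P. of_real (down_weight P j * down_rate P j) / (of_real (down_rate P j) + \<i> * of_real t))"
proof -
  have "has_bochner_integral lborel (\<lambda>y. of_real (up_prob P) * (\<Sum>i=1..up_num P. of_real (up_weight P i * up_rate P i) *
         (of_real (exp (- up_rate P i * y) * indicator {0..} y) * iexp (t * y)))
      + of_real (down_prob P) * (\<Sum>j=1..down_num P. of_real (down_weight P j * down_rate P j) *
         (of_real (exp (down_rate P j * y) * indicator {..<0} y) * iexp (t * y))))
     (of_real (up_prob P) * (\<Sum>i=1..up_num P. of_real (up_weight P i * up_rate P i) * (1 / (of_real (up_rate P i) - \<i> * of_real t)))
      + of_real (down_prob P) * (\<Sum>j=1..down_num P. of_real (down_weight P j * down_rate P j) * (1 / (of_real (down_rate P j) + \<i> * of_real t))))"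
    by (intro has_bochner_integral_add has_bochner_integral_mult_right has_bochner_integral_sum exp_char_up exp_char_down)
       (use mejd_params_rates[OF P] in auto)
  moreover have "(\<lambda>y. of_real (jump_density P y) * iexp (t * y)) = (\<lambda>y. of_real (up_prob P) * (\<Sum>i=1..up_num P. of_real (up_weight P i * up_rate P i) *
         (of_real (exp (- up_rate P i * y) * indicator {0..} y) * iexp (t * y)))
      + of_real (down_prob P) * (\<Sum>j=1..down_num P. of_real (down_weight P j * down_rate P j) *
         (of_real (exp (down_rate P j * y) * indicator {..<0} y) * iexp (t * y))))"
    by (auto simp: fun_eq_iff jump_density_def sum_distrib_left sum_distrib_right algebra_simps)
  ultimately show ?thesis
    unfolding jump_char_def by (simp add: has_bochner_integral_iff)
qed

text \<open>The resolvent density at level \<open>q\<close>: by \<open>exp_time_law_density\<close>,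
  \<open>q\<close> times it is the density at an exponential time. Positive roots govern the decay
  to the right, negative ones the decay to the left; the minus sign compensates
  \<open>1 / (- z + s) = - 1 / (z - s)\<close>.\<close>

definition res_density :: "real set \<Rightarrow> (real \<Rightarrow> real) \<Rightarrow> real \<Rightarrow> real" where
  "res_density R w y = (\<Sum>z\<in>{z\<in>R. 0 < z}. w z * (exp (- z * y) * indicator {0..} y))
     - (\<Sum>z\<in>{z\<in>R. z < 0}. w z * (exp (- z * y) * indicator {..<0} y))"

lemma measurable_res_density [measurable]: "res_density R w \<in> borel_measurable borel"
  unfolding res_density_def[abs_def] by measurable

lemma real_has_bochner_of_complex:
  "has_bochner_integral M (\<lambda>x. complex_of_real (f x)) (c :: complex) \<Longrightarrow> integrable M f"
  by (auto simp: has_bochner_integral_iff complex_of_real_integrable_eq)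

lemma (in mejd_roots) res_density_char:
  "has_bochner_integral lborel (\<lambda>y. of_real (res_density R w y) * iexp (t * y)) (1 / (of_real q - lexp P (\<i> * of_real t)))"
proof -
  let ?s = "\<i> * complex_of_real t"
  have fin: "finite {z\<in>R. 0 < z}" "finite {z\<in>R. z < 0}" using finite_R by auto
  have "has_bochner_integral lborel (\<lambda>y. (\<Sum>z\<in>{z\<in>R. 0 < z}. of_real (w z) * (of_real (exp (- z * y) * indicator {0..} y) * iexp (t * y)))
     - (\<Sum>z\<in>{z\<in>R. z < 0}. of_real (w z) * (of_real (exp (- z * y) * indicator {..<0} y) * iexp (t * y))))
    ((\<Sum>z\<in>{z\<in>R. 0 < z}. of_real (w z) * (1 / (of_real z - ?s))) - (\<Sum>z\<in>{z\<in>R. z < 0}. of_real (w z) * (1 / (of_real (- z) + ?s))))"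
    by (intro has_bochner_integral_diff has_bochner_integral_mult_right has_bochner_integral_sum exp_char_up exp_char_down) auto
  moreover have "(\<lambda>y. of_real (res_density R w y) * iexp (t * y)) =
      (\<lambda>y. (\<Sum>z\<in>{z\<in>R. 0 < z}. of_real (w z) * (of_real (exp (- z * y) * indicator {0..} y) * iexp (t * y)))
     - (\<Sum>z\<in>{z\<in>R. z < 0}. of_real (w z) * (of_real (exp (- z * y) * indicator {..<0} y) * iexp (t * y))))"
    by (auto simp: fun_eq_iff res_density_def sum_distrib_left sum_distrib_right algebra_simps)
  moreover have "(\<Sum>z\<in>{z\<in>R. 0 < z}. of_real (w z) * (1 / (of_real z - ?s))) - (\<Sum>z\<in>{z\<in>R. z < 0}. of_real (w z) * (1 / (of_real (- z) + ?s)))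
      = 1 / (of_real q - lexp P ?s)"
  proof -
    have "{z\<in>R. 0 < z} \<union> {z\<in>R. z < 0} = R" using R_nonzero by force
    moreover have "(\<Sum>z\<in>{z\<in>R. z < 0}. complex_of_real (w z) * (1 / (of_real (- z) + ?s))) = - (\<Sum>z\<in>{z\<in>R. z < 0}. complex_of_real (w z) * (1 / (of_real z - ?s)))"
      unfolding sum_negf[symmetric]
    proof (intro sum.cong refl)
      fix z
      have "of_real (- z) + ?s = - (of_real z - ?s)" by simp
      then show "complex_of_real (w z) * (1 / (of_real (- z) + ?s)) = - (complex_of_real (w z) * (1 / (of_real z - ?s)))"
        by (simp only: divide_minus_right mult_minus_right)
    qed
    ultimately have "(\<Sum>z\<in>{z\<in>R. 0 < z}. of_real (w z) * (1 / (of_real z - ?s))) - (\<Sum>z\<in>{z\<in>R. z < 0}. of_real (w z) * (1 / (of_real (- z) + ?s)))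
        = (\<Sum>z\<in>R. complex_of_real (w z) * (1 / (of_real z - ?s)))"
      using sum.union_disjoint[OF fin, of "\<lambda>z. complex_of_real (w z) * (1 / (of_real z - ?s))"] by force
    also have "\<dots> = - (\<Sum>z\<in>R. 1 * of_real (w z) / (?s - of_real z))"
      unfolding sum_negf[symmetric]
    proof (intro sum.cong refl)
      fix z
      have "?s - of_real z = - (of_real z - ?s)" by simp
      then show "complex_of_real (w z) * (1 / (of_real z - ?s)) = - (1 * of_real (w z) / (?s - of_real z))"
        by (simp only: divide_minus_right mult_1 minus_minus times_divide_eq_right mult_1_right)
    qed
    also have "(\<Sum>z\<in>R. 1 * of_real (w z) / (?s - of_real z)) = 1 / (lexp P ?s - of_real q)"
    proof -
      obtain A :: "complex poly" where A: "degree A \<le> up_num P + down_num P" "\<And>x. poly A x = lden P x"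
      proof
        show "degree ((\<Prod>i=1..up_num P. [:of_real (up_rate P i), - 1:]) * (\<Prod>j=1..down_num P. [:of_real (down_rate P j), 1 :: complex:])) \<le> up_num P + down_num P"
          using degree_prod_pCons_le[of "{1..up_num P}" "\<lambda>i. of_real (up_rate P i)" "\<lambda>_. - 1 :: complex"]
            degree_prod_pCons_le[of "{1..down_num P}" "\<lambda>i. of_real (down_rate P i)" "\<lambda>_. 1 :: complex"]
          by (intro degree_mult_le_add) auto
      qed (simp add: poly_prod lden_def)
      show ?thesis
      proof (rule exponent_partial_fractions[where V=A])
        \<comment> \<open>Poles and roots are real and nonzero, so the imaginary axis avoids
          both.\<close>
        have nz: "of_real a + ?s \<noteq> 0" "of_real a - ?s \<noteq> 0" if "0 < a" for a
          using that by (auto simp: complex_eq_iff)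
        have "of_real (up_rate P i) - ?s \<noteq> 0" if "i \<in> {1..up_num P}" for i
          using nz(2)[of "up_rate P i"] mejd_params_rates(1)[OF params that] by blast
        moreover have "of_real (down_rate P i) + ?s \<noteq> 0" if "i \<in> {1..down_num P}" for i
          using nz(1)[of "down_rate P i"] mejd_params_rates(2)[OF params that] by blast
        ultimately show "lden P ?s \<noteq> 0" unfolding lden_def by (simp only: mult_eq_0_iff prod_zero_iff finite_atLeastAtMost) blast
        show "?s \<notin> of_real ` R" using R_nonzero by (auto simp: complex_eq_iff)
      qed (use A in auto)
    qed
    also have "- (1 / (lexp P ?s - of_real q)) = 1 / (of_real q - lexp P ?s)"
      by (metis minus_diff_eq divide_minus_right)
    finally show ?thesis .
  qed
  ultimately show ?thesis by simp
qed

lemma (in mejd_roots) integrable_res_density: "integrable lborel (res_density R w)"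
  using res_density_char[of 0] by (intro real_has_bochner_of_complex) simp

section \<open>Discretisation of time from the right\<close>

definition up_grid :: "real \<Rightarrow> real \<Rightarrow> real" where
  "up_grid \<delta> t = (of_int \<lfloor>t / \<delta>\<rfloor> + 1) * \<delta>"

lemma up_grid_bounds: assumes "0 < \<delta>" shows "t < up_grid \<delta> t" "up_grid \<delta> t \<le> t + \<delta>"
proof -
  have "t / \<delta> < of_int \<lfloor>t / \<delta>\<rfloor> + 1" by linarith
  then show "t < up_grid \<delta> t" using assms by (simp add: up_grid_def field_simps)
  have "of_int \<lfloor>t / \<delta>\<rfloor> * \<delta> \<le> t / \<delta> * \<delta>" using assms by (intro mult_right_mono) auto
  then show "up_grid \<delta> t \<le> t + \<delta>" using assms by (simp add: up_grid_def algebra_simps)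
qed

lemma up_grid_nat: assumes "0 < \<delta>" "0 \<le> t" shows "up_grid \<delta> t = real (nat \<lfloor>t / \<delta>\<rfloor> + 1) * \<delta>"
  using assms by (simp add: up_grid_def)

text \<open>The grid point lies strictly to the right of \<open>t\<close>, as a limit along
  \<open>at_right t\<close> demands; the paths are known to be continuous only from that
  side.\<close>

lemma up_grid_at_right:
  assumes "\<And>n. 0 < \<delta> n" "\<delta> \<longlonglongrightarrow> 0"
  shows "filterlim (\<lambda>n. up_grid (\<delta> n) t) (at_right t) sequentially"
  unfolding filterlim_at
proof
  show "\<forall>\<^sub>F n in sequentially. up_grid (\<delta> n) t \<in> {t<..} \<and> up_grid (\<delta> n) t \<noteq> t"
  proof (intro always_eventually allI)
    fix n show "up_grid (\<delta> n) t \<in> {t<..} \<and> up_grid (\<delta> n) t \<noteq> t"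
      using up_grid_bounds(1)[OF assms(1), of t n] by simp
  qed
  show "(\<lambda>n. up_grid (\<delta> n) t) \<longlonglongrightarrow> t"
  proof (rule tendsto_sandwich[of "\<lambda>_. t" _ _ "\<lambda>n. t + \<delta> n"])
    show "(\<lambda>n. t + \<delta> n) \<longlonglongrightarrow> t" using tendsto_add[OF tendsto_const assms(2), of t] by simp
  qed (use up_grid_bounds[OF assms(1)] in \<open>auto intro!: always_eventually less_imp_le\<close>)
qed

section \<open>One-dimensional laws, path regularity and exponential times\<close>

context mejd_driven
begin

lemma dX_law:
  assumes tau: "\<tau> 0 = 0" "\<And>i. \<tau> i < \<tau> (Suc i)"
  shows "distr M borel (dX \<tau> i) = \<kappa> (\<tau> (Suc i) - \<tau> i)"
proof (rule measure_eqI)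
  have dpos: "0 < \<tau> (Suc j) - \<tau> j" for j using tau by simp
  have sk: "sets (\<kappa> (\<tau> (Suc j) - \<tau> j)) = sets borel" "emeasure (\<kappa> (\<tau> (Suc j) - \<tau> j)) UNIV = 1" for j
  proof -
    interpret k: real_distribution "\<kappa> (\<tau> (Suc j) - \<tau> j)" by (rule \<kappa>_real_distribution[OF dpos])
    show "sets (\<kappa> (\<tau> (Suc j) - \<tau> j)) = sets borel" by simp
    show "emeasure (\<kappa> (\<tau> (Suc j) - \<tau> j)) UNIV = 1" using k.emeasure_space_1 by simp
  qed
  show "sets (distr M borel (dX \<tau> i)) = sets (\<kappa> (\<tau> (Suc i) - \<tau> i))" using sk by simp
  fix A assume "A \<in> sets (distr M borel (dX \<tau> i))"
  then have A: "A \<in> sets borel" by simp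
  \<comment> \<open>A marginal of the joint law: the other increments are left
    unconstrained.\<close>
  have "emeasure (distr M borel (dX \<tau> i)) A = emeasure M {\<omega>\<in>space M. \<forall>j<Suc i. dX \<tau> j \<omega> \<in> (if j = i then A else UNIV)}"
    by (subst emeasure_distr[OF dX_meas[OF tau] A]) (auto intro!: arg_cong[where f="emeasure M"])
  also have "\<dots> = (\<Prod>j<Suc i. emeasure (\<kappa> (\<tau> (Suc j) - \<tau> j)) (if j = i then A else UNIV))"
    by (rule emeasure_dX[OF tau]) (use A in auto)
  also have "\<dots> = emeasure (\<kappa> (\<tau> (Suc i) - \<tau> i)) A"
    by (simp add: sk)
  finally show "emeasure (distr M borel (dX \<tau> i)) A = emeasure (\<kappa> (\<tau> (Suc i) - \<tau> i)) A" .
qed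

lemma dX_indep:
  assumes tau: "\<tau> 0 = 0" "\<And>i. \<tau> i < \<tau> (Suc i)" and k: "0 < k"
  shows "indep_vars (\<lambda>_. borel) (dX \<tau>) {..<k}"
proof (subst indep_vars_finite[where E="\<lambda>_. sets borel"])
  show "\<forall>A\<in>(\<Pi> i\<in>{..<k}. sets borel). prob (\<Inter>j\<in>{..<k}. dX \<tau> j -` A j \<inter> space M) = (\<Prod>j\<in>{..<k}. prob (dX \<tau> j -` A j \<inter> space M))"
  proof
    fix A :: "nat \<Rightarrow> real set" assume A: "A \<in> (\<Pi> i\<in>{..<k}. sets borel)"
    have "(\<Inter>j\<in>{..<k}. dX \<tau> j -` A j \<inter> space M) = {\<omega>\<in>space M. \<forall>j<k. dX \<tau> j \<omega> \<in> A j}" using k by auto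
    then have "emeasure M (\<Inter>j\<in>{..<k}. dX \<tau> j -` A j \<inter> space M) = (\<Prod>j<k. emeasure (\<kappa> (\<tau> (Suc j) - \<tau> j)) (A j))"
      using emeasure_dX[OF tau, of k A] A by auto
    also have "\<dots> = (\<Prod>j<k. emeasure M (dX \<tau> j -` A j \<inter> space M))"
    proof (intro prod.cong refl)
      fix j assume "j \<in> {..<k}"
      then have "A j \<in> sets borel" using A by auto
      then show "emeasure (\<kappa> (\<tau> (Suc j) - \<tau> j)) (A j) = emeasure M (dX \<tau> j -` A j \<inter> space M)"
        unfolding dX_law[OF tau, symmetric] by (rule emeasure_distr[OF dX_meas[OF tau]])
    qed
    finally show "prob (\<Inter>j\<in>{..<k}. dX \<tau> j -` A j \<inter> space M) = (\<Prod>j\<in>{..<k}. prob (dX \<tau> j -` A j \<inter> space M))"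
      by (simp add: emeasure_eq_measure prod_ennreal prod_nonneg)
  qed
qed (use k dX_meas[OF tau] in \<open>auto simp: Int_stable_def sets.sigma_sets_eq[of borel, simplified]\<close>)

lemma X_0: "\<omega> \<in> space M \<Longrightarrow> X 0 \<omega> = 0"
  by (simp add: mejd_process_def N_0 W_0)

lemma X_law: assumes "0 < t" shows "distr M borel (X t) = \<kappa> t"
proof -
  have "distr M borel (X t) = distr M borel (dX (\<lambda>i. real i * t) 0)"
    by (rule distr_cong) (auto simp: dX_def X_0)
  then show ?thesis using dX_law[of "\<lambda>i. real i * t" 0] assms by simp
qed

lemma char_X:
  assumes t: "0 < t"
  shows "char (distr M borel (X t)) s = exp (of_real t * lexp P (\<i> * of_real s))"
  unfolding X_law[OF t] char_\<kappa>[OF t] jump_char_formula[OF params] lexp_def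
  by (simp add: power2_eq_square algebra_simps)

text \<open>A characteristic function has modulus at most 1. This gives \<open>q - lexp\<close> a
  positive real part, hence convergence of the Laplace integral over time.\<close>

lemma Re_lexp_le_0: "Re (lexp P (\<i> * of_real s)) \<le> 0"
proof -
  have "real_distribution (distr M borel (X 1))"
    by (auto simp: real_distribution_def real_distribution_axioms_def intro!: prob_space_distr X_meas)
  from real_distribution.cmod_char_le_1[OF this, of s] show ?thesis
    by (simp add: char_X norm_exp_eq_Re)
qed

lemma X_right_cont:
  assumes w: "\<omega> \<in> space M" and t: "0 \<le> t"
  shows "((\<lambda>s. X s \<omega>) \<longlongrightarrow> X t \<omega>) (at_right t)"
proof -
  have "continuous (at_right t) (\<lambda>s. real (N s \<omega>))"
    using driver w t unfolding mejd_driver_def poisson_process_def by auto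
  then have "((\<lambda>s. real (N s \<omega>)) \<longlongrightarrow> real (N t \<omega>)) (at_right t)"
    by (simp add: continuous_within)
  then have "\<forall>\<^sub>F s in at_right t. dist (real (N s \<omega>)) (real (N t \<omega>)) < 1"
    by (rule tendstoD) simp
  \<comment> \<open>Integers closer than 1 coincide, so the jump sum is constant on a short interval
    to the right.\<close>
  then have N: "\<forall>\<^sub>F s in at_right t. N s \<omega> = N t \<omega>"
    by eventually_elim (auto simp: dist_real_def)
  have "continuous_on {0..} (\<lambda>t. W t \<omega>)"
    using driver w unfolding mejd_driver_def std_brownian_motion_def by auto
  then have "((\<lambda>s. W s \<omega>) \<longlongrightarrow> W t \<omega>) (at t within {0..})"
    using t by (auto simp: continuous_on_def)
  then have W: "((\<lambda>s. W s \<omega>) \<longlongrightarrow> W t \<omega>) (at_right t)"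
    by (rule tendsto_within_subset) (use t in auto)
  have "((\<lambda>s. 0 + drift P * s + vol P * W s \<omega> + (\<Sum>i=1..N t \<omega>. Y i \<omega>)) \<longlongrightarrow> X t \<omega>) (at_right t)"
    unfolding mejd_process_def by (intro tendsto_intros W)
  then show ?thesis
  proof (rule Lim_transform_eventually)
    show "\<forall>\<^sub>F s in at_right t. 0 + drift P * s + vol P * W s \<omega> + (\<Sum>i=1..N t \<omega>. Y i \<omega>) = X s \<omega>"
      using N by eventually_elim (simp add: mejd_process_def)
  qed
qed

text \<open>Paths are only controlled at nonnegative times, hence the truncation at \<open>0\<close>.\<close>

definition Xp :: "real \<times> 'a \<Rightarrow> real" where
  "Xp p = X (max 0 (fst p)) (snd p)"

text \<open>Joint measurability in time and sample point: right-continuity makes \<open>Xp\<close> a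
  pointwise limit of discretisations that use countably many times, each measurable.\<close>

lemma Xp_meas [measurable]: "Xp \<in> borel_measurable ((borel :: real measure) \<Otimes>\<^sub>M M)"
proof (rule borel_measurable_LIMSEQ_metric)
  let ?d = "\<lambda>n::nat. 1 / real (Suc n)"
  let ?f = "\<lambda>n p. X (real (nat \<lfloor>max 0 (fst p) / ?d n\<rfloor> + 1) * ?d n) (snd p)"
  show "?f n \<in> borel_measurable ((borel :: real measure) \<Otimes>\<^sub>M M)" for n
  proof (rule measurable_compose_countable[where g="\<lambda>p. nat \<lfloor>max 0 (fst p) / ?d n\<rfloor>" and f="\<lambda>k p. X (real (k + 1) * ?d n) (snd p)"])
    show "(\<lambda>p. X (real (k + 1) * ?d n) (snd p)) \<in> borel_measurable ((borel :: real measure) \<Otimes>\<^sub>M M)" for k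
      by (rule measurable_compose[OF measurable_snd X_meas]) simp
    show "(\<lambda>p. nat \<lfloor>max 0 (fst p) / ?d n\<rfloor>) \<in> measurable ((borel :: real measure) \<Otimes>\<^sub>M M) (count_space UNIV)"
      by measurable
  qed
  fix p assume "p \<in> space ((borel :: real measure) \<Otimes>\<^sub>M M)"
  then have w: "snd p \<in> space M" by (auto simp: space_pair_measure)
  have "filterlim (\<lambda>n. up_grid (?d n) (max 0 (fst p))) (at_right (max 0 (fst p))) sequentially"
  proof (rule up_grid_at_right)
    show "?d \<longlonglongrightarrow> 0" using LIMSEQ_inverse_real_of_nat by (simp add: inverse_eq_divide)
  qed simp
  from filterlim_compose[OF X_right_cont[OF w, of "max 0 (fst p)"] this]
  show "(\<lambda>n. ?f n p) \<longlonglongrightarrow> Xp p"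
    by (simp add: up_grid_nat Xp_def del: of_nat_Suc)
qed

definition exp_time_law :: "real \<Rightarrow> real measure" where
  "exp_time_law q = distr (density lborel (exponential_density q) \<Otimes>\<^sub>M M) borel Xp"

lemma Xp_meas_exp: "Xp \<in> borel_measurable (density lborel f \<Otimes>\<^sub>M M)"
  using Xp_meas measurable_cong_sets[OF sets_pair_measure_cong[of "density lborel f" borel M M] refl] by auto

lemma exp_time_law_real_distribution: assumes q: "0 < q" shows "real_distribution (exp_time_law q)"
proof -
  interpret E: prob_space "density lborel (exponential_density q)" by (rule prob_space_exponential_density[OF q])
  interpret EM: pair_prob_space "density lborel (exponential_density q)" M ..
  show ?thesis unfolding exp_time_law_def real_distribution_def real_distribution_axioms_def
    by (auto intro!: EM.P.prob_space_distr Xp_meas_exp)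
qed

lemma nn_integral_exp_time_law:
  assumes q: "0 < q" and f [measurable]: "f \<in> borel_measurable borel"
  shows "(\<integral>\<^sup>+y. f y \<partial>exp_time_law q) = (\<integral>\<^sup>+t. ennreal (q * exp (- q * t)) * indicator {0..} t * (\<integral>\<^sup>+\<omega>. f (X t \<omega>) \<partial>M) \<partial>lborel)"
proof -
  let ?E = "density lborel (exponential_density q)"
  interpret E: prob_space ?E by (rule prob_space_exponential_density[OF q])
  interpret EM: pair_prob_space ?E M ..
  have [measurable]: "(\<lambda>p. f (Xp p)) \<in> borel_measurable (?E \<Otimes>\<^sub>M M)"
    using measurable_compose[OF Xp_meas_exp f] .
  have [measurable]: "(\<lambda>p. f (Xp p)) \<in> borel_measurable ((borel :: real measure) \<Otimes>\<^sub>M M)" by measurable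
  have "(\<integral>\<^sup>+y. f y \<partial>exp_time_law q) = (\<integral>\<^sup>+p. f (Xp p) \<partial>(?E \<Otimes>\<^sub>M M))"
    unfolding exp_time_law_def by (rule nn_integral_distr[OF Xp_meas_exp]) simp
  also have "\<dots> = (\<integral>\<^sup>+t. \<integral>\<^sup>+\<omega>. f (Xp (t, \<omega>)) \<partial>M \<partial>?E)"
    by (subst nn_integral_fst[symmetric]) auto
  also have "\<dots> = (\<integral>\<^sup>+t. ennreal (exponential_density q t) * (\<integral>\<^sup>+\<omega>. f (Xp (t, \<omega>)) \<partial>M) \<partial>lborel)"
    by (rule nn_integral_density) measurable
  also have "\<dots> = (\<integral>\<^sup>+t. ennreal (q * exp (- q * t)) * indicator {0..} t * (\<integral>\<^sup>+\<omega>. f (X t \<omega>) \<partial>M) \<partial>lborel)"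
    by (intro nn_integral_cong) (auto simp: exponential_density_def Xp_def mult.commute split: split_indicator)
  finally show ?thesis .
qed

lemma char_exp_time_law:
  assumes q: "0 < q"
  shows "char (exp_time_law q) s = of_real q / (of_real q - lexp P (\<i> * of_real s))"
proof -
  let ?E = "density lborel (exponential_density q)"
  let ?\<psi> = "lexp P (\<i> * of_real s)"
  interpret E: prob_space ?E by (rule prob_space_exponential_density[OF q])
  interpret EM: pair_prob_space ?E M ..
  note [measurable] = Xp_meas_exp
  have "char (exp_time_law q) s = (CLINT p|?E \<Otimes>\<^sub>M M. iexp (s * Xp p))"
    unfolding char_def exp_time_law_def by (subst integral_distr) auto
  also have "\<dots> = (CLINT t|?E. CLINT \<omega>|M. iexp (s * Xp (t, \<omega>)))"
    by (rule EM.integral_fst'[symmetric]) (rule EM.P.integrable_const_bound[where B=1], auto)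
  also have "\<dots> = (CLINT t|lborel. exponential_density q t *\<^sub>R (CLINT \<omega>|M. iexp (s * Xp (t, \<omega>))))"
    using q by (subst integral_density) (auto intro!: exponential_density_nonneg)
  also have "\<dots> = (CLINT t|lborel. of_real q * (indicator {0..} t *\<^sub>R exp (- (of_real q - ?\<psi>) * of_real t)))"
  proof (rule integral_cong_AE)
    show "AE t in lborel. exponential_density q t *\<^sub>R (CLINT \<omega>|M. iexp (s * Xp (t, \<omega>)))
       = of_real q * (indicator {0..} t *\<^sub>R exp (- (of_real q - ?\<psi>) * of_real t))"
      using AE_lborel_singleton[of 0]
    proof eventually_elim
      case (elim t)
      show ?case
      proof (cases "0 < t")
        case True
        have "(CLINT \<omega>|M. iexp (s * Xp (t, \<omega>))) = char (distr M borel (X t)) s"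
          unfolding char_def using True X_meas[of t] by (subst integral_distr) (auto simp: Xp_def)
        then show ?thesis using True
          by (simp add: char_X exponential_density_def scaleR_conv_of_real exp_of_real[symmetric] exp_add[symmetric] algebra_simps)
      qed (use elim in \<open>auto simp: exponential_density_def\<close>)
    qed
    show "(\<lambda>t. of_real q * (indicator {0..} t *\<^sub>R exp (- (of_real q - ?\<psi>) * of_real t))) \<in> borel_measurable lborel"
      by (intro borel_measurable_times borel_measurable_scaleR borel_measurable_const borel_measurable_indicator
         measurable_lborel1[THEN equalityD2, THEN subsetD] borel_measurable_continuous_onI continuous_intros) auto
  qed auto
  also have "\<dots> = of_real q * (1 / (of_real q - ?\<psi>))"
    using complex_exp_integral(2)[of "of_real q - ?\<psi>"] Re_lexp_le_0[of s] q
    by (subst integral_mult_right_zero) simp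
  finally show ?thesis by simp
qed

text \<open>Comparison of characteristic functions. Nonnegativity of the exponential sum is part of
  the conclusion, since the signs of the weights are not controlled.\<close>

lemma exp_time_law_density:
  assumes "mejd_roots P q \<beta> g"
  defines "r \<equiv> res_density (roots_set P \<beta> g) (rweight P q (roots_set P \<beta> g))"
  shows "exp_time_law q = density lborel (\<lambda>y. ennreal (q * r y))" "AE y in lborel. 0 \<le> r y"
proof -
  interpret mejd_roots P q \<beta> g by fact
  have "integrable lborel (\<lambda>y. q * r y)" unfolding r_def using integrable_res_density by simp
  moreover have "char (exp_time_law q) t = (CLINT y|lborel. of_real (q * r y) * iexp (t * y))" for t
  proof -
    have "(CLINT y|lborel. of_real (q * r y) * iexp (t * y)) = of_real q * (CLINT y|lborel. of_real (r y) * iexp (t * y))"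
      by (subst integral_mult_right_zero[symmetric]) (simp add: mult.assoc)
    also have "(CLINT y|lborel. of_real (r y) * iexp (t * y)) = 1 / (of_real q - lexp P (\<i> * of_real t))"
      unfolding r_def by (rule has_bochner_integral_integral_eq[OF res_density_char])
    finally show ?thesis by (simp add: char_exp_time_law[OF q_pos])
  qed
  ultimately have "exp_time_law q = density lborel (\<lambda>y. ennreal (q * r y))" "AE y in lborel. 0 \<le> q * r y"
    by (auto intro!: char_eq_imp_density[OF exp_time_law_real_distribution[OF q_pos]])
  then show "exp_time_law q = density lborel (\<lambda>y. ennreal (q * r y))" "AE y in lborel. 0 \<le> r y"
    using q_pos by (auto simp: zero_le_mult_iff)
qed

lemma exp_moment_mult:
  assumes t: "0 < t" "0 < s"
  shows "(\<integral>\<^sup>+\<omega>. exp (c * X (t + s) \<omega>) \<partial>M) = (\<integral>\<^sup>+\<omega>. exp (c * X t \<omega>) \<partial>M) * (\<integral>\<^sup>+\<omega>. exp (c * X s \<omega>) \<partial>M)"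
proof -
  \<comment> \<open>The first two steps have lengths \<open>t\<close> and \<open>s\<close>; the
    later ones only keep the grid strictly increasing.\<close>
  define \<tau> where "\<tau> i = (if i = 0 then 0 else t + real (i - 1) * s)" for i :: nat
  have tau: "\<tau> 0 = 0" "\<And>i. \<tau> i < \<tau> (Suc i)"
    using t by (auto simp: \<tau>_def less_Suc_eq_0_disj)
  have d: "\<tau> 1 = t" "\<tau> 2 = t + s" by (auto simp: \<tau>_def)
  have law: "(\<integral>\<^sup>+\<omega>. exp (c * dX \<tau> i \<omega>) \<partial>M) = (\<integral>\<^sup>+\<omega>. exp (c * X (\<tau> (Suc i) - \<tau> i) \<omega>) \<partial>M)" for i
  proof -
    have dpos: "0 < \<tau> (Suc i) - \<tau> i" using tau by simp
    have "(\<integral>\<^sup>+\<omega>. exp (c * dX \<tau> i \<omega>) \<partial>M) = (\<integral>\<^sup>+y. exp (c * y) \<partial>distr M borel (dX \<tau> i))"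
      by (subst nn_integral_distr[OF dX_meas[OF tau]]) auto
    also have "\<dots> = (\<integral>\<^sup>+y. exp (c * y) \<partial>distr M borel (X (\<tau> (Suc i) - \<tau> i)))"
      by (simp only: dX_law[OF tau] X_law[OF dpos])
    also have "\<dots> = (\<integral>\<^sup>+\<omega>. exp (c * X (\<tau> (Suc i) - \<tau> i) \<omega>) \<partial>M)"
      using dpos by (subst nn_integral_distr[OF X_meas]) auto
    finally show ?thesis .
  qed
  have "indep_vars (\<lambda>_. borel) (\<lambda>i \<omega>. ennreal (exp (c * dX \<tau> i \<omega>))) {..<2}"
    by (rule indep_vars_compose2[OF dX_indep[OF tau]]) auto
  from indep_vars_nn_integral[OF _ this]
  have "(\<integral>\<^sup>+\<omega>. (\<Prod>i<2. ennreal (exp (c * dX \<tau> i \<omega>))) \<partial>M) = (\<Prod>i<2. \<integral>\<^sup>+\<omega>. exp (c * dX \<tau> i \<omega>) \<partial>M)"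
    by simp
  also have "\<dots> = (\<integral>\<^sup>+\<omega>. exp (c * X t \<omega>) \<partial>M) * (\<integral>\<^sup>+\<omega>. exp (c * X s \<omega>) \<partial>M)"
    unfolding law using d tau by (simp add: numeral_2_eq_2)
  also have "(\<integral>\<^sup>+\<omega>. (\<Prod>i<2. ennreal (exp (c * dX \<tau> i \<omega>))) \<partial>M) = (\<integral>\<^sup>+\<omega>. exp (c * X (t + s) \<omega>) \<partial>M)"
    using d tau by (intro nn_integral_cong)
      (simp add: numeral_2_eq_2 dX_def X_0 ennreal_mult[symmetric] exp_add[symmetric] algebra_simps)
  finally show ?thesis .
qed

end

lemma integrable_exp_up: "0 < a \<Longrightarrow> integrable lborel (\<lambda>y. exp (- a * y) * indicator {0..} y :: real)"
  using exp_char_up[of a 0] by (intro real_has_bochner_of_complex) simp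

lemma integrable_exp_down: "0 < a \<Longrightarrow> integrable lborel (\<lambda>y. exp (a * y) * indicator {..<0} y :: real)"
  using exp_char_down[of a 0] by (intro real_has_bochner_of_complex) simp

lemma (in mejd_roots) integrable_exp_res_density:
  assumes c: "- g 1 < c" "c < \<beta> 1"
  shows "integrable lborel (\<lambda>y. exp (c * y) * res_density R w y)"
proof -
  have "integrable lborel (\<lambda>y. (\<Sum>z\<in>{z\<in>R. 0 < z}. w z * (exp (- (z - c) * y) * indicator {0..} y))
     - (\<Sum>z\<in>{z\<in>R. z < 0}. w z * (exp ((c - z) * y) * indicator {..<0} y)))"
  proof (intro Bochner_Integration.integrable_diff Bochner_Integration.integrable_sum integrable_mult_right
      integrable_exp_up integrable_exp_down)
    fix z assume "z \<in> {z\<in>R. 0 < z}"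
    then show "0 < z - c" unfolding R_pos using beta_ge c(2) by fastforce
  next
    fix z assume "z \<in> {z\<in>R. z < 0}"
    then show "0 < c - z" unfolding R_neg using g_ge c(1) by fastforce
  qed
  also have "(\<lambda>y. (\<Sum>z\<in>{z\<in>R. 0 < z}. w z * (exp (- (z - c) * y) * indicator {0..} y))
     - (\<Sum>z\<in>{z\<in>R. z < 0}. w z * (exp ((c - z) * y) * indicator {..<0} y))) = (\<lambda>y. exp (c * y) * res_density R w y)"
    by (auto simp: fun_eq_iff res_density_def right_diff_distrib sum_distrib_left left_diff_distrib exp_diff exp_minus field_simps intro!: sum.cong arg_cong2[where f="(-)"])
  finally show ?thesis .
qed

text \<open>The average over an exponential time is finite by the explicit density, which decays
  fast enough on either side. By \<open>exp_moment_mult\<close> an infinite moment at one time would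
  persist at all later times and make that average infinite.\<close>

lemma (in mejd_driven) exp_moment_finite:
  assumes r: "mejd_roots P q \<beta> g" and c: "- g 1 < c" "c < \<beta> 1" and t: "0 \<le> t"
  shows "(\<integral>\<^sup>+y. exp (c * y) \<partial>exp_time_law q) < \<infinity>" "(\<integral>\<^sup>+\<omega>. exp (c * X t \<omega>) \<partial>M) < \<infinity>"
proof -
  interpret r: mejd_roots P q \<beta> g by fact
  note D = exp_time_law_density[OF r]
  have "(\<integral>\<^sup>+y. exp (c * y) \<partial>exp_time_law q) = (\<integral>\<^sup>+y. ennreal (q * (exp (c * y) * res_density r.R r.w y)) \<partial>lborel)"
    unfolding D(1) by (subst nn_integral_density) (use r.q_pos D(2) in \<open>auto intro!: nn_integral_cong_AE elim!: eventually_mono simp: ennreal_mult[symmetric] mult_ac\<close>)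
  also have "\<dots> \<le> (\<integral>\<^sup>+y. ennreal (norm (q * (exp (c * y) * res_density r.R r.w y))) \<partial>lborel)"
    by (intro nn_integral_mono ennreal_leI) simp
  also have "\<dots> < \<infinity>"
    using integrable_mult_right[of q lborel "\<lambda>y. exp (c * y) * res_density r.R r.w y"] r.integrable_exp_res_density[OF c]
    unfolding integrable_iff_bounded by blast
  finally show fin: "(\<integral>\<^sup>+y. exp (c * y) \<partial>exp_time_law q) < \<infinity>" .
  let ?m = "\<lambda>t. \<integral>\<^sup>+\<omega>. exp (c * X t \<omega>) \<partial>M"
  show "?m t < \<infinity>"
  proof (cases "t = 0")
    case True
    then have "?m t = (\<integral>\<^sup>+\<omega>. 1 \<partial>M)" by (intro nn_integral_cong) (simp add: X_0)
    then show ?thesis by (simp add: emeasure_space_1)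
  next
    case False
    then have t: "0 < t" using t by simp
    show ?thesis
    proof (rule ccontr)
      assume "\<not> ?m t < \<infinity>"
      then have inf: "?m t = \<infinity>" by (simp add: less_top[symmetric])
      have m_inf: "?m (t + s) = \<infinity>" if s: "0 < s" for s
      proof -
        \<comment> \<open>Needed because infinity times 0 is 0 in extended arithmetic.\<close>
        have "?m s \<noteq> 0"
        proof
          assume "?m s = 0"
          then have "AE \<omega> in M. ennreal (exp (c * X s \<omega>)) = 0"
            using X_meas[of s] s by (subst (asm) nn_integral_0_iff_AE) auto
          then have "AE \<omega> in M. False" by eventually_elim simp
          then show False by (simp add: AE_False emeasure_space_1)
        qed
        then show ?thesis unfolding exp_moment_mult[OF t s] inf by (simp add: ennreal_top_mult)
      qed
      have "(\<integral>\<^sup>+u. \<infinity> * indicator {t<..t + 1} u \<partial>lborel) \<le>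
          (\<integral>\<^sup>+u. ennreal (q * exp (- q * u)) * indicator {0..} u * ?m u \<partial>lborel)"
      proof (intro nn_integral_mono)
        fix u :: real
        show "\<infinity> * indicator {t<..t + 1} u \<le> ennreal (q * exp (- q * u)) * indicator {0..} u * ?m u"
          using m_inf[of "u - t"] t r.q_pos by (auto simp: ennreal_mult_top split: split_indicator)
      qed
      also have "\<dots> < \<infinity>"
        using fin nn_integral_exp_time_law[OF r.q_pos, of "\<lambda>y. ennreal (exp (c * y))"] by simp
      finally show False by (simp add: nn_integral_cmult_indicator)
    qed
  qed
qed

section \<open>The Markov property for occupation functionals\<close>

text \<open>Independence allows integrating out \<open>v\<close> through its law alone, so
  \<open>v\<close> may be exchanged for any \<open>v'\<close> of the same law. In the application
  \<open>v\<close> holds increments after time \<open>t\<close> and \<open>v'\<close> increments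
  from time 0.\<close>

lemma (in prob_space) indep_var_nn_integral:
  assumes ind: "indep_var S A T v" and law: "distr M T v = distr M T v'" and v': "v' \<in> measurable M T"
    and F: "F \<in> borel_measurable (S \<Otimes>\<^sub>M T)"
  shows "(\<integral>\<^sup>+\<omega>. F (A \<omega>, v \<omega>) \<partial>M) = (\<integral>\<^sup>+\<omega>. \<integral>\<^sup>+\<omega>'. F (A \<omega>, v' \<omega>') \<partial>M \<partial>M)"
proof -
  have A: "A \<in> measurable M S" and v: "v \<in> measurable M T"
    and D: "distr M S A \<Otimes>\<^sub>M distr M T v = distr M (S \<Otimes>\<^sub>M T) (\<lambda>x. (A x, v x))"
    using ind unfolding indep_var_distribution_eq by auto
  interpret V: prob_space "distr M T v'" using v' by (rule prob_space_distr)
  have "(\<integral>\<^sup>+\<omega>. F (A \<omega>, v \<omega>) \<partial>M) = (\<integral>\<^sup>+p. F p \<partial>distr M (S \<Otimes>\<^sub>M T) (\<lambda>x. (A x, v x)))"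
    using A v F by (subst nn_integral_distr) auto
  also have "\<dots> = (\<integral>\<^sup>+p. F p \<partial>(distr M S A \<Otimes>\<^sub>M distr M T v'))"
    by (simp only: D[symmetric] law)
  also have "\<dots> = (\<integral>\<^sup>+a. \<integral>\<^sup>+b. F (a, b) \<partial>distr M T v' \<partial>distr M S A)"
    by (rule V.nn_integral_fst[symmetric]) (use F in \<open>simp cong: measurable_cong_sets\<close>)
  also have "\<dots> = (\<integral>\<^sup>+a. \<integral>\<^sup>+\<omega>'. F (a, v' \<omega>') \<partial>M \<partial>distr M S A)"
    using v' measurable_compose[OF measurable_Pair1' F] by (intro nn_integral_cong nn_integral_distr) auto
  also have "\<dots> = (\<integral>\<^sup>+\<omega>. \<integral>\<^sup>+\<omega>'. F (A \<omega>, v' \<omega>') \<partial>M \<partial>M)"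
  proof -
    have "(\<lambda>p. F (fst p, v' (snd p))) \<in> borel_measurable (S \<Otimes>\<^sub>M M)"
      using F v' by measurable
    then have "(\<lambda>a. \<integral>\<^sup>+\<omega>'. F (a, v' \<omega>') \<partial>M) \<in> borel_measurable S"
      using borel_measurable_nn_integral[of "\<lambda>a \<omega>'. F (a, v' \<omega>')" S] by (simp add: split_beta')
    then show ?thesis by (simp add: nn_integral_distr[OF A])
  qed
  finally show ?thesis .
qed

lemma (in prob_space) indep_vars_reindex:
  assumes ind: "indep_vars (\<lambda>_. L) X I" and f: "inj_on f K" "f ` K \<subseteq> I"
  shows "indep_vars (\<lambda>_. L) (\<lambda>j. X (f j)) K"
proof -
  have "indep_vars (\<lambda>j. PiM {f j} (\<lambda>_. L)) (\<lambda>j \<omega>. restrict (\<lambda>i. X i \<omega>) {f j}) K"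
    by (rule indep_vars_restrict[OF ind]) (use f in \<open>auto simp: disjoint_family_on_def inj_on_def\<close>)
  then have "indep_vars (\<lambda>_. L) (\<lambda>j \<omega>. (\<lambda>z. z (f j)) (restrict (\<lambda>i. X i \<omega>) {f j})) K"
    by (rule indep_vars_compose2) (rule measurable_component_singleton, simp)
  then show ?thesis by simp
qed

context mejd_driven
begin

text \<open>Payoff of the path piece of duration \<open>s\<close> after time \<open>t\<close>,
  transplanted to start at \<open>y\<close>: \<open>k\<close> acts as a killing rate and
  \<open>c\<close> as exponent of the terminal value. Only increments after \<open>t\<close> enter,
  as the Markov property requires.\<close>

definition J :: "(real \<Rightarrow> real) \<Rightarrow> real \<Rightarrow> real \<Rightarrow> real \<Rightarrow> real \<Rightarrow> 'a \<Rightarrow> real" where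
  "J k c s t y \<omega> = exp (- (LBINT r:{0..s}. k (y + (Xp (t + r, \<omega>) - Xp (t, \<omega>)))) + c * (y + (Xp (t + s, \<omega>) - Xp (t, \<omega>))))"

lemma J_meas [measurable (raw)]:
  assumes [measurable]: "k \<in> borel_measurable borel" "f \<in> borel_measurable L" "g \<in> borel_measurable L" "h \<in> borel_measurable L" "w \<in> measurable L M"
  shows "(\<lambda>x. J k c (f x) (g x) (h x) (w x)) \<in> borel_measurable L"
proof -
  \<comment> \<open>The variable upper limit is moved into the integrand, so that measurability of
    parameter integrals applies.\<close>
  have "(\<lambda>x. LBINT r:{0..f x}. k (h x + (Xp (g x + r, w x) - Xp (g x, w x)))) =
      (\<lambda>x. LBINT r. (if 0 \<le> r \<and> r \<le> f x then k (h x + (Xp (g x + r, w x) - Xp (g x, w x))) else 0))"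
    by (auto simp: set_lebesgue_integral_def fun_eq_iff indicator_def intro!: Bochner_Integration.integral_cong)
  moreover have "(\<lambda>x. LBINT r. (if 0 \<le> r \<and> r \<le> f x then k (h x + (Xp (g x + r, w x) - Xp (g x, w x))) else 0)) \<in> borel_measurable L"
  proof (rule lborel.borel_measurable_lebesgue_integral)
    have gp: "(\<lambda>p. g (fst p) + snd p) \<in> borel_measurable (L \<Otimes>\<^sub>M (borel :: real measure))"
      "(\<lambda>p. g (fst p)) \<in> borel_measurable (L \<Otimes>\<^sub>M (borel :: real measure))"
      by (intro borel_measurable_add measurable_snd measurable_compose[OF measurable_fst assms(3)])+
    have wp: "(\<lambda>p. w (fst p)) \<in> measurable (L \<Otimes>\<^sub>M (borel :: real measure)) M" by (rule measurable_compose[OF measurable_fst assms(5)])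
    have X: "(\<lambda>p. h (fst p) + (Xp (g (fst p) + snd p, w (fst p)) - Xp (g (fst p), w (fst p)))) \<in> borel_measurable (L \<Otimes>\<^sub>M (borel :: real measure))"
      by (intro borel_measurable_add borel_measurable_diff measurable_compose[OF measurable_fst assms(4)]
         measurable_compose[OF measurable_Pair[OF gp(1) wp] Xp_meas] measurable_compose[OF measurable_Pair[OF gp(2) wp] Xp_meas])
    have [measurable]: "(\<lambda>p. f (fst p)) \<in> borel_measurable (L \<Otimes>\<^sub>M (borel :: real measure))"
      by (rule measurable_compose[OF measurable_fst assms(2)])
    have "{p \<in> space (L \<Otimes>\<^sub>M (borel :: real measure)). 0 \<le> snd p \<and> snd p \<le> f (fst p)} \<in> sets (L \<Otimes>\<^sub>M borel)"
      by (intro sets.sets_Collect_conj borel_measurable_le borel_measurable_const measurable_snd) measurable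
    then have "(\<lambda>p. if 0 \<le> snd p \<and> snd p \<le> f (fst p) then k (h (fst p) + (Xp (g (fst p) + snd p, w (fst p)) - Xp (g (fst p), w (fst p)))) else 0)
        \<in> borel_measurable (L \<Otimes>\<^sub>M (borel :: real measure))"
      by (intro measurable_If measurable_compose[OF X assms(1)] borel_measurable_const)
    also have "borel_measurable (L \<Otimes>\<^sub>M (borel :: real measure)) = borel_measurable (L \<Otimes>\<^sub>M lborel)"
      by (rule measurable_cong_sets[OF sets_pair_measure_cong]) auto
    finally show "(\<lambda>(x, r). if 0 \<le> r \<and> r \<le> f x then k (h x + (Xp (g x + r, w x) - Xp (g x, w x))) else 0)
        \<in> borel_measurable (L \<Otimes>\<^sub>M lborel)"
      unfolding split_beta' .
  qed
  ultimately have [measurable]: "(\<lambda>x. LBINT r:{0..f x}. k (h x + (Xp (g x + r, w x) - Xp (g x, w x)))) \<in> borel_measurable L"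
    by simp
  have "(\<lambda>x. g x + f x) \<in> borel_measurable L" by measurable
  note [measurable] = measurable_compose[OF measurable_Pair[OF this assms(5)] Xp_meas] measurable_compose[OF measurable_Pair[OF assms(3,5)] Xp_meas]
  show ?thesis unfolding J_def by measurable
qed

text \<open>The Feynman-Kac semigroup with killing rate \<open>k\<close>, at time \<open>s\<close>,
  applied to the exponential function with exponent \<open>c\<close>.\<close>

definition U :: "(real \<Rightarrow> real) \<Rightarrow> real \<Rightarrow> real \<Rightarrow> real \<Rightarrow> ennreal" where
  "U k c s y = (\<integral>\<^sup>+\<omega>. J k c s 0 y \<omega> \<partial>M)"

lemma U_meas [measurable (raw)]:
  assumes [measurable]: "k \<in> borel_measurable borel" "f \<in> borel_measurable L" "h \<in> borel_measurable L"
  shows "(\<lambda>x. U k c (f x) (h x)) \<in> borel_measurable L"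
  unfolding U_def by measurable

lemma J_le: assumes "\<And>x. 0 \<le> k x" shows "J k c s t y \<omega> \<le> exp (c * (y + (Xp (t + s, \<omega>) - Xp (t, \<omega>))))"
  unfolding J_def using assms by (auto simp: set_lebesgue_integral_def intro!: integral_nonneg_AE)

text \<open>The end point \<open>s\<close>, where \<open>grid\<close> is capped, is left out of the
  convergence hypothesis; it is a null set.\<close>

lemma set_lim_bounded:
  fixes f :: "nat \<Rightarrow> real \<Rightarrow> real"
  assumes [measurable]: "\<And>n. f n \<in> borel_measurable borel" "g \<in> borel_measurable borel"
    and b: "\<And>n r. \<bar>f n r\<bar> \<le> B"
    and lim: "\<And>r. 0 \<le> r \<Longrightarrow> r < s \<Longrightarrow> (\<lambda>n. f n r) \<longlonglongrightarrow> g r"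
  shows "(\<lambda>n. LBINT r:{0..s}. f n r) \<longlonglongrightarrow> (LBINT r:{0..s}. g r)"
  unfolding set_lebesgue_integral_def
proof (rule integral_dominated_convergence[where w="\<lambda>r. indicator {0..s} r * B"])
  show "AE x in lborel. (\<lambda>i. indicator {0..s} x *\<^sub>R f i x) \<longlonglongrightarrow> indicator {0..s} x *\<^sub>R g x"
    using AE_lborel_singleton[of s]
    by eventually_elim (auto split: split_indicator intro: lim)
  show "AE x in lborel. norm (indicator {0..s} x *\<^sub>R f i x) \<le> indicator {0..s} x * B" for i
    using b by (auto split: split_indicator)
qed auto

lemma J_lim:
  assumes [measurable]: "\<And>n. k n \<in> borel_measurable borel" "k' \<in> borel_measurable borel"
    and b: "\<And>n x. 0 \<le> k n x \<and> k n x \<le> B" and lim: "\<And>x. (\<lambda>n. k n x) \<longlonglongrightarrow> k' x" and w: "\<omega> \<in> space M"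
  shows "(\<lambda>n. J (k n) c s t y \<omega>) \<longlonglongrightarrow> J k' c s t y \<omega>"
proof -
  have [measurable]: "(\<lambda>r. Xp (t + r, \<omega>)) \<in> borel_measurable borel"
    using measurable_compose[OF measurable_Pair[of "\<lambda>r. t + r" borel borel "\<lambda>_. \<omega>" M] Xp_meas] w by simp
  have "(\<lambda>n. LBINT r:{0..s}. k n (y + (Xp (t + r, \<omega>) - Xp (t, \<omega>)))) \<longlonglongrightarrow>
      (LBINT r:{0..s}. k' (y + (Xp (t + r, \<omega>) - Xp (t, \<omega>))))"
    by (rule set_lim_bounded[where B=B]) (use b lim in auto)
  then show ?thesis unfolding J_def by (intro tendsto_intros)
qed

text \<open>Index of the grid point just to the right of \<open>r\<close>; the cap keeps the step
  path within the \<open>n\<close> increments up to the final time.\<close>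

definition grid :: "nat \<Rightarrow> real \<Rightarrow> real \<Rightarrow> nat" where
  "grid n \<delta> r = min n (nat \<lfloor>r / \<delta>\<rfloor> + 1)"

text \<open>The functional \<open>J\<close> with the path replaced by the step path of its increments \<open>v 1, \<dots>, v n\<close>
  over a grid of mesh \<open>s / n\<close>.\<close>

definition Psi :: "(real \<Rightarrow> real) \<Rightarrow> real \<Rightarrow> nat \<Rightarrow> real \<Rightarrow> real \<Rightarrow> (nat \<Rightarrow> real) \<Rightarrow> real" where
  "Psi k c n s y v = exp (- (LBINT r:{0..s}. k (y + (\<Sum>i=1..grid n (s / real n) r. v i))) + c * (y + (\<Sum>i=1..n. v i)))"

lemma Psi_nonneg [simp]: "0 \<le> Psi k c n s y v"
  by (simp add: Psi_def)

lemma Psi_meas: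
  assumes [measurable]: "k \<in> borel_measurable borel"
  shows "(\<lambda>p. Psi k c n s (fst p) (snd p)) \<in> borel_measurable ((borel :: real measure) \<Otimes>\<^sub>M PiM {1..n} (\<lambda>_. borel :: real measure))"
proof -
  have v: "(\<lambda>p. snd p i) \<in> borel_measurable ((borel :: real measure) \<Otimes>\<^sub>M PiM {1..n} (\<lambda>_. borel :: real measure))" if "i \<in> {1..n}" for i
    by (rule measurable_compose[OF measurable_snd measurable_component_singleton[OF that]])
  \<comment> \<open>Only indices in \<open>{1..n}\<close> are coordinates of the product space,
    hence the cap; for values of \<open>grid\<close> it changes nothing.\<close>
  have S: "(\<lambda>p. \<Sum>i=1..min n m. snd p i) \<in> borel_measurable ((borel :: real measure) \<Otimes>\<^sub>M PiM {1..n} (\<lambda>_. borel :: real measure))" for m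
    by (rule borel_measurable_sum[of "{1..min n m}" "\<lambda>i p. snd p i"]) (auto intro: v)
  let ?L = "((borel :: real measure) \<Otimes>\<^sub>M PiM {1..n} (\<lambda>_. borel :: real measure)) \<Otimes>\<^sub>M lborel :: ((real \<times> (nat \<Rightarrow> real)) \<times> real) measure"
  have "(\<lambda>q. \<Sum>i=1..min n (grid n (s / real n) (snd q)). snd (fst q) i) \<in> borel_measurable ?L"
  proof (rule measurable_compose_countable[where g="\<lambda>q. grid n (s / real n) (snd q)" and f="\<lambda>m q. \<Sum>i=1..min n m. snd (fst q) i"])
    show "(\<lambda>q. \<Sum>i = 1..min n m. snd (fst q) i) \<in> borel_measurable ?L" for m
      by (rule measurable_compose[OF measurable_fst S])
    show "(\<lambda>q. grid n (s / real n) (snd q)) \<in> measurable ?L (count_space UNIV)"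
      unfolding grid_def by measurable
  qed
  then have a [measurable]: "(\<lambda>q. \<Sum>i=1..grid n (s / real n) (snd q). snd (fst q) i) \<in> borel_measurable ?L"
    by (simp add: grid_def)
  have [measurable]: "(\<lambda>p. LBINT r:{0..s}. k (fst p + (\<Sum>i=1..grid n (s / real n) r. snd p i))) \<in> borel_measurable ((borel :: real measure) \<Otimes>\<^sub>M PiM {1..n} (\<lambda>_. borel :: real measure))"
    unfolding set_lebesgue_integral_def
  proof (rule lborel.borel_measurable_lebesgue_integral)
    show "(\<lambda>(p, r). indicator {0..s} r *\<^sub>R k (fst p + (\<Sum>i=1..grid n (s / real n) r. snd p i))) \<in> borel_measurable ?L"
      unfolding split_beta' by measurable
  qed
  have [measurable]: "(\<lambda>p. \<Sum>i=1..n. snd p i) \<in> borel_measurable ((borel :: real measure) \<Otimes>\<^sub>M PiM {1..n} (\<lambda>_. borel :: real measure))"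
    using S[of n] by simp
  show ?thesis unfolding Psi_def by measurable
qed

lemma Psi_path:
  assumes tau: "\<And>i. \<tau> i = t0 + real i * (s / real n)" and n: "0 < n" and s: "0 < s" and t0: "0 \<le> t0"
  shows "Psi k c n s y (\<lambda>i\<in>{1..n}. X (\<tau> i) \<omega> - X (\<tau> (i - 1)) \<omega>)
    = exp (- (LBINT r:{0..s}. k (y + (Xp (t0 + real (grid n (s / real n) r) * (s / real n), \<omega>) - Xp (t0, \<omega>))))
        + c * (y + (Xp (t0 + s, \<omega>) - Xp (t0, \<omega>))))"
proof -
  have tel: "(\<Sum>i=1..m. X (\<tau> i) \<omega> - X (\<tau> (i - 1)) \<omega>) = X (\<tau> m) \<omega> - X (\<tau> 0) \<omega>" for m
    by (induction m) auto
  have "(\<Sum>i=1..m. (\<lambda>i\<in>{1..n}. X (\<tau> i) \<omega> - X (\<tau> (i - 1)) \<omega>) i) = Xp (t0 + real m * (s / real n), \<omega>) - Xp (t0, \<omega>)" if "m \<le> n" for m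
  proof -
    have "(\<Sum>i=1..m. (\<lambda>i\<in>{1..n}. X (\<tau> i) \<omega> - X (\<tau> (i - 1)) \<omega>) i) = (\<Sum>i=1..m. X (\<tau> i) \<omega> - X (\<tau> (i - 1)) \<omega>)"
      using that by (intro sum.cong) auto
    also have "\<dots> = X (\<tau> m) \<omega> - X (\<tau> 0) \<omega>" by (rule tel)
    also have "\<dots> = Xp (t0 + real m * (s / real n), \<omega>) - Xp (t0, \<omega>)"
      using s t0 by (simp add: Xp_def tau)
    finally show ?thesis .
  qed
  note * = this
  have "grid n (s / real n) r \<le> n" for r by (simp add: grid_def)
  note g = *[OF this]
  have e: "t0 + real n * (s / real n) = t0 + s" using n by simp
  show ?thesis unfolding Psi_def g *[OF order_refl] e ..
qed

text \<open>Grid times approach \<open>r\<close> strictly from the right, where the path is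
  continuous, and \<open>k\<close> is continuous here. Discontinuous rates are reached by a second
  limit in \<open>markov_property\<close>.\<close>

lemma Psi_lim:
  assumes k: "continuous_on UNIV k" and b: "\<And>x. 0 \<le> k x \<and> k x \<le> B" and s: "0 < s" and t0: "0 \<le> t0" and w: "\<omega> \<in> space M"
  shows "(\<lambda>m. exp (- (LBINT r:{0..s}. k (y + (Xp (t0 + real (grid (Suc m) (s / real (Suc m)) r) * (s / real (Suc m)), \<omega>) - Xp (t0, \<omega>))))
        + c * (y + (Xp (t0 + s, \<omega>) - Xp (t0, \<omega>))))) \<longlonglongrightarrow> J k c s t0 y \<omega>"
proof -
  have [measurable]: "k \<in> borel_measurable borel" using k by (rule borel_measurable_continuous_onI)
  have Xw [measurable]: "(\<lambda>r. Xp (r, \<omega>)) \<in> borel_measurable borel"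
    using measurable_compose[OF measurable_Pair[of "\<lambda>r. r" borel borel "\<lambda>_. \<omega>" M] Xp_meas] w by simp
  have "(\<lambda>m. LBINT r:{0..s}. k (y + (Xp (t0 + real (grid (Suc m) (s / real (Suc m)) r) * (s / real (Suc m)), \<omega>) - Xp (t0, \<omega>))))
     \<longlonglongrightarrow> (LBINT r:{0..s}. k (y + (Xp (t0 + r, \<omega>) - Xp (t0, \<omega>))))"
  proof (rule set_lim_bounded[where B=B])
    show "(\<lambda>r. k (y + (Xp (t0 + real (grid (Suc m) (s / real (Suc m)) r) * (s / real (Suc m)), \<omega>) - Xp (t0, \<omega>)))) \<in> borel_measurable borel" for m
    proof -
      have "(\<lambda>r. t0 + real (grid (Suc m) (s / real (Suc m)) r) * (s / real (Suc m))) \<in> borel_measurable borel"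
        unfolding grid_def by measurable
      from measurable_compose[OF this Xw]
      have "(\<lambda>r. y + (Xp (t0 + real (grid (Suc m) (s / real (Suc m)) r) * (s / real (Suc m)), \<omega>) - Xp (t0, \<omega>))) \<in> borel_measurable borel"
        by (intro borel_measurable_add borel_measurable_diff borel_measurable_const)
      then show ?thesis by measurable
    qed
    have "(\<lambda>r. t0 + r) \<in> borel_measurable borel" by measurable
    from measurable_compose[OF this Xw]
    have "(\<lambda>r. y + (Xp (t0 + r, \<omega>) - Xp (t0, \<omega>))) \<in> borel_measurable borel"
      by (intro borel_measurable_add borel_measurable_diff borel_measurable_const)
    then show "(\<lambda>r. k (y + (Xp (t0 + r, \<omega>) - Xp (t0, \<omega>)))) \<in> borel_measurable borel" by measurable
    fix r assume r: "0 \<le> r" "r < s"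
    \<comment> \<open>Below the final time the cap in \<open>grid\<close> is inactive.\<close>
    have g: "real (grid (Suc m) (s / real (Suc m)) r) * (s / real (Suc m)) = up_grid (s / real (Suc m)) r" for m
    proof -
      have "r * real (Suc m) < s * real (Suc m)" using r by (intro mult_strict_right_mono) auto
      then have "r / (s / real (Suc m)) < real (Suc m)" using s by (simp add: pos_divide_less_eq mult.commute del: of_nat_Suc)
      then have "nat \<lfloor>r / (s / real (Suc m))\<rfloor> + 1 \<le> Suc m" by linarith
      then show ?thesis using r s by (subst up_grid_nat) (auto simp: grid_def simp del: of_nat_Suc)
    qed
    have "(\<lambda>m. s / real (Suc m)) \<longlonglongrightarrow> 0"
      using tendsto_mult[OF tendsto_const LIMSEQ_inverse_real_of_nat, of s] by (simp add: divide_inverse)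
    then have up: "filterlim (\<lambda>m. up_grid (s / real (Suc m)) r) (at_right r) sequentially"
      by (intro up_grid_at_right) (use s in auto)
    have "filterlim (\<lambda>m. t0 + up_grid (s / real (Suc m)) r) (at_right (t0 + r)) sequentially"
      using up unfolding filterlim_at
      by (auto intro!: tendsto_intros elim!: eventually_mono)
    from filterlim_compose[OF X_right_cont[OF w] this]
    have "(\<lambda>m. X (t0 + up_grid (s / real (Suc m)) r) \<omega>) \<longlonglongrightarrow> X (t0 + r) \<omega>" using t0 r by simp
    moreover have "0 \<le> up_grid (s / real (Suc m)) r" for m
      using up_grid_bounds(1)[of "s / real (Suc m)" r] s r by simp
    ultimately have "(\<lambda>m. Xp (t0 + up_grid (s / real (Suc m)) r, \<omega>)) \<longlonglongrightarrow> Xp (t0 + r, \<omega>)"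
      using t0 r by (simp add: Xp_def)
    then have "(\<lambda>m. y + (Xp (t0 + up_grid (s / real (Suc m)) r, \<omega>) - Xp (t0, \<omega>))) \<longlonglongrightarrow> y + (Xp (t0 + r, \<omega>) - Xp (t0, \<omega>))"
      by (intro tendsto_intros)
    then show "(\<lambda>m. k (y + (Xp (t0 + real (grid (Suc m) (s / real (Suc m)) r) * (s / real (Suc m)), \<omega>) - Xp (t0, \<omega>))))
       \<longlonglongrightarrow> k (y + (Xp (t0 + r, \<omega>) - Xp (t0, \<omega>)))"
      unfolding g using k by (intro isCont_tendsto_compose[of _ k]) (auto simp: continuous_on_eq_continuous_at)
  qed (use b in auto)
  then show ?thesis unfolding J_def by (intro tendsto_intros)
qed

text \<open>For a functional of finitely many increments the Markov property is independence of the
  first increment from the later ones, together with the fact that the law of an increment depends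
  on its length only.\<close>

lemma markov_grid:
  assumes t: "0 < t" and s: "0 < s" and n: "0 < n"
    and k [measurable]: "k \<in> borel_measurable borel" and \<phi> [measurable]: "\<phi> \<in> borel_measurable borel"
  shows "(\<integral>\<^sup>+\<omega>. \<phi> (x + X t \<omega>) * ennreal (Psi k c n s (x + X t \<omega>) (\<lambda>i\<in>{1..n}. X (t + real i * (s / real n)) \<omega> - X (t + real (i - 1) * (s / real n)) \<omega>)) \<partial>M)
    = (\<integral>\<^sup>+\<omega>. \<phi> (x + X t \<omega>) * (\<integral>\<^sup>+\<omega>'. ennreal (Psi k c n s (x + X t \<omega>)
         (\<lambda>i\<in>{1..n}. X (0 + real i * (s / real n)) \<omega>' - X (0 + real (i - 1) * (s / real n)) \<omega>')) \<partial>M) \<partial>M)"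
proof -
  define \<delta> where "\<delta> = s / real n"
  have d: "0 < \<delta>" using s n by (simp add: \<delta>_def)
  \<comment> \<open>One step of length \<open>t\<close>, then steps of the mesh size: an index shift
    by one matches its later increments with those of the uniform grid
    \<open>\<sigma>\<close>.\<close>
  define \<tau> where "\<tau> i = (if i = 0 then 0 else t + real (i - 1) * \<delta>)" for i :: nat
  define \<sigma> where "\<sigma> i = real i * \<delta>" for i :: nat
  have tau: "\<tau> 0 = 0" "\<And>i. \<tau> i < \<tau> (Suc i)"
    using t d by (auto simp: \<tau>_def less_Suc_eq_0_disj)
  have sig: "\<sigma> 0 = 0" "\<And>i. \<sigma> i < \<sigma> (Suc i)"
    using d by (auto simp: \<sigma>_def)
  let ?T = "PiM {1..n} (\<lambda>_. borel :: real measure)"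
  define v where "v = (\<lambda>\<omega>. \<lambda>i\<in>{1..n}. dX \<tau> i \<omega>)"
  define v' where "v' = (\<lambda>\<omega>. \<lambda>i\<in>{1..n}. dX \<sigma> (i - 1) \<omega>)"
  have mt: "dX \<tau> i \<in> borel_measurable M" and ms: "dX \<sigma> i \<in> borel_measurable M" for i
    by (rule dX_meas[OF tau], rule dX_meas[OF sig])
  have ind: "indep_vars (\<lambda>_. borel) (dX \<tau>) {..<Suc n}"
    by (rule dX_indep[OF tau]) simp
  let ?S = "PiM {0} (\<lambda>_. borel :: real measure)"
  define a where "a = (\<lambda>\<omega>. \<lambda>i\<in>{0}. dX \<tau> i \<omega>)"
  have indv: "indep_var ?S a ?T v"
    unfolding v_def a_def by (rule indep_var_restrict[OF ind]) auto
  have "distr M ?T v = PiM {1..n} (\<lambda>i. distr M borel (dX \<tau> i))"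
    unfolding v_def
    by (subst indep_vars_iff_distr_eq_PiM'[symmetric]) (use n mt in \<open>auto intro: indep_vars_subset[OF ind]\<close>)
  also have "\<dots> = PiM {1..n} (\<lambda>i. distr M borel (dX \<sigma> (i - 1)))"
  proof (rule PiM_cong)
    fix i assume "i \<in> {1..n}"
    then obtain j where "i = Suc j" by (cases i) auto
    then show "distr M borel (dX \<tau> i) = distr M borel (dX \<sigma> (i - 1))"
      unfolding dX_law[OF tau] dX_law[OF sig] by (simp add: \<tau>_def \<sigma>_def algebra_simps)
  qed simp
  also have "\<dots> = distr M ?T v'"
  proof -
    have "indep_vars (\<lambda>_. borel) (dX \<sigma>) {..<n}" by (rule dX_indep[OF sig n])
    moreover have "inj_on (\<lambda>i. i - 1) {1..n}" "(\<lambda>i. i - 1) ` {1..n} \<subseteq> {..<n}" by (auto simp: inj_on_def)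
    ultimately have "indep_vars (\<lambda>_. borel) (\<lambda>i. dX \<sigma> (i - 1)) {1..n}"
      by (rule indep_vars_reindex)
    then show ?thesis
      unfolding v'_def by (subst (asm) indep_vars_iff_distr_eq_PiM') (use n ms in auto)
  qed
  finally have law: "distr M ?T v = distr M ?T v'" .
  have v'm: "v' \<in> measurable M ?T" unfolding v'_def using ms by (intro measurable_restrict) auto
  have c0: "(\<lambda>p. fst p 0) \<in> borel_measurable (?S \<Otimes>\<^sub>M ?T)"
    by (rule measurable_compose[OF measurable_fst measurable_component_singleton]) simp
  have "(\<lambda>p. (x + fst p 0, snd p)) \<in> measurable (?S \<Otimes>\<^sub>M ?T) (borel \<Otimes>\<^sub>M ?T)"
    by (intro measurable_Pair borel_measurable_add borel_measurable_const c0 measurable_snd)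
  from measurable_compose[OF this Psi_meas[OF k]]
  have Psi0: "(\<lambda>p. Psi k c n s (x + fst p 0) (snd p)) \<in> borel_measurable (?S \<Otimes>\<^sub>M ?T)" by simp
  have \<phi>0: "(\<lambda>p. \<phi> (x + fst p 0)) \<in> borel_measurable (?S \<Otimes>\<^sub>M ?T)"
    by (rule measurable_compose[OF _ \<phi>]) (intro borel_measurable_add borel_measurable_const c0)
  have X0: "dX \<tau> 0 \<omega> = X t \<omega>" if "\<omega> \<in> space M" for \<omega>
    using that by (simp add: dX_def \<tau>_def X_0)
  have vv: "v \<omega> = (\<lambda>i\<in>{1..n}. X (t + real i * (s / real n)) \<omega> - X (t + real (i - 1) * (s / real n)) \<omega>)" for \<omega>
  proof -
    have "i = Suc (i - 1)" if "i \<in> {1..n}" for i using that by simp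
    then show ?thesis unfolding v_def by (auto simp: restrict_def dX_def \<tau>_def \<delta>_def fun_eq_iff)
  qed
  have vv': "v' \<omega> = (\<lambda>i\<in>{1..n}. X (0 + real i * (s / real n)) \<omega> - X (0 + real (i - 1) * (s / real n)) \<omega>)" for \<omega>
    unfolding v'_def by (auto simp: restrict_def dX_def \<sigma>_def \<delta>_def fun_eq_iff)
  have a0: "a \<omega> 0 = dX \<tau> 0 \<omega>" for \<omega> by (simp add: a_def)
  have "(\<integral>\<^sup>+\<omega>. (\<lambda>p. \<phi> (x + fst p 0) * ennreal (Psi k c n s (x + fst p 0) (snd p))) (a \<omega>, v \<omega>) \<partial>M)
     = (\<integral>\<^sup>+\<omega>. \<integral>\<^sup>+\<omega>'. (\<lambda>p. \<phi> (x + fst p 0) * ennreal (Psi k c n s (x + fst p 0) (snd p))) (a \<omega>, v' \<omega>') \<partial>M \<partial>M)"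
    by (rule indep_var_nn_integral[OF indv law v'm]) (intro borel_measurable_times_ennreal \<phi>0 measurable_compose[OF Psi0 measurable_ennreal])
  also have "\<dots> = (\<integral>\<^sup>+\<omega>. \<phi> (x + dX \<tau> 0 \<omega>) * (\<integral>\<^sup>+\<omega>'. ennreal (Psi k c n s (x + dX \<tau> 0 \<omega>) (v' \<omega>')) \<partial>M) \<partial>M)"
  proof (intro nn_integral_cong)
    fix \<omega> assume "\<omega> \<in> space M"
    have "(\<lambda>\<omega>'. Psi k c n s (x + dX \<tau> 0 \<omega>) (v' \<omega>')) \<in> borel_measurable M"
      using measurable_compose[OF v'm, of "\<lambda>z. Psi k c n s (x + dX \<tau> 0 \<omega>) z" borel]
        measurable_compose[OF measurable_Pair1'[of "x + dX \<tau> 0 \<omega>" borel ?T] Psi_meas[OF k]] by simp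
    then show "(\<integral>\<^sup>+\<omega>'. (\<lambda>p. \<phi> (x + fst p 0) * ennreal (Psi k c n s (x + fst p 0) (snd p))) (a \<omega>, v' \<omega>') \<partial>M)
      = \<phi> (x + dX \<tau> 0 \<omega>) * (\<integral>\<^sup>+\<omega>'. ennreal (Psi k c n s (x + dX \<tau> 0 \<omega>) (v' \<omega>')) \<partial>M)"
      by (simp add: nn_integral_cmult a0)
  qed
  finally show ?thesis unfolding vv vv' by (simp add: X0 a0 cong: nn_integral_cong)
qed

context
  fixes c :: real
  assumes mom: "\<And>t. 0 \<le> t \<Longrightarrow> (\<integral>\<^sup>+\<omega>. exp (c * X t \<omega>) \<partial>M) < \<infinity>"
begin

lemma mom_shift: "0 \<le> t \<Longrightarrow> (\<integral>\<^sup>+\<omega>. exp (c * (x + X t \<omega>)) \<partial>M) < \<infinity>"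
proof -
  assume t: "0 \<le> t"
  have "(\<integral>\<^sup>+\<omega>. exp (c * (x + X t \<omega>)) \<partial>M) = (\<integral>\<^sup>+\<omega>. ennreal (exp (c * x)) * ennreal (exp (c * X t \<omega>)) \<partial>M)"
    by (intro nn_integral_cong) (simp add: ennreal_mult[symmetric] exp_add[symmetric] algebra_simps)
  also have "\<dots> = ennreal (exp (c * x)) * (\<integral>\<^sup>+\<omega>. exp (c * X t \<omega>) \<partial>M)"
    using X_meas[OF t] by (intro nn_integral_cmult) measurable
  also have "\<dots> < \<infinity>" using mom[OF t] by (simp add: ennreal_mult_less_top)
  finally show ?thesis .
qed

text \<open>Both sides of the Markov identity pass to limits: the dominating functions are
  \<open>C exp (c (x + X (t + s)))\<close> on the left and \<open>C exp (c (x + X t)) E (exp (c X s))\<close> on the right.\<close>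

lemma markov_limit:
  fixes F :: "nat \<Rightarrow> real \<Rightarrow> 'a \<Rightarrow> real"
  assumes t: "0 < t" and s: "0 < s" and \<phi> [measurable]: "\<phi> \<in> borel_measurable borel" and C: "C < \<infinity>" "\<And>y. \<phi> y \<le> C"
    and k [measurable]: "k \<in> borel_measurable borel"
    and eq: "\<And>n. (\<integral>\<^sup>+\<omega>. \<phi> (x + X t \<omega>) * ennreal (F n t \<omega>) \<partial>M)
      = (\<integral>\<^sup>+\<omega>. \<phi> (x + X t \<omega>) * (\<integral>\<^sup>+\<omega>'. ennreal (G n (x + X t \<omega>) \<omega>') \<partial>M) \<partial>M)"
    and mF: "\<And>n. F n t \<in> borel_measurable M" and mG: "\<And>n. (\<lambda>p. G n (fst p) (snd p)) \<in> borel_measurable (borel \<Otimes>\<^sub>M M)"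
    and bF: "\<And>n \<omega>. \<omega> \<in> space M \<Longrightarrow> 0 \<le> F n t \<omega> \<and> F n t \<omega> \<le> exp (c * (x + X (t + s) \<omega>))"
    and bG: "\<And>n y \<omega>. \<omega> \<in> space M \<Longrightarrow> 0 \<le> G n y \<omega> \<and> G n y \<omega> \<le> exp (c * (y + X s \<omega>))"
    and lF: "\<And>\<omega>. \<omega> \<in> space M \<Longrightarrow> (\<lambda>n. F n t \<omega>) \<longlonglongrightarrow> J k c s t (x + X t \<omega>) \<omega>"
    and lG: "\<And>y \<omega>. \<omega> \<in> space M \<Longrightarrow> (\<lambda>n. G n y \<omega>) \<longlonglongrightarrow> J k c s 0 y \<omega>"
  shows "(\<integral>\<^sup>+\<omega>. \<phi> (x + X t \<omega>) * ennreal (J k c s t (x + X t \<omega>) \<omega>) \<partial>M) = (\<integral>\<^sup>+\<omega>. \<phi> (x + X t \<omega>) * U k c s (x + X t \<omega>) \<partial>M)"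
proof -
  have Xt [measurable]: "X t \<in> borel_measurable M" "X s \<in> borel_measurable M" "X (t + s) \<in> borel_measurable M"
    using t s by (auto intro: X_meas)
  have fin: "\<phi> y < \<infinity>" for y using C le_less_trans by blast
  have mGy [measurable]: "(\<lambda>\<omega>. G n y \<omega>) \<in> borel_measurable M" for n y
    using measurable_compose[OF measurable_Pair1'[of y borel M] mG[of n]] by simp
  have mGX [measurable]: "(\<lambda>y. \<integral>\<^sup>+\<omega>'. ennreal (G n y \<omega>') \<partial>M) \<in> borel_measurable borel" for n
    using mG[of n] borel_measurable_nn_integral[of "\<lambda>y \<omega>'. ennreal (G n y \<omega>')" borel] by (simp add: split_beta')
  note [measurable] = mF
  have Ulim: "(\<lambda>n. \<integral>\<^sup>+\<omega>'. ennreal (G n y \<omega>') \<partial>M) \<longlonglongrightarrow> U k c s y" for y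
    unfolding U_def
  proof (rule nn_integral_dominated_convergence[where w="\<lambda>\<omega>. ennreal (exp (c * (y + X s \<omega>)))"])
    show "(\<integral>\<^sup>+ \<omega>. ennreal (exp (c * (y + X s \<omega>))) \<partial>M) < \<infinity>" using s by (intro mom_shift) simp
  qed (use bG lG in \<open>auto intro!: AE_I2 ennreal_leI tendsto_ennrealI\<close>)
  have L: "(\<lambda>n. \<integral>\<^sup>+\<omega>. \<phi> (x + X t \<omega>) * ennreal (F n t \<omega>) \<partial>M) \<longlonglongrightarrow> (\<integral>\<^sup>+\<omega>. \<phi> (x + X t \<omega>) * ennreal (J k c s t (x + X t \<omega>) \<omega>) \<partial>M)"
  proof (rule nn_integral_dominated_convergence[where w="\<lambda>\<omega>. C * ennreal (exp (c * (x + X (t + s) \<omega>)))"])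
    have "(\<integral>\<^sup>+ \<omega>. C * ennreal (exp (c * (x + X (t + s) \<omega>))) \<partial>M) = C * (\<integral>\<^sup>+ \<omega>. ennreal (exp (c * (x + X (t + s) \<omega>))) \<partial>M)"
      by (intro nn_integral_cmult) measurable
    also have "\<dots> < \<infinity>" using mom_shift[of "t + s" x] t s C(1) by (simp add: ennreal_mult_less_top)
    finally show "(\<integral>\<^sup>+ \<omega>. C * ennreal (exp (c * (x + X (t + s) \<omega>))) \<partial>M) < \<infinity>" .
    show "AE \<omega> in M. \<phi> (x + X t \<omega>) * ennreal (F n t \<omega>) \<le> C * ennreal (exp (c * (x + X (t + s) \<omega>)))" for n
      using bF C(2) by (auto intro!: AE_I2 mult_mono ennreal_leI)
    show "AE \<omega> in M. (\<lambda>n. \<phi> (x + X t \<omega>) * ennreal (F n t \<omega>)) \<longlonglongrightarrow> \<phi> (x + X t \<omega>) * ennreal (J k c s t (x + X t \<omega>) \<omega>)"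
      using lF fin by (auto intro!: AE_I2 ennreal_tendsto_cmult tendsto_ennrealI)
  qed measurable
  have R: "(\<lambda>n. \<integral>\<^sup>+\<omega>. \<phi> (x + X t \<omega>) * (\<integral>\<^sup>+\<omega>'. ennreal (G n (x + X t \<omega>) \<omega>') \<partial>M) \<partial>M)
     \<longlonglongrightarrow> (\<integral>\<^sup>+\<omega>. \<phi> (x + X t \<omega>) * U k c s (x + X t \<omega>) \<partial>M)"
  proof (rule nn_integral_dominated_convergence[where w="\<lambda>\<omega>. C * (ennreal (exp (c * (x + X t \<omega>))) * (\<integral>\<^sup>+\<omega>'. exp (c * X s \<omega>') \<partial>M))"])
    have "(\<integral>\<^sup>+ \<omega>. C * (ennreal (exp (c * (x + X t \<omega>))) * (\<integral>\<^sup>+\<omega>'. exp (c * X s \<omega>') \<partial>M)) \<partial>M)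
       = C * ((\<integral>\<^sup>+ \<omega>. ennreal (exp (c * (x + X t \<omega>))) \<partial>M) * (\<integral>\<^sup>+\<omega>'. exp (c * X s \<omega>') \<partial>M))"
      by (subst nn_integral_cmult, measurable, subst nn_integral_multc) auto
    also have "\<dots> < \<infinity>" using mom_shift[of t x] mom[of s] t s C(1) by (simp add: ennreal_mult_less_top)
    finally show "(\<integral>\<^sup>+ \<omega>. C * (ennreal (exp (c * (x + X t \<omega>))) * (\<integral>\<^sup>+\<omega>'. exp (c * X s \<omega>') \<partial>M)) \<partial>M) < \<infinity>" .
    have G: "(\<integral>\<^sup>+\<omega>'. ennreal (G n y \<omega>') \<partial>M) \<le> ennreal (exp (c * y)) * (\<integral>\<^sup>+\<omega>'. exp (c * X s \<omega>') \<partial>M)" for n y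
    proof -
      have "(\<integral>\<^sup>+\<omega>'. ennreal (G n y \<omega>') \<partial>M) \<le> (\<integral>\<^sup>+\<omega>'. ennreal (exp (c * y)) * ennreal (exp (c * X s \<omega>')) \<partial>M)"
        using bG by (intro nn_integral_mono) (auto simp: ennreal_mult[symmetric] exp_add[symmetric] distrib_left intro!: ennreal_leI)
      also have "\<dots> = ennreal (exp (c * y)) * (\<integral>\<^sup>+\<omega>'. exp (c * X s \<omega>') \<partial>M)" by (intro nn_integral_cmult) measurable
      finally show ?thesis .
    qed
    show "AE \<omega> in M. \<phi> (x + X t \<omega>) * (\<integral>\<^sup>+\<omega>'. ennreal (G n (x + X t \<omega>) \<omega>') \<partial>M) \<le> C * (ennreal (exp (c * (x + X t \<omega>))) * (\<integral>\<^sup>+\<omega>'. exp (c * X s \<omega>') \<partial>M))" for n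
      using G C(2) by (intro AE_I2 mult_mono) auto
    show "AE \<omega> in M. (\<lambda>n. \<phi> (x + X t \<omega>) * (\<integral>\<^sup>+\<omega>'. ennreal (G n (x + X t \<omega>) \<omega>') \<partial>M)) \<longlonglongrightarrow> \<phi> (x + X t \<omega>) * U k c s (x + X t \<omega>)"
      using Ulim fin by (auto intro!: AE_I2 ennreal_tendsto_cmult)
  qed measurable
  show ?thesis using L R unfolding eq by (rule LIMSEQ_unique)
qed

lemma increments_measurable:
  assumes t: "0 \<le> t" and d: "0 \<le> d"
  shows "(\<lambda>\<omega>. \<lambda>i\<in>{1..n}. X (t + real i * d) \<omega> - X (t + real (i - 1) * d) \<omega>) \<in> measurable M (PiM {1..n} (\<lambda>_. borel))"
  by (intro measurable_restrict borel_measurable_diff X_meas add_nonneg_nonneg mult_nonneg_nonneg t d) auto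

lemma markov_continuous:
  assumes t: "0 < t" and s: "0 < s" and \<phi>: "\<phi> \<in> borel_measurable borel" and C: "C < \<infinity>" "\<And>y. \<phi> y \<le> C"
    and k: "continuous_on UNIV k" and b: "\<And>x. 0 \<le> k x \<and> k x \<le> B"
  shows "(\<integral>\<^sup>+\<omega>. \<phi> (x + X t \<omega>) * ennreal (J k c s t (x + X t \<omega>) \<omega>) \<partial>M) = (\<integral>\<^sup>+\<omega>. \<phi> (x + X t \<omega>) * U k c s (x + X t \<omega>) \<partial>M)"
proof -
  have km [measurable]: "k \<in> borel_measurable borel" using k by (rule borel_measurable_continuous_onI)
  let ?v = "\<lambda>m t0 \<omega>. \<lambda>i\<in>{1..Suc m}. X (t0 + real i * (s / real (Suc m))) \<omega> - X (t0 + real (i - 1) * (s / real (Suc m))) \<omega>"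
  have path: "Psi k c (Suc m) s y (?v m t0 \<omega>) = exp (- (LBINT r:{0..s}. k (y + (Xp (t0 + real (grid (Suc m) (s / real (Suc m)) r) * (s / real (Suc m)), \<omega>) - Xp (t0, \<omega>))))
        + c * (y + (Xp (t0 + s, \<omega>) - Xp (t0, \<omega>))))" if "0 \<le> t0" for m t0 y \<omega>
    by (rule Psi_path) (use that s in auto)
  have bound: "Psi k c (Suc m) s y (?v m t0 \<omega>) \<le> exp (c * (y + (Xp (t0 + s, \<omega>) - Xp (t0, \<omega>))))" if "0 \<le> t0" for m t0 y \<omega>
    unfolding path[OF that] using b by (auto simp: set_lebesgue_integral_def intro!: integral_nonneg_AE)
  have vm: "?v m t0 \<in> measurable M (PiM {1..Suc m} (\<lambda>_. borel))" if "0 \<le> t0" for m t0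
    by (rule increments_measurable) (use that s in auto)
  show ?thesis
  proof (rule markov_limit[OF t s \<phi> C km,
      where F="\<lambda>m _ \<omega>. Psi k c (Suc m) s (x + X t \<omega>) (?v m t \<omega>)" and G="\<lambda>m y \<omega>. Psi k c (Suc m) s y (?v m 0 \<omega>)"])
    show "(\<integral>\<^sup>+\<omega>. \<phi> (x + X t \<omega>) * ennreal (Psi k c (Suc m) s (x + X t \<omega>) (?v m t \<omega>)) \<partial>M)
      = (\<integral>\<^sup>+\<omega>. \<phi> (x + X t \<omega>) * (\<integral>\<^sup>+\<omega>'. ennreal (Psi k c (Suc m) s (x + X t \<omega>) (?v m 0 \<omega>')) \<partial>M) \<partial>M)" for m
      by (rule markov_grid[OF t s _ km \<phi>]) simp
    have "(\<lambda>\<omega>. (x + X t \<omega>, ?v m t \<omega>)) \<in> measurable M (borel \<Otimes>\<^sub>M PiM {1..Suc m} (\<lambda>_. borel))" for m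
      using t by (intro measurable_Pair borel_measurable_add borel_measurable_const X_meas vm) auto
    from measurable_compose[OF this Psi_meas[OF km]]
    show "(\<lambda>\<omega>. Psi k c (Suc m) s (x + X t \<omega>) (?v m t \<omega>)) \<in> borel_measurable M" for m by simp
    have "(\<lambda>p. (fst p, ?v m 0 (snd p))) \<in> measurable (borel \<Otimes>\<^sub>M M) (borel \<Otimes>\<^sub>M PiM {1..Suc m} (\<lambda>_. borel))" for m
      by (rule measurable_Pair[OF measurable_fst measurable_compose[OF measurable_snd vm]]) simp
    from measurable_compose[OF this Psi_meas[OF km]]
    show "(\<lambda>p. Psi k c (Suc m) s (fst p) (?v m 0 (snd p))) \<in> borel_measurable (borel \<Otimes>\<^sub>M M)" for m by simp
    fix m y \<omega> assume w: "\<omega> \<in> space M"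
    show "0 \<le> Psi k c (Suc m) s (x + X t \<omega>) (?v m t \<omega>) \<and> Psi k c (Suc m) s (x + X t \<omega>) (?v m t \<omega>) \<le> exp (c * (x + X (t + s) \<omega>))"
      using bound[of t m "x + X t \<omega>" \<omega>] t s by (simp add: Xp_def path)
    show "0 \<le> Psi k c (Suc m) s y (?v m 0 \<omega>) \<and> Psi k c (Suc m) s y (?v m 0 \<omega>) \<le> exp (c * (y + X s \<omega>))"
      using bound[of 0 m y \<omega>] s w by (simp add: Xp_def path X_0)
  next
    fix \<omega> y assume w: "\<omega> \<in> space M"
    show "(\<lambda>m. Psi k c (Suc m) s (x + X t \<omega>) (?v m t \<omega>)) \<longlonglongrightarrow> J k c s t (x + X t \<omega>) \<omega>"
      unfolding path[OF less_imp_le[OF t]] by (rule Psi_lim[OF k b s _ w]) (use t in simp)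
    show "(\<lambda>m. Psi k c (Suc m) s y (?v m 0 \<omega>)) \<longlonglongrightarrow> J k c s 0 y \<omega>"
      unfolding path[OF order_refl] by (rule Psi_lim[OF k b s _ w]) simp
  qed
qed

text \<open>The rates of interest are discontinuous at the barriers, so they are approached
  pointwise by uniformly bounded continuous ones, with the same dominating functions as
  before.\<close>

lemma markov_property:
  assumes t: "0 < t" and s: "0 < s" and \<phi>: "\<phi> \<in> borel_measurable borel" and C: "C < \<infinity>" "\<And>y. \<phi> y \<le> C"
    and k: "\<And>n. continuous_on UNIV (k n)" and b: "\<And>n x. 0 \<le> k n x \<and> k n x \<le> B" and lim: "\<And>x. (\<lambda>n. k n x) \<longlonglongrightarrow> k' x"
  shows "(\<integral>\<^sup>+\<omega>. \<phi> (x + X t \<omega>) * ennreal (J k' c s t (x + X t \<omega>) \<omega>) \<partial>M) = (\<integral>\<^sup>+\<omega>. \<phi> (x + X t \<omega>) * U k' c s (x + X t \<omega>) \<partial>M)"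
proof -
  have km [measurable]: "k n \<in> borel_measurable borel" for n using k by (rule borel_measurable_continuous_onI)
  have k'm [measurable]: "k' \<in> borel_measurable borel" using km lim by (rule borel_measurable_LIMSEQ_real[rotated])
  have [measurable]: "X t \<in> borel_measurable M" using t by (intro X_meas) simp
  show ?thesis
  proof (rule markov_limit[OF t s \<phi> C k'm,
      where F="\<lambda>n _ \<omega>. J (k n) c s t (x + X t \<omega>) \<omega>" and G="\<lambda>n y \<omega>. J (k n) c s 0 y \<omega>"])
    show "(\<integral>\<^sup>+\<omega>. \<phi> (x + X t \<omega>) * ennreal (J (k n) c s t (x + X t \<omega>) \<omega>) \<partial>M)
      = (\<integral>\<^sup>+\<omega>. \<phi> (x + X t \<omega>) * (\<integral>\<^sup>+\<omega>'. ennreal (J (k n) c s 0 (x + X t \<omega>) \<omega>') \<partial>M) \<partial>M)" for n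
      using markov_continuous[OF t s \<phi> C k b] unfolding U_def .
    show "(\<lambda>\<omega>. J (k n) c s t (x + X t \<omega>) \<omega>) \<in> borel_measurable M" for n by measurable
    show "(\<lambda>p. J (k n) c s 0 (fst p) (snd p)) \<in> borel_measurable (borel \<Otimes>\<^sub>M M)" for n by measurable
    fix n y \<omega> assume w: "\<omega> \<in> space M"
    show "0 \<le> J (k n) c s t (x + X t \<omega>) \<omega> \<and> J (k n) c s t (x + X t \<omega>) \<omega> \<le> exp (c * (x + X (t + s) \<omega>))"
      using J_le[of "k n" c s t "x + X t \<omega>" \<omega>] b t s by (auto simp: Xp_def J_def)
    show "0 \<le> J (k n) c s 0 y \<omega> \<and> J (k n) c s 0 y \<omega> \<le> exp (c * (y + X s \<omega>))"
      using J_le[of "k n" c s 0 y \<omega>] b s w by (auto simp: Xp_def X_0 J_def)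
  next
    fix \<omega> y assume w: "\<omega> \<in> space M"
    show "(\<lambda>n. J (k n) c s t (x + X t \<omega>) \<omega>) \<longlonglongrightarrow> J k' c s t (x + X t \<omega>) \<omega>" by (rule J_lim[OF km k'm b lim w])
    show "(\<lambda>n. J (k n) c s 0 y \<omega>) \<longlonglongrightarrow> J k' c s 0 y \<omega>" by (rule J_lim[OF km k'm b lim w])
  qed
qed

end

end

definition occ_rate :: "real \<Rightarrow> real \<Rightarrow> real \<Rightarrow> real \<Rightarrow> real \<Rightarrow> real" where
  "occ_rate h H a b y = a * indicator {..h} y + b * indicator {H..} y"

lemma measurable_occ_rate [measurable]: "occ_rate h H a b \<in> borel_measurable borel"
  unfolding occ_rate_def[abs_def] by measurable

text \<open>Continuous ramps that equal 1 on the whole closed half line, so that the limit includes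
  the barrier itself; reflection will handle \<open>{H..}\<close>.\<close>

lemma indicator_atMost_lim: "(\<lambda>n. max 0 (min 1 (1 - real n * (y - h)))) \<longlonglongrightarrow> indicator {..h::real} y"
proof (cases "y \<le> h")
  case True
  then have "1 \<le> 1 - real n * (y - h)" for n by (simp add: mult_nonneg_nonpos)
  then have "max 0 (min 1 (1 - real n * (y - h))) = 1" for n by (simp add: min_absorb1)
  then show ?thesis using True by simp
next
  case False
  have "\<forall>\<^sub>F n in sequentially. max 0 (min 1 (1 - real n * (y - h))) = 0"
    using eventually_ge_at_top[of "nat \<lceil>1 / (y - h)\<rceil>"]
  proof eventually_elim
    case (elim n)
    then have "1 / (y - h) \<le> real n" by linarith
    then have "1 - real n * (y - h) \<le> 0" using False by (simp add: field_simps)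
    then show ?case by (simp add: max_absorb1 min.coboundedI2)
  qed
  then show ?thesis using False by (simp add: tendsto_eventually)
qed

lemma (in mejd_driven) markov_occ:
  fixes h H a b c :: real
  assumes mom: "\<And>t. 0 \<le> t \<Longrightarrow> (\<integral>\<^sup>+\<omega>. exp (c * X t \<omega>) \<partial>M) < \<infinity>" and ab: "0 \<le> a" "0 \<le> b"
    and t: "0 < t" and s: "0 < s" and \<phi>: "\<phi> \<in> borel_measurable borel" and C: "C < \<infinity>" "\<And>y. \<phi> y \<le> C"
  defines "k \<equiv> occ_rate h H a b"
  shows "(\<integral>\<^sup>+\<omega>. \<phi> (x + X t \<omega>) * ennreal (J k c s t (x + X t \<omega>) \<omega>) \<partial>M) = (\<integral>\<^sup>+\<omega>. \<phi> (x + X t \<omega>) * U k c s (x + X t \<omega>) \<partial>M)"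
proof (rule markov_property[OF mom t s \<phi> C])
  let ?k = "\<lambda>n y. a * max 0 (min 1 (1 - real n * (y - h))) + b * max 0 (min 1 (1 - real n * (- y - - H)))"
  show "continuous_on UNIV (?k n)" for n by (intro continuous_intros)
  show "0 \<le> ?k n y \<and> ?k n y \<le> a * 1 + b * 1" for n y
    using ab by (intro conjI add_mono mult_left_mono add_nonneg_nonneg mult_nonneg_nonneg) auto
  show "(\<lambda>n. ?k n y) \<longlonglongrightarrow> k y" for y
  proof -
    have "(\<lambda>n. ?k n y) \<longlonglongrightarrow> a * indicator {..h} y + b * indicator {..- H} (- y)"
      by (intro tendsto_intros indicator_atMost_lim)
    then show ?thesis by (simp add: k_def occ_rate_def indicator_def)
  qed
qed

section \<open>The resolvent equation\<close>

lemma ennreal_add_eqI: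
  "x + y = x' + y' \<Longrightarrow> 0 \<le> x \<Longrightarrow> 0 \<le> y \<Longrightarrow> 0 \<le> x' \<Longrightarrow> 0 \<le> y' \<Longrightarrow> ennreal x + ennreal y = ennreal x' + ennreal y'"
  by (simp flip: ennreal_plus)

lemma nn_set_integral_eq_ennreal:
  fixes f :: "real \<Rightarrow> real"
  assumes [measurable]: "f \<in> borel_measurable borel" and b: "\<And>t. t \<in> {0..T} \<Longrightarrow> 0 \<le> f t \<and> f t \<le> C"
  shows "(\<integral>\<^sup>+t. ennreal (f t) * indicator {0..T} t \<partial>lborel) = ennreal (LBINT t:{0..T}. f t)"
    and "set_integrable lborel {0..T} f"
proof -
  show i: "set_integrable lborel {0..T} f"
    unfolding set_integrable_def
    by (rule Bochner_Integration.integrable_bound[where f="\<lambda>t. indicator {0..T} t * C"])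
       (use b in \<open>force split: split_indicator\<close>)+
  have "(\<integral>\<^sup>+t. ennreal (f t) * indicator {0..T} t \<partial>lborel) = (\<integral>\<^sup>+t. ennreal (indicator {0..T} t *\<^sub>R f t) \<partial>lborel)"
    by (intro nn_integral_cong) (auto split: split_indicator)
  also have "\<dots> = ennreal (LBINT t:{0..T}. f t)"
    unfolding set_lebesgue_integral_def using i b
    by (intro nn_integral_eq_integral) (auto simp: set_integrable_def split: split_indicator)
  finally show "(\<integral>\<^sup>+t. ennreal (f t) * indicator {0..T} t \<partial>lborel) = ennreal (LBINT t:{0..T}. f t)" .
qed

context mejd_driven
begin

text \<open>Started from the actual position at time \<open>t\<close>, the increments add up to the
  path itself and the time shift turns the occupation integral into a tail integral.\<close>

lemma J_tail:
  assumes w: "\<omega> \<in> space M" and t: "0 \<le> t" "t \<le> T" and [measurable]: "k \<in> borel_measurable borel"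
  shows "J k c (T - t) t (x + Xp (t, \<omega>)) \<omega> = exp (- (LBINT r:{t..T}. k (x + Xp (r, \<omega>))) + c * (x + Xp (T, \<omega>)))"
proof -
  have "(LBINT r:{t..T}. k (x + Xp (r, \<omega>))) = (LBINT r. indicator {t..T} (t + 1 * r) *\<^sub>R k (x + Xp (t + 1 * r, \<omega>)))"
    unfolding set_lebesgue_integral_def by (subst lborel_integral_real_affine[where c=1 and t=t]) auto
  also have "\<dots> = (LBINT r:{0..T - t}. k (x + Xp (t, \<omega>) + (Xp (t + r, \<omega>) - Xp (t, \<omega>))))"
    unfolding set_lebesgue_integral_def by (intro Bochner_Integration.integral_cong) (auto split: split_indicator)
  finally show ?thesis by (simp add: J_def)
qed

text \<open>Pathwise perturbation formula: \<open>exp_integral_identity\<close> for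
  \<open>k - d\<close> along the path, multiplied by the terminal payoff and the discount at rate
  \<open>\<alpha> + d\<close>. The parts with \<open>k\<close> and with \<open>d\<close> stand on
  opposite sides, so that all terms are nonnegative and can be integrated without integrability
  conditions.\<close>

lemma path_identity:
  assumes w: "\<omega> \<in> space M" and T: "0 \<le> T" and km [measurable]: "k \<in> borel_measurable borel"
    and b: "\<And>x. 0 \<le> k x \<and> k x \<le> B" and q: "0 \<le> \<alpha>" "0 \<le> d"
  shows "ennreal (exp (- (\<alpha> + d) * T) * exp (c * (x + Xp (T, \<omega>))))
      + (\<integral>\<^sup>+t. ennreal (d * (exp (- (\<alpha> + d) * t) * exp (- \<alpha> * (T - t)) * J k c (T - t) t (x + Xp (t, \<omega>)) \<omega>)) * indicator {0..T} t \<partial>lborel)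
    = ennreal (exp (- \<alpha> * T) * J k c T 0 x \<omega>)
      + (\<integral>\<^sup>+t. ennreal (k (x + Xp (t, \<omega>)) * (exp (- (\<alpha> + d) * t) * exp (- \<alpha> * (T - t)) * J k c (T - t) t (x + Xp (t, \<omega>)) \<omega>)) * indicator {0..T} t \<partial>lborel)"
proof -
  have Xw [measurable]: "(\<lambda>r. Xp (r, \<omega>)) \<in> borel_measurable borel"
    using measurable_compose[OF measurable_Pair[of "\<lambda>r. r" borel borel "\<lambda>_. \<omega>" M] Xp_meas] w by simp
  have kX [measurable]: "(\<lambda>r. k (x + Xp (r, \<omega>))) \<in> borel_measurable borel"
    by (rule measurable_compose[OF _ km]) (intro borel_measurable_add borel_measurable_const Xw)
  define e where "e t = exp (- (LBINT r:{t..T}. k (x + Xp (r, \<omega>))))" for t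
  define E where "E = exp (c * (x + Xp (T, \<omega>)))"
  define D where "D t = exp (- (\<alpha> + d) * t) * exp (- \<alpha> * (T - t)) * (e t * E)" for t
  have e_meas [measurable]: "e \<in> borel_measurable borel" unfolding e_def[abs_def]
    by (rule measurable_compose[OF borel_measurable_uminus[OF measurable_tail_integral[OF kX]] borel_measurable_exp])
  have D_meas [measurable]: "D \<in> borel_measurable borel" unfolding D_def[abs_def]
    by (intro borel_measurable_times e_meas borel_measurable_const) measurable
  have e1: "e t \<le> 1" "0 \<le> e t" for t
    unfolding e_def using b by (auto simp: set_lebesgue_integral_def intro!: integral_nonneg_AE)
  have J: "J k c (T - t) t (x + Xp (t, \<omega>)) \<omega> = e t * E" if "t \<in> {0..T}" for t
    using J_tail[OF w, of t T k c x] that by (simp add: e_def E_def exp_add exp_diff exp_minus field_simps)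
  have J0: "J k c T 0 x \<omega> = e 0 * E"
    using J[of 0] T w by (simp add: Xp_def X_0)
  have D_b: "0 \<le> D t \<and> D t \<le> E" if "t \<in> {0..T}" for t
  proof -
    have "exp (- (\<alpha> + d) * t) * exp (- \<alpha> * (T - t)) \<le> 1 * 1"
    proof (rule mult_mono)
      have "0 \<le> (\<alpha> + d) * t" "0 \<le> \<alpha> * (T - t)" using that q by auto
      then show "exp (- (\<alpha> + d) * t) \<le> 1" "exp (- \<alpha> * (T - t)) \<le> 1" by (auto simp: algebra_simps)
    qed auto
    then have "exp (- (\<alpha> + d) * t) * exp (- \<alpha> * (T - t)) * (e t * E) \<le> 1 * (1 * E)"
      using e1[of t] by (intro mult_mono) (auto simp: E_def)
    then show ?thesis using e1[of t] by (simp add: D_def E_def)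
  qed
  let ?a = "\<lambda>t. k (x + Xp (t, \<omega>)) - d"
  have int: "(LBINT r:{t..T}. ?a r) = (LBINT r:{t..T}. k (x + Xp (r, \<omega>))) - d * (T - t)" if "t \<in> {0..T}" for t
  proof -
    have i1: "set_integrable lborel {t..T} (\<lambda>r. k (x + Xp (r, \<omega>)))" unfolding set_integrable_def
    proof (rule Bochner_Integration.integrable_bound[where f="\<lambda>r. indicator {t..T} r * B"])
      show "AE r in lborel. norm (indicator {t..T} r *\<^sub>R k (x + Xp (r, \<omega>))) \<le> norm (indicator {t..T} r * B)"
      proof (rule AE_I2)
        fix r show "norm (indicator {t..T} r *\<^sub>R k (x + Xp (r, \<omega>))) \<le> norm (indicator {t..T} r * B)"
          using b[of "x + Xp (r, \<omega>)"] by (auto split: split_indicator)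
      qed
      show "(\<lambda>r. indicator {t..T} r *\<^sub>R k (x + Xp (r, \<omega>))) \<in> borel_measurable lborel"
        using kX by (intro borel_measurable_scaleR borel_measurable_indicator) auto
    qed simp
    have i2: "set_integrable lborel {t..T} (\<lambda>r. d)" by (simp add: set_integrable_def)
    have "(LBINT r:{t..T}. d) = d * (T - t)" using that by (simp add: set_lebesgue_integral_def mult.commute)
    then show ?thesis using set_integral_diff(2)[OF i1 i2] by simp
  qed
  have "(LBINT t:{0..T}. ?a t * exp (- (LBINT s:{t..T}. ?a s))) = 1 - exp (- (LBINT s:{0..T}. ?a s))"
  proof (rule exp_integral_identity[OF _ _ T])
    show "\<bar>?a t\<bar> \<le> B + d" for t using b[of "x + Xp (t, \<omega>)"] q by auto
    show "?a \<in> borel_measurable borel" by (intro borel_measurable_diff kX borel_measurable_const)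
  qed
  moreover have "exp (- (LBINT s:{0..T}. ?a s)) = e 0 * exp (d * T)"
    using int[of 0] T by (simp add: e_def exp_add[symmetric])
  ultimately have "exp (- (\<alpha> + d) * T) * E * (LBINT t:{0..T}. ?a t * exp (- (LBINT s:{t..T}. ?a s)))
      = exp (- (\<alpha> + d) * T) * E - exp (- (\<alpha> + d) * T) * E * (e 0 * exp (d * T))"
    by (simp only: right_diff_distrib mult_1_right)
  also have "exp (- (\<alpha> + d) * T) * E * (e 0 * exp (d * T)) = exp (- \<alpha> * T) * (e 0 * E)"
    by (simp add: algebra_simps flip: exp_add)
  also have "exp (- (\<alpha> + d) * T) * E * (LBINT t:{0..T}. ?a t * exp (- (LBINT s:{t..T}. ?a s)))
      = (LBINT t:{0..T}. k (x + Xp (t, \<omega>)) * D t - d * D t)"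
    unfolding set_integral_mult_right[symmetric]
  proof (rule set_lebesgue_integral_cong)
    show "\<forall>t. t \<in> {0..T} \<longrightarrow> exp (- (\<alpha> + d) * T) * E * (?a t * exp (- (LBINT s:{t..T}. ?a s)))
        = k (x + Xp (t, \<omega>)) * D t - d * D t"
    proof safe
      fix t assume t: "t \<in> {0..T}"
      have "exp (- (LBINT s:{t..T}. ?a s)) = e t * exp (d * (T - t))"
        unfolding int[OF t] e_def by (simp add: exp_add[symmetric])
      \<comment> \<open>Discounting at rate \<open>\<alpha> + d\<close> up to \<open>t\<close> and
        at rate \<open>\<alpha>\<close> afterwards: the first factor will become the exponential
        time, the second the transform restarted at \<open>t\<close>.\<close>
      moreover have "exp (- (\<alpha> + d) * T) * exp (d * (T - t)) = exp (- (\<alpha> + d) * t) * exp (- \<alpha> * (T - t))"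
        by (simp add: algebra_simps flip: exp_add)
      moreover have "exp (- (\<alpha> + d) * T) * E * (?a t * (e t * exp (d * (T - t)))) = ?a t * ((exp (- (\<alpha> + d) * T) * exp (d * (T - t))) * (e t * E))"
        by (simp only: mult_ac)
      ultimately show "exp (- (\<alpha> + d) * T) * E * (?a t * exp (- (LBINT s:{t..T}. ?a s))) = k (x + Xp (t, \<omega>)) * D t - d * D t"
        by (simp only: D_def left_diff_distrib)
    qed
  qed simp
  finally have main: "(LBINT t:{0..T}. k (x + Xp (t, \<omega>)) * D t - d * D t) = exp (- (\<alpha> + d) * T) * E - exp (- \<alpha> * T) * (e 0 * E)" .
  have E0: "0 \<le> E" by (simp add: E_def)
  have bk: "0 \<le> k (x + Xp (t, \<omega>)) * D t \<and> k (x + Xp (t, \<omega>)) * D t \<le> B * E" if "t \<in> {0..T}" for t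
    using D_b[OF that] b[of "x + Xp (t, \<omega>)"] E0 by (auto intro!: mult_mono)
  have bd: "0 \<le> d * D t \<and> d * D t \<le> d * E" if "t \<in> {0..T}" for t
    using D_b[OF that] q by (auto intro!: mult_left_mono)
  have mk: "(\<lambda>t. k (x + Xp (t, \<omega>)) * D t) \<in> borel_measurable borel" "(\<lambda>t. d * D t) \<in> borel_measurable borel"
    by (intro borel_measurable_times kX D_meas borel_measurable_const)+
  note K = nn_set_integral_eq_ennreal[OF mk(1) bk]
  note Dd = nn_set_integral_eq_ennreal[OF mk(2) bd]
  have eqs: "(LBINT t:{0..T}. k (x + Xp (t, \<omega>)) * D t) - (LBINT t:{0..T}. d * D t) = exp (- (\<alpha> + d) * T) * E - exp (- \<alpha> * T) * (e 0 * E)"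
    using main set_integral_diff(2)[OF K(2) Dd(2)] by simp
  have nn: "0 \<le> (LBINT t:{0..T}. k (x + Xp (t, \<omega>)) * D t)" "0 \<le> (LBINT t:{0..T}. d * D t)"
    unfolding set_lebesgue_integral_def
    by (intro Bochner_Integration.integral_nonneg; use bk bd in \<open>force split: split_indicator\<close>)+
  have "ennreal (exp (- (\<alpha> + d) * T) * E) + (\<integral>\<^sup>+t. ennreal (d * D t) * indicator {0..T} t \<partial>lborel)
    = ennreal (exp (- \<alpha> * T) * (e 0 * E)) + (\<integral>\<^sup>+t. ennreal (k (x + Xp (t, \<omega>)) * D t) * indicator {0..T} t \<partial>lborel)"
  proof -
    have "exp (- (\<alpha> + d) * T) * E + (LBINT t:{0..T}. d * D t) = exp (- \<alpha> * T) * (e 0 * E) + (LBINT t:{0..T}. k (x + Xp (t, \<omega>)) * D t)"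
      using eqs by linarith
    moreover have "0 \<le> exp (- (\<alpha> + d) * T) * E" "0 \<le> exp (- \<alpha> * T) * (e 0 * E)" using e1(2)[of 0] E0 by auto
    ultimately have "ennreal (exp (- (\<alpha> + d) * T) * E) + ennreal (LBINT t:{0..T}. d * D t)
        = ennreal (exp (- \<alpha> * T) * (e 0 * E)) + ennreal (LBINT t:{0..T}. k (x + Xp (t, \<omega>)) * D t)"
      by (intro ennreal_add_eqI nn)
    then show ?thesis by (simp only: K(1) Dd(1))
  qed
  moreover have "(\<integral>\<^sup>+t. ennreal (f t * D t) * indicator {0..T} t \<partial>lborel)
    = (\<integral>\<^sup>+t. ennreal (f t * (exp (- (\<alpha> + d) * t) * exp (- \<alpha> * (T - t)) * J k c (T - t) t (x + Xp (t, \<omega>)) \<omega>)) * indicator {0..T} t \<partial>lborel)" for f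
    by (intro nn_integral_cong) (auto simp: J D_def split: split_indicator)
  ultimately show ?thesis by (simp add: J0 E_def)
qed

lemma pair_sigma_finite_lborel: "pair_sigma_finite lborel M"
  by (intro pair_sigma_finite.intro sigma_finite_lborel sigma_finite_measure_axioms)

lemma nn_integral_swap_M:
  assumes f: "(\<lambda>p. f (fst p) (snd p)) \<in> borel_measurable ((borel :: real measure) \<Otimes>\<^sub>M M)"
  shows "(\<integral>\<^sup>+t. \<integral>\<^sup>+\<omega>. f t \<omega> \<partial>M \<partial>lborel) = (\<integral>\<^sup>+\<omega>. \<integral>\<^sup>+t. f t \<omega> \<partial>lborel \<partial>M)"
proof -
  interpret L: pair_sigma_finite lborel M by (rule pair_sigma_finite_lborel)
  have "borel_measurable ((borel :: real measure) \<Otimes>\<^sub>M M) = (borel_measurable (lborel \<Otimes>\<^sub>M M) :: (_ \<Rightarrow> ennreal) set)"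
    by (rule measurable_cong_sets[OF sets_pair_measure_cong]) auto
  then have "(\<lambda>(t, \<omega>). f t \<omega>) \<in> borel_measurable (lborel \<Otimes>\<^sub>M M)" using f by (simp only: split_beta')
  from L.Fubini'[OF this] show ?thesis by simp
qed

lemma nn_integral_swap_lborel:
  fixes f :: "real \<Rightarrow> real \<Rightarrow> ennreal"
  assumes f: "(\<lambda>p. f (fst p) (snd p)) \<in> borel_measurable (borel \<Otimes>\<^sub>M borel)"
  shows "(\<integral>\<^sup>+t. \<integral>\<^sup>+s. f t s \<partial>lborel \<partial>lborel) = (\<integral>\<^sup>+s. \<integral>\<^sup>+t. f t s \<partial>lborel \<partial>lborel)"
proof -
  have "borel_measurable ((borel :: real measure) \<Otimes>\<^sub>M (borel :: real measure)) = (borel_measurable (lborel \<Otimes>\<^sub>M lborel) :: (_ \<Rightarrow> ennreal) set)"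
    by (rule measurable_cong_sets[OF sets_pair_measure_cong]) auto
  then have "(\<lambda>(t, s). f t s) \<in> borel_measurable (lborel \<Otimes>\<^sub>M lborel)" using f by (simp only: split_beta')
  from lborel_pair.Fubini'[OF this] show ?thesis by simp
qed

text \<open>The substitution \<open>s = T - t\<close> turns the triangle
  \<open>0 \<le> t \<le> T\<close> into a quadrant, where the time before and the time after
  \<open>t\<close> separate.\<close>

lemma tonelli_time:
  fixes h :: "real \<Rightarrow> real \<Rightarrow> 'a \<Rightarrow> ennreal"
  assumes h: "(\<lambda>z. h (fst (fst z)) (snd (fst z)) (snd z)) \<in> borel_measurable ((borel \<Otimes>\<^sub>M borel) \<Otimes>\<^sub>M M)"
  shows "(\<integral>\<^sup>+\<omega>. \<integral>\<^sup>+T. \<integral>\<^sup>+t. h t (T - t) \<omega> * indicator {0..T} t \<partial>lborel \<partial>lborel \<partial>M)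
    = (\<integral>\<^sup>+t. indicator {0..} t * (\<integral>\<^sup>+s. indicator {0..} s * (\<integral>\<^sup>+\<omega>. h t s \<omega> \<partial>M) \<partial>lborel) \<partial>lborel)"
proof -
  define g where "g t s = (\<integral>\<^sup>+\<omega>. h t s \<omega> \<partial>M)" for t s
  have gm: "(\<lambda>p. g (fst p) (snd p)) \<in> borel_measurable ((borel :: real measure) \<Otimes>\<^sub>M (borel :: real measure))"
    unfolding g_def using h by (intro borel_measurable_nn_integral) (simp only: split_beta')
  have sh: "(\<lambda>p. (fst p, snd p - fst p)) \<in> measurable ((borel :: real measure) \<Otimes>\<^sub>M (borel :: real measure)) (borel \<Otimes>\<^sub>M borel)"
    by (intro measurable_Pair borel_measurable_diff measurable_fst measurable_snd)
  have ind: "(\<lambda>p. indicator {0..snd p} (fst p) :: ennreal) \<in> borel_measurable ((borel :: real measure) \<Otimes>\<^sub>M (borel :: real measure))"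
  proof -
    have eq: "(\<lambda>p :: real \<times> real. indicator {0..snd p} (fst p) :: ennreal) = (\<lambda>p. indicator {p. 0 \<le> fst p \<and> fst p \<le> snd p} p)"
      by (auto simp: fun_eq_iff indicator_def)
    have "{p :: real \<times> real. 0 \<le> fst p \<and> fst p \<le> snd p} \<in> sets (borel \<Otimes>\<^sub>M borel)"
      unfolding borel_prod by (intro borel_closed closed_Collect_conj closed_Collect_le continuous_intros)
    then show ?thesis unfolding eq by (rule borel_measurable_indicator)
  qed
  have "(\<integral>\<^sup>+\<omega>. \<integral>\<^sup>+T. \<integral>\<^sup>+t. h t (T - t) \<omega> * indicator {0..T} t \<partial>lborel \<partial>lborel \<partial>M)
     = (\<integral>\<^sup>+T. \<integral>\<^sup>+\<omega>. \<integral>\<^sup>+t. h t (T - t) \<omega> * indicator {0..T} t \<partial>lborel \<partial>M \<partial>lborel)"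
  proof (rule nn_integral_swap_M[symmetric])
    have m: "(\<lambda>z. ((snd z, fst (fst z) - snd z), snd (fst z))) \<in> measurable (((borel :: real measure) \<Otimes>\<^sub>M M) \<Otimes>\<^sub>M (borel :: real measure)) ((borel \<Otimes>\<^sub>M borel) \<Otimes>\<^sub>M M)"
      by (intro measurable_Pair borel_measurable_diff measurable_snd measurable_compose[OF measurable_fst measurable_fst] measurable_compose[OF measurable_fst measurable_snd])
    have m': "(\<lambda>z. (snd z, fst (fst z))) \<in> measurable (((borel :: real measure) \<Otimes>\<^sub>M M) \<Otimes>\<^sub>M (borel :: real measure)) (borel \<Otimes>\<^sub>M borel)"
      by (intro measurable_Pair measurable_snd measurable_compose[OF measurable_fst measurable_fst])
    have "(\<lambda>z. h (snd z) (fst (fst z) - snd z) (snd (fst z)) * indicator {0..fst (fst z)} (snd z)) \<in> borel_measurable (((borel :: real measure) \<Otimes>\<^sub>M M) \<Otimes>\<^sub>M (borel :: real measure))"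
      using measurable_compose[OF m h] measurable_compose[OF m' ind] by (intro borel_measurable_times_ennreal) (simp_all only: fst_conv snd_conv)
    also have "borel_measurable (((borel :: real measure) \<Otimes>\<^sub>M M) \<Otimes>\<^sub>M (borel :: real measure)) = borel_measurable (((borel :: real measure) \<Otimes>\<^sub>M M) \<Otimes>\<^sub>M lborel)"
      by (rule measurable_cong_sets[OF sets_pair_measure_cong]) auto
    finally show "(\<lambda>p. \<integral>\<^sup>+t. h t (fst p - t) (snd p) * indicator {0..fst p} t \<partial>lborel) \<in> borel_measurable ((borel :: real measure) \<Otimes>\<^sub>M M)"
      by (intro lborel.borel_measurable_nn_integral) (simp only: split_beta')
  qed
  also have "\<dots> = (\<integral>\<^sup>+T. \<integral>\<^sup>+t. indicator {0..T} t * g t (T - t) \<partial>lborel \<partial>lborel)"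
  proof (rule nn_integral_cong)
    fix T :: real
    have mT: "(\<lambda>p. ((fst p, T - fst p), snd p)) \<in> measurable ((borel :: real measure) \<Otimes>\<^sub>M M) ((borel \<Otimes>\<^sub>M borel) \<Otimes>\<^sub>M M)"
      by (intro measurable_Pair borel_measurable_diff borel_measurable_const measurable_fst measurable_snd)
    have "(\<lambda>p. h (fst p) (T - fst p) (snd p)) \<in> borel_measurable ((borel :: real measure) \<Otimes>\<^sub>M M)"
      using measurable_compose[OF mT h] by (simp only: fst_conv snd_conv)
    moreover have "(\<lambda>p. indicator {0..T} (fst p) :: ennreal) \<in> borel_measurable ((borel :: real measure) \<Otimes>\<^sub>M M)"
      by (rule measurable_compose[OF measurable_fst]) simp
    ultimately have "(\<integral>\<^sup>+\<omega>. \<integral>\<^sup>+t. h t (T - t) \<omega> * indicator {0..T} t \<partial>lborel \<partial>M) = (\<integral>\<^sup>+t. \<integral>\<^sup>+\<omega>. h t (T - t) \<omega> * indicator {0..T} t \<partial>M \<partial>lborel)"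
      by (intro nn_integral_swap_M[symmetric] borel_measurable_times_ennreal)
    also have "\<dots> = (\<integral>\<^sup>+t. indicator {0..T} t * g t (T - t) \<partial>lborel)"
      unfolding g_def by (intro nn_integral_cong) (auto split: split_indicator)
    finally show "(\<integral>\<^sup>+\<omega>. \<integral>\<^sup>+t. h t (T - t) \<omega> * indicator {0..T} t \<partial>lborel \<partial>M) = (\<integral>\<^sup>+t. indicator {0..T} t * g t (T - t) \<partial>lborel)" .
  qed
  also have "\<dots> = (\<integral>\<^sup>+t. \<integral>\<^sup>+T. indicator {0..T} t * g t (T - t) \<partial>lborel \<partial>lborel)"
  proof (rule nn_integral_swap_lborel[symmetric])
    show "(\<lambda>p. indicator {0..snd p} (fst p) * g (fst p) (snd p - fst p)) \<in> borel_measurable (borel \<Otimes>\<^sub>M borel)"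
      using measurable_compose[OF sh gm] by (intro borel_measurable_times_ennreal ind) (simp only: fst_conv snd_conv)
  qed
  also have "\<dots> = (\<integral>\<^sup>+t. indicator {0..} t * (\<integral>\<^sup>+s. indicator {0..} s * g t s \<partial>lborel) \<partial>lborel)"
  proof (rule nn_integral_cong)
    fix t :: real
    have gt: "g t \<in> borel_measurable borel"
      using measurable_compose[OF measurable_Pair1'[of t borel borel] gm] by simp
    have m1: "(\<lambda>T. indicator {0..T} t * g t (T - t)) \<in> borel_measurable borel"
    proof -
      have "(\<lambda>T. indicator {0..T} t :: ennreal) \<in> borel_measurable borel"
        using measurable_compose[OF measurable_Pair1'[of t borel borel] ind] by simp
      moreover have "(\<lambda>T. T - t) \<in> borel_measurable borel" by simp
      ultimately show ?thesis using measurable_compose[of "\<lambda>T. T - t" borel borel "g t" borel] gt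
        by (intro borel_measurable_times_ennreal)
    qed
    have "(\<integral>\<^sup>+T. indicator {0..T} t * g t (T - t) \<partial>lborel) = (\<integral>\<^sup>+s. indicator {0..t + 1 * s} t * g t (t + 1 * s - t) \<partial>lborel)"
      using nn_integral_real_affine[OF m1, of 1 t] by simp
    also have "\<dots> = (\<integral>\<^sup>+s. indicator {0..} t * (indicator {0..} s * g t s) \<partial>lborel)"
      by (intro nn_integral_cong) (auto split: split_indicator)
    also have "\<dots> = indicator {0..} t * (\<integral>\<^sup>+s. indicator {0..} s * g t s \<partial>lborel)"
      using gt by (intro nn_integral_cmult borel_measurable_times_ennreal borel_measurable_indicator) auto
    finally show "(\<integral>\<^sup>+T. indicator {0..T} t * g t (T - t) \<partial>lborel) = indicator {0..} t * (\<integral>\<^sup>+s. indicator {0..} s * g t s \<partial>lborel)" .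
  qed
  finally show ?thesis by (simp only: g_def)
qed

text \<open>The transform of the theorem as an extended nonnegative integral, meaningful before its
  finiteness is known.\<close>

definition payoff_transform :: "(real \<Rightarrow> real) \<Rightarrow> real \<Rightarrow> real \<Rightarrow> real \<Rightarrow> ennreal" where
  "payoff_transform k \<alpha> c x = (\<integral>\<^sup>+T. indicator {0..} T * (ennreal (\<alpha> * exp (- \<alpha> * T)) * U k c T x) \<partial>lborel)"

lemma payoff_transform_meas:
  assumes k: "k \<in> borel_measurable borel"
  shows "payoff_transform k \<alpha> c \<in> borel_measurable borel"
proof -
  have "(\<lambda>p. U k c (snd p) (fst p)) \<in> borel_measurable ((borel :: real measure) \<Otimes>\<^sub>M lborel)"
    using k by measurable
  then have "(\<lambda>(x, T). indicator {0..} T * (ennreal (\<alpha> * exp (- \<alpha> * T)) * U k c T x)) \<in> borel_measurable ((borel :: real measure) \<Otimes>\<^sub>M lborel)"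
    unfolding split_beta' by (intro borel_measurable_times_ennreal) (measurable; simp)+
  then show ?thesis unfolding payoff_transform_def[abs_def] by (rule lborel.borel_measurable_nn_integral)
qed

text \<open>With the Markov property the double time integral becomes an integral against the law of the
  process at an exponential time.\<close>

lemma time_integral:
  assumes a: "0 < \<alpha>" and d: "0 \<le> d" and km [measurable]: "k \<in> borel_measurable borel" and \<phi>: "\<phi> \<in> borel_measurable borel"
    and markov: "\<And>t s. 0 < t \<Longrightarrow> 0 < s \<Longrightarrow>
      (\<integral>\<^sup>+\<omega>. \<phi> (x + X t \<omega>) * ennreal (J k c s t (x + X t \<omega>) \<omega>) \<partial>M) = (\<integral>\<^sup>+\<omega>. \<phi> (x + X t \<omega>) * U k c s (x + X t \<omega>) \<partial>M)"
  defines "h \<equiv> \<lambda>t s \<omega>. ennreal (exp (- (\<alpha> + d) * t)) * (ennreal (exp (- \<alpha> * s)) * (\<phi> (x + Xp (t, \<omega>)) * ennreal (J k c s t (x + Xp (t, \<omega>)) \<omega>)))"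
  shows "ennreal (\<alpha> * (\<alpha> + d)) * (\<integral>\<^sup>+\<omega>. \<integral>\<^sup>+T. \<integral>\<^sup>+t. h t (T - t) \<omega> * indicator {0..T} t \<partial>lborel \<partial>lborel \<partial>M)
    = (\<integral>\<^sup>+y. \<phi> (x + y) * payoff_transform k \<alpha> c (x + y) \<partial>exp_time_law (\<alpha> + d))"
proof -
  have q: "0 < \<alpha> + d" using a d by simp
  let ?L = "((borel :: real measure) \<Otimes>\<^sub>M (borel :: real measure)) \<Otimes>\<^sub>M M"
  have t: "(\<lambda>z. fst (fst z)) \<in> borel_measurable ?L" and s: "(\<lambda>z. snd (fst z)) \<in> borel_measurable ?L"
    by (auto intro!: measurable_compose[OF measurable_fst])
  have X: "(\<lambda>z. x + Xp (fst (fst z), snd z)) \<in> borel_measurable ?L"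
    by (intro borel_measurable_add borel_measurable_const measurable_compose[OF measurable_Pair[OF t measurable_snd] Xp_meas])
  have JJ: "(\<lambda>z. J k c (snd (fst z)) (fst (fst z)) (x + Xp (fst (fst z), snd z)) (snd z)) \<in> borel_measurable ?L"
    by (rule J_meas[OF km s t X measurable_snd])
  have et: "(\<lambda>z. exp (- (\<alpha> + d) * fst (fst z))) \<in> borel_measurable ?L" "(\<lambda>z. exp (- \<alpha> * snd (fst z))) \<in> borel_measurable ?L"
    by (rule measurable_compose[OF t], simp, rule measurable_compose[OF s], simp)
  have h: "(\<lambda>z. h (fst (fst z)) (snd (fst z)) (snd z)) \<in> borel_measurable ?L"
    unfolding h_def by (intro borel_measurable_times_ennreal measurable_compose[OF et(1) measurable_ennreal]
      measurable_compose[OF et(2) measurable_ennreal] measurable_compose[OF JJ measurable_ennreal] measurable_compose[OF X \<phi>])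
  have Um: "(\<lambda>p. U k c (snd p) (fst p)) \<in> borel_measurable ((borel :: real measure) \<Otimes>\<^sub>M (borel :: real measure))"
    by measurable
  have Xt: "X t \<in> borel_measurable M" if "0 < t" for t using that by (intro X_meas) simp
  have inner: "ennreal \<alpha> * (\<integral>\<^sup>+s. indicator {0..} s * (\<integral>\<^sup>+\<omega>. h t s \<omega> \<partial>M) \<partial>lborel)
      = ennreal (exp (- (\<alpha> + d) * t)) * (\<integral>\<^sup>+\<omega>. \<phi> (x + X t \<omega>) * payoff_transform k \<alpha> c (x + X t \<omega>) \<partial>M)" if t: "0 < t" for t
  proof -
    let ?e = "ennreal (exp (- (\<alpha> + d) * t))"
    note Xt = Xt[OF t]
    have xX: "(\<lambda>\<omega>. x + X t \<omega>) \<in> borel_measurable M" using Xt by simp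
    have UX: "(\<lambda>\<omega>. U k c s (x + X t \<omega>)) \<in> borel_measurable M" for s
      by (rule U_meas[OF km _ xX]) simp
    have hs: "(\<integral>\<^sup>+\<omega>. h t s \<omega> \<partial>M) = ?e * (\<integral>\<^sup>+\<omega>. ennreal (exp (- \<alpha> * s)) * (\<phi> (x + X t \<omega>) * U k c s (x + X t \<omega>)) \<partial>M)" if s: "0 < s" for s
    proof -
      have Xp: "Xp (t, \<omega>) = X t \<omega>" for \<omega> using t by (simp add: Xp_def)
      have m1: "(\<lambda>\<omega>. \<phi> (x + X t \<omega>) * ennreal (J k c s t (x + X t \<omega>) \<omega>)) \<in> borel_measurable M"
        by (intro borel_measurable_times_ennreal measurable_compose[OF xX \<phi>] measurable_compose[OF J_meas[OF km _ _ xX] measurable_ennreal]) auto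
      have "(\<integral>\<^sup>+\<omega>. h t s \<omega> \<partial>M) = ?e * (ennreal (exp (- \<alpha> * s)) * (\<integral>\<^sup>+\<omega>. \<phi> (x + X t \<omega>) * ennreal (J k c s t (x + X t \<omega>) \<omega>) \<partial>M))"
        unfolding h_def Xp using m1 by (simp only: nn_integral_cmult borel_measurable_times_ennreal borel_measurable_const)
      also have "\<dots> = ?e * (\<integral>\<^sup>+\<omega>. ennreal (exp (- \<alpha> * s)) * (\<phi> (x + X t \<omega>) * U k c s (x + X t \<omega>)) \<partial>M)"
        unfolding markov[OF t s]
        by (subst nn_integral_cmult[OF borel_measurable_times_ennreal[OF measurable_compose[OF xX \<phi>] UX]]) simp
      finally show ?thesis .
    qed
    have UXm: "(\<lambda>p. U k c (fst p) (x + X t (snd p))) \<in> borel_measurable ((borel :: real measure) \<Otimes>\<^sub>M M)"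
      by (rule U_meas[OF km measurable_fst measurable_compose[OF measurable_snd xX]])
    have em: "(\<lambda>p. ennreal (\<alpha> * exp (- \<alpha> * fst p))) \<in> borel_measurable ((borel :: real measure) \<Otimes>\<^sub>M M)"
      by (rule measurable_compose[OF measurable_fst]) simp
    have im: "(\<lambda>p. indicator {0..} (fst p) :: ennreal) \<in> borel_measurable ((borel :: real measure) \<Otimes>\<^sub>M M)"
      by (rule measurable_compose[OF measurable_fst]) simp
    have \<phi>m: "(\<lambda>p. \<phi> (x + X t (snd p))) \<in> borel_measurable ((borel :: real measure) \<Otimes>\<^sub>M M)"
      by (rule measurable_compose[OF measurable_snd measurable_compose[OF xX \<phi>]])
    have am: "(\<lambda>s. indicator {0..} s * (\<integral>\<^sup>+\<omega>. h t s \<omega> \<partial>M)) \<in> borel_measurable borel"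
    proof -
      have "(\<lambda>p. ((t, fst p), snd p)) \<in> measurable ((borel :: real measure) \<Otimes>\<^sub>M M) ?L"
        by (intro measurable_Pair borel_measurable_const measurable_fst measurable_snd)
      from measurable_compose[OF this h] have "(\<lambda>(s, \<omega>). h t s \<omega>) \<in> borel_measurable ((borel :: real measure) \<Otimes>\<^sub>M M)"
        by (simp only: split_beta' fst_conv snd_conv)
      then show ?thesis by (intro borel_measurable_times_ennreal borel_measurable_nn_integral) simp
    qed
    have "ennreal \<alpha> * (\<integral>\<^sup>+s. indicator {0..} s * (\<integral>\<^sup>+\<omega>. h t s \<omega> \<partial>M) \<partial>lborel)
      = (\<integral>\<^sup>+s. ennreal \<alpha> * (indicator {0..} s * (\<integral>\<^sup>+\<omega>. h t s \<omega> \<partial>M)) \<partial>lborel)"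
      using am by (intro nn_integral_cmult[symmetric]) simp
    also have "\<dots> = (\<integral>\<^sup>+s. ?e * (\<integral>\<^sup>+\<omega>. \<phi> (x + X t \<omega>) * (indicator {0..} s * (ennreal (\<alpha> * exp (- \<alpha> * s)) * U k c s (x + X t \<omega>))) \<partial>M) \<partial>lborel)"
    proof (rule nn_integral_cong_AE)
      \<comment> \<open>The Markov identity is available for positive times only; time 0 is a null
        set.\<close>
      show "AE s in lborel. ennreal \<alpha> * (indicator {0..} s * (\<integral>\<^sup>+\<omega>. h t s \<omega> \<partial>M))
        = ?e * (\<integral>\<^sup>+\<omega>. \<phi> (x + X t \<omega>) * (indicator {0..} s * (ennreal (\<alpha> * exp (- \<alpha> * s)) * U k c s (x + X t \<omega>))) \<partial>M)"
        using AE_lborel_singleton[of 0]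
      proof eventually_elim
        case (elim s)
        show ?case
        proof (cases "0 < s")
          case True
          have "ennreal \<alpha> * (\<integral>\<^sup>+\<omega>. ennreal (exp (- \<alpha> * s)) * (\<phi> (x + X t \<omega>) * U k c s (x + X t \<omega>)) \<partial>M)
            = (\<integral>\<^sup>+\<omega>. ennreal \<alpha> * (ennreal (exp (- \<alpha> * s)) * (\<phi> (x + X t \<omega>) * U k c s (x + X t \<omega>))) \<partial>M)"
            by (intro nn_integral_cmult[symmetric] borel_measurable_times_ennreal borel_measurable_const measurable_compose[OF xX \<phi>] UX)
          also have "\<dots> = (\<integral>\<^sup>+\<omega>. \<phi> (x + X t \<omega>) * (ennreal (\<alpha> * exp (- \<alpha> * s)) * U k c s (x + X t \<omega>)) \<partial>M)"
            using a by (intro nn_integral_cong) (simp add: ennreal_mult mult_ac)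
          finally have I: "ennreal \<alpha> * (\<integral>\<^sup>+\<omega>. ennreal (exp (- \<alpha> * s)) * (\<phi> (x + X t \<omega>) * U k c s (x + X t \<omega>)) \<partial>M)
            = (\<integral>\<^sup>+\<omega>. \<phi> (x + X t \<omega>) * (ennreal (\<alpha> * exp (- \<alpha> * s)) * U k c s (x + X t \<omega>)) \<partial>M)" .
          have i1: "indicator {0..} s = (1 :: ennreal)" using True by simp
          show ?thesis unfolding i1 mult_1 hs[OF True] by (subst mult.left_commute) (simp only: I)
        qed (use elim in auto)
      qed
    qed
    also have "\<dots> = ?e * (\<integral>\<^sup>+s. \<integral>\<^sup>+\<omega>. \<phi> (x + X t \<omega>) * (indicator {0..} s * (ennreal (\<alpha> * exp (- \<alpha> * s)) * U k c s (x + X t \<omega>))) \<partial>M \<partial>lborel)"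
    proof (rule nn_integral_cmult)
      have "(\<lambda>(s, \<omega>). \<phi> (x + X t \<omega>) * (indicator {0..} s * (ennreal (\<alpha> * exp (- \<alpha> * s)) * U k c s (x + X t \<omega>)))) \<in> borel_measurable ((borel :: real measure) \<Otimes>\<^sub>M M)"
        unfolding split_beta' by (intro borel_measurable_times_ennreal \<phi>m im em UXm)
      from borel_measurable_nn_integral[OF this]
      show "(\<lambda>s. \<integral>\<^sup>+\<omega>. \<phi> (x + X t \<omega>) * (indicator {0..} s * (ennreal (\<alpha> * exp (- \<alpha> * s)) * U k c s (x + X t \<omega>))) \<partial>M) \<in> borel_measurable lborel" by simp
    qed
    also have "(\<integral>\<^sup>+s. \<integral>\<^sup>+\<omega>. \<phi> (x + X t \<omega>) * (indicator {0..} s * (ennreal (\<alpha> * exp (- \<alpha> * s)) * U k c s (x + X t \<omega>))) \<partial>M \<partial>lborel)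
      = (\<integral>\<^sup>+\<omega>. \<integral>\<^sup>+s. \<phi> (x + X t \<omega>) * (indicator {0..} s * (ennreal (\<alpha> * exp (- \<alpha> * s)) * U k c s (x + X t \<omega>))) \<partial>lborel \<partial>M)"
      by (intro nn_integral_swap_M borel_measurable_times_ennreal \<phi>m im em UXm)
    also have "\<dots> = (\<integral>\<^sup>+\<omega>. \<phi> (x + X t \<omega>) * payoff_transform k \<alpha> c (x + X t \<omega>) \<partial>M)"
    proof (rule nn_integral_cong)
      fix \<omega> assume "\<omega> \<in> space M"
      have "(\<lambda>s. U k c s (x + X t \<omega>)) \<in> borel_measurable borel" by (rule U_meas[OF km]) auto
      then show "(\<integral>\<^sup>+s. \<phi> (x + X t \<omega>) * (indicator {0..} s * (ennreal (\<alpha> * exp (- \<alpha> * s)) * U k c s (x + X t \<omega>))) \<partial>lborel) = \<phi> (x + X t \<omega>) * payoff_transform k \<alpha> c (x + X t \<omega>)"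
        unfolding payoff_transform_def by (intro nn_integral_cmult) simp
    qed
    finally show ?thesis .
  qed
  have tm: "(\<lambda>t. indicator {0..} t * (\<integral>\<^sup>+s. indicator {0..} s * (\<integral>\<^sup>+\<omega>. h t s \<omega> \<partial>M) \<partial>lborel)) \<in> borel_measurable lborel"
  proof -
    have "(\<lambda>p. \<integral>\<^sup>+\<omega>. h (fst p) (snd p) \<omega> \<partial>M) \<in> borel_measurable ((borel :: real measure) \<Otimes>\<^sub>M (borel :: real measure))"
      using h by (intro borel_measurable_nn_integral) (simp only: split_beta')
    moreover have "(\<lambda>p. indicator {0..} (snd p) :: ennreal) \<in> borel_measurable ((borel :: real measure) \<Otimes>\<^sub>M (borel :: real measure))"
      by (rule measurable_compose[OF measurable_snd]) simp
    ultimately have "(\<lambda>p. indicator {0..} (snd p) * (\<integral>\<^sup>+\<omega>. h (fst p) (snd p) \<omega> \<partial>M)) \<in> borel_measurable ((borel :: real measure) \<Otimes>\<^sub>M (borel :: real measure))"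
      by (intro borel_measurable_times_ennreal)
    also have "borel_measurable ((borel :: real measure) \<Otimes>\<^sub>M (borel :: real measure)) = borel_measurable ((borel :: real measure) \<Otimes>\<^sub>M lborel)"
      by (rule measurable_cong_sets[OF sets_pair_measure_cong]) auto
    finally have "(\<lambda>t. \<integral>\<^sup>+s. indicator {0..} s * (\<integral>\<^sup>+\<omega>. h t s \<omega> \<partial>M) \<partial>lborel) \<in> borel_measurable borel"
      by (intro lborel.borel_measurable_nn_integral) (simp only: split_beta')
    then show ?thesis by (intro borel_measurable_times_ennreal) auto
  qed
  have "ennreal (\<alpha> * (\<alpha> + d)) * (\<integral>\<^sup>+\<omega>. \<integral>\<^sup>+T. \<integral>\<^sup>+t. h t (T - t) \<omega> * indicator {0..T} t \<partial>lborel \<partial>lborel \<partial>M)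
    = (\<integral>\<^sup>+t. ennreal (\<alpha> * (\<alpha> + d)) * (indicator {0..} t * (\<integral>\<^sup>+s. indicator {0..} s * (\<integral>\<^sup>+\<omega>. h t s \<omega> \<partial>M) \<partial>lborel)) \<partial>lborel)"
    unfolding tonelli_time[OF h] by (rule nn_integral_cmult[symmetric, OF tm])
  also have "\<dots> = (\<integral>\<^sup>+t. ennreal ((\<alpha> + d) * exp (- (\<alpha> + d) * t)) * indicator {0..} t * (\<integral>\<^sup>+\<omega>. \<phi> (x + X t \<omega>) * payoff_transform k \<alpha> c (x + X t \<omega>) \<partial>M) \<partial>lborel)"
  proof (rule nn_integral_cong_AE)
    show "AE t in lborel. ennreal (\<alpha> * (\<alpha> + d)) * (indicator {0..} t * (\<integral>\<^sup>+s. indicator {0..} s * (\<integral>\<^sup>+\<omega>. h t s \<omega> \<partial>M) \<partial>lborel))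
      = ennreal ((\<alpha> + d) * exp (- (\<alpha> + d) * t)) * indicator {0..} t * (\<integral>\<^sup>+\<omega>. \<phi> (x + X t \<omega>) * payoff_transform k \<alpha> c (x + X t \<omega>) \<partial>M)"
      using AE_lborel_singleton[of 0]
    proof eventually_elim
      case (elim t)
      show ?case
      proof (cases "0 < t")
        case True
        have "ennreal (\<alpha> * (\<alpha> + d)) * (indicator {0..} t * (\<integral>\<^sup>+s. indicator {0..} s * (\<integral>\<^sup>+\<omega>. h t s \<omega> \<partial>M) \<partial>lborel))
          = ennreal (\<alpha> + d) * (ennreal \<alpha> * (\<integral>\<^sup>+s. indicator {0..} s * (\<integral>\<^sup>+\<omega>. h t s \<omega> \<partial>M) \<partial>lborel))"
          using a q True by (simp add: ennreal_mult mult_ac)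
        also have "\<dots> = ennreal ((\<alpha> + d) * exp (- (\<alpha> + d) * t)) * indicator {0..} t * (\<integral>\<^sup>+\<omega>. \<phi> (x + X t \<omega>) * payoff_transform k \<alpha> c (x + X t \<omega>) \<partial>M)"
          unfolding inner[OF True] using q True by (simp add: ennreal_mult mult_ac)
        finally show ?thesis .
      qed (use elim in auto)
    qed
  qed
  also have "\<dots> = (\<integral>\<^sup>+y. \<phi> (x + y) * payoff_transform k \<alpha> c (x + y) \<partial>exp_time_law (\<alpha> + d))"
  proof (rule nn_integral_exp_time_law[OF q, symmetric])
    have add: "(\<lambda>y. x + y) \<in> borel_measurable borel" by simp
    show "(\<lambda>y. \<phi> (x + y) * payoff_transform k \<alpha> c (x + y)) \<in> borel_measurable borel"
      using measurable_compose[OF add \<phi>] measurable_compose[OF add payoff_transform_meas[OF km]] by (intro borel_measurable_times_ennreal)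
  qed
  finally show ?thesis .
qed

end

text \<open>\<open>path_identity\<close> averaged over sample points and integrated over
  \<open>T\<close>. The factor \<open>\<alpha> * (\<alpha> + d)\<close> normalises both exponential
  densities at once: terms in one time become an expectation at an exponential time or the transform
  itself, and the terms in two times are \<open>time_integral\<close> with weights \<open>k\<close>
  and \<open>d\<close>.\<close>

lemma (in mejd_driven) resolvent_nn:
  fixes h H a b c \<alpha> d x :: real
  assumes mom: "\<And>t. 0 \<le> t \<Longrightarrow> (\<integral>\<^sup>+\<omega>. exp (c * X t \<omega>) \<partial>M) < \<infinity>" and ab: "0 \<le> a" "0 \<le> b"
    and al: "0 < \<alpha>" and d: "0 \<le> d"
  defines "k \<equiv> occ_rate h H a b"
  shows "ennreal (\<alpha> + d) * payoff_transform k \<alpha> c x + (\<integral>\<^sup>+y. ennreal (k (x + y)) * payoff_transform k \<alpha> c (x + y) \<partial>exp_time_law (\<alpha> + d))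
    = ennreal \<alpha> * (\<integral>\<^sup>+y. ennreal (exp (c * (x + y))) \<partial>exp_time_law (\<alpha> + d)) + (\<integral>\<^sup>+y. ennreal d * payoff_transform k \<alpha> c (x + y) \<partial>exp_time_law (\<alpha> + d))"
proof -
  let ?q = "\<alpha> + d"
  have q: "0 < ?q" using al d by simp
  have km: "k \<in> borel_measurable borel" unfolding k_def by measurable
  have kb: "0 \<le> k y \<and> k y \<le> a + b" for y
    using ab by (auto simp: k_def occ_rate_def indicator_def)
  define G where "G f t s \<omega> = ennreal (exp (- ?q * t)) * (ennreal (exp (- \<alpha> * s)) * (ennreal (f (x + Xp (t, \<omega>))) * ennreal (J k c s t (x + Xp (t, \<omega>)) \<omega>)))"
    for f :: "real \<Rightarrow> real" and t s \<omega>
  have G_eq: "ennreal (f (x + Xp (t, \<omega>)) * (exp (- ?q * t) * exp (- \<alpha> * (T - t)) * J k c (T - t) t (x + Xp (t, \<omega>)) \<omega>)) = G f t (T - t) \<omega>"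
    if "\<And>y. 0 \<le> f y" for f t T \<omega>
    using that by (simp add: G_def ennreal_mult J_def mult_ac)
  have Gint: "ennreal (\<alpha> * ?q) * (\<integral>\<^sup>+\<omega>. \<integral>\<^sup>+T. \<integral>\<^sup>+t. G f t (T - t) \<omega> * indicator {0..T} t \<partial>lborel \<partial>lborel \<partial>M)
      = (\<integral>\<^sup>+y. ennreal (f (x + y)) * payoff_transform k \<alpha> c (x + y) \<partial>exp_time_law ?q)"
    if f: "f \<in> borel_measurable borel" "\<And>y. f y \<le> B" for f B
    unfolding G_def
  proof (rule time_integral[OF al d km, of "\<lambda>y. ennreal (f y)"])
    fix t s :: real assume ts: "0 < t" "0 < s"
    show "(\<integral>\<^sup>+\<omega>. ennreal (f (x + X t \<omega>)) * ennreal (J k c s t (x + X t \<omega>) \<omega>) \<partial>M) = (\<integral>\<^sup>+\<omega>. ennreal (f (x + X t \<omega>)) * U k c s (x + X t \<omega>) \<partial>M)"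
      unfolding k_def by (rule markov_occ[OF mom ab ts, where C="ennreal B" and \<phi>="\<lambda>y. ennreal (f y)"]) (use f in \<open>auto intro!: ennreal_leI\<close>)
  qed (use f in simp)
  define A where "A T \<omega> = ennreal (exp (- ?q * T) * exp (c * (x + Xp (T, \<omega>))))" for T \<omega>
  define C where "C T \<omega> = ennreal (exp (- \<alpha> * T) * J k c T 0 x \<omega>)" for T \<omega>
  define I where "I f T \<omega> = (\<integral>\<^sup>+t. G f t (T - t) \<omega> * indicator {0..T} t \<partial>lborel)" for f T \<omega>
  have path: "indicator {0..} T * A T \<omega> + I (\<lambda>_. d) T \<omega> = indicator {0..} T * C T \<omega> + I k T \<omega>" if w: "\<omega> \<in> space M" for T \<omega>
  proof (cases "0 \<le> T")
    case True
    have "A T \<omega> + I (\<lambda>_. d) T \<omega> = C T \<omega> + I k T \<omega>"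
      using path_identity[OF w True km kb less_imp_le[OF al] d, of c x]
      unfolding A_def C_def I_def G_eq[of "\<lambda>_. d", OF d] G_eq[of k, OF conjunct1[OF kb]] .
    then show ?thesis using True by simp
  next
    case False
    then show ?thesis by (simp add: I_def)
  qed
  have LM: "borel_measurable ((borel :: real measure) \<Otimes>\<^sub>M M) = (borel_measurable (lborel \<Otimes>\<^sub>M M) :: (_ \<Rightarrow> ennreal) set)"
    by (rule measurable_cong_sets[OF sets_pair_measure_cong]) auto
  let ?B = "(borel :: real measure) \<Otimes>\<^sub>M M"
  have ind: "(\<lambda>p. indicator {0..} (fst p) :: ennreal) \<in> borel_measurable ?B"
    by (rule measurable_compose[OF measurable_fst]) simp
  have XpB: "(\<lambda>p. Xp (fst p, snd p)) \<in> borel_measurable ?B" by simp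
  have Am: "(\<lambda>p. indicator {0..} (fst p) * A (fst p) (snd p)) \<in> borel_measurable ?B"
  proof -
    have "(\<lambda>p. exp (- ?q * fst p)) \<in> borel_measurable ?B" by (rule measurable_compose[OF measurable_fst]) simp
    moreover have "(\<lambda>p. exp (c * (x + Xp (fst p, snd p)))) \<in> borel_measurable ?B"
      by (rule measurable_compose[OF XpB, of "\<lambda>y. exp (c * (x + y))"]) simp
    ultimately show ?thesis unfolding A_def
      by (intro borel_measurable_times_ennreal ind measurable_compose[OF borel_measurable_times measurable_ennreal])
  qed
  have Cm: "(\<lambda>p. indicator {0..} (fst p) * C (fst p) (snd p)) \<in> borel_measurable ?B"
  proof -
    have "(\<lambda>p. exp (- \<alpha> * fst p)) \<in> borel_measurable ?B" by (rule measurable_compose[OF measurable_fst]) simp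
    moreover have "(\<lambda>p. J k c (fst p) 0 x (snd p)) \<in> borel_measurable ?B"
      by (rule J_meas[OF km]) auto
    ultimately show ?thesis unfolding C_def
      by (intro borel_measurable_times_ennreal ind measurable_compose[OF borel_measurable_times measurable_ennreal])
  qed
  have Im: "(\<lambda>p. I f (fst p) (snd p)) \<in> borel_measurable ?B" if f: "f \<in> borel_measurable borel" for f
  proof -
    let ?L = "?B \<Otimes>\<^sub>M (borel :: real measure)"
    have T: "(\<lambda>z. fst (fst z)) \<in> borel_measurable ?L" and w: "(\<lambda>z. snd (fst z)) \<in> measurable ?L M" and t: "(\<lambda>z. snd z) \<in> borel_measurable ?L"
      by (auto intro!: measurable_compose[OF measurable_fst])
    have X: "(\<lambda>z. x + Xp (snd z, snd (fst z))) \<in> borel_measurable ?L"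
      by (intro borel_measurable_add borel_measurable_const measurable_compose[OF measurable_Pair[OF t w] Xp_meas])
    have s: "(\<lambda>z. fst (fst z) - snd z) \<in> borel_measurable ?L" by (intro borel_measurable_diff T t)
    have J: "(\<lambda>z. J k c (fst (fst z) - snd z) (snd z) (x + Xp (snd z, snd (fst z))) (snd (fst z))) \<in> borel_measurable ?L"
      by (rule J_meas[OF km s t X w])
    have e: "(\<lambda>z. exp (- ?q * snd z)) \<in> borel_measurable ?L" "(\<lambda>z. exp (- \<alpha> * (fst (fst z) - snd z))) \<in> borel_measurable ?L"
      by (rule measurable_compose[OF t], simp, rule measurable_compose[OF s], simp)
    have i: "(\<lambda>z. indicator {0..fst (fst z)} (snd z) :: ennreal) \<in> borel_measurable ?L"
    proof -
      have "{z \<in> space ?L. 0 \<le> snd z \<and> snd z \<le> fst (fst z)} \<in> sets ?L"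
        by (intro sets.sets_Collect_conj borel_measurable_le borel_measurable_const t T)
      then have "(\<lambda>z. indicator {z \<in> space ?L. 0 \<le> snd z \<and> snd z \<le> fst (fst z)} z :: ennreal) \<in> borel_measurable ?L"
        by (rule borel_measurable_indicator)
      then show ?thesis by (subst measurable_cong[where g="\<lambda>z. indicator {z \<in> space ?L. 0 \<le> snd z \<and> snd z \<le> fst (fst z)} z"]) (auto simp: indicator_def)
    qed
    have "(\<lambda>z. G f (snd z) (fst (fst z) - snd z) (snd (fst z)) * indicator {0..fst (fst z)} (snd z)) \<in> borel_measurable ?L"
      unfolding G_def
      by (intro borel_measurable_times_ennreal i measurable_compose[OF e(1) measurable_ennreal] measurable_compose[OF e(2) measurable_ennreal]
        measurable_compose[OF J measurable_ennreal] measurable_compose[OF measurable_compose[OF X f] measurable_ennreal])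
    also have "borel_measurable ?L = borel_measurable (?B \<Otimes>\<^sub>M lborel)"
      by (rule measurable_cong_sets[OF sets_pair_measure_cong]) auto
    finally show ?thesis unfolding I_def by (intro lborel.borel_measurable_nn_integral) (simp only: split_beta')
  qed
  have slice: "(\<lambda>T. f T \<omega>) \<in> borel_measurable lborel" and outer: "(\<lambda>\<omega>. \<integral>\<^sup>+T. f T \<omega> \<partial>lborel) \<in> borel_measurable M"
    if "(\<lambda>p. f (fst p) (snd p)) \<in> borel_measurable ?B" "\<omega> \<in> space M" for f :: "real \<Rightarrow> 'a \<Rightarrow> ennreal" and \<omega>
  proof -
    have "(\<lambda>T. (T, \<omega>)) \<in> measurable (borel :: real measure) ?B" using that(2) by (intro measurable_Pair) auto
    from measurable_compose[OF this that(1)] show "(\<lambda>T. f T \<omega>) \<in> borel_measurable lborel" by simp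
    have "(\<lambda>p. (snd p, fst p)) \<in> measurable (M \<Otimes>\<^sub>M (borel :: real measure)) ?B"
      by (intro measurable_Pair measurable_fst measurable_snd)
    from measurable_compose[OF this that(1)] have "(\<lambda>(\<omega>, T). f T \<omega>) \<in> borel_measurable (M \<Otimes>\<^sub>M (borel :: real measure))"
      by (simp only: split_beta' fst_conv snd_conv)
    also have "borel_measurable (M \<Otimes>\<^sub>M (borel :: real measure)) = borel_measurable (M \<Otimes>\<^sub>M lborel)"
      by (rule measurable_cong_sets[OF sets_pair_measure_cong]) auto
    finally show "(\<lambda>\<omega>. \<integral>\<^sup>+T. f T \<omega> \<partial>lborel) \<in> borel_measurable M" by (rule lborel.borel_measurable_nn_integral)
  qed
  have add: "(\<integral>\<^sup>+\<omega>. \<integral>\<^sup>+T. f T \<omega> + g T \<omega> \<partial>lborel \<partial>M) = (\<integral>\<^sup>+\<omega>. \<integral>\<^sup>+T. f T \<omega> \<partial>lborel \<partial>M) + (\<integral>\<^sup>+\<omega>. \<integral>\<^sup>+T. g T \<omega> \<partial>lborel \<partial>M)"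
    if "(\<lambda>p. f (fst p) (snd p)) \<in> borel_measurable ?B" "(\<lambda>p. g (fst p) (snd p)) \<in> borel_measurable ?B" for f g :: "real \<Rightarrow> 'a \<Rightarrow> ennreal"
  proof -
    obtain \<omega>0 where "\<omega>0 \<in> space M" using not_empty by blast
    then have "(\<integral>\<^sup>+\<omega>. (\<integral>\<^sup>+T. f T \<omega> \<partial>lborel) + (\<integral>\<^sup>+T. g T \<omega> \<partial>lborel) \<partial>M) = (\<integral>\<^sup>+\<omega>. \<integral>\<^sup>+T. f T \<omega> \<partial>lborel \<partial>M) + (\<integral>\<^sup>+\<omega>. \<integral>\<^sup>+T. g T \<omega> \<partial>lborel \<partial>M)"
      by (intro nn_integral_add outer that)
    moreover have "(\<integral>\<^sup>+\<omega>. \<integral>\<^sup>+T. f T \<omega> + g T \<omega> \<partial>lborel \<partial>M) = (\<integral>\<^sup>+\<omega>. (\<integral>\<^sup>+T. f T \<omega> \<partial>lborel) + (\<integral>\<^sup>+T. g T \<omega> \<partial>lborel) \<partial>M)"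
      by (intro nn_integral_cong nn_integral_add slice that)
    ultimately show ?thesis by simp
  qed
  have "(\<integral>\<^sup>+\<omega>. \<integral>\<^sup>+T. indicator {0..} T * A T \<omega> + I (\<lambda>_. d) T \<omega> \<partial>lborel \<partial>M) = (\<integral>\<^sup>+\<omega>. \<integral>\<^sup>+T. indicator {0..} T * C T \<omega> + I k T \<omega> \<partial>lborel \<partial>M)"
    by (intro nn_integral_cong path)
  then have main: "(\<integral>\<^sup>+\<omega>. \<integral>\<^sup>+T. indicator {0..} T * A T \<omega> \<partial>lborel \<partial>M) + (\<integral>\<^sup>+\<omega>. \<integral>\<^sup>+T. I (\<lambda>_. d) T \<omega> \<partial>lborel \<partial>M)
     = (\<integral>\<^sup>+\<omega>. \<integral>\<^sup>+T. indicator {0..} T * C T \<omega> \<partial>lborel \<partial>M) + (\<integral>\<^sup>+\<omega>. \<integral>\<^sup>+T. I k T \<omega> \<partial>lborel \<partial>M)"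
    by (simp only: add[OF Am Im[OF borel_measurable_const]] add[OF Cm Im[OF km]])
  have Aint: "ennreal (\<alpha> * ?q) * (\<integral>\<^sup>+\<omega>. \<integral>\<^sup>+T. indicator {0..} T * A T \<omega> \<partial>lborel \<partial>M) = ennreal \<alpha> * (\<integral>\<^sup>+y. ennreal (exp (c * (x + y))) \<partial>exp_time_law ?q)"
  proof -
    have "(\<integral>\<^sup>+y. ennreal (exp (c * (x + y))) \<partial>exp_time_law ?q) = (\<integral>\<^sup>+T. ennreal (?q * exp (- ?q * T)) * indicator {0..} T * (\<integral>\<^sup>+\<omega>. exp (c * (x + X T \<omega>)) \<partial>M) \<partial>lborel)"
      by (rule nn_integral_exp_time_law[OF q]) simp
    also have "\<dots> = (\<integral>\<^sup>+T. ennreal ?q * (\<integral>\<^sup>+\<omega>. indicator {0..} T * A T \<omega> \<partial>M) \<partial>lborel)"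
    proof (rule nn_integral_cong)
      fix T :: real
      show "ennreal (?q * exp (- ?q * T)) * indicator {0..} T * (\<integral>\<^sup>+\<omega>. exp (c * (x + X T \<omega>)) \<partial>M) = ennreal ?q * (\<integral>\<^sup>+\<omega>. indicator {0..} T * A T \<omega> \<partial>M)"
      proof (cases "0 \<le> T")
        case True
        have "(\<lambda>\<omega>. ennreal (exp (c * (x + X T \<omega>)))) \<in> borel_measurable M" using X_meas[OF True] by simp
        then have "(\<integral>\<^sup>+\<omega>. A T \<omega> \<partial>M) = ennreal (exp (- ?q * T)) * (\<integral>\<^sup>+\<omega>. exp (c * (x + X T \<omega>)) \<partial>M)"
          unfolding A_def using True by (simp add: Xp_def ennreal_mult nn_integral_cmult)
        then show ?thesis using True q by (simp add: ennreal_mult mult.assoc)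
      qed simp
    qed
    also have "\<dots> = ennreal ?q * (\<integral>\<^sup>+T. \<integral>\<^sup>+\<omega>. indicator {0..} T * A T \<omega> \<partial>M \<partial>lborel)"
    proof (rule nn_integral_cmult)
      have "(\<lambda>(T, \<omega>). indicator {0..} T * A T \<omega>) \<in> borel_measurable ?B" using Am by (simp only: split_beta')
      from borel_measurable_nn_integral[OF this] show "(\<lambda>T. \<integral>\<^sup>+\<omega>. indicator {0..} T * A T \<omega> \<partial>M) \<in> borel_measurable lborel" by simp
    qed
    also have "\<dots> = ennreal ?q * (\<integral>\<^sup>+\<omega>. \<integral>\<^sup>+T. indicator {0..} T * A T \<omega> \<partial>lborel \<partial>M)"
      by (subst nn_integral_swap_M[OF Am]) (rule refl)
    finally show ?thesis using al q by (simp add: ennreal_mult mult.assoc)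
  qed
  have Cint: "ennreal (\<alpha> * ?q) * (\<integral>\<^sup>+\<omega>. \<integral>\<^sup>+T. indicator {0..} T * C T \<omega> \<partial>lborel \<partial>M) = ennreal ?q * payoff_transform k \<alpha> c x"
  proof -
    have "payoff_transform k \<alpha> c x = (\<integral>\<^sup>+T. ennreal \<alpha> * (\<integral>\<^sup>+\<omega>. indicator {0..} T * C T \<omega> \<partial>M) \<partial>lborel)"
      unfolding payoff_transform_def
    proof (rule nn_integral_cong)
      fix T :: real
      have "(\<lambda>\<omega>. ennreal (J k c T 0 x \<omega>)) \<in> borel_measurable M"
        by (rule measurable_compose[OF J_meas[OF km] measurable_ennreal]) auto
      then have "(\<integral>\<^sup>+\<omega>. indicator {0..} T * C T \<omega> \<partial>M) = indicator {0..} T * (ennreal (exp (- \<alpha> * T)) * U k c T x)"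
        unfolding C_def U_def using J_def by (simp add: ennreal_mult nn_integral_cmult)
      then show "indicator {0..} T * (ennreal (\<alpha> * exp (- \<alpha> * T)) * U k c T x) = ennreal \<alpha> * (\<integral>\<^sup>+\<omega>. indicator {0..} T * C T \<omega> \<partial>M)"
        using al by (simp add: ennreal_mult mult_ac)
    qed
    also have "\<dots> = ennreal \<alpha> * (\<integral>\<^sup>+T. \<integral>\<^sup>+\<omega>. indicator {0..} T * C T \<omega> \<partial>M \<partial>lborel)"
    proof (rule nn_integral_cmult)
      have "(\<lambda>(T, \<omega>). indicator {0..} T * C T \<omega>) \<in> borel_measurable ?B" using Cm by (simp only: split_beta')
      from borel_measurable_nn_integral[OF this] show "(\<lambda>T. \<integral>\<^sup>+\<omega>. indicator {0..} T * C T \<omega> \<partial>M) \<in> borel_measurable lborel" by simp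
    qed
    also have "\<dots> = ennreal \<alpha> * (\<integral>\<^sup>+\<omega>. \<integral>\<^sup>+T. indicator {0..} T * C T \<omega> \<partial>lborel \<partial>M)"
      by (subst nn_integral_swap_M[OF Cm]) (rule refl)
    finally show ?thesis using al q by (simp add: ennreal_mult mult_ac)
  qed
  have kab: "k y \<le> a + b" for y using kb by simp
  show ?thesis
    using arg_cong[OF main, of "\<lambda>z. ennreal (\<alpha> * ?q) * z"]
    unfolding distrib_left[of "ennreal (\<alpha> * ?q)"] Aint Cint I_def Gint[OF km kab] Gint[OF borel_measurable_const order_refl] by simp
qed

text \<open>Dropping the killing can only increase the payoff, and starting at \<open>x\<close>
  multiplies an unkilled payoff by \<open>exp (c * x)\<close>. This is the growth bound on which the
  later integrability rests.\<close>

lemma (in mejd_driven) payoff_transform_bound: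
  assumes al: "0 < \<alpha>" and k: "k \<in> borel_measurable borel" "\<And>y. 0 \<le> k y"
  shows "payoff_transform k \<alpha> c x \<le> ennreal (exp (c * x)) * (\<integral>\<^sup>+y. ennreal (exp (c * y)) \<partial>exp_time_law \<alpha>)"
proof -
  have "payoff_transform k \<alpha> c x \<le> (\<integral>\<^sup>+T. ennreal (\<alpha> * exp (- \<alpha> * T)) * indicator {0..} T * (\<integral>\<^sup>+\<omega>. exp (c * (x + X T \<omega>)) \<partial>M) \<partial>lborel)"
    unfolding payoff_transform_def
  proof (intro nn_integral_mono)
    fix T :: real
    show "indicator {0..} T * (ennreal (\<alpha> * exp (- \<alpha> * T)) * U k c T x)
      \<le> ennreal (\<alpha> * exp (- \<alpha> * T)) * indicator {0..} T * (\<integral>\<^sup>+\<omega>. exp (c * (x + X T \<omega>)) \<partial>M)"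
    proof (cases "0 \<le> T")
      case True
      have "U k c T x \<le> (\<integral>\<^sup>+\<omega>. exp (c * (x + X T \<omega>)) \<partial>M)"
        unfolding U_def
      proof (intro nn_integral_mono ennreal_leI)
        fix \<omega> assume "\<omega> \<in> space M"
        then show "J k c T 0 x \<omega> \<le> exp (c * (x + X T \<omega>))"
          using J_le[of k c T 0 x \<omega>] k(2) True by (simp add: Xp_def X_0)
      qed
      then show ?thesis using True by (simp add: mult_left_mono)
    qed simp
  qed
  also have "\<dots> = (\<integral>\<^sup>+y. ennreal (exp (c * (x + y))) \<partial>exp_time_law \<alpha>)"
    by (rule nn_integral_exp_time_law[OF al, symmetric]) simp
  also have "\<dots> = (\<integral>\<^sup>+y. ennreal (exp (c * x)) * ennreal (exp (c * y)) \<partial>exp_time_law \<alpha>)"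
    by (intro nn_integral_cong) (simp add: ennreal_mult[symmetric] exp_add[symmetric] distrib_left)
  also have "\<dots> = ennreal (exp (c * x)) * (\<integral>\<^sup>+y. ennreal (exp (c * y)) \<partial>exp_time_law \<alpha>)"
    by (rule nn_integral_cmult) (simp add: exp_time_law_def)
  finally show ?thesis .
qed

text \<open>The growth bound makes every term finite, so the common factor
  \<open>\<alpha> + d\<close> cancels and the subtraction can be carried out in the reals. Roots at
  level \<open>\<alpha>\<close> serve the bound, those at level \<open>\<alpha> + d\<close> the
  kernel.\<close>

lemma (in mejd_driven) resolvent_real:
  fixes h H a b c \<alpha> d x :: real
  assumes ab: "0 \<le> a" "0 \<le> b" and al: "0 < \<alpha>" and d: "0 \<le> d"
    and r0: "mejd_roots P \<alpha> \<beta>0 g0" "- g0 1 < c" "c < \<beta>0 1"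
    and r: "mejd_roots P (\<alpha> + d) \<beta> g" "- g 1 < c" "c < \<beta> 1"
  defines "k \<equiv> occ_rate h H a b"
  defines "F \<equiv> \<lambda>x. enn2real (payoff_transform k \<alpha> c x)"
  defines "r \<equiv> res_density (roots_set P \<beta> g) (rweight P (\<alpha> + d) (roots_set P \<beta> g))"
  shows "payoff_transform k \<alpha> c x = ennreal (F x)"
    and "F \<in> borel_measurable borel"
    and "\<exists>K. \<forall>x. 0 \<le> F x \<and> F x \<le> K * exp (c * x)"
    and "F x = (LBINT y. (\<alpha> * exp (c * (x + y)) + (d - k (x + y)) * F (x + y)) * r y)"
proof -
  let ?q = "\<alpha> + d"
  interpret R: mejd_roots P ?q \<beta> g by fact
  have q: "0 < ?q" by (rule R.q_pos)
  have km: "k \<in> borel_measurable borel" unfolding k_def by measurable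
  have kb: "0 \<le> k y \<and> k y \<le> a + b" for y
    using ab by (auto simp: k_def occ_rate_def indicator_def)
  define K where "K = enn2real (\<integral>\<^sup>+y. ennreal (exp (c * y)) \<partial>exp_time_law \<alpha>)"
  have K: "(\<integral>\<^sup>+y. ennreal (exp (c * y)) \<partial>exp_time_law \<alpha>) = ennreal K" "0 \<le> K"
    using exp_moment_finite(1)[OF r0, of 0] by (auto simp: K_def less_top)
  have bound: "payoff_transform k \<alpha> c x \<le> ennreal (K * exp (c * x))" for x
    using payoff_transform_bound[OF al km, of c x] kb K by (simp add: ennreal_mult[symmetric] mult.commute)
  then have "payoff_transform k \<alpha> c x < \<infinity>" for x by (rule le_less_trans) simp
  then have payoff_transform: "payoff_transform k \<alpha> c x = ennreal (F x)" for x by (simp add: F_def less_top)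
  show "payoff_transform k \<alpha> c x = ennreal (F x)" by (rule payoff_transform)
  show Fm [measurable]: "F \<in> borel_measurable borel" unfolding F_def using payoff_transform_meas[OF km] by measurable
  have F: "0 \<le> F x" "F x \<le> K * exp (c * x)" for x
    using bound[of x] K unfolding payoff_transform by (auto simp: F_def ennreal_le_iff)
  then show "\<exists>K. \<forall>x. 0 \<le> F x \<and> F x \<le> K * exp (c * x)" by blast
  note [measurable] = km
  have rm [measurable]: "r \<in> borel_measurable borel" unfolding r_def by measurable
  note D = exp_time_law_density[OF r(1), folded r_def]
  have er: "integrable lborel (\<lambda>y. exp (c * y) * r y)"
    unfolding r_def by (rule R.integrable_exp_res_density[OF r(2,3)])
  have int: "integrable lborel (\<lambda>y. f (x + y) * r y)"
    if [measurable]: "f \<in> borel_measurable borel" and b: "\<And>y. \<bar>f y\<bar> \<le> C * exp (c * y)" for f C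
  proof (rule Bochner_Integration.integrable_bound[OF integrable_mult_right[OF er, of "C * exp (c * x)"]])
    show "AE y in lborel. norm (f (x + y) * r y) \<le> norm (C * exp (c * x) * (exp (c * y) * r y))"
    proof (rule AE_I2)
      fix y
      have "norm (f (x + y)) \<le> norm (C * exp (c * x) * exp (c * y))"
        using b[of "x + y"] by (simp add: distrib_left exp_add mult.assoc)
      then show "norm (f (x + y) * r y) \<le> norm (C * exp (c * x) * (exp (c * y) * r y))"
        by (metis mult.assoc mult_right_mono norm_ge_zero norm_mult)
    qed
  qed measurable
  have nn: "(\<integral>\<^sup>+y. ennreal (f (x + y)) \<partial>exp_time_law ?q) = ennreal (?q * (LBINT y. f (x + y) * r y))" "0 \<le> (LBINT y. f (x + y) * r y)"
    if f [measurable]: "f \<in> borel_measurable borel" and b: "\<And>y. 0 \<le> f y" "\<And>y. f y \<le> C * exp (c * y)" for f C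
  proof -
    have i: "integrable lborel (\<lambda>y. f (x + y) * r y)" by (rule int[OF f]) (use b in simp)
    have ae: "AE y in lborel. 0 \<le> f (x + y) * r y" using D(2) by eventually_elim (use b in simp)
    show "0 \<le> (LBINT y. f (x + y) * r y)" using ae by (rule integral_nonneg_AE)
    have "(\<integral>\<^sup>+y. ennreal (f (x + y)) \<partial>exp_time_law ?q) = (\<integral>\<^sup>+y. ennreal (?q * r y) * ennreal (f (x + y)) \<partial>lborel)"
      unfolding D(1) by (rule nn_integral_density) measurable
    also have "\<dots> = (\<integral>\<^sup>+y. ennreal (?q * (f (x + y) * r y)) \<partial>lborel)"
      using D(2) by (intro nn_integral_cong_AE) (auto elim!: eventually_mono simp: ennreal_mult[symmetric] b mult_ac less_imp_le[OF q])
    also have "\<dots> = ennreal (LBINT y. ?q * (f (x + y) * r y))"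
      by (rule nn_integral_eq_integral) (use i ae q in \<open>auto elim!: eventually_mono\<close>)
    finally show "(\<integral>\<^sup>+y. ennreal (f (x + y)) \<partial>exp_time_law ?q) = ennreal (?q * (LBINT y. f (x + y) * r y))" by simp
  qed
  have b1: "exp (c * y) \<le> 1 * exp (c * y)" for y by simp
  have b2: "k y * F y \<le> ((a + b) * K) * exp (c * y)" for y
    using kb[of y] F[of y] by (auto simp: mult.assoc intro!: mult_mono)
  have b3: "d * F y \<le> (d * K) * exp (c * y)" for y
    using d F[of y] by (auto simp: mult.assoc intro!: mult_left_mono)
  have m: "(\<lambda>y. exp (c * y)) \<in> borel_measurable borel" "(\<lambda>y. k y * F y) \<in> borel_measurable borel" "(\<lambda>y. d * F y) \<in> borel_measurable borel"
    by measurable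
  have p2: "0 \<le> k y * F y" and p3: "0 \<le> d * F y" and p1: "0 \<le> exp (c * y)" for y using kb[of y] F[of y] d by auto
  note N1 = nn[OF m(1) p1 b1] and N2 = nn[OF m(2) p2 b2] and N3 = nn[OF m(3) p3 b3]
  have mom: "(\<integral>\<^sup>+\<omega>. exp (c * X t \<omega>) \<partial>M) < \<infinity>" if "0 \<le> t" for t
    by (rule exp_moment_finite(2)[OF r0 that])
  have kF: "ennreal (k y) * ennreal (F y) = ennreal (k y * F y)" and dF: "ennreal d * ennreal (F y) = ennreal (d * F y)" for y
    using kb[of y] F[of y] d by (simp_all add: ennreal_mult)
  have "ennreal ?q * ennreal (F x) + ennreal (?q * (LBINT y. k (x + y) * F (x + y) * r y))
    = ennreal \<alpha> * ennreal (?q * (LBINT y. exp (c * (x + y)) * r y)) + ennreal (?q * (LBINT y. d * F (x + y) * r y))"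
    using resolvent_nn[where h=h and H=H and a=a and b=b and c=c and \<alpha>=\<alpha> and d=d and x=x, OF mom ab al d, folded k_def]
    unfolding payoff_transform kF dF N1(1) N2(1) N3(1) .
  then have "?q * F x + ?q * (LBINT y. k (x + y) * F (x + y) * r y)
    = \<alpha> * (?q * (LBINT y. exp (c * (x + y)) * r y)) + ?q * (LBINT y. d * F (x + y) * r y)"
    using q al F[of x] N1(2) N2(2) N3(2)
    by (simp add: ennreal_mult[symmetric] ennreal_plus[symmetric] del: ennreal_plus)
  then have "?q * (F x + (LBINT y. k (x + y) * F (x + y) * r y)) = ?q * (\<alpha> * (LBINT y. exp (c * (x + y)) * r y) + (LBINT y. d * F (x + y) * r y))"
    by (simp add: algebra_simps)
  then have eq: "F x + (LBINT y. k (x + y) * F (x + y) * r y) = \<alpha> * (LBINT y. exp (c * (x + y)) * r y) + (LBINT y. d * F (x + y) * r y)"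
    using q by simp
  have i1: "integrable lborel (\<lambda>y. exp (c * (x + y)) * r y)" by (rule int[OF m(1), of 1]) simp
  have i2: "integrable lborel (\<lambda>y. k (x + y) * F (x + y) * r y)" by (rule int[OF m(2)]) (use p2 b2 in simp)
  have i3: "integrable lborel (\<lambda>y. d * F (x + y) * r y)" by (rule int[OF m(3)]) (use p3 b3 in simp)
  have "(LBINT y. (\<alpha> * exp (c * (x + y)) + (d - k (x + y)) * F (x + y)) * r y)
    = (LBINT y. \<alpha> * (exp (c * (x + y)) * r y) + (d * F (x + y) * r y - k (x + y) * F (x + y) * r y))"
    by (intro Bochner_Integration.integral_cong) (auto simp: algebra_simps)
  also have "\<dots> = \<alpha> * (LBINT y. exp (c * (x + y)) * r y) + ((LBINT y. d * F (x + y) * r y) - (LBINT y. k (x + y) * F (x + y) * r y))"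
    using i1 i2 i3 by (simp add: Bochner_Integration.integral_add Bochner_Integration.integral_diff)
  finally show "F x = (LBINT y. (\<alpha> * exp (c * (x + y)) + (d - k (x + y)) * F (x + y)) * r y)"
    using eq by simp
qed

section \<open>Resolvents of exponential sums\<close>

lemma exp_sum_independent_ge:
  fixes c :: "real \<Rightarrow> real"
  assumes fin: "finite Z" and zero: "\<And>x. b \<le> x \<Longrightarrow> (\<Sum>z\<in>Z. c z * exp (z * x)) = 0" and z: "z \<in> Z"
  shows "c z = 0"
proof -
  have "c (- (- z)) = 0"
  proof (rule exp_sum_independent[where Z="uminus ` Z" and b="- b" and c="\<lambda>y. c (- y)"])
    fix x assume "x \<le> - b"
    then show "(\<Sum>y\<in>uminus ` Z. c (- y) * exp (y * x)) = 0"
      using zero[of "- x"] by (subst sum.reindex) (auto simp: inj_on_def)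
  qed (use fin z in auto)
  then show ?thesis by simp
qed

text \<open>The contribution of the root \<open>z\<close> to the resolvent of \<open>f\<close> at
  \<open>x\<close>, stripped of \<open>exp (z * x)\<close> and of the weight. The sign in the second
  case makes both cases antiderivatives of \<open>- exp (- z * y) * f y\<close>, so that
  \<open>Phi_diff\<close> has one formula for both.\<close>

definition Phi :: "(real \<Rightarrow> real) \<Rightarrow> real \<Rightarrow> real \<Rightarrow> real" where
  "Phi f z x = (if 0 < z then (LBINT y:{x..}. exp (- z * y) * f y) else - (LBINT y:{..<x}. exp (- z * y) * f y))"

text \<open>Only points strictly between two members of \<open>I\<close> are constrained: at a
  barrier, an end point of \<open>I\<close>, the occupation rate jumps and \<open>f\<close> may take
  another value. The same notion serves intervals and half lines.\<close>

definition exp_piece :: "(real \<Rightarrow> real) \<Rightarrow> real set \<Rightarrow> real set \<Rightarrow> (real \<Rightarrow> real) \<Rightarrow> bool" where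
  "exp_piece f I A b \<longleftrightarrow> (\<forall>x1\<in>I. \<forall>x2\<in>I. \<forall>y. x1 < y \<longrightarrow> y < x2 \<longrightarrow> f y = (\<Sum>a\<in>A. b a * exp (a * y)))"

lemma integral_exp_Icc:
  assumes "x1 \<le> x2" "(s::real) \<noteq> 0"
  shows "(LBINT y:{x1..x2}. exp (s * y)) = (exp (s * x2) - exp (s * x1)) / s"
proof -
  have "((\<lambda>y. exp (s * y) / s) has_vector_derivative exp (s * y)) (at y within A)" for y A
    using assms(2) by (auto intro!: derivative_eq_intros simp: has_real_derivative_iff_has_vector_derivative[symmetric])
  then show ?thesis
    unfolding set_lebesgue_integral_def using assms(1)
    by (subst integral_FTC_atLeastAtMost[where F="\<lambda>y. exp (s * y) / s"]) (auto intro!: continuous_intros simp: diff_divide_distrib)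
qed

context mejd_roots
begin

abbreviation "r \<equiv> res_density R w"

text \<open>The growth rate \<open>c\<close> lies below every positive and above every negative
  root, so the factor \<open>exp (- z * y)\<close> beats \<open>f\<close> in the direction of
  integration.\<close>

lemma exp_tail_integrable:
  assumes z: "z \<in> R" and c: "- g 1 < c" "c < \<beta> 1" and [measurable]: "f \<in> borel_measurable borel"
    and b: "\<And>y. \<bar>f y\<bar> \<le> C * exp (c * y)"
  shows "0 < z \<Longrightarrow> set_integrable lborel {x..} (\<lambda>y. exp (- z * y) * f y)"
    and "z < 0 \<Longrightarrow> set_integrable lborel {..<x} (\<lambda>y. exp (- z * y) * f y)"
proof -
  have C: "0 \<le> C" using b[of 0] by auto
  { assume "0 < z"
    then obtain i where "i \<in> {1..up_num P + 1}" "z = \<beta> i" using z R_pos by blast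
    then have cz: "c < z" using beta_ge c by fastforce
    have i: "integrable lborel (\<lambda>y. exp (- (z - c) * y) * indicator {x..} y)"
    proof -
      have "integrable lborel (\<lambda>y. exp (- (z - c) * x) * (exp (- (z - c) * (- x + 1 * y)) * indicator {0..} (- x + 1 * y)))"
        using lborel_integrable_real_affine[OF integrable_exp_up[of "z - c"], of 1 "- x"] cz by (intro integrable_mult_right) simp
      also have "(\<lambda>y. exp (- (z - c) * x) * (exp (- (z - c) * (- x + 1 * y)) * indicator {0..} (- x + 1 * y)))
        = (\<lambda>y. exp (- (z - c) * y) * indicator {x..} y)"
        by (auto simp: fun_eq_iff algebra_simps indicator_def simp flip: exp_add)
      finally show ?thesis .
    qed
    show "set_integrable lborel {x..} (\<lambda>y. exp (- z * y) * f y)"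
      unfolding set_integrable_def
    proof (rule Bochner_Integration.integrable_bound[OF integrable_mult_right[OF i, of C]])
      show "AE y in lborel. norm (indicator {x..} y *\<^sub>R (exp (- z * y) * f y)) \<le> norm (C * (exp (- (z - c) * y) * indicator {x..} y))"
      proof (rule AE_I2)
        fix y
        have "exp (- z * y) * \<bar>f y\<bar> \<le> exp (- z * y) * (C * exp (c * y))" using b by (intro mult_left_mono) auto
        also have "\<dots> = C * exp (- (z - c) * y)" by (simp add: algebra_simps flip: exp_add)
        finally show "norm (indicator {x..} y *\<^sub>R (exp (- z * y) * f y)) \<le> norm (C * (exp (- (z - c) * y) * indicator {x..} y))"
          using C by (auto simp: abs_mult split: split_indicator)
      qed
    qed measurable }
  { assume "z < 0"
    then obtain i where "i \<in> {1..down_num P + 1}" "z = - g i" using z R_neg by blast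
    then have cz: "z < c" using g_ge c by fastforce
    have i: "integrable lborel (\<lambda>y. exp ((c - z) * y) * indicator {..<x} y)"
    proof -
      have "integrable lborel (\<lambda>y. exp ((c - z) * x) * (exp ((c - z) * (- x + 1 * y)) * indicator {..<0} (- x + 1 * y)))"
        using lborel_integrable_real_affine[OF integrable_exp_down[of "c - z"], of 1 "- x"] cz by (intro integrable_mult_right) simp
      also have "(\<lambda>y. exp ((c - z) * x) * (exp ((c - z) * (- x + 1 * y)) * indicator {..<0} (- x + 1 * y)))
        = (\<lambda>y. exp ((c - z) * y) * indicator {..<x} y)"
        by (auto simp: fun_eq_iff algebra_simps indicator_def simp flip: exp_add)
      finally show ?thesis .
    qed
    show "set_integrable lborel {..<x} (\<lambda>y. exp (- z * y) * f y)"
      unfolding set_integrable_def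
    proof (rule Bochner_Integration.integrable_bound[OF integrable_mult_right[OF i, of C]])
      show "AE y in lborel. norm (indicator {..<x} y *\<^sub>R (exp (- z * y) * f y)) \<le> norm (C * (exp ((c - z) * y) * indicator {..<x} y))"
      proof (rule AE_I2)
        fix y
        have "exp (- z * y) * \<bar>f y\<bar> \<le> exp (- z * y) * (C * exp (c * y))" using b by (intro mult_left_mono) auto
        also have "\<dots> = C * exp ((c - z) * y)" by (simp add: algebra_simps flip: exp_add)
        finally show "norm (indicator {..<x} y *\<^sub>R (exp (- z * y) * f y)) \<le> norm (C * (exp ((c - z) * y) * indicator {..<x} y))"
          using C by (auto simp: abs_mult split: split_indicator)
      qed
    qed measurable }
qed

context
  fixes f :: "real \<Rightarrow> real" and c C :: real
  assumes f_meas [measurable]: "f \<in> borel_measurable borel" and f_bound: "\<And>y. \<bar>f y\<bar> \<le> C * exp (c * y)"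
    and c: "- g 1 < c" "c < \<beta> 1"
begin

lemmas tail_int = exp_tail_integrable[OF _ c f_meas f_bound]

lemma resolvent_Phi: "(LBINT y. f (x + y) * r y) = (\<Sum>z\<in>R. w z * exp (z * x) * Phi f z x)"
proof -
  have up: "has_bochner_integral lborel (\<lambda>y. f (x + y) * (w z * (exp (- z * y) * indicator {0..} y))) (w z * exp (z * x) * Phi f z x)"
    if z: "z \<in> R" "0 < z" for z
  proof -
    have i: "integrable lborel (\<lambda>y. indicator {x..} y *\<^sub>R (exp (- z * y) * f y))"
      using tail_int(1)[OF z, of x] by (simp add: set_integrable_def)
    have eq: "(\<lambda>y. f (x + y) * (w z * (exp (- z * y) * indicator {0..} y)))
      = (\<lambda>y. (w z * exp (z * x)) * (indicator {x..} (x + 1 * y) *\<^sub>R (exp (- z * (x + 1 * y)) * f (x + 1 * y))))"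
      by (auto simp: fun_eq_iff algebra_simps exp_add[symmetric] indicator_def)
    have "has_bochner_integral lborel (\<lambda>y. indicator {x..} (x + 1 * y) *\<^sub>R (exp (- z * (x + 1 * y)) * f (x + 1 * y))) (Phi f z x)"
      using lborel_integrable_real_affine[OF i, of 1 x] lborel_integral_real_affine[of 1 "\<lambda>y. indicator {x..} y *\<^sub>R (exp (- z * y) * f y)" x] z
      by (simp add: has_bochner_integral_iff Phi_def set_lebesgue_integral_def)
    then show ?thesis unfolding eq by (rule has_bochner_integral_mult_right)
  qed
  have down: "has_bochner_integral lborel (\<lambda>y. f (x + y) * (w z * (exp (- z * y) * indicator {..<0} y))) (- (w z * exp (z * x) * Phi f z x))"
    if z: "z \<in> R" "z < 0" for z
  proof -
    have i: "integrable lborel (\<lambda>y. indicator {..<x} y *\<^sub>R (exp (- z * y) * f y))"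
      using tail_int(2)[OF z, of x] by (simp add: set_integrable_def)
    have eq: "(\<lambda>y. f (x + y) * (w z * (exp (- z * y) * indicator {..<0} y)))
      = (\<lambda>y. (w z * exp (z * x)) * (indicator {..<x} (x + 1 * y) *\<^sub>R (exp (- z * (x + 1 * y)) * f (x + 1 * y))))"
      by (auto simp: fun_eq_iff algebra_simps exp_add[symmetric] indicator_def)
    have "has_bochner_integral lborel (\<lambda>y. indicator {..<x} (x + 1 * y) *\<^sub>R (exp (- z * (x + 1 * y)) * f (x + 1 * y))) (- Phi f z x)"
      using lborel_integrable_real_affine[OF i, of 1 x] lborel_integral_real_affine[of 1 "\<lambda>y. indicator {..<x} y *\<^sub>R (exp (- z * y) * f y)" x] z
      by (simp add: has_bochner_integral_iff Phi_def set_lebesgue_integral_def)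
    from has_bochner_integral_mult_right[OF this, of "w z * exp (z * x)"] show ?thesis unfolding eq by simp
  qed
  have "has_bochner_integral lborel (\<lambda>y. (\<Sum>z\<in>{z\<in>R. 0 < z}. f (x + y) * (w z * (exp (- z * y) * indicator {0..} y)))
     - (\<Sum>z\<in>{z\<in>R. z < 0}. f (x + y) * (w z * (exp (- z * y) * indicator {..<0} y))))
     ((\<Sum>z\<in>{z\<in>R. 0 < z}. w z * exp (z * x) * Phi f z x) - (\<Sum>z\<in>{z\<in>R. z < 0}. - (w z * exp (z * x) * Phi f z x)))"
    by (intro has_bochner_integral_diff has_bochner_integral_sum up down) auto
  moreover have "(\<lambda>y. (\<Sum>z\<in>{z\<in>R. 0 < z}. f (x + y) * (w z * (exp (- z * y) * indicator {0..} y)))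
     - (\<Sum>z\<in>{z\<in>R. z < 0}. f (x + y) * (w z * (exp (- z * y) * indicator {..<0} y)))) = (\<lambda>y. f (x + y) * r y)"
    by (simp add: res_density_def right_diff_distrib sum_distrib_left)
  moreover have "(\<Sum>z\<in>{z\<in>R. 0 < z}. w z * exp (z * x) * Phi f z x) - (\<Sum>z\<in>{z\<in>R. z < 0}. - (w z * exp (z * x) * Phi f z x))
     = (\<Sum>z\<in>R. w z * exp (z * x) * Phi f z x)"
  proof -
    have "{z\<in>R. 0 < z} \<union> {z\<in>R. z < 0} = R" using R_nonzero by force
    moreover have "{z\<in>R. 0 < z} \<inter> {z\<in>R. z < 0} = {}" by auto
    ultimately show ?thesis
      using sum.union_disjoint[of "{z\<in>R. 0 < z}" "{z\<in>R. z < 0}" "\<lambda>z. w z * exp (z * x) * Phi f z x"] finite_R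
      by (simp add: sum_negf)
  qed
  ultimately show ?thesis by (simp add: has_bochner_integral_iff)
qed

lemma Phi_diff:
  assumes z: "z \<in> R" and x: "x1 \<le> x2"
  shows "Phi f z x1 - Phi f z x2 = (LBINT y:{x1..x2}. exp (- z * y) * f y)"
    and "set_integrable lborel {x1..x2} (\<lambda>y. exp (- z * y) * f y)"
proof -
  let ?h = "\<lambda>y. exp (- z * y) * f y"
  have sub: "set_integrable lborel B ?h \<Longrightarrow> A \<subseteq> B \<Longrightarrow> A \<in> sets borel \<Longrightarrow> set_integrable lborel A ?h" for A B
    by (rule set_integrable_subset) auto
  have co: "(LBINT y:{x1..<x2}. ?h y) = (LBINT y:{x1..x2}. ?h y)"
    unfolding set_lebesgue_integral_def
  proof (rule integral_cong_AE)
    show "AE y in lborel. indicator {x1..<x2} y *\<^sub>R ?h y = indicator {x1..x2} y *\<^sub>R ?h y"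
      using AE_lborel_singleton[of x2] by eventually_elim (auto split: split_indicator)
  qed measurable
  consider "0 < z" | "z < 0" using R_nonzero[OF z] by linarith
  then have "Phi f z x1 - Phi f z x2 = (LBINT y:{x1..<x2}. ?h y) \<and> set_integrable lborel {x1..x2} ?h"
  proof cases
    case 1
    note i = tail_int(1)[OF z 1]
    have "{x1..} = {x1..<x2} \<union> {x2..}" using x by auto
    then have "(LBINT y:{x1..}. ?h y) = (LBINT y:{x1..<x2}. ?h y) + (LBINT y:{x2..}. ?h y)"
      using set_integral_Un[of "{x1..<x2}" "{x2..}" lborel ?h] sub[OF i[of x1], of "{x1..<x2}"] i[of x2] by force
    then show ?thesis using 1 sub[OF i[of x1], of "{x1..x2}"] by (auto simp: Phi_def)
  next
    case 2
    note i = tail_int(2)[OF z 2]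
    have "{..<x2} = {..<x1} \<union> {x1..<x2}" using x by auto
    then have "(LBINT y:{..<x2}. ?h y) = (LBINT y:{..<x1}. ?h y) + (LBINT y:{x1..<x2}. ?h y)"
      using set_integral_Un[of "{..<x1}" "{x1..<x2}" lborel ?h] sub[OF i[of x2], of "{x1..<x2}"] i[of x1] by force
    moreover have "set_integrable lborel {x1..x2} ?h" by (rule sub[OF i[of "x2 + 1"]]) auto
    ultimately show ?thesis using 2 by (simp add: Phi_def)
  qed
  then show "Phi f z x1 - Phi f z x2 = (LBINT y:{x1..x2}. ?h y)" "set_integrable lborel {x1..x2} ?h" using co by auto
qed

text \<open>Tails of an integrable function vanish. This will remove the homogeneous terms that are
  too large in the outer regions.\<close>

lemma Phi_lim:
  assumes z: "z \<in> R"
  shows "0 < z \<Longrightarrow> (\<lambda>n. Phi f z (real n)) \<longlonglongrightarrow> 0" and "z < 0 \<Longrightarrow> (\<lambda>n. Phi f z (- real n)) \<longlonglongrightarrow> 0"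
proof -
  let ?h = "\<lambda>y. exp (- z * y) * f y"
  { assume pos: "0 < z"
    have "(\<lambda>n. LBINT y. indicator {real n..} y *\<^sub>R ?h y) \<longlonglongrightarrow> (LBINT y::real. 0)"
    proof (rule integral_dominated_convergence[where w="\<lambda>y. norm (indicator {0..} y *\<^sub>R ?h y)"])
      show "AE y in lborel. (\<lambda>n. indicator {real n..} y *\<^sub>R ?h y) \<longlonglongrightarrow> 0"
      proof (intro AE_I2 tendsto_eventually)
        fix y show "\<forall>\<^sub>F n in sequentially. indicator {real n..} y *\<^sub>R ?h y = 0"
          using eventually_gt_at_top[of "nat \<lceil>\<bar>y\<bar>\<rceil>"]
        proof eventually_elim
          case (elim n)
          then have "y < real n" "- real n < y" by linarith+
          then show ?case by simp
        qed
      qed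
      show "integrable lborel (\<lambda>y. norm (indicator {0..} y *\<^sub>R ?h y))"
        using tail_int(1)[OF z pos, of 0] unfolding set_integrable_def by (rule integrable_norm)
    qed (auto split: split_indicator)
    then show "(\<lambda>n. Phi f z (real n)) \<longlonglongrightarrow> 0" using pos by (simp add: Phi_def set_lebesgue_integral_def) }
  { assume neg: "z < 0"
    have "(\<lambda>n. LBINT y. indicator {..<- real n} y *\<^sub>R ?h y) \<longlonglongrightarrow> (LBINT y::real. 0)"
    proof (rule integral_dominated_convergence[where w="\<lambda>y. norm (indicator {..<0} y *\<^sub>R ?h y)"])
      show "AE y in lborel. (\<lambda>n. indicator {..<- real n} y *\<^sub>R ?h y) \<longlonglongrightarrow> 0"
      proof (intro AE_I2 tendsto_eventually)
        fix y show "\<forall>\<^sub>F n in sequentially. indicator {..<- real n} y *\<^sub>R ?h y = 0"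
          using eventually_gt_at_top[of "nat \<lceil>\<bar>y\<bar>\<rceil>"]
        proof eventually_elim
          case (elim n)
          then have "y < real n" "- real n < y" by linarith+
          then show ?case by simp
        qed
      qed
      show "integrable lborel (\<lambda>y. norm (indicator {..<0} y *\<^sub>R ?h y))"
        using tail_int(2)[OF z neg, of 0] unfolding set_integrable_def by (rule integrable_norm)
    qed (auto split: split_indicator)
    from tendsto_minus[OF this] show "(\<lambda>n. Phi f z (- real n)) \<longlonglongrightarrow> 0" using neg by (simp add: Phi_def set_lebesgue_integral_def) }
qed

text \<open>On an interval where \<open>f\<close> is an exponential sum, so is its resolvent; the constants \<open>K z\<close>
  carry the dependence on \<open>f\<close> outside the interval.\<close>

lemma Phi_piece:
  assumes A: "finite A" "A \<inter> R = {}" and x0: "x0 \<in> I"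
    and piece: "exp_piece f I A b"
    and z: "z \<in> R" and x: "x \<in> I"
  shows "Phi f z x + (\<Sum>a\<in>A. b a * exp ((a - z) * x) / (a - z)) = Phi f z x0 + (\<Sum>a\<in>A. b a * exp ((a - z) * x0) / (a - z))"
proof -
  let ?H = "\<lambda>x. \<Sum>a\<in>A. b a * exp ((a - z) * x) / (a - z)"
  have step: "Phi f z x1 - Phi f z x2 = ?H x2 - ?H x1" if I: "x1 \<in> I" "x2 \<in> I" "x1 \<le> x2" for x1 x2
  proof -
    have "Phi f z x1 - Phi f z x2 = (LBINT y:{x1..x2}. exp (- z * y) * f y)" by (rule Phi_diff(1)[OF z I(3)])
    also have "\<dots> = (LBINT y. \<Sum>a\<in>A. b a * (indicator {x1..x2} y *\<^sub>R exp ((a - z) * y)))"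
      unfolding set_lebesgue_integral_def
    proof (rule integral_cong_AE)
      show "AE y in lborel. indicator {x1..x2} y *\<^sub>R (exp (- z * y) * f y) = (\<Sum>a\<in>A. b a * (indicator {x1..x2} y *\<^sub>R exp ((a - z) * y)))"
        using AE_lborel_singleton[of x1] AE_lborel_singleton[of x2]
      proof eventually_elim
        case (elim y)
        show ?case
        proof (cases "y \<in> {x1..x2}")
          case True
          then have "f y = (\<Sum>a\<in>A. b a * exp (a * y))" using piece I elim by (auto simp: exp_piece_def)
          then show ?thesis using True
            by (simp add: sum_distrib_left exp_diff exp_minus field_simps)
        qed simp
      qed
    qed measurable
    also have "\<dots> = (\<Sum>a\<in>A. b a * (LBINT y:{x1..x2}. exp ((a - z) * y)))"
    proof -
      have i: "integrable lborel (\<lambda>y. indicator {x1..x2} y *\<^sub>R exp ((a - z) * y))" for a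
        using borel_integrable_atLeastAtMost'[of x1 x2 "\<lambda>y. exp ((a - z) * y)"] by (simp add: set_integrable_def continuous_intros)
      show ?thesis using i by (simp add: set_lebesgue_integral_def)
    qed
    also have "\<dots> = (\<Sum>a\<in>A. b a * ((exp ((a - z) * x2) - exp ((a - z) * x1)) / (a - z)))"
    proof (intro sum.cong refl)
      fix a assume "a \<in> A"
      then have "a - z \<noteq> 0" using A z by auto
      then show "b a * (LBINT y:{x1..x2}. exp ((a - z) * y)) = b a * ((exp ((a - z) * x2) - exp ((a - z) * x1)) / (a - z))"
        using integral_exp_Icc[OF I(3)] by simp
    qed
    also have "\<dots> = ?H x2 - ?H x1"
      by (simp add: sum_subtractf[symmetric] diff_divide_distrib right_diff_distrib)
    finally show ?thesis .
  qed
  show ?thesis using step[OF x x0] step[OF x0 x] by (cases "x \<le> x0") auto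
qed

text \<open>Summing the particular terms over the roots, by partial fractions with
  \<open>v = 1\<close>, gives each exponent \<open>a\<close> the factor
  \<open>- 1 / (G(a) - q)\<close>, the action of the resolvent on a pure exponential. The constants
  \<open>K\<close> multiply solutions of the homogeneous equation \<open>G(z) = q\<close>.\<close>

lemma resolvent_piece:
  assumes A: "finite A" "A \<inter> R = {}" "A \<inter> levy_poles P = {}" and x0: "x0 \<in> I"
    and piece: "exp_piece f I A b"
  obtains K where "\<And>z x. z \<in> R \<Longrightarrow> x \<in> I \<Longrightarrow> Phi f z x = K z - (\<Sum>a\<in>A. b a * exp ((a - z) * x) / (a - z))"
    and "\<And>x. x \<in> I \<Longrightarrow> (LBINT y. f (x + y) * r y) = (\<Sum>z\<in>R. w z * K z * exp (z * x)) - (\<Sum>a\<in>A. b a / (levy_exponent P a - q) * exp (a * x))"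
proof
  define K where "K z = Phi f z x0 + (\<Sum>a\<in>A. b a * exp ((a - z) * x0) / (a - z))" for z
  show 1: "Phi f z x = K z - (\<Sum>a\<in>A. b a * exp ((a - z) * x) / (a - z))" if "z \<in> R" "x \<in> I" for z x
    using Phi_piece[OF A(1,2) x0 piece that] by (simp add: K_def)
  fix x assume x: "x \<in> I"
  have pf: "(\<Sum>z\<in>R. w z / (a - z)) = 1 / (levy_exponent P a - q)" if a: "a \<in> A" for a
  proof -
    obtain V :: "real poly" where "degree V \<le> up_num P + down_num P" "\<And>x. poly V x = lden P x"
    proof
      show "degree ((\<Prod>i=1..up_num P. [:up_rate P i, - 1:]) * (\<Prod>j=1..down_num P. [:down_rate P j, 1 :: real:])) \<le> up_num P + down_num P"
        using degree_prod_pCons_le[of "{1..up_num P}" "\<lambda>i. up_rate P i" "\<lambda>_. - 1 :: real"]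
          degree_prod_pCons_le[of "{1..down_num P}" "\<lambda>i. down_rate P i" "\<lambda>_. 1 :: real"]
        by (intro degree_mult_le_add) auto
    qed (simp add: poly_prod lden_def)
    then have "(\<Sum>z\<in>R. 1 * of_real (w z) / (a - of_real z)) = 1 / (lexp P a - of_real q)"
      using A a by (intro exponent_partial_fractions[where V=V]) (auto simp: lden_zero_iff)
    then show ?thesis by (simp add: lexp_real)
  qed
  have "(LBINT y. f (x + y) * r y) = (\<Sum>z\<in>R. w z * exp (z * x) * (K z - (\<Sum>a\<in>A. b a * exp ((a - z) * x) / (a - z))))"
    unfolding resolvent_Phi by (intro sum.cong refl) (simp add: 1 x)
  also have "\<dots> = (\<Sum>z\<in>R. w z * K z * exp (z * x)) - (\<Sum>z\<in>R. \<Sum>a\<in>A. (b a * exp (a * x)) * (w z / (a - z)))"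
  proof -
    have e: "exp (z * x) * exp ((a - z) * x) = exp (a * x)" for a z :: real by (simp add: algebra_simps flip: exp_add)
    have "w z * exp (z * x) * (K z - (\<Sum>a\<in>A. b a * exp ((a - z) * x) / (a - z)))
       = w z * K z * exp (z * x) - (\<Sum>a\<in>A. (b a * (exp (z * x) * exp ((a - z) * x))) * (w z / (a - z)))" for z
      by (simp add: right_diff_distrib sum_distrib_left mult_ac)
    then show ?thesis by (simp only: e sum_subtractf)
  qed
  also have "(\<Sum>z\<in>R. \<Sum>a\<in>A. (b a * exp (a * x)) * (w z / (a - z))) = (\<Sum>a\<in>A. (b a * exp (a * x)) * (\<Sum>z\<in>R. w z / (a - z)))"
    by (subst sum.swap) (simp add: sum_distrib_left)
  also have "\<dots> = (\<Sum>a\<in>A. b a / (levy_exponent P a - q) * exp (a * x))"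
    by (intro sum.cong refl) (simp add: pf)
  finally show "(LBINT y. f (x + y) * r y) = (\<Sum>z\<in>R. w z * K z * exp (z * x)) - (\<Sum>a\<in>A. b a / (levy_exponent P a - q) * exp (a * x))" .
qed

end

text \<open>Matching at an end point \<open>p\<close> of a half line \<open>I\<close>. On \<open>I\<close> the resolvent must reproduce the
  exponential sum \<open>F\<close>, so the homogeneous terms vanish there; continuity of \<open>Phi\<close> at \<open>p\<close> then
  determines the homogeneous terms on the other side.\<close>

lemma matching:
  assumes f: "f \<in> borel_measurable borel" "\<And>y. \<bar>f y\<bar> \<le> C * exp (c * y)" and c: "- g 1 < c" "c < \<beta> 1"
    and I: "I = {..p} \<or> I = {p..}"
    and A: "finite A" "A \<inter> R = {}" "A \<inter> levy_poles P = {}"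
    and piece: "exp_piece f I A b"
    and F: "\<And>x. x \<in> I \<Longrightarrow> (LBINT y. f (x + y) * r y) = - (\<Sum>a\<in>A. b a / (levy_exponent P a - q) * exp (a * x))"
    and V: "degree V < sys_dim P" "\<And>x. lden P x \<noteq> 0 \<Longrightarrow> poly V x = v x * lden P x"
  shows "(\<Sum>z\<in>R. v z * (w z * Phi f z p * exp (z * p))) = - (\<Sum>a\<in>A. b a * exp (a * p) * v a / (levy_exponent P a - q))"
proof -
  have p: "p \<in> I" using I by auto
  obtain K where K: "\<And>z x. z \<in> R \<Longrightarrow> x \<in> I \<Longrightarrow> Phi f z x = K z - (\<Sum>a\<in>A. b a * exp ((a - z) * x) / (a - z))"
    and FK: "\<And>x. x \<in> I \<Longrightarrow> (LBINT y. f (x + y) * r y) = (\<Sum>z\<in>R. w z * K z * exp (z * x)) - (\<Sum>a\<in>A. b a / (levy_exponent P a - q) * exp (a * x))"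
    using resolvent_piece[OF f c A p piece] by blast
  have zero: "(\<Sum>z\<in>R. (w z * K z) * exp (z * x)) = 0" if "x \<in> I" for x
    using F[OF that] FK[OF that] by simp
  have wK: "w z * K z = 0" if z: "z \<in> R" for z
    using I
  proof
    assume "I = {..p}"
    then show ?thesis using exp_sum_independent[OF finite_R, of p "\<lambda>z. w z * K z"] zero z by auto
  next
    assume "I = {p..}"
    then show ?thesis using exp_sum_independent_ge[OF finite_R, of p "\<lambda>z. w z * K z"] zero z by auto
  qed
  have "v z * (w z * Phi f z p * exp (z * p)) = - (\<Sum>a\<in>A. (b a * exp (a * p)) * (v z * w z / (a - z)))" if z: "z \<in> R" for z
  proof -
    have e: "exp (z * p) * exp ((a - z) * p) = exp (a * p)" for a :: real by (simp add: algebra_simps flip: exp_add)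
    have "v z * (w z * Phi f z p * exp (z * p)) = (w z * K z) * (v z * exp (z * p)) - (\<Sum>a\<in>A. (b a * (exp (z * p) * exp ((a - z) * p))) * (v z * w z / (a - z)))"
      unfolding K[OF z p] by (simp add: right_diff_distrib left_diff_distrib sum_distrib_left sum_distrib_right mult_ac)
    then show ?thesis unfolding wK[OF z] e by simp
  qed
  then have "(\<Sum>z\<in>R. v z * (w z * Phi f z p * exp (z * p))) = - (\<Sum>z\<in>R. \<Sum>a\<in>A. (b a * exp (a * p)) * (v z * w z / (a - z)))"
    by (simp add: sum_negf)
  also have "(\<Sum>z\<in>R. \<Sum>a\<in>A. (b a * exp (a * p)) * (v z * w z / (a - z))) = (\<Sum>a\<in>A. (b a * exp (a * p)) * (\<Sum>z\<in>R. v z * w z / (a - z)))"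
    by (subst sum.swap) (simp add: sum_distrib_left)
  also have "\<dots> = (\<Sum>a\<in>A. b a * exp (a * p) * v a / (levy_exponent P a - q))"
  proof (intro sum.cong refl)
    fix a assume a: "a \<in> A"
    have "(\<Sum>z\<in>R. v (of_real z) * of_real (w z) / (a - of_real z)) = v a / (lexp P a - of_real q)"
      using A a V by (intro exponent_partial_fractions[where V=V]) (auto simp: lden_zero_iff)
    then have "(\<Sum>z\<in>R. v z * w z / (a - z)) = v a / (levy_exponent P a - q)" by (simp add: lexp_real)
    then show "(b a * exp (a * p)) * (\<Sum>z\<in>R. v z * w z / (a - z)) = b a * exp (a * p) * v a / (levy_exponent P a - q)" by simp
  qed
  finally show ?thesis .
qed

text \<open>\<open>matching\<close> in the situation at hand: on the outer side \<open>f\<close> is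
  \<open>q * exp (c * y) - \<rho> * F y\<close>, and \<open>F\<close> is built from roots of
  \<open>G = q + \<rho>\<close>, which are reproduced because \<open>G(a) - q = \<rho>\<close>. The
  constants \<open>K\<close> belong to the middle region; expressing \<open>Phi\<close> at
  \<open>p\<close> through them adds the term with \<open>c0\<close>.\<close>

lemma matching_roots:
  assumes f: "f \<in> borel_measurable borel" "\<And>y. \<bar>f y\<bar> \<le> C * exp (c * y)" and c: "- g 1 < c" "c < \<beta> 1"
    and I: "I = {..p} \<or> I = {p..}"
    and A: "finite A" "\<And>a. a \<in> A \<Longrightarrow> a \<notin> levy_poles P \<and> levy_exponent P a = q + \<rho>" and \<rho>: "0 < \<rho>"
    and gam: "c \<notin> levy_poles P" "levy_exponent P c < q"
    and cS: "cS = q / (levy_exponent P c - (q + \<rho>))" and c0: "c0 = q / (levy_exponent P c - q)"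
    and F: "\<And>x. x \<in> I \<Longrightarrow> F x = (\<Sum>a\<in>A. u a * exp (a * x)) - cS * exp (c * x)"
    and FR: "\<And>x. F x = (LBINT y. f (x + y) * r y)"
    and fF: "\<And>x1 x2 y. x1 \<in> I \<Longrightarrow> x2 \<in> I \<Longrightarrow> x1 < y \<Longrightarrow> y < x2 \<Longrightarrow> f y = q * exp (c * y) - \<rho> * F y"
    and K: "\<And>z. z \<in> R \<Longrightarrow> Phi f z p = K z - q * exp ((c - z) * p) / (c - z)"
    and V: "degree V < sys_dim P" "\<And>x. lden P x \<noteq> 0 \<Longrightarrow> poly V x = v x * lden P x"
  shows "(\<Sum>z\<in>R. v z * (w z * K z * exp (z * p))) = (\<Sum>a\<in>A. u a * exp (a * p) * v a) + (c0 - cS) * exp (c * p) * v c"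
proof -
  have cA: "c \<notin> A" using A gam \<rho> by force
  have cR: "c \<notin> R" using gam by (auto simp: root_iff)
  have ne: "levy_exponent P c - q \<noteq> 0" "levy_exponent P c - (q + \<rho>) \<noteq> 0" using gam \<rho> by auto
  \<comment> \<open>Coefficients of \<open>f\<close> after inserting the exponential sum for
    \<open>F\<close>; the exponent \<open>c\<close> collects contributions from both of its
    parts.\<close>
  define b where "b a = (if a = c then q + \<rho> * cS else - \<rho> * u a)" for a
  have A': "finite (insert c A)" "insert c A \<inter> R = {}" "insert c A \<inter> levy_poles P = {}"
    using A gam \<rho> cR by (auto simp: root_iff)
  have convex: "y \<in> I" if "x1 \<in> I" "x2 \<in> I" "x1 < y" "y < x2" for x1 x2 y
    using I that by auto
  have piece: "exp_piece f I (insert c A) b"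
    unfolding exp_piece_def
  proof (intro ballI allI impI)
    fix x1 x2 y assume y: "x1 \<in> I" "x2 \<in> I" "x1 < y" "y < x2"
    have "(\<Sum>a\<in>A. b a * exp (a * y)) = - \<rho> * (\<Sum>a\<in>A. u a * exp (a * y))"
      using cA by (auto simp: b_def sum_distrib_left intro!: sum.cong)
    then show "f y = (\<Sum>a\<in>insert c A. b a * exp (a * y))"
      using fF[OF y] F[OF convex[OF y]] A(1) cA by (simp add: b_def algebra_simps)
  qed
  have ratio: "b a / (levy_exponent P a - q) = - u a" if "a \<in> A" for a
    using that A cA \<rho> by (auto simp: b_def)
  have ratio_c: "b c / (levy_exponent P c - q) = cS"
  proof -
    \<comment> \<open>The equation that singles out \<open>cS\<close>: with it the resolvent
      reproduces the coefficient of \<open>exp (c * x)\<close>.\<close>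
    have "q = cS * (levy_exponent P c - (q + \<rho>))" using cS ne by simp
    then have "q + \<rho> * cS = cS * (levy_exponent P c - q)" by (simp add: algebra_simps)
    then show ?thesis using ne by (simp add: b_def)
  qed
  have S: "(\<Sum>a\<in>insert c A. b a / (levy_exponent P a - q) * Y a) = cS * Y c - (\<Sum>a\<in>A. u a * Y a)" for Y
  proof -
    have "(\<Sum>a\<in>A. b a / (levy_exponent P a - q) * Y a) = (\<Sum>a\<in>A. - (u a * Y a))"
      by (intro sum.cong refl) (simp only: ratio mult_minus_left)
    then show ?thesis unfolding sum.insert[OF A(1) cA] ratio_c by (simp add: sum_negf)
  qed
  have "(LBINT y. f (x + y) * r y) = - (\<Sum>a\<in>insert c A. b a / (levy_exponent P a - q) * exp (a * x))" if "x \<in> I" for x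
    unfolding FR[symmetric] F[OF that] S by simp
  from matching[OF f c I A' piece this V]
  have "(\<Sum>z\<in>R. v z * (w z * Phi f z p * exp (z * p))) = - (\<Sum>a\<in>insert c A. b a / (levy_exponent P a - q) * (exp (a * p) * v a))"
    by (simp add: mult_ac)
  also have "\<dots> = (\<Sum>a\<in>A. u a * exp (a * p) * v a) - cS * exp (c * p) * v c"
    unfolding S by (simp add: mult.assoc)
  finally have m: "(\<Sum>z\<in>R. v z * (w z * Phi f z p * exp (z * p))) = (\<Sum>a\<in>A. u a * exp (a * p) * v a) - cS * exp (c * p) * v c" .
  have "(\<Sum>z\<in>R. v z * (w z * K z * exp (z * p))) = (\<Sum>z\<in>R. v z * (w z * Phi f z p * exp (z * p)) + q * exp (c * p) * (v z * w z / (c - z)))"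
  proof (intro sum.cong refl)
    fix z assume z: "z \<in> R"
    have e: "exp (z * p) * exp ((c - z) * p) = exp (c * p)" by (simp add: algebra_simps flip: exp_add)
    have "v z * (w z * Phi f z p * exp (z * p)) = v z * (w z * K z * exp (z * p)) - q * (exp (z * p) * exp ((c - z) * p)) * (v z * w z / (c - z))"
      unfolding K[OF z] by (simp add: left_diff_distrib right_diff_distrib mult_ac)
    then show "v z * (w z * K z * exp (z * p)) = v z * (w z * Phi f z p * exp (z * p)) + q * exp (c * p) * (v z * w z / (c - z))"
      unfolding e by simp
  qed
  also have "\<dots> = (\<Sum>z\<in>R. v z * (w z * Phi f z p * exp (z * p))) + q * exp (c * p) * (\<Sum>z\<in>R. v z * w z / (c - z))"
    by (simp add: sum.distrib sum_distrib_left)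
  also have "(\<Sum>z\<in>R. v z * w z / (c - z)) = v c / (levy_exponent P c - q)"
  proof -
    have "(\<Sum>z\<in>R. v (of_real z) * of_real (w z) / (c - of_real z)) = v c / (lexp P c - of_real q)"
      using cR gam V by (intro exponent_partial_fractions[where V=V]) (auto simp: lden_zero_iff)
    then show ?thesis by (simp add: lexp_real)
  qed
  finally show ?thesis unfolding m c0 by (simp add: left_diff_distrib)
qed

end

text \<open>A fraction among the entries cancels one factor of \<open>lden\<close>, and the entry
  \<open>a\<close> adds one degree. Hence no numerator exceeds degree \<open>m + n + 1\<close>, one
  below the number of roots, as the partial fractions require.\<close>

lemma fit_vec_poly:
  assumes i: "i < sys_dim P"
  obtains V :: "real poly" where "degree V < sys_dim P" "\<And>x. lden P x \<noteq> 0 \<Longrightarrow> poly V x = fit_vec P x $ i * lden P x"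
proof -
  let ?m = "up_num P" and ?n = "down_num P"
  define A where "A I = (\<Prod>i\<in>I. [:up_rate P i, - 1:])" for I
  define B where "B I = (\<Prod>i\<in>I. [:down_rate P i, 1:])" for I
  have dA: "degree (A I) \<le> card I" and dB: "degree (B I) \<le> card I" if "finite I" for I
    using that by (simp_all add: A_def B_def degree_prod_pCons_le)
  have pA: "poly (A I) x = (\<Prod>i\<in>I. up_rate P i - x)" and pB: "poly (B I) x = (\<Prod>i\<in>I. down_rate P i + x)" for I x
    by (simp_all add: A_def B_def poly_prod)
  have fv: "fit_vec P x $ i = ([1, x] @ map (\<lambda>i. 1 / (up_rate P i - x)) [1..<?m + 1] @ map (\<lambda>j. 1 / (down_rate P j + x)) [1..<?n + 1]) ! i" for x
    unfolding fit_vec_def vec_of_list_index ..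
  have AB: "degree (A {1..?m} * B {1..?n}) \<le> ?m + ?n"
    using dA[of "{1..?m}"] dB[of "{1..?n}"] by (intro degree_mult_le_add) auto
  consider "i = 0" | "i = 1" | k where "i = 2 + k" "k < ?m" | k where "i = 2 + ?m + k" "k < ?n"
  proof -
    have "i = 0 \<or> i = 1 \<or> (i = 2 + (i - 2) \<and> i - 2 < ?m) \<or> (i = 2 + ?m + (i - 2 - ?m) \<and> i - 2 - ?m < ?n)"
      using i by arith
    then show ?thesis using that by blast
  qed
  then show thesis
  proof cases
    case 1
    have "fit_vec P x $ i = 1" for x unfolding fv using 1 by (simp del: upt_Suc)
    moreover have "degree (A {1..?m} * B {1..?n}) < sys_dim P" using AB by simp
    ultimately show ?thesis
      by (intro that[of "A {1..?m} * B {1..?n}"]) (simp_all add: pA pB lden_def)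
  next
    case 2
    have "degree ([:0, 1:] * (A {1..?m} * B {1..?n})) \<le> 1 + (?m + ?n)"
      by (rule degree_mult_le_add[OF _ AB]) simp
    then have "degree ([:0, 1:] * (A {1..?m} * B {1..?n})) < sys_dim P" by simp
    moreover have "fit_vec P x $ i = x" for x unfolding fv using 2 by (simp del: upt_Suc)
    ultimately show ?thesis
      by (intro that[of "[:0, 1:] * (A {1..?m} * B {1..?n})"]) (simp_all add: pA pB lden_def)
  next
    case 3
    have k: "Suc k \<in> {1..?m}" using 3 by simp
    have "degree (A ({1..?m} - {Suc k}) * B {1..?n}) < sys_dim P"
      using degree_mult_le_add[OF dA[of "{1..?m} - {Suc k}"] dB[of "{1..?n}"]] k by simp
    moreover have "fit_vec P x $ i = 1 / (up_rate P (Suc k) - x)" for x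
      unfolding fv using 3 by (simp add: nth_append del: upt_Suc)
    moreover have "poly (A ({1..?m} - {Suc k}) * B {1..?n}) x = 1 / (up_rate P (Suc k) - x) * lden P x" if "lden P x \<noteq> 0" for x
    proof -
      have "up_rate P (Suc k) - x \<noteq> 0" using that k by (auto simp: lden_def)
      then show ?thesis using prod.remove[OF _ k, of "\<lambda>i. up_rate P i - x"] by (simp add: pA pB lden_def)
    qed
    ultimately show ?thesis using that[of "A ({1..?m} - {Suc k}) * B {1..?n}"] by simp
  next
    case 4
    have k: "Suc k \<in> {1..?n}" using 4 by simp
    have "degree (A {1..?m} * B ({1..?n} - {Suc k})) < sys_dim P"
      using degree_mult_le_add[OF dA[of "{1..?m}"] dB[of "{1..?n} - {Suc k}"]] k by simp
    moreover have "fit_vec P x $ i = 1 / (down_rate P (Suc k) + x)" for x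
      unfolding fv using 4 by (simp add: nth_append del: upt_Suc)
    moreover have "poly (A {1..?m} * B ({1..?n} - {Suc k})) x = 1 / (down_rate P (Suc k) + x) * lden P x" if "lden P x \<noteq> 0" for x
    proof -
      have "down_rate P (Suc k) + x \<noteq> 0" using that k by (auto simp: lden_def)
      then show ?thesis using prod.remove[OF _ k, of "\<lambda>i. down_rate P i + x"] by (simp add: pA pB lden_def)
    qed
    ultimately show ?thesis using that[of "A {1..?m} * B ({1..?n} - {Suc k})"] by simp
  qed
qed

section \<open>The discounted payoff and the linear system\<close>

lemma (in mejd_driven) payoff_eq_J:
  assumes T: "0 \<le> T" and w: "\<omega> \<in> space M"
  shows "occ_payoff (mejd_process P W N Y x) h H a b c T \<omega> = J (occ_rate h H a b) c T 0 x \<omega>"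
proof -
  have Xm: "(\<lambda>r. Xp (r, \<omega>)) \<in> borel_measurable borel"
    using measurable_compose[OF measurable_Pair[of "\<lambda>r. r" borel borel "\<lambda>_. \<omega>" M] Xp_meas] w by simp
  have int: "set_integrable lborel {0..T} (\<lambda>r. indicator A (x + Xp (r, \<omega>)) :: real)" if [measurable]: "A \<in> sets borel" for A
    unfolding set_integrable_def
  proof (rule Bochner_Integration.integrable_bound[where f="\<lambda>r. indicator {0..T} r :: real"])
    show "(\<lambda>r. indicator {0..T} r *\<^sub>R indicator A (x + Xp (r, \<omega>)) :: real) \<in> borel_measurable lborel"
      using Xm by measurable
  qed (auto simp: T split: split_indicator)
  have Xe: "(LBINT r:{0..T}. indicator A (mejd_process P W N Y x r \<omega>)) = (LBINT r:{0..T}. indicator A (x + Xp (r, \<omega>)) :: real)" for A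
    unfolding process_shift[of x] by (rule set_lebesgue_integral_cong) (auto simp: Xp_def)
  have "(LBINT r:{0..T}. occ_rate h H a b (x + Xp (r, \<omega>)))
      = a * (LBINT r:{0..T}. indicator {..h} (x + Xp (r, \<omega>))) + b * (LBINT r:{0..T}. indicator {H..} (x + Xp (r, \<omega>)))"
    unfolding occ_rate_def using int[of "{..h}"] int[of "{H..}"]
    by (subst set_integral_add(2)) auto
  then show ?thesis
    using T w by (simp add: occ_payoff_def J_def Xe process_shift[of x T] Xp_def X_0)
qed

text \<open>The extended integral is converted into nested Bochner integrals, together with the
  integrability that gives these their meaning.\<close>

lemma (in mejd_driven) laplace_payoff:
  assumes ab: "0 \<le> a" "0 \<le> b" and r: "mejd_roots P q \<beta> g" "- g 1 < c" "c < \<beta> 1" and al: "0 < \<alpha>"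
    and F: "payoff_transform (occ_rate h H a b) \<alpha> c x = ennreal F" "0 \<le> F"
  defines "p \<equiv> occ_payoff (mejd_process P W N Y x) h H a b c"
  shows "0 \<le> T \<Longrightarrow> integrable M (p T)"
    and "set_integrable lborel {0..} (\<lambda>T. \<alpha> * exp (- \<alpha> * T) * expectation (p T))"
    and "(LBINT T:{0..}. \<alpha> * exp (- \<alpha> * T) * expectation (p T)) = F"
proof -
  let ?k = "occ_rate h H a b"
  have km [measurable]: "?k \<in> borel_measurable borel" by measurable
  have p_J: "p T \<omega> = J ?k c T 0 x \<omega>" if "0 \<le> T" "\<omega> \<in> space M" for T \<omega>
    unfolding p_def by (rule payoff_eq_J[OF that])
  have k0: "0 \<le> ?k y" for y using ab by (auto simp: occ_rate_def)
  have Jint: "integrable M (\<lambda>\<omega>. J ?k c T 0 x \<omega>)" if T: "0 \<le> T" for T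
  proof (rule integrableI_bounded)
    show "(\<lambda>\<omega>. J ?k c T 0 x \<omega>) \<in> borel_measurable M" by measurable
    have "(\<integral>\<^sup>+\<omega>. ennreal (norm (J ?k c T 0 x \<omega>)) \<partial>M) \<le> (\<integral>\<^sup>+\<omega>. ennreal (exp (c * x)) * ennreal (exp (c * X T \<omega>)) \<partial>M)"
    proof (rule nn_integral_mono)
      fix \<omega> assume w: "\<omega> \<in> space M"
      have "J ?k c T 0 x \<omega> \<le> exp (c * x) * exp (c * X T \<omega>)"
        using J_le[of ?k c T 0 x \<omega>, OF k0] T w by (simp add: Xp_def X_0 distrib_left exp_add)
      moreover have "0 \<le> J ?k c T 0 x \<omega>" by (simp add: J_def)
      ultimately show "ennreal (norm (J ?k c T 0 x \<omega>)) \<le> ennreal (exp (c * x)) * ennreal (exp (c * X T \<omega>))"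
        by (simp add: ennreal_mult[symmetric] ennreal_leI)
    qed
    also have "\<dots> < \<infinity>"
      using exp_moment_finite(2)[OF r T] X_meas[OF T]
      by (subst nn_integral_cmult) (auto simp: ennreal_mult_less_top)
    finally show "(\<integral>\<^sup>+\<omega>. ennreal (norm (J ?k c T 0 x \<omega>)) \<partial>M) < \<infinity>" .
  qed
  show "integrable M (p T)" if "0 \<le> T" for T
    using Jint[OF that] p_J[OF that] by (subst Bochner_Integration.integrable_cong[OF refl]) auto
  define E where "E T = indicator {0..} T *\<^sub>R (\<alpha> * exp (- \<alpha> * T) * expectation (p T))" for T
  have E0: "0 \<le> E T" for T
    using al by (auto simp: E_def p_def occ_payoff_def intro!: mult_nonneg_nonneg integral_nonneg_AE split: split_indicator)
  have E: "indicator {0..} T * (ennreal (\<alpha> * exp (- \<alpha> * T)) * U ?k c T x) = ennreal (E T)" for T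
  proof (cases "0 \<le> T")
    case True
    have "U ?k c T x = ennreal (expectation (J ?k c T 0 x))"
      unfolding U_def by (rule nn_integral_eq_integral[OF Jint[OF True]]) (simp add: J_def)
    also have "expectation (J ?k c T 0 x) = expectation (p T)"
      by (rule Bochner_Integration.integral_cong) (simp_all add: p_J True)
    finally show ?thesis using True al by (simp add: E_def ennreal_mult')
  qed (simp add: E_def)
  \<comment> \<open>Measurability of the expectation in \<open>T\<close> is inherited from the
    jointly measurable \<open>U\<close>.\<close>
  have "(\<lambda>T. enn2real (indicator {0..} T * (ennreal (\<alpha> * exp (- \<alpha> * T)) * U ?k c T x))) \<in> borel_measurable lborel"
    by measurable
  then have Em: "E \<in> borel_measurable lborel" unfolding E using E0 by simp
  have "(\<integral>\<^sup>+T. ennreal (E T) \<partial>lborel) = ennreal F"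
    using F(1) unfolding payoff_transform_def E .
  then have "has_bochner_integral lborel E F"
    using E0 F(2) Em by (intro has_bochner_integral_nn_integral) auto
  then show "set_integrable lborel {0..} (\<lambda>T. \<alpha> * exp (- \<alpha> * T) * expectation (p T))"
    and "(LBINT T:{0..}. \<alpha> * exp (- \<alpha> * T) * expectation (p T)) = F"
    unfolding E_def set_integrable_def set_lebesgue_integral_def has_bochner_integral_iff by auto
qed

section \<open>Rows of the linear system\<close>

lemma dim_fit_vec [simp]: "dim_vec (fit_vec P a) = sys_dim P"
  by (simp add: fit_vec_def)

lemma mat_of_cols_mult_vec_of_list:
  fixes xs :: "real list"
  assumes "length cs = length xs" "i < n"
  shows "(mat_of_cols n cs *\<^sub>v vec_of_list xs) $ i = (\<Sum>p\<leftarrow>zip cs xs. snd p * fst p $ i)"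
proof -
  have "(mat_of_cols n cs *\<^sub>v vec_of_list xs) $ i = (\<Sum>j = 0..<length xs. cs ! j $ i * xs ! j)"
    using assms by (simp add: scalar_prod_def vec_of_list_index mat_of_cols_index)
  then show ?thesis using assms
    by (subst sum_list_sum_nth) (auto simp: mult.commute intro!: sum.cong)
qed

lemma diag_of_list_mult_vec:
  assumes "length ds = length xs"
  shows "diag_of_list ds *\<^sub>v vec_of_list xs = vec_of_list (map2 (*) ds xs)"
proof (rule eq_vecI)
  fix i assume "i < dim_vec (vec_of_list (map2 (*) ds xs))"
  then have i: "i < length xs" by (simp add: assms)
  then have "(diag_of_list ds *\<^sub>v vec_of_list xs) $ i = (\<Sum>j = 0..<length xs. (if i = j then ds ! j else 0) * xs ! j)"
    by (simp add: diag_of_list_def mat_diag_def scalar_prod_def vec_of_list_index assms)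
  also have "\<dots> = (\<Sum>j = 0..<length xs. if i = j then ds ! j * xs ! j else 0)"
    by (intro sum.cong) auto
  also have "\<dots> = ds ! i * xs ! i" using i by simp
  finally show "(diag_of_list ds *\<^sub>v vec_of_list xs) $ i = vec_of_list (map2 (*) ds xs) $ i"
    using i assms by (simp add: vec_of_list_index)
qed (simp add: assms diag_of_list_def mat_diag_def)

lemma vec_of_list_append: "vec_of_list (xs @ ys) = vec_of_list xs @\<^sub>v vec_of_list ys"
  by (rule eq_vecI) (auto simp: vec_of_list_index nth_append)

lemma sum_list_zip_upt:
  fixes f :: "nat \<Rightarrow> real" and c :: "nat \<Rightarrow> real Matrix.vec"
  shows "(\<Sum>p\<leftarrow>zip (map c [1..<n + 2]) (map f [1..<n + 2]). snd p * fst p $ i) = (\<Sum>k=1..n + 1. f k * c k $ i)"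
proof -
  have "zip (map c [1..<n + 2]) (map f [1..<n + 2]) = map (\<lambda>k. (c k, f k)) [1..<n + 2]"
    by (simp add: zip_map_map zip_same_conv_map del: upt_Suc)
  then show ?thesis
    by (simp add: comp_def interv_sum_list_conv_sum_set_nat atLeastLessThanSuc_atLeastAtMost del: upt_Suc)
qed

text \<open>Reduction of the block system to scalar equations. Each middle coefficient is normalised
  at one barrier; \<open>Z_beta\<close> and \<open>Z_gamma\<close> supply the exponential by which
  its term has changed at the other one.\<close>

lemma B_mat_system:
  fixes \<omega>L \<omega>0 \<nu>0 \<nu>U \<beta>L \<beta>0 \<gamma>0 \<gamma>U :: "nat \<Rightarrow> real"
  assumes row_h: "\<And>i. i < sys_dim P \<Longrightarrow>
      (\<Sum>k=1..up_num P + 1. \<omega>L k * fit_vec P (\<beta>L k) $ i) + (\<Sum>j=1..down_num P + 1. \<nu>0 j * fit_vec P (- \<gamma>0 j) $ i)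
        + (\<Sum>k=1..up_num P + 1. exp (\<beta>0 k * (h - H)) * \<omega>0 k * fit_vec P (\<beta>0 k) $ i)
      = (cL - c0) * exp (\<gamma> * h) * fit_vec P \<gamma> $ i"
    and row_H: "\<And>i. i < sys_dim P \<Longrightarrow>
      (\<Sum>j=1..down_num P + 1. exp (\<gamma>0 j * (h - H)) * \<nu>0 j * fit_vec P (- \<gamma>0 j) $ i)
        + (\<Sum>j=1..down_num P + 1. \<nu>U j * fit_vec P (- \<gamma>U j) $ i) + (\<Sum>k=1..up_num P + 1. \<omega>0 k * fit_vec P (\<beta>0 k) $ i)
      = (cU - c0) * exp (\<gamma> * H) * fit_vec P \<gamma> $ i"
  shows "B_mat P h H \<beta>L \<beta>0 \<gamma>0 \<gamma>U *\<^sub>v coeff_vec P \<omega>L \<omega>0 \<nu>0 \<nu>U = V_vec P h H \<gamma> cL c0 cU"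
proof -
  let ?m = "up_num P" and ?n = "down_num P" and ?d = "sys_dim P"
  let ?M = "M_mat P \<beta>L \<gamma>0" and ?N = "N_mat P \<beta>0 \<gamma>U" and ?Zb = "Z_beta P h H \<beta>0" and ?Zg = "Z_gamma P h H \<gamma>0"
  let ?up = "\<lambda>f :: nat \<Rightarrow> real. map f [1..<?m + 2]" and ?dn = "\<lambda>f :: nat \<Rightarrow> real. map f [1..<?n + 2]"
  let ?a = "?up \<omega>L @ ?dn \<nu>0" and ?b = "?dn \<nu>U @ ?up \<omega>0"
  have c: "?M \<in> carrier_mat ?d ?d" "?N \<in> carrier_mat ?d ?d" "?Zb \<in> carrier_mat ?d ?d" "?Zg \<in> carrier_mat ?d ?d"
    "vec_of_list ?a \<in> carrier_vec ?d" "vec_of_list ?b \<in> carrier_vec ?d"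
    by (intro carrier_matI carrier_vecI;
        simp add: M_mat_def N_mat_def Z_beta_def Z_gamma_def diag_of_list_def mat_diag_def del: upt_Suc vec_of_list_map)+
  have M: "(?M *\<^sub>v vec_of_list (?up f @ ?dn g)) $ i
      = (\<Sum>k=1..?m + 1. f k * fit_vec P (\<beta>L k) $ i) + (\<Sum>j=1..?n + 1. g j * fit_vec P (- \<gamma>0 j) $ i)" if "i < ?d" for f g i
    unfolding M_mat_def using that
    by (subst mat_of_cols_mult_vec_of_list) (simp_all only: zip_append length_map length_upt length_append sum_list_append map_append sum_list_zip_upt)
  have N: "(?N *\<^sub>v vec_of_list (?dn g @ ?up f)) $ i
      = (\<Sum>j=1..?n + 1. g j * fit_vec P (- \<gamma>U j) $ i) + (\<Sum>k=1..?m + 1. f k * fit_vec P (\<beta>0 k) $ i)" if "i < ?d" for f g i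
    unfolding N_mat_def using that
    by (subst mat_of_cols_mult_vec_of_list) (simp_all only: zip_append length_map length_upt length_append sum_list_append map_append sum_list_zip_upt)
  \<comment> \<open>The zero block of a diagonal is written over the same index range as the
    coefficients it meets, so that both lists have the same block structure.\<close>
  have rep: "replicate (k + 1) 0 = map (\<lambda>_. 0 :: real) [1..<k + 2]" for k
    by (simp add: map_replicate_const del: upt_Suc)
  have mul: "map2 (*) (map f [1..<k]) (map g [1..<k]) = map (\<lambda>i. f i * g i) [1..<k]" for f g :: "nat \<Rightarrow> real" and k
    by (simp add: zip_map_map zip_same_conv_map del: upt_Suc)
  have Zb: "?Zb *\<^sub>v vec_of_list ?b = vec_of_list (?dn (\<lambda>j. 0) @ ?up (\<lambda>k. exp (\<beta>0 k * (h - H)) * \<omega>0 k))"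
    unfolding Z_beta_def rep
    by (subst diag_of_list_mult_vec) (simp_all only: zip_append length_map length_upt length_append map_append mul mult_zero_left)
  have Zg: "?Zg *\<^sub>v vec_of_list ?a = vec_of_list (?up (\<lambda>j. 0) @ ?dn (\<lambda>j. exp (\<gamma>0 j * (h - H)) * \<nu>0 j))"
    unfolding Z_gamma_def rep
    by (subst diag_of_list_mult_vec) (simp_all only: zip_append length_map length_upt length_append map_append mul mult_zero_left)
  have "coeff_vec P \<omega>L \<omega>0 \<nu>0 \<nu>U = vec_of_list ?a @\<^sub>v vec_of_list ?b"
    by (simp only: coeff_vec_def append_assoc flip: vec_of_list_append)
  then have "B_mat P h H \<beta>L \<beta>0 \<gamma>0 \<gamma>U *\<^sub>v coeff_vec P \<omega>L \<omega>0 \<nu>0 \<nu>U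
      = (?M *\<^sub>v vec_of_list ?a + (?N * ?Zb) *\<^sub>v vec_of_list ?b) @\<^sub>v ((?M * ?Zg) *\<^sub>v vec_of_list ?a + ?N *\<^sub>v vec_of_list ?b)"
    unfolding B_mat_def using c(1-4)
    by (simp only: four_block_mat_mult_vec[OF c(1) mult_carrier_mat[OF c(2,3)] mult_carrier_mat[OF c(1,4)] c(2,5,6)])
  also have "(?N * ?Zb) *\<^sub>v vec_of_list ?b = ?N *\<^sub>v (?Zb *\<^sub>v vec_of_list ?b)"
    using c by (intro assoc_mult_mat_vec)
  also have "(?M * ?Zg) *\<^sub>v vec_of_list ?a = ?M *\<^sub>v (?Zg *\<^sub>v vec_of_list ?a)"
    using c by (intro assoc_mult_mat_vec)
  also have "?M *\<^sub>v vec_of_list ?a + ?N *\<^sub>v (?Zb *\<^sub>v vec_of_list ?b) = ((cL - c0) * exp (\<gamma> * h)) \<cdot>\<^sub>v fit_vec P \<gamma>"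
  proof (rule eq_vecI)
    fix i assume "i < dim_vec (((cL - c0) * exp (\<gamma> * h)) \<cdot>\<^sub>v fit_vec P \<gamma>)"
    then have i: "i < ?d" by simp
    have "(?M *\<^sub>v vec_of_list ?a + ?N *\<^sub>v (?Zb *\<^sub>v vec_of_list ?b)) $ i
        = (?M *\<^sub>v vec_of_list ?a) $ i + (?N *\<^sub>v (?Zb *\<^sub>v vec_of_list ?b)) $ i"
      using i c by (intro index_add_vec) auto
    then show "(?M *\<^sub>v vec_of_list ?a + ?N *\<^sub>v (?Zb *\<^sub>v vec_of_list ?b)) $ i = (((cL - c0) * exp (\<gamma> * h)) \<cdot>\<^sub>v fit_vec P \<gamma>) $ i"
      unfolding Zb M[OF i] N[OF i] using row_h[OF i] i by simp
  qed (use c in auto)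
  also have "?M *\<^sub>v (?Zg *\<^sub>v vec_of_list ?a) + ?N *\<^sub>v vec_of_list ?b = ((cU - c0) * exp (\<gamma> * H)) \<cdot>\<^sub>v fit_vec P \<gamma>"
  proof (rule eq_vecI)
    fix i assume "i < dim_vec (((cU - c0) * exp (\<gamma> * H)) \<cdot>\<^sub>v fit_vec P \<gamma>)"
    then have i: "i < ?d" by simp
    have "(?M *\<^sub>v (?Zg *\<^sub>v vec_of_list ?a) + ?N *\<^sub>v vec_of_list ?b) $ i
        = (?M *\<^sub>v (?Zg *\<^sub>v vec_of_list ?a)) $ i + (?N *\<^sub>v vec_of_list ?b) $ i"
      using i c by (intro index_add_vec) auto
    then show "(?M *\<^sub>v (?Zg *\<^sub>v vec_of_list ?a) + ?N *\<^sub>v vec_of_list ?b) $ i = (((cU - c0) * exp (\<gamma> * H)) \<cdot>\<^sub>v fit_vec P \<gamma>) $ i"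
      unfolding Zg M[OF i] N[OF i] using row_H[OF i] i by simp
  qed (use c in auto)
  finally show ?thesis by (simp only: V_vec_def)
qed

section \<open>Solutions in the three regions and their matching\<close>

lemma exp_decay:
  fixes s :: real
  assumes "s < 0"
  shows "(\<lambda>n. exp (s * real n)) \<longlonglongrightarrow> 0"
  using LIMSEQ_power_zero[of "exp s"] assms by (simp add: exp_of_nat2_mult)

context mejd_roots
begin

text \<open>Far to the left, \<open>Phi\<close> at a negative root vanishes, and so does the
  particular term because \<open>c\<close> exceeds that root. The constant of the homogeneous term
  is therefore 0, and only positive roots survive.\<close>

lemma resolvent_left_tail:
  assumes f: "f \<in> borel_measurable borel" "\<And>y. \<bar>f y\<bar> \<le> C * exp (c * y)" and c: "- g 1 < c" "c < \<beta> 1"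
    and gam: "c \<notin> levy_poles P" "levy_exponent P c < q"
    and p: "\<And>y. y < p \<Longrightarrow> f y = \<alpha> * exp (c * y)"
  obtains u where "\<And>x. x \<le> p \<Longrightarrow> (LBINT y. f (x + y) * r y)
      = (\<Sum>i=1..up_num P + 1. u (\<beta> i) * exp (\<beta> i * x)) - \<alpha> / (levy_exponent P c - q) * exp (c * x)"
proof -
  have A: "finite {c}" "{c} \<inter> R = {}" "{c} \<inter> levy_poles P = {}" using gam by (auto simp: root_iff)
  have "exp_piece f {..p} {c} (\<lambda>_. \<alpha>)" unfolding exp_piece_def using p by auto
  from resolvent_piece[OF f c A _ this, of p]
  obtain K where K: "\<And>z x. z \<in> R \<Longrightarrow> x \<le> p \<Longrightarrow> Phi f z x = K z - \<alpha> * exp ((c - z) * x) / (c - z)"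
    and L: "\<And>x. x \<le> p \<Longrightarrow> (LBINT y. f (x + y) * r y) = (\<Sum>z\<in>R. w z * K z * exp (z * x)) - \<alpha> / (levy_exponent P c - q) * exp (c * x)"
    by auto
  have "K (- g j) = 0" if j: "j \<in> {1..down_num P + 1}" for j
  proof -
    have z: "- g j \<in> R" "- g j < 0" "0 < c + g j"
      using j g_pos[of j] g_ge[of j] c by (auto simp: roots_set_def)
    \<comment> \<open>With the particular term added back, the sequence is eventually the constant
      \<open>K (- g j)\<close>, which must then equal the limit 0.\<close>
    have "(\<lambda>n. Phi f (- g j) (- real n) + \<alpha> / (c + g j) * exp (- (c + g j) * real n)) \<longlonglongrightarrow> 0 + \<alpha> / (c + g j) * 0"
      using z by (intro tendsto_intros Phi_lim(2)[OF f c] exp_decay) auto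
    moreover have "\<forall>\<^sub>F n in sequentially. Phi f (- g j) (- real n) + \<alpha> / (c + g j) * exp (- (c + g j) * real n) = K (- g j)"
      using eventually_ge_at_top[of "nat \<lceil>- p\<rceil>"]
    proof eventually_elim
      case (elim n)
      then have "- real n \<le> p" by linarith
      moreover have e: "(c + g j) * - real n = - (c + g j) * real n" by (simp add: algebra_simps)
      ultimately have "Phi f (- g j) (- real n) = K (- g j) - \<alpha> * exp (- (c + g j) * real n) / (c + g j)"
        using K[OF z(1), of "- real n"] unfolding diff_minus_eq_add e by blast
      then show ?case by simp
    qed
    ultimately have "(\<lambda>n::nat. K (- g j)) \<longlonglongrightarrow> 0 + \<alpha> / (c + g j) * 0" by (rule Lim_transform_eventually)
    then show ?thesis by (simp add: LIMSEQ_const_iff)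
  qed
  then show thesis by (intro that[of "\<lambda>z. w z * K z"]) (simp add: L sum_R)
qed

text \<open>Mirror image of \<open>resolvent_left_tail\<close>: \<open>c\<close> lies below every
  positive root, so these drop out far to the right.\<close>

lemma resolvent_right_tail:
  assumes f: "f \<in> borel_measurable borel" "\<And>y. \<bar>f y\<bar> \<le> C * exp (c * y)" and c: "- g 1 < c" "c < \<beta> 1"
    and gam: "c \<notin> levy_poles P" "levy_exponent P c < q"
    and p: "\<And>y. p < y \<Longrightarrow> f y = \<alpha> * exp (c * y)"
  obtains u where "\<And>x. p \<le> x \<Longrightarrow> (LBINT y. f (x + y) * r y)
      = (\<Sum>j=1..down_num P + 1. u (- g j) * exp (- g j * x)) - \<alpha> / (levy_exponent P c - q) * exp (c * x)"
proof -
  have A: "finite {c}" "{c} \<inter> R = {}" "{c} \<inter> levy_poles P = {}" using gam by (auto simp: root_iff)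
  have "exp_piece f {p..} {c} (\<lambda>_. \<alpha>)" unfolding exp_piece_def using p by auto
  from resolvent_piece[OF f c A _ this, of p]
  obtain K where K: "\<And>z x. z \<in> R \<Longrightarrow> p \<le> x \<Longrightarrow> Phi f z x = K z - \<alpha> * exp ((c - z) * x) / (c - z)"
    and L: "\<And>x. p \<le> x \<Longrightarrow> (LBINT y. f (x + y) * r y) = (\<Sum>z\<in>R. w z * K z * exp (z * x)) - \<alpha> / (levy_exponent P c - q) * exp (c * x)"
    by auto
  have "K (\<beta> i) = 0" if i: "i \<in> {1..up_num P + 1}" for i
  proof -
    have z: "\<beta> i \<in> R" "0 < \<beta> i" "c - \<beta> i < 0"
      using i beta_pos[of i] beta_ge[of i] c by (auto simp: roots_set_def)
    have "(\<lambda>n. Phi f (\<beta> i) (real n) + \<alpha> / (c - \<beta> i) * exp ((c - \<beta> i) * real n)) \<longlonglongrightarrow> 0 + \<alpha> / (c - \<beta> i) * 0"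
      using z by (intro tendsto_intros Phi_lim(1)[OF f c] exp_decay) auto
    moreover have "\<forall>\<^sub>F n in sequentially. Phi f (\<beta> i) (real n) + \<alpha> / (c - \<beta> i) * exp ((c - \<beta> i) * real n) = K (\<beta> i)"
      using eventually_ge_at_top[of "nat \<lceil>p\<rceil>"]
    proof eventually_elim
      case (elim n)
      then have "p \<le> real n" by linarith
      then show ?case using K[OF z(1)] by simp
    qed
    ultimately have "(\<lambda>n::nat. K (\<beta> i)) \<longlonglongrightarrow> 0 + \<alpha> / (c - \<beta> i) * 0" by (rule Lim_transform_eventually)
    then show ?thesis by (simp add: LIMSEQ_const_iff)
  qed
  then show thesis by (intro that[of "\<lambda>z. w z * K z"]) (simp add: L sum_R)
qed

end

text \<open>No probability is left here: \<open>F\<close> is a measurable function of exponential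
  growth that satisfies three resolvent equations. Each describes one region, and the one with
  \<open>d = 0\<close> is also evaluated at both barriers, which couples the regions.\<close>

lemma piecewise_solution:
  fixes F :: "real \<Rightarrow> real" and h H \<rho>1 \<rho>2 :: real
  assumes r0: "mejd_roots P \<alpha> \<beta>0 g0" and rL: "mejd_roots P (\<alpha> + \<rho>1) \<beta>L gL" and rU: "mejd_roots P (\<alpha> + \<rho>2) \<beta>U gU"
    and hH: "h < H" and \<rho>: "0 < \<rho>1" "0 < \<rho>2"
    and c: "0 \<le> c" "c < \<beta>0 1" "c < \<beta>L 1" "c < \<beta>U 1" "c \<notin> levy_poles P" "levy_exponent P c < \<alpha>"
    and F: "F \<in> borel_measurable borel" "\<And>x. 0 \<le> F x \<and> F x \<le> K * exp (c * x)"
    and eq: "\<And>d \<beta> g x. d \<in> {0, \<rho>1, \<rho>2} \<Longrightarrow> mejd_roots P (\<alpha> + d) \<beta> g \<Longrightarrow> c < \<beta> 1 \<Longrightarrow>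
      F x = (LBINT y. (\<alpha> * exp (c * (x + y)) + (d - occ_rate h H \<rho>1 \<rho>2 (x + y)) * F (x + y))
        * res_density (roots_set P \<beta> g) (rweight P (\<alpha> + d) (roots_set P \<beta> g)) y)"
  defines "cL \<equiv> \<alpha> / (levy_exponent P c - (\<alpha> + \<rho>1))" and "c0 \<equiv> \<alpha> / (levy_exponent P c - \<alpha>)"
    and "cU \<equiv> \<alpha> / (levy_exponent P c - (\<alpha> + \<rho>2))"
  obtains \<omega>L \<omega>0 \<nu>0 \<nu>U :: "nat \<Rightarrow> real" where
    "\<And>x. F x = (if x \<le> h then (\<Sum>i=1..up_num P + 1. \<omega>L i * exp (\<beta>L i * (x - h))) - cL * exp (c * x)
            else if x < H then - (\<Sum>i=1..up_num P + 1. \<omega>0 i * exp (\<beta>0 i * (x - H)))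
              - (\<Sum>j=1..down_num P + 1. \<nu>0 j * exp (- g0 j * (x - h))) - c0 * exp (c * x)
            else (\<Sum>j=1..down_num P + 1. \<nu>U j * exp (- gU j * (x - H))) - cU * exp (c * x))"
    and "B_mat P h H \<beta>L \<beta>0 g0 gU *\<^sub>v coeff_vec P \<omega>L \<omega>0 \<nu>0 \<nu>U = V_vec P h H c cL c0 cU"
proof -
  interpret R0: mejd_roots P \<alpha> \<beta>0 g0 by fact
  interpret RL: mejd_roots P "\<alpha> + \<rho>1" \<beta>L gL by fact
  interpret RU: mejd_roots P "\<alpha> + \<rho>2" \<beta>U gU by fact
  let ?m = "up_num P" and ?n = "down_num P"
  have cg: "- g0 1 < c" "- gL 1 < c" "- gU 1 < c"
    using c(1) R0.g_pos[of 1] RL.g_pos[of 1] RU.g_pos[of 1] by auto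
  define k where "k = occ_rate h H \<rho>1 \<rho>2"
  have [measurable]: "k \<in> borel_measurable borel" unfolding k_def by measurable
  have k: "y < H \<Longrightarrow> h < y \<Longrightarrow> k y = 0" "y \<le> h \<Longrightarrow> k y = \<rho>1" "H \<le> y \<Longrightarrow> k y = \<rho>2" for y
    using hH by (auto simp: k_def occ_rate_def)
  have k_le: "\<bar>k y\<bar> \<le> \<rho>1 + \<rho>2" for y
    using k[of y] \<rho> by linarith
  define f where "f d y = \<alpha> * exp (c * y) + (d - k y) * F y" for d y
  have fm: "f d \<in> borel_measurable borel" for d unfolding f_def[abs_def] using F(1) by measurable
  have fb: "\<bar>f d y\<bar> \<le> (\<alpha> + (\<bar>d\<bar> + \<rho>1 + \<rho>2) * K) * exp (c * y)" for d y
  proof -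
    have "\<bar>d - k y\<bar> * \<bar>F y\<bar> \<le> (\<bar>d\<bar> + \<rho>1 + \<rho>2) * (K * exp (c * y))"
      using k_le[of y] F(2)[of y] by (intro mult_mono) auto
    moreover have "\<bar>f d y\<bar> \<le> \<alpha> * exp (c * y) + \<bar>d - k y\<bar> * \<bar>F y\<bar>"
      unfolding f_def using R0.q_pos by (auto simp: abs_mult intro!: order_trans[OF abs_triangle_ineq])
    ultimately show ?thesis by (simp add: algebra_simps)
  qed
  have Feq: "F x = (LBINT y. f 0 (x + y) * R0.r y)" "F x = (LBINT y. f \<rho>1 (x + y) * RL.r y)"
    "F x = (LBINT y. f \<rho>2 (x + y) * RU.r y)" for x
    using eq[of 0 \<beta>0 g0 x] eq[of \<rho>1 \<beta>L gL x] eq[of \<rho>2 \<beta>U gU x] r0 rL rU c by (simp_all add: f_def k_def)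
  have levy: "levy_exponent P c < \<alpha> + \<rho>1" "levy_exponent P c < \<alpha> + \<rho>2" using c \<rho> by auto
  have tails: "y < h \<Longrightarrow> f \<rho>1 y = \<alpha> * exp (c * y)" "H < y \<Longrightarrow> f \<rho>2 y = \<alpha> * exp (c * y)" for y
    by (simp_all add: f_def k)
  obtain uL where uL: "\<And>x. x \<le> h \<Longrightarrow> F x = (\<Sum>i=1..?m + 1. uL (\<beta>L i) * exp (\<beta>L i * x)) - cL * exp (c * x)"
    using RL.resolvent_left_tail[OF fm fb cg(2) c(3,5) levy(1) tails(1)]
    unfolding Feq(2)[symmetric] cL_def[symmetric] by blast
  obtain uU where uU: "\<And>x. H \<le> x \<Longrightarrow> F x = (\<Sum>j=1..?n + 1. uU (- gU j) * exp (- gU j * x)) - cU * exp (c * x)"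
    using RU.resolvent_right_tail[OF fm fb cg(3) c(4,5) levy(2) tails(2)]
    unfolding Feq(3)[symmetric] cU_def[symmetric] by blast
  have A: "finite {c}" "{c} \<inter> R0.R = {}" "{c} \<inter> levy_poles P = {}" using c by (auto simp: R0.root_iff)
  have "exp_piece (f 0) {h..H} {c} (\<lambda>_. \<alpha>)" unfolding exp_piece_def by (auto simp: f_def k)
  from R0.resolvent_piece[OF fm fb cg(1) c(2) A _ this, of h]
  obtain K0 where K0: "\<And>z x. z \<in> R0.R \<Longrightarrow> x \<in> {h..H} \<Longrightarrow> Phi (f 0) z x = K0 z - \<alpha> * exp ((c - z) * x) / (c - z)"
    and F0: "\<And>x. x \<in> {h..H} \<Longrightarrow> F x = (\<Sum>z\<in>R0.R. R0.w z * K0 z * exp (z * x)) - c0 * exp (c * x)"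
    unfolding Feq(1)[symmetric] c0_def using hH by auto
  \<comment> \<open>Every term is normalised at a barrier: the lower and the decaying middle terms
    at \<open>h\<close>, the upper and the growing middle terms at \<open>H\<close>. The minus signs
    follow the form of the middle expression in the theorem.\<close>
  define \<omega>L where "\<omega>L i = uL (\<beta>L i) * exp (\<beta>L i * h)" for i
  define \<nu>U where "\<nu>U j = uU (- gU j) * exp (- gU j * H)" for j
  define \<omega>0 where "\<omega>0 i = - (R0.w (\<beta>0 i) * K0 (\<beta>0 i) * exp (\<beta>0 i * H))" for i
  define \<nu>0 where "\<nu>0 j = - (R0.w (- g0 j) * K0 (- g0 j) * exp (- g0 j * h))" for j
  show thesis
  proof (rule that)
    fix x
    consider "x \<le> h" | "h < x" "x < H" | "H \<le> x" by linarith
    then show "F x = (if x \<le> h then (\<Sum>i=1..?m + 1. \<omega>L i * exp (\<beta>L i * (x - h))) - cL * exp (c * x)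
            else if x < H then - (\<Sum>i=1..?m + 1. \<omega>0 i * exp (\<beta>0 i * (x - H)))
              - (\<Sum>j=1..?n + 1. \<nu>0 j * exp (- g0 j * (x - h))) - c0 * exp (c * x)
            else (\<Sum>j=1..?n + 1. \<nu>U j * exp (- gU j * (x - H))) - cU * exp (c * x))"
    proof cases
      case 1
      have "\<omega>L i * exp (\<beta>L i * (x - h)) = uL (\<beta>L i) * exp (\<beta>L i * x)" for i
        by (simp add: \<omega>L_def right_diff_distrib exp_diff)
      then show ?thesis using 1 uL[OF 1] by simp
    next
      case 2
      have "\<omega>0 i * exp (\<beta>0 i * (x - H)) = - (R0.w (\<beta>0 i) * K0 (\<beta>0 i) * exp (\<beta>0 i * x))"
        and "\<nu>0 i * exp (- g0 i * (x - h)) = - (R0.w (- g0 i) * K0 (- g0 i) * exp (- g0 i * x))" for i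
        by (simp_all add: \<omega>0_def \<nu>0_def mult.assoc right_diff_distrib flip: exp_add)
      then show ?thesis using 2 F0[of x] by (simp add: R0.sum_R sum_negf)
    next
      case 3
      have "\<nu>U i * exp (- gU i * (x - H)) = uU (- gU i) * exp (- gU i * x)" for i
        by (simp add: \<nu>U_def mult.assoc right_diff_distrib flip: exp_add)
      then show ?thesis using 3 uU[OF 3] hH by simp
    qed
  next
    \<comment> \<open>The constants \<open>K0\<close> come from the middle region and are tested at
      \<open>h\<close> against the lower expression; the same constants reappear at
      \<open>H\<close>.\<close>
    have jump_h: "(\<Sum>z\<in>R0.R. v z * (R0.w z * K0 z * exp (z * h)))
        = (\<Sum>i=1..?m + 1. \<omega>L i * v (\<beta>L i)) + (c0 - cL) * exp (c * h) * v c"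
      if V: "degree V < sys_dim P" "\<And>x. lden P x \<noteq> 0 \<Longrightarrow> poly V x = v x * lden P x" for v V
    proof -
      have re: "(\<Sum>a\<in>\<beta>L ` {1..?m + 1}. s a) = (\<Sum>i=1..?m + 1. s (\<beta>L i))" for s :: "real \<Rightarrow> real"
        using RL.beta_inj by (simp add: sum.reindex)
      have "(\<Sum>z\<in>R0.R. v z * (R0.w z * K0 z * exp (z * h)))
          = (\<Sum>a\<in>\<beta>L ` {1..?m + 1}. uL a * exp (a * h) * v a) + (c0 - cL) * exp (c * h) * v c"
      proof (rule R0.matching_roots[OF fm fb cg(1) c(2) _ _ _ \<rho>(1) c(5,6) cL_def[THEN meta_eq_to_obj_eq] c0_def[THEN meta_eq_to_obj_eq] _ Feq(1) _ _ V])
        show "F x = (\<Sum>a\<in>\<beta>L ` {1..?m + 1}. uL a * exp (a * x)) - cL * exp (c * x)" if "x \<in> {..h}" for x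
          unfolding re using uL that by simp
        show "a \<notin> levy_poles P \<and> levy_exponent P a = \<alpha> + \<rho>1" if "a \<in> \<beta>L ` {1..?m + 1}" for a
          using that by (subst RL.root_iff[symmetric]) (auto simp: roots_set_def)
        show "Phi (f 0) z h = K0 z - \<alpha> * exp ((c - z) * h) / (c - z)" if "z \<in> R0.R" for z
          using K0[OF that] hH by simp
      qed (auto simp: f_def k)
      then show ?thesis unfolding re \<omega>L_def .
    qed
    have jump_H: "(\<Sum>z\<in>R0.R. v z * (R0.w z * K0 z * exp (z * H)))
        = (\<Sum>j=1..?n + 1. \<nu>U j * v (- gU j)) + (c0 - cU) * exp (c * H) * v c"
      if V: "degree V < sys_dim P" "\<And>x. lden P x \<noteq> 0 \<Longrightarrow> poly V x = v x * lden P x" for v V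
    proof -
      have re: "(\<Sum>a\<in>(\<lambda>j. - gU j) ` {1..?n + 1}. s a) = (\<Sum>i=1..?n + 1. s (- gU i))" for s :: "real \<Rightarrow> real"
        using RU.g_inj by (subst sum.reindex) (auto simp: inj_on_def)
      have "(\<Sum>z\<in>R0.R. v z * (R0.w z * K0 z * exp (z * H)))
          = (\<Sum>a\<in>(\<lambda>j. - gU j) ` {1..?n + 1}. uU a * exp (a * H) * v a) + (c0 - cU) * exp (c * H) * v c"
      proof (rule R0.matching_roots[OF fm fb cg(1) c(2) _ _ _ \<rho>(2) c(5,6) cU_def[THEN meta_eq_to_obj_eq] c0_def[THEN meta_eq_to_obj_eq] _ Feq(1) _ _ V])
        show "F x = (\<Sum>a\<in>(\<lambda>j. - gU j) ` {1..?n + 1}. uU a * exp (a * x)) - cU * exp (c * x)" if "x \<in> {H..}" for x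
          unfolding re using uU that by simp
        show "a \<notin> levy_poles P \<and> levy_exponent P a = \<alpha> + \<rho>2" if "a \<in> (\<lambda>j. - gU j) ` {1..?n + 1}" for a
          using that by (subst RU.root_iff[symmetric]) (auto simp: roots_set_def)
        show "Phi (f 0) z H = K0 z - \<alpha> * exp ((c - z) * H) / (c - z)" if "z \<in> R0.R" for z
          using K0[OF that] hH by simp
      qed (auto simp: f_def k)
      then show ?thesis unfolding re \<nu>U_def .
    qed
    show "B_mat P h H \<beta>L \<beta>0 g0 gU *\<^sub>v coeff_vec P \<omega>L \<omega>0 \<nu>0 \<nu>U = V_vec P h H c cL c0 cU"
    proof (rule B_mat_system)
      fix i assume "i < sys_dim P"
      then obtain V where V: "degree V < sys_dim P" "\<And>x. lden P x \<noteq> 0 \<Longrightarrow> poly V x = fit_vec P x $ i * lden P (x :: real)"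
        by (rule fit_vec_poly) blast
      let ?v = "\<lambda>x. fit_vec P x $ i"
      have "?v (\<beta>0 j) * (R0.w (\<beta>0 j) * K0 (\<beta>0 j) * exp (\<beta>0 j * h)) = - (exp (\<beta>0 j * (h - H)) * \<omega>0 j * ?v (\<beta>0 j))"
        and "?v (- g0 j) * (R0.w (- g0 j) * K0 (- g0 j) * exp (- g0 j * h)) = - (\<nu>0 j * ?v (- g0 j))" for j
        by (simp_all add: \<omega>0_def \<nu>0_def right_diff_distrib exp_diff)
      then show "(\<Sum>k=1..?m + 1. \<omega>L k * ?v (\<beta>L k)) + (\<Sum>j=1..?n + 1. \<nu>0 j * ?v (- g0 j))
          + (\<Sum>k=1..?m + 1. exp (\<beta>0 k * (h - H)) * \<omega>0 k * ?v (\<beta>0 k)) = (cL - c0) * exp (c * h) * ?v c"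
        using jump_h[OF V] unfolding R0.sum_R by (simp add: sum_negf algebra_simps)
      have "?v (\<beta>0 j) * (R0.w (\<beta>0 j) * K0 (\<beta>0 j) * exp (\<beta>0 j * H)) = - (\<omega>0 j * ?v (\<beta>0 j))"
        and "?v (- g0 j) * (R0.w (- g0 j) * K0 (- g0 j) * exp (- g0 j * H)) = - (exp (g0 j * (h - H)) * \<nu>0 j * ?v (- g0 j))" for j
        by (simp_all add: \<omega>0_def \<nu>0_def right_diff_distrib exp_diff exp_minus field_simps)
      then show "(\<Sum>j=1..?n + 1. exp (g0 j * (h - H)) * \<nu>0 j * ?v (- g0 j))
          + (\<Sum>j=1..?n + 1. \<nu>U j * ?v (- gU j)) + (\<Sum>k=1..?m + 1. \<omega>0 k * ?v (\<beta>0 k)) = (cU - c0) * exp (c * H) * ?v c"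
        using jump_H[OF V] unfolding R0.sum_R by (simp add: sum_negf algebra_simps)
    qed
  qed
qed

text \<open>Integrability is asserted along with the formula, since a Bochner integral that does not
  exist has the value 0. Roots are indexed by the level, so equal rates share one family. The upper
  half of \<open>V_vec\<close> carries \<open>cL - c0\<close>, the jump of the coefficient of
  \<open>exp (\<gamma> * x)\<close> at \<open>h\<close>, where the opening statement writes
  \<open>cU - c0\<close>; the two agree exactly when the two rates are equal.\<close>

theorem theorem3:
  fixes P :: mejd and M :: "'a measure"
    and W :: "real \<Rightarrow> 'a \<Rightarrow> real" and N :: "real \<Rightarrow> 'a \<Rightarrow> nat" and Y :: "nat \<Rightarrow> 'a \<Rightarrow> real"
    and h H \<alpha> \<rho>1 \<rho>2 \<gamma> cL c0 cU :: real
    and \<beta> g :: "real \<Rightarrow> nat \<Rightarrow> real"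
  assumes params: "mejd_params P"
    and driver: "mejd_driver M P W N Y"
    and barriers: "h < H"
    and rates: "\<alpha> > 0" "\<rho>1 > 0" "\<rho>2 > 0"
    and gamma: "0 \<le> \<gamma>" "\<gamma> < min (up_rate P 1) (down_rate P 1)" "levy_exponent P \<gamma> < \<alpha>"
    and roots: "root_assumption P \<alpha> (\<beta> \<alpha>) (g \<alpha>)"
      "root_assumption P (\<alpha> + \<rho>1) (\<beta> (\<alpha> + \<rho>1)) (g (\<alpha> + \<rho>1))"
      "root_assumption P (\<alpha> + \<rho>2) (\<beta> (\<alpha> + \<rho>2)) (g (\<alpha> + \<rho>2))"
    and cL: "cL = \<alpha> / (levy_exponent P \<gamma> - (\<alpha> + \<rho>1))"
    and c0: "c0 = \<alpha> / (levy_exponent P \<gamma> - \<alpha>)"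
    and cU: "cU = \<alpha> / (levy_exponent P \<gamma> - (\<alpha> + \<rho>2))"
  shows "\<exists>\<omega>L \<omega>0 \<nu>0 \<nu>U :: nat \<Rightarrow> real.
    (\<forall>x. (\<forall>T\<ge>0. integrable M (occ_payoff (mejd_process P W N Y x) h H \<rho>1 \<rho>2 \<gamma> T)) \<and>
         set_integrable lborel {0..} (\<lambda>T. \<alpha> * exp (- \<alpha> * T) *
           prob_space.expectation M (occ_payoff (mejd_process P W N Y x) h H \<rho>1 \<rho>2 \<gamma> T)) \<and>
         (LBINT T:{0..}. \<alpha> * exp (- \<alpha> * T) *
           prob_space.expectation M (occ_payoff (mejd_process P W N Y x) h H \<rho>1 \<rho>2 \<gamma> T))
         = (if x \<le> h then
              (\<Sum>i=1..up_num P + 1. \<omega>L i * exp (\<beta> (\<alpha> + \<rho>1) i * (x - h))) - cL * exp (\<gamma> * x)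
            else if x < H then
              - (\<Sum>i=1..up_num P + 1. \<omega>0 i * exp (\<beta> \<alpha> i * (x - H)))
              - (\<Sum>j=1..down_num P + 1. \<nu>0 j * exp (- g \<alpha> j * (x - h))) - c0 * exp (\<gamma> * x)
            else
              (\<Sum>j=1..down_num P + 1. \<nu>U j * exp (- g (\<alpha> + \<rho>2) j * (x - H))) - cU * exp (\<gamma> * x))) \<and>
    B_mat P h H (\<beta> (\<alpha> + \<rho>1)) (\<beta> \<alpha>) (g \<alpha>) (g (\<alpha> + \<rho>2)) *\<^sub>v coeff_vec P \<omega>L \<omega>0 \<nu>0 \<nu>U
      = V_vec P h H \<gamma> cL c0 cU"
proof -
  interpret prob_space M using driver by (simp add: mejd_driver_def)
  interpret mejd_driven M P W N Y by unfold_locales (fact params driver)+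
  have r0: "mejd_roots P \<alpha> (\<beta> \<alpha>) (g \<alpha>)"
    and rL: "mejd_roots P (\<alpha> + \<rho>1) (\<beta> (\<alpha> + \<rho>1)) (g (\<alpha> + \<rho>1))"
    and rU: "mejd_roots P (\<alpha> + \<rho>2) (\<beta> (\<alpha> + \<rho>2)) (g (\<alpha> + \<rho>2))"
    using params rates roots by (auto intro!: mejd_roots.intro)
  have lb: "- g' 1 < \<gamma>" if "mejd_roots P q \<beta>' g'" for q \<beta>' g'
    using mejd_roots.g_pos[OF that, of 1] gamma(1) by auto
  \<comment> \<open>As \<open>G(\<gamma>) < \<alpha>\<close>, the point \<gamma> lies below the
    first positive root at each of the three levels, so all three kernels integrate the
    payoff.\<close>
  have ub: "\<beta> \<alpha> 1 > \<gamma>" "\<beta> (\<alpha> + \<rho>1) 1 > \<gamma>" "\<beta> (\<alpha> + \<rho>2) 1 > \<gamma>"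
    using mejd_roots.below_first_root[OF r0, of \<gamma>] mejd_roots.below_first_root[OF rL, of \<gamma>]
      mejd_roots.below_first_root[OF rU, of \<gamma>] gamma rates by auto
  have pole: "\<gamma> \<notin> levy_poles P"
    using gamma mejd_params_rates[OF params] by (fastforce simp: levy_poles_def)
  let ?k = "occ_rate h H \<rho>1 \<rho>2"
  define F where "F = (\<lambda>x. enn2real (payoff_transform ?k \<alpha> \<gamma> x))"
  have ab: "0 \<le> \<rho>1" "0 \<le> \<rho>2" using rates by auto
  note rr = resolvent_real[OF ab rates(1) _ r0 lb[OF r0] ub(1), where h=h and H=H]
  have F: "payoff_transform ?k \<alpha> \<gamma> x = ennreal (F x)" "F \<in> borel_measurable borel" for x
    using rr(1,2)[of 0] r0 lb[OF r0] ub unfolding F_def by auto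
  obtain K where K: "\<And>x. 0 \<le> F x \<and> F x \<le> K * exp (\<gamma> * x)"
    using rr(3)[of 0 "\<beta> \<alpha>" "g \<alpha>"] r0 lb[OF r0] ub unfolding F_def by fastforce
  have "F x = (LBINT y. (\<alpha> * exp (\<gamma> * (x + y)) + (d - ?k (x + y)) * F (x + y))
        * res_density (roots_set P \<beta>' g') (rweight P (\<alpha> + d) (roots_set P \<beta>' g')) y)"
    if d: "d \<in> {0, \<rho>1, \<rho>2}" and r: "mejd_roots P (\<alpha> + d) \<beta>' g'" "\<gamma> < \<beta>' 1" for d \<beta>' g' x
  proof -
    have "0 \<le> d" using d ab by auto
    from rr(4)[OF this r(1) lb[OF r(1)] r(2)] show ?thesis unfolding F_def .
  qed
  from piecewise_solution[OF r0 rL rU barriers rates(2,3) gamma(1) ub pole gamma(3) F(2) K this]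
  obtain \<omega>L \<omega>0 \<nu>0 \<nu>U :: "nat \<Rightarrow> real" where sol:
    "\<And>x. F x = (if x \<le> h then (\<Sum>i=1..up_num P + 1. \<omega>L i * exp (\<beta> (\<alpha> + \<rho>1) i * (x - h))) - cL * exp (\<gamma> * x)
            else if x < H then - (\<Sum>i=1..up_num P + 1. \<omega>0 i * exp (\<beta> \<alpha> i * (x - H)))
              - (\<Sum>j=1..down_num P + 1. \<nu>0 j * exp (- g \<alpha> j * (x - h))) - c0 * exp (\<gamma> * x)
            else (\<Sum>j=1..down_num P + 1. \<nu>U j * exp (- g (\<alpha> + \<rho>2) j * (x - H))) - cU * exp (\<gamma> * x))"
    and sys: "B_mat P h H (\<beta> (\<alpha> + \<rho>1)) (\<beta> \<alpha>) (g \<alpha>) (g (\<alpha> + \<rho>2)) *\<^sub>v coeff_vec P \<omega>L \<omega>0 \<nu>0 \<nu>U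
      = V_vec P h H \<gamma> cL c0 cU"
    unfolding cL c0 cU by blast
  have "0 \<le> F x" for x using K by blast
  note L = laplace_payoff[OF ab r0 lb[OF r0] ub(1) rates(1) F(1) this]
  show ?thesis
    unfolding sol[symmetric]
    by (intro exI[of _ \<omega>L] exI[of _ \<omega>0] exI[of _ \<nu>0] exI[of _ \<nu>U] conjI allI impI L sys; simp only: sol[symmetric] L)
qed

end
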